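(* Assume the cyclic formality conjecture (CF) formulated in the context: for every smooth manifold $M$ there exists a natural $\mathbb{C}[[u]]$-linear quasi-isomorphism of $L_\infty$ modules over $\mathfrak{g}_S^\bullet(M)$ $$\phi: CC_\bullet^-(C^\infty(M))\to(\Omega^\bullet(M)[[u]],\,ud)$$ with $\phi_0=\mu$. Let $M$ be a smooth manifold, let $\pi$ be a formal Poisson structure on $M$, and let $A(\pi)=(C^\infty(M)[[t]],*_\pi)$ be the associated deformed algebra, regarded as an algebra over $k=\mathbb{C}[[t]]$. Then there exists a quasi-isomorphism of complexes $$\mu^\pi: C_\bullet(A(\pi),A(\pi))\to(\Omega^\bullet(M)[[t]],\,L_\pi)$$ which extends to a $\mathbb{C}[[u]]$-linear quasi-isomorphism of complexes $$\mu^\pi: CC_\bullet^-(A(\pi))\to(\Omega^\bullet(M)[[u]][[t]],\,L_\pi+ud).$$ Here "extends" means that the second map reduces to the first modulo $u$.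
   Context: $C^\infty(M)$ denotes complex-valued smooth functions, $T$ the tangent bundle, $\Omega^\bullet(M)$ differential forms; $t$ and $u$ are formal variables. **Multivector fields.** $\mathfrak{g}_S^\bullet(M)=\Gamma(M,\wedge^{\bullet+1}T)$ is the differential graded (dg) Lie algebra with zero differential and the Schouten–Nijenhuis bracket $[\,,]_S$. This is the unique bilinear operation making $\Gamma(M,\wedge^{\bullet+1}T)$ a graded Lie algebra and such that: $[X,\pi]_S=L_X\pi$ for vector fields $X$; $[f,g]_S=0$ for functions $f,g$; and $[\pi,\varphi\wedge\psi]_S=[\pi,\varphi]_S\wedge\psi+(-1)^{|\pi|(|\varphi|+1)}\varphi\wedge[\pi,\psi]_S$, where $|\pi|=n-1$ for $\pi\in\Gamma(M,\wedge^nT)$. A formal Poisson structure is a series $\pi=\sum_{m\ge0}t^{m+1}\pi_m$ with $\pi_m\in\Gamma(M,\wedge^2T)$ and $[\pi,\pi]_S=0$. For $\pi\in\Gamma(M,\wedge^dT)$ let $i_\pi:\Omega^\bullet(M)\to\Omega^{\bullet-d}(M)$ be contraction and $L_\pi=[d,i_\pi]$ (graded commutator); extend $t$-linearly to series in $t$. The operators $L_\pi$ make $(\Omega^\bullet(M),0)$ and $(\Omega^\bullet(M)[[u]],ud)$ dg modules over $\mathfrak{g}_S^\bullet(M)$. **Hochschild cochains.** For a unital $k$-algebra $A$, let $\overline A=A/k1$, $C^n(A,A)=\mathrm{Hom}(\overline A^{\otimes n},A)$ (only multidifferential maps if $A=C^\infty(M)$), and $\mathfrak{g}_G^\bullet(A)=C^{\bullet+1}(A,A)$.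 For $D\in C^n(A,A)$, $E\in C^m(A,A)$ put $$(D\circ E)(a_1,\dots,a_{n+m-1})=\sum_{j=0}^{n-1}(-1)^{(m-1)j}D(a_1,\dots,a_j,E(a_{j+1},\dots,a_{j+m}),\dots),$$ $[D,E]_G=D\circ E-(-1)^{(n-1)(m-1)}E\circ D$. With $m(a,b)=ab$ and $\delta=[m,\cdot]_G$, $\mathfrak{g}_G^\bullet(A)$ is a dg Lie algebra. **Hochschild and cyclic chains.** $C_n(A,A)=A\otimes\overline A^{\otimes n}$, $$b(a_0\otimes\cdots\otimes a_n)=(-1)^na_na_0\otimes a_1\otimes\cdots\otimes a_{n-1}+\sum_{i=0}^{n-1}(-1)^ia_0\otimes\cdots\otimes a_ia_{i+1}\otimes\cdots\otimes a_n,$$ $$B(a_0\otimes\cdots\otimes a_n)=\sum_{i=0}^n(-1)^{ni}\,1\otimes a_i\otimes\cdots\otimes a_n\otimes a_0\otimes\cdots\otimes a_{i-1},$$ and $CC^-_\bullet(A)=(C_\bullet(A,A)[[u]],b+uB)$ with $u$ of homological degree $-2$. For $A=C^\infty(M)$, $A^{\otimes(n+1)}$ means one of $C^\infty(M^{n+1})$, germs of smooth functions on $M^{n+1}$ at the diagonal, or jets at the diagonal (fix one choice), and $A\otimes\overline A^{\otimes n}$ is defined accordingly. For $A(\pi)$, tensor powers over $k=\mathbb{C}[[t]]$ mean $A(\pi)^{\otimes_k(n+1)}=C^\infty(M)^{\otimes(n+1)}[[t]]$, and similarly for $A(\pi)\otimes\overline{A(\pi)}^{\otimes_k n}$. For $D\in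 C^d(A,A)$ put $$L_D(a_0\otimes\cdots\otimes a_n)=\sum_{i=0}^{n-d}(-1)^{(d-1)(i+1)}a_0\otimes\cdots\otimes a_i\otimes D(a_{i+1},\dots,a_{i+d})\otimes\cdots\otimes a_n+\sum_{j=n-d+1}^{n}(-1)^{n(j+1)}D(a_{j+1},\dots,a_n,a_0,\dots)\otimes a_{d+j-n}\otimes\cdots\otimes a_j.$$ The operators $L_D$ make $C_\bullet(A,A)$ and $CC_\bullet^-(A)$ dg modules over $\mathfrak{g}_G^\bullet(A)$ (chains and forms of degree $n$ are placed in cohomological degree $-n$). Connes' quasi-isomorphism $\mu:CC_\bullet^-(C^\infty(M))\to(\Omega^\bullet(M)[[u]],ud)$ is the $\mathbb{C}[[u]]$-linear map $\mu(a_0\otimes\cdots\otimes a_n)=\frac1{n!}a_0\,da_1\cdots da_n$. **$L_\infty$ notions.** A dg Lie algebra $\mathfrak{g}^\bullet$ is encoded by a degree $1$, square-zero coderivation of the cofree cocommutative coalgebra $S(\mathfrak{g}^\bullet[1])$. An $L_\infty$ morphism $f:\mathfrak{g}^\bullet\to\mathfrak{h}^\bullet$ is a morphism of dg coalgebras $S(\mathfrak{g}^\bullet[1])\to S(\mathfrak{h}^\bullet[1])$; it is given by components $f_n:\wedge^n\mathfrak{g}^\bullet\to\mathfrak{h}^\bullet$ of degree $1-n$, $n\ge1$, and is a quasi-isomorphism if $f_1$ is. An $L_\infty$ module over $\mathfrak{g}^\bullet$ is a graded space $N^\bullet$ with a degree $1$ square-zero coderivation of the comodule $S(\mathfrak{g}^\bullet[1])\otimes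 N^\bullet$; equivalently, a differential $\delta_N$ on $N^\bullet$ and an $L_\infty$ morphism from $\mathfrak{g}^\bullet$ to the dg Lie algebra $\mathrm{Hom}(N^\bullet,N^\bullet)$ with differential $[\delta_N,\cdot]$. A morphism of $L_\infty$ modules $\varphi:N^\bullet\to P^\bullet$ is a morphism of dg comodules $S(\mathfrak{g}^\bullet[1])\otimes N^\bullet\to S(\mathfrak{g}^\bullet[1])\otimes P^\bullet$; it has components $\varphi_n:\wedge^n\mathfrak{g}^\bullet\otimes N^\bullet\to P^\bullet$ of degree $-n$, $n\ge0$, and is a quasi-isomorphism if $\varphi_0$ is. **Kontsevich's theorem and star products.** By Kontsevich's theorem there is a natural $L_\infty$ quasi-isomorphism $K:\mathfrak{g}_S^\bullet(M)\to\mathfrak{g}_G^\bullet(C^\infty(M))$ with $K_1(\pi)(a_1,\dots,a_n)=\langle\pi,da_1\cdots da_n\rangle$; it is fixed. A star product on $C^\infty(M)$ is an associative $\mathbb{C}[[t]]$-bilinear product $a*b=ab+\sum_{m\ge1}t^mP_m(a,b)$ on $C^\infty(M)[[t]]$ with unit $1$ and $P_m$ bidifferential operators; an isomorphism of star products is a series $T=\mathrm{Id}+\sum_{m\ge1}t^mT_m$, with $T_m$ differential operators, intertwining the products. For a formal Poisson structure $\pi$, $*_\pi$ denotes a star product in the isomorphism class of $a*b=ab+\Pi(a,b)$, $\Pi=\sum_{n\ge1}\frac1{n!}K_n(\pi,\dots,\pi)$, and $A(\pi)=(C^\infty(M)[[t]],*_\pi)$. **Conjecture (CF).** Via $K$,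 $CC_\bullet^-(C^\infty(M))$ becomes an $L_\infty$ module over $\mathfrak{g}_S^\bullet(M)$ (compose $K$ with $D\mapsto L_D$). (CF) states: there exists a natural $\mathbb{C}[[u]]$-linear quasi-isomorphism $\phi:CC_\bullet^-(C^\infty(M))\to(\Omega^\bullet(M)[[u]],ud)$ of $L_\infty$ modules over $\mathfrak{g}_S^\bullet(M)$ such that $\phi_0=\mu$. *)

theory Defs
  imports "HOL-Analysis.Analysis" "HOL-Library.Function_Algebras"
begin

section \<open>Complex vector spaces\<close>

text \<open>
  Addition and zero on function types are the pointwise ones of
  \<^theory>\<open>HOL-Library.Function_Algebras\<close>; the following class adds complex scalars.
\<close>

class cspace = ab_group_add +
  fixes cscale :: "complex \<Rightarrow> 'a \<Rightarrow> 'a"  (infixr "\<bullet>\<^sub>C" 75)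
  assumes cscale_add_right: "a \<bullet>\<^sub>C (x + y) = a \<bullet>\<^sub>C x + a \<bullet>\<^sub>C y"
    and cscale_add_left: "(a + b) \<bullet>\<^sub>C x = a \<bullet>\<^sub>C x + b \<bullet>\<^sub>C x"
    and cscale_cscale: "a \<bullet>\<^sub>C (b \<bullet>\<^sub>C x) = (a * b) \<bullet>\<^sub>C x"
    and cscale_one: "1 \<bullet>\<^sub>C x = x"

instantiation complex :: cspace
begin
definition cscale_complex :: "complex \<Rightarrow> complex \<Rightarrow> complex"
  where "cscale_complex a x = a * x"
instance
  by standard (simp_all add: cscale_complex_def algebra_simps)
end

instantiation "fun" :: (type, cspace) cspace
begin
definition cscale_fun :: "complex \<Rightarrow> ('a \<Rightarrow> 'b) \<Rightarrow> 'a \<Rightarrow> 'b"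
  where "cscale_fun a f = (\<lambda>x. a \<bullet>\<^sub>C f x)"
instance
  by standard
    (simp_all add: cscale_fun_def fun_eq_iff cscale_add_right cscale_add_left cscale_cscale cscale_one)
end

definition csubspace :: "'a::cspace set \<Rightarrow> bool" where
  "csubspace V \<longleftrightarrow> 0 \<in> V \<and> (\<forall>x\<in>V. \<forall>y\<in>V. x + y \<in> V) \<and> (\<forall>a. \<forall>x\<in>V. a \<bullet>\<^sub>C x \<in> V)"

section \<open>Graded spaces and complexes\<close>

text \<open>
  A graded space is given by representatives: its component in (cohomological) degree \<open>i\<close>
  is the quotient \<open>elems X i / nulls X i\<close>. Maps are given on representatives, and all
  identities in the target are required modulo \<open>nulls\<close>.
\<close>

record 'v gspace =
  elems :: "int \<Rightarrow> 'v set"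
  nulls :: "int \<Rightarrow> 'v set"

definition is_gspace :: "'v::cspace gspace \<Rightarrow> bool" where
  "is_gspace X \<longleftrightarrow>
    (\<forall>i. csubspace (elems X i) \<and> csubspace (nulls X i) \<and> nulls X i \<subseteq> elems X i)"

definition plain :: "(int \<Rightarrow> 'v::zero set) \<Rightarrow> 'v gspace" where
  "plain V = \<lparr>elems = V, nulls = (\<lambda>_. {0})\<rparr>"

text \<open>Linear maps of degree \<open>k\<close>; \<open>f i\<close> is the map on the component of degree \<open>i\<close>.\<close>

definition graded_map ::
    "'v::cspace gspace \<Rightarrow> 'w::cspace gspace \<Rightarrow> int \<Rightarrow> (int \<Rightarrow> 'v \<Rightarrow> 'w) \<Rightarrow> bool" where
  "graded_map X Y k f \<longleftrightarrow> (\<forall>i.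
     (\<forall>x\<in>elems X i. f i x \<in> elems Y (i + k)) \<and>
     (\<forall>x\<in>nulls X i. f i x \<in> nulls Y (i + k)) \<and>
     (\<forall>x\<in>elems X i. \<forall>y\<in>elems X i. f i (x + y) - (f i x + f i y) \<in> nulls Y (i + k)) \<and>
     (\<forall>a. \<forall>x\<in>elems X i. f i (a \<bullet>\<^sub>C x) - a \<bullet>\<^sub>C f i x \<in> nulls Y (i + k)))"

definition is_complex :: "'v::cspace gspace \<Rightarrow> (int \<Rightarrow> 'v \<Rightarrow> 'v) \<Rightarrow> bool" where
  "is_complex X \<delta> \<longleftrightarrow> is_gspace X \<and> graded_map X X 1 \<delta> \<and>
     (\<forall>i. \<forall>x\<in>elems X i. \<delta> (i + 1) (\<delta> i x) \<in> nulls X (i + 2))"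

definition cocycles :: "'v::cspace gspace \<Rightarrow> (int \<Rightarrow> 'v \<Rightarrow> 'v) \<Rightarrow> int \<Rightarrow> 'v set" where
  "cocycles X \<delta> i = {x \<in> elems X i. \<delta> i x \<in> nulls X (i + 1)}"

definition coboundaries :: "'v::cspace gspace \<Rightarrow> (int \<Rightarrow> 'v \<Rightarrow> 'v) \<Rightarrow> int \<Rightarrow> 'v set" where
  "coboundaries X \<delta> i = {x \<in> elems X i. \<exists>y\<in>elems X (i - 1). x - \<delta> (i - 1) y \<in> nulls X i}"

text \<open>A quasi-isomorphism is a chain map of degree \<open>0\<close> that is injective and surjective on
  cohomology.\<close>

definition quasi_iso ::
    "'v::cspace gspace \<Rightarrow> (int \<Rightarrow> 'v \<Rightarrow> 'v) \<Rightarrow> 'w::cspace gspace \<Rightarrow> (int \<Rightarrow> 'w \<Rightarrow> 'w)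
      \<Rightarrow> (int \<Rightarrow> 'v \<Rightarrow> 'w) \<Rightarrow> bool" where
  "quasi_iso X \<delta> Y \<epsilon> f \<longleftrightarrow>
     is_complex X \<delta> \<and> is_complex Y \<epsilon> \<and> graded_map X Y 0 f \<and>
     (\<forall>i. \<forall>x\<in>elems X i. f (i + 1) (\<delta> i x) - \<epsilon> i (f i x) \<in> nulls Y (i + 1)) \<and>
     (\<forall>i. \<forall>x\<in>cocycles X \<delta> i. f i x \<in> coboundaries Y \<epsilon> i \<longrightarrow> x \<in> coboundaries X \<delta> i) \<and>
     (\<forall>i. \<forall>y\<in>cocycles Y \<epsilon> i. \<exists>x\<in>cocycles X \<delta> i. f i x - y \<in> coboundaries Y \<epsilon> i)"

text \<open>
  Formal power series are coefficient sequences. The variable \<open>t\<close> has degree \<open>0\<close> and \<open>u\<close> has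
  cohomological degree \<open>2\<close>, so the degree \<open>i\<close> part of \<open>X[[u]]\<close> consists of the series whose
  coefficient at \<open>u^k\<close> has degree \<open>i - 2k\<close>. In \<open>X[[u]][[t]]\<close> the first index is the exponent
  of \<open>u\<close>, the second one that of \<open>t\<close>.
\<close>

definition useries :: "'v gspace \<Rightarrow> (nat \<Rightarrow> 'v) gspace" where
  "useries X = \<lparr>elems = (\<lambda>i. {x. \<forall>k. x k \<in> elems X (i - 2 * int k)}),
                nulls = (\<lambda>i. {x. \<forall>k. x k \<in> nulls X (i - 2 * int k)})\<rparr>"

definition tseries :: "'v gspace \<Rightarrow> (nat \<Rightarrow> 'v) gspace" where
  "tseries X = \<lparr>elems = (\<lambda>i. {x. \<forall>m. x m \<in> elems X i}),
                nulls = (\<lambda>i. {x. \<forall>m. x m \<in> nulls X i})\<rparr>"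

definition mult_u :: "(nat \<Rightarrow> 'v::zero) \<Rightarrow> nat \<Rightarrow> 'v" where
  "mult_u x = (\<lambda>k. if k = 0 then 0 else x (k - 1))"

definition mult_tser :: "(nat \<Rightarrow> complex) \<Rightarrow> (nat \<Rightarrow> 'v::cspace) \<Rightarrow> nat \<Rightarrow> 'v" where
  "mult_tser s x = (\<lambda>m. \<Sum>i\<le>m. s i \<bullet>\<^sub>C x (m - i))"

text \<open>
  For a homogeneous \<open>\<complex>\<close>-linear map between spaces of power series in \<open>u\<close>, commuting with \<open>u\<close>
  is the same as \<open>\<complex>[[u]]\<close>-linearity (by \<open>u\<close>-adic separatedness it is then automatically
  compatible with infinite sums).
\<close>

definition u_linear ::
    "(nat \<Rightarrow> 'v::cspace) gspace \<Rightarrow> (nat \<Rightarrow> 'w::cspace) gspace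
      \<Rightarrow> ((nat \<Rightarrow> 'v) \<Rightarrow> nat \<Rightarrow> 'w) \<Rightarrow> int \<Rightarrow> bool" where
  "u_linear X Y f k \<longleftrightarrow>
     (\<forall>i. \<forall>x\<in>elems X i. f (mult_u x) - mult_u (f x) \<in> nulls Y (i + 2 + k))"

definition t_linear ::
    "(nat \<Rightarrow> 'v::cspace) gspace \<Rightarrow> (nat \<Rightarrow> 'w::cspace) gspace
      \<Rightarrow> ((nat \<Rightarrow> 'v) \<Rightarrow> nat \<Rightarrow> 'w) \<Rightarrow> bool" where
  "t_linear X Y f \<longleftrightarrow>
     (\<forall>i s. \<forall>x\<in>elems X i. f (mult_tser s x) - mult_tser s (f x) \<in> nulls Y i)"

definition ut_linear ::
    "(nat \<Rightarrow> nat \<Rightarrow> 'v::cspace) gspace \<Rightarrow> (nat \<Rightarrow> nat \<Rightarrow> 'w::cspace) gspace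
      \<Rightarrow> ((nat \<Rightarrow> nat \<Rightarrow> 'v) \<Rightarrow> nat \<Rightarrow> nat \<Rightarrow> 'w) \<Rightarrow> bool" where
  "ut_linear X Y f \<longleftrightarrow>
     (\<forall>i s. \<forall>x\<in>elems X i.
        f (\<lambda>k. mult_tser s (x k)) - (\<lambda>k. mult_tser s (f x k)) \<in> nulls Y i)"

definition plus_u :: "('v \<Rightarrow> 'w::ab_group_add) \<Rightarrow> ('v \<Rightarrow> 'w) \<Rightarrow> (nat \<Rightarrow> 'v) \<Rightarrow> nat \<Rightarrow> 'w" where
  "plus_u D E x = (\<lambda>k. D (x k) + (if k = 0 then 0 else E (x (k - 1))))"  \<comment> \<open>\<open>D + u E\<close>\<close>

definition tconv :: "(nat \<Rightarrow> 'v \<Rightarrow> 'w::ab_group_add) \<Rightarrow> (nat \<Rightarrow> 'v) \<Rightarrow> nat \<Rightarrow> 'w" where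
  "tconv D x = (\<lambda>m. \<Sum>i\<le>m. D i (x (m - i)))"  \<comment> \<open>\<open>\<Sum>\<^sub>i t\<^sup>i D\<^sub>i\<close>\<close>

section \<open>Differential graded Lie algebras, \<open>L\<^sub>\<infinity>\<close> morphisms and modules\<close>

record 'a dgla =
  grd :: "int \<Rightarrow> 'a set"
  dif :: "int \<Rightarrow> 'a \<Rightarrow> 'a"
  brk :: "int \<Rightarrow> int \<Rightarrow> 'a \<Rightarrow> 'a \<Rightarrow> 'a"

abbreviation msign :: "int \<Rightarrow> complex" where
  "msign k \<equiv> (-1) powi k"

definition is_dgla :: "'a::cspace dgla \<Rightarrow> bool" where
  "is_dgla g \<longleftrightarrow>
     is_complex (plain (grd g)) (dif g) \<and>
     (\<forall>i. \<forall>x\<in>grd g i. graded_map (plain (grd g)) (plain (grd g)) i (\<lambda>j. brk g i j x)) \<and>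
     (\<forall>i j. \<forall>x\<in>grd g i. \<forall>y\<in>grd g j.
        brk g i j x y = - (msign (i * j) \<bullet>\<^sub>C brk g j i y x)) \<and>
     (\<forall>i j k. \<forall>x\<in>grd g i. \<forall>y\<in>grd g j. \<forall>z\<in>grd g k.
        brk g i (j + k) x (brk g j k y z) =
          brk g (i + j) k (brk g i j x y) z
          + msign (i * j) \<bullet>\<^sub>C brk g j (i + k) y (brk g i k x z)) \<and>
     (\<forall>i j. \<forall>x\<in>grd g i. \<forall>y\<in>grd g j.
        dif g (i + j) (brk g i j x y) =
          brk g (i + 1) j (dif g i x) y + msign i \<bullet>\<^sub>C brk g i (j + 1) x (dif g j y))"

text \<open>
  Maps out of the symmetric coalgebra \<open>S(g[1])\<close> are given by their values on products
  \<open>x\<^sub>1 \<cdots> x\<^sub>n\<close> of homogeneous elements, that is on lists of pairs (degree in \<open>g\<close>, element); in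
  \<open>S(g[1])\<close> an element of degree \<open>i\<close> of \<open>g\<close> has degree \<open>i - 1\<close>. The differential of \<open>g\<close> is
  encoded by the coderivation with components \<open>x \<mapsto> dx\<close> and \<open>xy \<mapsto> (-1)\<^sup>i\<^sup>-\<^sup>1 [x,y]\<close>
  (\<open>x\<close> of degree \<open>i\<close> in \<open>g\<close>), and a dg module by \<open>n \<mapsto> \<delta>n\<close> and \<open>xn \<mapsto> (-1)\<^sup>i\<^sup>-\<^sup>1 L\<^sub>x n\<close>. With these
  signs a Maurer--Cartan element \<open>\<pi>\<close> (solution of \<open>d\<pi> + [\<pi>,\<pi>]/2 = 0\<close>) is sent by an
  \<open>L\<^sub>\<infinity>\<close> morphism \<open>f\<close> to the Maurer--Cartan element \<open>\<Sum>\<^sub>n f\<^sub>n(\<pi>,\<dots>,\<pi>) / n!\<close>, and the differential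
  twisted by \<open>\<pi>\<close> is \<open>\<delta> + L\<^sub>\<pi>\<close>.
\<close>

definition homog :: "'a dgla \<Rightarrow> (int \<times> 'a) list \<Rightarrow> bool" where
  "homog g xs \<longleftrightarrow> (\<forall>(i, x)\<in>set xs. x \<in> grd g i)"

definition sdegs :: "(int \<times> 'a) list \<Rightarrow> int list" where
  "sdegs xs = map (\<lambda>(i, x). i - 1) xs"

definition sdeg :: "(int \<times> 'a) list \<Rightarrow> int" where
  "sdeg xs = sum_list (sdegs xs)"

text \<open>Koszul sign of the unshuffle that moves the positions in \<open>S\<close> to the front.\<close>

definition ksign :: "int list \<Rightarrow> nat set \<Rightarrow> complex" where
  "ksign ds S = (-1) ^ card {(i, j). i < j \<and> j < length ds \<and> i \<notin> S \<and> j \<in> S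
                                     \<and> odd (ds ! i) \<and> odd (ds ! j)}"

fun coder :: "'a::cspace dgla \<Rightarrow> (int \<times> 'a) list \<Rightarrow> int \<times> 'a" where
  "coder g [(i, x)] = (i + 1, dif g i x)"
| "coder g [(i, x), (j, y)] = (i + j, msign (i - 1) \<bullet>\<^sub>C brk g i j x y)"
| "coder g _ = (0, 0)"

definition sym_multilinear ::
    "'a::cspace dgla \<Rightarrow> 'w::cspace gspace \<Rightarrow> int \<Rightarrow> ((int \<times> 'a) list \<Rightarrow> 'w) \<Rightarrow> bool" where
  "sym_multilinear g Y k F \<longleftrightarrow>
     (\<forall>us vs i x y. homog g us \<longrightarrow> homog g vs \<longrightarrow> x \<in> grd g i \<longrightarrow> y \<in> grd g i \<longrightarrow>
        F (us @ (i, x + y) # vs) - (F (us @ (i, x) # vs) + F (us @ (i, y) # vs))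
          \<in> nulls Y (k + sdeg (us @ (i, x) # vs))) \<and>
     (\<forall>us vs i x a. homog g us \<longrightarrow> homog g vs \<longrightarrow> x \<in> grd g i \<longrightarrow>
        F (us @ (i, a \<bullet>\<^sub>C x) # vs) - a \<bullet>\<^sub>C F (us @ (i, x) # vs)
          \<in> nulls Y (k + sdeg (us @ (i, x) # vs))) \<and>
     (\<forall>us vs i j x y. homog g us \<longrightarrow> homog g vs \<longrightarrow> x \<in> grd g i \<longrightarrow> y \<in> grd g j \<longrightarrow>
        F (us @ (i, x) # (j, y) # vs) - msign ((i - 1) * (j - 1)) \<bullet>\<^sub>C F (us @ (j, y) # (i, x) # vs)
          \<in> nulls Y (k + sdeg (us @ (i, x) # (j, y) # vs)))"

text \<open>
  Component form of: the coalgebra map \<open>S(g[1]) \<rightarrow> S(h[1])\<close> determined by \<open>F\<close> commutes with the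
  codifferentials. The value of \<open>F\<close> on the empty list is irrelevant.
\<close>

definition Linf_morphism ::
    "'a::cspace dgla \<Rightarrow> 'b::cspace dgla \<Rightarrow> ((int \<times> 'a) list \<Rightarrow> 'b) \<Rightarrow> bool" where
  "Linf_morphism g h F \<longleftrightarrow> is_dgla g \<and> is_dgla h \<and>
     (\<forall>xs. homog g xs \<longrightarrow> xs \<noteq> [] \<longrightarrow> F xs \<in> grd h (1 + sdeg xs)) \<and>
     sym_multilinear g (plain (grd h)) 1 F \<and>
     (\<forall>xs. homog g xs \<longrightarrow> xs \<noteq> [] \<longrightarrow>
        (\<Sum>S\<in>{S. S \<subseteq> {..<length xs} \<and> card S \<in> {1, 2}}.
           ksign (sdegs xs) S \<bullet>\<^sub>C F (coder g (nths xs S) # nths xs (- S)))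
        = dif h (1 + sdeg xs) (F xs)
          + (1/2) \<bullet>\<^sub>C (\<Sum>S\<in>{S. S \<subseteq> {..<length xs} \<and> S \<noteq> {} \<and> S \<noteq> {..<length xs}}.
              ksign (sdegs xs) S \<bullet>\<^sub>C
                snd (coder h [(1 + sdeg (nths xs S), F (nths xs S)),
                              (1 + sdeg (nths xs (- S)), F (nths xs (- S)))])))"

definition Linf_quasi_iso ::
    "'a::cspace dgla \<Rightarrow> 'b::cspace dgla \<Rightarrow> ((int \<times> 'a) list \<Rightarrow> 'b) \<Rightarrow> bool" where
  "Linf_quasi_iso g h F \<longleftrightarrow> Linf_morphism g h F \<and>
     quasi_iso (plain (grd g)) (dif g) (plain (grd h)) (dif h) (\<lambda>i x. F [(i, x)])"

text \<open>
  Component form of: \<open>r\<close> (including its component \<open>r []\<close>, the differential of \<open>N\<close>) determines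
  a square-zero coderivation of degree \<open>1\<close> of the comodule \<open>S(g[1]) \<otimes> N\<close>.
\<close>

definition Linf_module ::
    "'a::cspace dgla \<Rightarrow> 'n::cspace gspace \<Rightarrow> ((int \<times> 'a) list \<Rightarrow> 'n \<Rightarrow> 'n) \<Rightarrow> bool" where
  "Linf_module g N r \<longleftrightarrow> is_dgla g \<and> is_gspace N \<and>
     (\<forall>xs. homog g xs \<longrightarrow> graded_map N N (sdeg xs + 1) (\<lambda>_. r xs)) \<and>
     (\<forall>i. \<forall>n\<in>elems N i. sym_multilinear g N (i + 1) (\<lambda>xs. r xs n)) \<and>
     (\<forall>xs i. \<forall>n\<in>elems N i. homog g xs \<longrightarrow>
        (\<Sum>S\<in>{S. S \<subseteq> {..<length xs} \<and> card S \<in> {1, 2}}.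
           ksign (sdegs xs) S \<bullet>\<^sub>C r (coder g (nths xs S) # nths xs (- S)) n)
        + (\<Sum>S\<in>Pow {..<length xs}.
             (ksign (sdegs xs) S * msign (sdeg (nths xs S))) \<bullet>\<^sub>C
               r (nths xs S) (r (nths xs (- S)) n))
        \<in> nulls N (i + sdeg xs + 2))"

definition Linf_module_morphism ::
    "'a::cspace dgla \<Rightarrow> 'n::cspace gspace \<Rightarrow> ((int \<times> 'a) list \<Rightarrow> 'n \<Rightarrow> 'n)
      \<Rightarrow> 'p::cspace gspace \<Rightarrow> ((int \<times> 'a) list \<Rightarrow> 'p \<Rightarrow> 'p)
      \<Rightarrow> ((int \<times> 'a) list \<Rightarrow> 'n \<Rightarrow> 'p) \<Rightarrow> bool" where
  "Linf_module_morphism g N r P q \<phi> \<longleftrightarrow> Linf_module g N r \<and> Linf_module g P q \<and>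
     (\<forall>xs. homog g xs \<longrightarrow> graded_map N P (sdeg xs) (\<lambda>_. \<phi> xs)) \<and>
     (\<forall>i. \<forall>n\<in>elems N i. sym_multilinear g P i (\<lambda>xs. \<phi> xs n)) \<and>
     (\<forall>xs i. \<forall>n\<in>elems N i. homog g xs \<longrightarrow>
        (\<Sum>S\<in>{S. S \<subseteq> {..<length xs} \<and> card S \<in> {1, 2}}.
           ksign (sdegs xs) S \<bullet>\<^sub>C \<phi> (coder g (nths xs S) # nths xs (- S)) n)
        + (\<Sum>S\<in>Pow {..<length xs}.
             (ksign (sdegs xs) S * msign (sdeg (nths xs S))) \<bullet>\<^sub>C
               \<phi> (nths xs S) (r (nths xs (- S)) n))
        - (\<Sum>S\<in>Pow {..<length xs}.
             ksign (sdegs xs) S \<bullet>\<^sub>C q (nths xs S) (\<phi> (nths xs (- S)) n))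
        \<in> nulls P (i + sdeg xs + 1))"

definition Linf_module_quasi_iso ::
    "'a::cspace dgla \<Rightarrow> 'n::cspace gspace \<Rightarrow> ((int \<times> 'a) list \<Rightarrow> 'n \<Rightarrow> 'n)
      \<Rightarrow> 'p::cspace gspace \<Rightarrow> ((int \<times> 'a) list \<Rightarrow> 'p \<Rightarrow> 'p)
      \<Rightarrow> ((int \<times> 'a) list \<Rightarrow> 'n \<Rightarrow> 'p) \<Rightarrow> bool" where
  "Linf_module_quasi_iso g N r P q \<phi> \<longleftrightarrow> Linf_module_morphism g N r P q \<phi> \<and>
     quasi_iso N (\<lambda>_. r []) P (\<lambda>_. q []) (\<lambda>_. \<phi> [])"

section \<open>Smooth manifolds and smooth functions\<close>

text \<open>
  Points of \<open>(\<real>\<^sup>n)\<^sup>m\<close> are functions \<open>x :: nat \<Rightarrow> nat \<Rightarrow> real\<close>, where \<open>x j i\<close> is the \<open>i\<close>-th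
  coordinate of the \<open>j\<close>-th vector (zero unless \<open>j < m\<close> and \<open>i < n\<close>).
\<close>

definition partial_der ::
    "nat \<Rightarrow> nat \<Rightarrow> ((nat \<Rightarrow> nat \<Rightarrow> real) \<Rightarrow> complex) \<Rightarrow> (nat \<Rightarrow> nat \<Rightarrow> real) \<Rightarrow> complex" where
  "partial_der j i F x = vector_derivative (\<lambda>s. F (x(j := (x j)(i := s)))) (at (x j i))"

primrec Ck_coords ::
    "nat \<Rightarrow> nat \<Rightarrow> (nat \<Rightarrow> nat \<Rightarrow> real) set \<Rightarrow> nat \<Rightarrow> ((nat \<Rightarrow> nat \<Rightarrow> real) \<Rightarrow> complex) \<Rightarrow> bool" where
  "Ck_coords m n W 0 F \<longleftrightarrow> continuous_on W F"
| "Ck_coords m n W (Suc k) F \<longleftrightarrow> continuous_on W F \<and>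
     (\<forall>j<m. \<forall>i<n.
        (\<forall>x\<in>W. (\<lambda>s. F (x(j := (x j)(i := s)))) differentiable (at (x j i))) \<and>
        Ck_coords m n W k (partial_der j i F))"

definition smooth_coords ::
    "nat \<Rightarrow> nat \<Rightarrow> (nat \<Rightarrow> nat \<Rightarrow> real) set \<Rightarrow> ((nat \<Rightarrow> nat \<Rightarrow> real) \<Rightarrow> complex) \<Rightarrow> bool" where
  "smooth_coords m n W F \<longleftrightarrow> (\<forall>k. Ck_coords m n W k F)"

definition coord_box :: "nat \<Rightarrow> (nat \<Rightarrow> (nat \<Rightarrow> real) set) \<Rightarrow> (nat \<Rightarrow> nat \<Rightarrow> real) set" where
  "coord_box m V = {x. (\<forall>j<m. x j \<in> V j) \<and> (\<forall>j\<ge>m. x j = (\<lambda>_. 0))}"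

definition repeat_vec :: "nat \<Rightarrow> (nat \<Rightarrow> real) \<Rightarrow> nat \<Rightarrow> nat \<Rightarrow> real" where
  "repeat_vec m v = (\<lambda>j. if j < m then v else (\<lambda>_. 0))"

type_synonym 'p chart = "'p set \<times> ('p \<Rightarrow> nat \<Rightarrow> real)"

record 'p mfd =
  mtop :: "'p topology"
  mdim :: nat
  atlas :: "'p chart set"

abbreviation pts :: "'p mfd \<Rightarrow> 'p set" where
  "pts M \<equiv> topspace (mtop M)"

definition smooth_in_charts :: "'p mfd \<Rightarrow> 'p mfd \<Rightarrow> ('p \<Rightarrow> 'p) \<Rightarrow> bool" where
  "smooth_in_charts N M f \<longleftrightarrow>
     (\<forall>(U, \<phi>)\<in>atlas N. \<forall>(V, \<psi>)\<in>atlas M. \<forall>i<mdim M.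
        smooth_coords 1 (mdim N) (coord_box 1 (\<lambda>_. \<phi> ` {p\<in>U. f p \<in> V}))
          (\<lambda>x. complex_of_real (\<psi> (f (inv_into U \<phi> (x 0))) i)))"

definition smooth_manifold :: "'p mfd \<Rightarrow> bool" where
  "smooth_manifold M \<longleftrightarrow>
     Hausdorff_space (mtop M) \<and> second_countable (mtop M) \<and>
     (\<forall>(U, \<phi>)\<in>atlas M.
        openin (mtop M) U \<and> openin (Euclidean_space (mdim M)) (\<phi> ` U) \<and>
        homeomorphic_map (subtopology (mtop M) U)
          (subtopology (Euclidean_space (mdim M)) (\<phi> ` U)) \<phi>) \<and>
     (\<Union>(U, \<phi>)\<in>atlas M. U) = pts M \<and>
     smooth_in_charts M M (\<lambda>p. p)"

definition open_embedding :: "'p mfd \<Rightarrow> 'p mfd \<Rightarrow> ('p \<Rightarrow> 'p) \<Rightarrow> bool" where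
  "open_embedding N M f \<longleftrightarrow> smooth_manifold N \<and> smooth_manifold M \<and> mdim N = mdim M \<and>
     embedding_map (mtop N) (mtop M) f \<and> openin (mtop M) (f ` pts N) \<and>
     smooth_in_charts N M f \<and>
     (\<forall>(U, \<phi>)\<in>atlas N. \<forall>(V, \<psi>)\<in>atlas M. \<forall>i<mdim N.
        smooth_coords 1 (mdim M) (coord_box 1 (\<lambda>_. \<psi> ` (V \<inter> f ` U)))
          (\<lambda>x. complex_of_real (\<phi> (inv_into U f (inv_into V \<psi> (x 0))) i)))"

text \<open>
  Functions on \<open>M\<^sup>m\<close> are functions of lists of \<open>m\<close> points, extended by zero to all other lists.
  \<open>Cinf M m\<close> is \<open>C\<^sup>\<infinity>(M\<^sup>m)\<close>, which serves as the tensor power \<open>C\<^sup>\<infinity>(M)\<^sup>\<otimes>\<^sup>m\<close>, with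
  \<open>a\<^sub>1 \<otimes> \<dots> \<otimes> a\<^sub>m\<close> given by \<open>tensor [a\<^sub>1, \<dots>, a\<^sub>m]\<close>.
\<close>

definition in_charts ::
    "nat \<Rightarrow> (nat \<Rightarrow> 'p chart) \<Rightarrow> ('p list \<Rightarrow> complex) \<Rightarrow> (nat \<Rightarrow> nat \<Rightarrow> real) \<Rightarrow> complex" where
  "in_charts m ch c = (\<lambda>x. c (map (\<lambda>j. inv_into (fst (ch j)) (snd (ch j)) (x j)) [0..<m]))"

definition Cinf :: "'p mfd \<Rightarrow> nat \<Rightarrow> ('p list \<Rightarrow> complex) set" where
  "Cinf M m = {c. (\<forall>ps. c ps \<noteq> 0 \<longrightarrow> length ps = m \<and> set ps \<subseteq> pts M) \<and>
     (\<forall>ch. (\<forall>j<m. ch j \<in> atlas M) \<longrightarrow>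
        smooth_coords m (mdim M) (coord_box m (\<lambda>j. snd (ch j) ` fst (ch j))) (in_charts m ch c))}"

definition tensor :: "('p \<Rightarrow> complex) list \<Rightarrow> 'p list \<Rightarrow> complex" where
  "tensor as = (\<lambda>ps. if length ps = length as then (\<Prod>i<length as. (as ! i) (ps ! i)) else 0)"

definition smooth_funs :: "'p mfd \<Rightarrow> ('p \<Rightarrow> complex) set" where
  "smooth_funs M = {a. tensor [a] \<in> Cinf M 1}"

definition unit_fun :: "'p mfd \<Rightarrow> 'p \<Rightarrow> complex" where
  "unit_fun M = (\<lambda>p. if p \<in> pts M then 1 else 0)"

text \<open>\<open>c = \<dots> \<otimes> 1 \<otimes> \<dots>\<close> with \<open>1\<close> in position \<open>i\<close>: \<open>c\<close> does not depend on its \<open>i\<close>-th argument.\<close>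

definition unit_at :: "'p mfd \<Rightarrow> nat \<Rightarrow> ('p list \<Rightarrow> complex) \<Rightarrow> bool" where
  "unit_at M i c \<longleftrightarrow> (\<forall>ps. \<forall>q\<in>pts M. set ps \<subseteq> pts M \<longrightarrow> c (ps[i := q]) = c ps)"

section \<open>Multidifferential operators and Hochschild cochains\<close>

text \<open>
  A multidifferential operator with \<open>d\<close> arguments is represented by its extension
  \<open>E : C\<^sup>\<infinity>(M\<^sup>d) \<rightarrow> C\<^sup>\<infinity>(M)\<close>, which is a differential operator along the diagonal (in every chart
  a linear combination, with smooth coefficients, of partial derivatives evaluated at
  \<open>(p, \<dots>, p)\<close>, of bounded order); \<open>E\<close> is determined by the values
  \<open>D(a\<^sub>1, \<dots>, a\<^sub>d) = E (tensor [a\<^sub>1, \<dots>, a\<^sub>d])\<close>.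
\<close>

type_synonym 'p cochain = "('p list \<Rightarrow> complex) \<Rightarrow> 'p \<Rightarrow> complex"

definition midx :: "nat \<Rightarrow> nat \<Rightarrow> nat \<Rightarrow> (nat \<times> nat) list set" where
  "midx d n k = {\<alpha>. length \<alpha> \<le> k \<and> set \<alpha> \<subseteq> {..<d} \<times> {..<n}}"

definition partials ::
    "(nat \<times> nat) list \<Rightarrow> ((nat \<Rightarrow> nat \<Rightarrow> real) \<Rightarrow> complex) \<Rightarrow> (nat \<Rightarrow> nat \<Rightarrow> real) \<Rightarrow> complex" where
  "partials \<alpha> F = foldr (\<lambda>(j, i). partial_der j i) \<alpha> F"

definition multidiff :: "'p mfd \<Rightarrow> nat \<Rightarrow> 'p cochain \<Rightarrow> bool" where
  "multidiff M d E \<longleftrightarrow>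
     (\<forall>c. c \<notin> Cinf M d \<longrightarrow> E c = 0) \<and>
     (\<forall>c\<in>Cinf M d. E c \<in> smooth_funs M) \<and>
     (\<exists>k. \<forall>(U, \<phi>)\<in>atlas M. \<exists>h.
        (\<forall>\<alpha>\<in>midx d (mdim M) k. smooth_coords 1 (mdim M) (coord_box 1 (\<lambda>_. \<phi> ` U)) (h \<alpha>)) \<and>
        (\<forall>c\<in>Cinf M d. \<forall>p\<in>U.
           E c p = (\<Sum>\<alpha>\<in>midx d (mdim M) k.
              h \<alpha> (repeat_vec 1 (\<phi> p)) *
              partials \<alpha> (in_charts d (\<lambda>_. (U, \<phi>)) c) (repeat_vec d (\<phi> p)))))"

definition cochains :: "'p mfd \<Rightarrow> nat \<Rightarrow> 'p cochain set" where
  "cochains M d = {D. multidiff M d D \<and> (\<forall>i<d. \<forall>c\<in>Cinf M d. unit_at M i c \<longrightarrow> D c = 0)}"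

text \<open>Composition for \<open>D\<close> with \<open>n\<close> and \<open>E\<close> with \<open>m\<close> arguments.\<close>

definition circ :: "'p mfd \<Rightarrow> nat \<Rightarrow> nat \<Rightarrow> 'p cochain \<Rightarrow> 'p cochain \<Rightarrow> 'p cochain" where
  "circ M n m D E = (\<lambda>c. if c \<in> Cinf M (n + m - 1) then
     (\<Sum>j<n. msign ((int m - 1) * int j) \<bullet>\<^sub>C
        D (\<lambda>ys. if length ys = n \<and> set ys \<subseteq> pts M
                then E (\<lambda>zs. c (take j ys @ zs @ drop (j + 1) ys)) (ys ! j) else 0))
     else 0)"

definition gerst :: "'p mfd \<Rightarrow> nat \<Rightarrow> nat \<Rightarrow> 'p cochain \<Rightarrow> 'p cochain \<Rightarrow> 'p cochain" where
  "gerst M n m D E =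
     circ M n m D E - msign ((int n - 1) * (int m - 1)) \<bullet>\<^sub>C circ M m n E D"

definition mult_cochain :: "'p mfd \<Rightarrow> 'p cochain" where
  "mult_cochain M = (\<lambda>c. if c \<in> Cinf M 2 then (\<lambda>p. c [p, p]) else 0)"

definition g_G :: "'p mfd \<Rightarrow> 'p cochain dgla" where
  "g_G M = \<lparr>grd = (\<lambda>i. if i \<ge> -1 then cochains M (nat (i + 1)) else {0}),
            dif = (\<lambda>i E. gerst M 2 (nat (i + 1)) (mult_cochain M) E),
            brk = (\<lambda>i j. gerst M (nat (i + 1)) (nat (j + 1)))\<rparr>"

section \<open>Hochschild and cyclic chains\<close>

text \<open>
  The chains \<open>a\<^sub>0 \<otimes> \<dots> \<otimes> a\<^sub>n\<close> of degree \<open>n\<close> (cohomological degree \<open>-n\<close>) are functions on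
  \<open>M\<^sup>n\<^sup>+\<^sup>1\<close> modulo sums of functions that have \<open>1\<close> in one of the positions \<open>1, \<dots>, n\<close>.
\<close>

definition degenerate :: "'p mfd \<Rightarrow> nat \<Rightarrow> ('p list \<Rightarrow> complex) set" where
  "degenerate M n = {\<Sum>i\<in>{1..n}. c i | c. \<forall>i\<in>{1..n}. c i \<in> Cinf M (n + 1) \<and> unit_at M i (c i)}"

definition chains :: "'p mfd \<Rightarrow> ('p list \<Rightarrow> complex) gspace" where
  "chains M = \<lparr>elems = (\<lambda>i. if i \<le> 0 then Cinf M (nat (- i) + 1) else {0}),
               nulls = (\<lambda>i. if i \<le> 0 then degenerate M (nat (- i)) else {0})\<rparr>"

text \<open>
  In the operators below the degree of the chain \<open>c\<close> is read off from the length of the argument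
  list \<open>ps\<close>; for other chain degrees the right-hand side vanishes.
\<close>

text \<open>The Hochschild differential for the product \<open>P\<close>; here \<open>ps\<close> has length \<open>n\<close>.\<close>

definition hoch_b ::
    "'p mfd \<Rightarrow> 'p cochain \<Rightarrow> ('p list \<Rightarrow> complex) \<Rightarrow> 'p list \<Rightarrow> complex" where
  "hoch_b M P c = (\<lambda>ps. if ps = [] \<or> \<not> set ps \<subseteq> pts M then 0 else
     let n = length ps in
       (-1) ^ n * P (\<lambda>ys. c (drop 1 ys @ tl ps @ take 1 ys)) (ps ! 0)
       + (\<Sum>i<n. (-1) ^ i * P (\<lambda>ys. c (take i ps @ ys @ drop (i + 1) ps)) (ps ! i)))"

text \<open>Connes' operator; here \<open>ps\<close> has length \<open>n + 2\<close>.\<close>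

definition connes_B :: "'p mfd \<Rightarrow> ('p list \<Rightarrow> complex) \<Rightarrow> 'p list \<Rightarrow> complex" where
  "connes_B M c = (\<lambda>ps. if length ps < 2 \<or> \<not> set ps \<subseteq> pts M then 0 else
     let n = length ps - 2 in
       \<Sum>i\<le>n. (-1) ^ (n * i) * c (drop (n + 1 - i) (tl ps) @ take (n + 1 - i) (tl ps)))"

text \<open>
  The operator \<open>L\<^sub>D\<close> for \<open>D\<close> with \<open>d\<close> arguments; here \<open>ps\<close> has length \<open>N + 1\<close> with
  \<open>N = n - d + 1\<close>.
\<close>

definition hoch_L ::
    "'p mfd \<Rightarrow> nat \<Rightarrow> 'p cochain \<Rightarrow> ('p list \<Rightarrow> complex) \<Rightarrow> 'p list \<Rightarrow> complex" where
  "hoch_L M d D c = (\<lambda>ps. if ps = [] \<or> \<not> set ps \<subseteq> pts M then 0 else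
     let N = length ps - 1; n = N + d - 1 in
       (\<Sum>i<N. msign ((int d - 1) * (int i + 1)) *
          D (\<lambda>ys. c (take (i + 1) ps @ ys @ drop (i + 2) ps)) (ps ! (i + 1)))
       + (\<Sum>j\<in>{N..<N + d}. msign (int n * (int j + 1)) *
          D (\<lambda>ys. c (drop (n - j) ys @ tl ps @ take (n - j) ys)) (ps ! 0)))"

section \<open>Multivector fields\<close>

text \<open>
  A section \<open>\<pi>\<close> of \<open>\<And>\<^sup>p T\<close> is represented by the corresponding alternating multiderivation of
  \<open>C\<^sup>\<infinity>(M)\<close>, normalised such that \<open>X\<^sub>1 \<and> \<dots> \<and> X\<^sub>p\<close> corresponds to
  \<open>(a\<^sub>1, \<dots>, a\<^sub>p) \<mapsto> det (X\<^sub>i a\<^sub>j)\<close>; functions are the case \<open>p = 0\<close>, and vector fields, the case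
  \<open>p = 1\<close>, are the derivations \<open>a \<mapsto> X [a]\<close>.
\<close>

type_synonym 'p mvect = "('p \<Rightarrow> complex) list \<Rightarrow> 'p \<Rightarrow> complex"

definition mvects :: "'p mfd \<Rightarrow> nat \<Rightarrow> 'p mvect set" where
  "mvects M p = {\<pi>.
     (\<forall>as. \<not> (length as = p \<and> set as \<subseteq> smooth_funs M) \<longrightarrow> \<pi> as = 0) \<and>
     (\<forall>as. length as = p \<longrightarrow> set as \<subseteq> smooth_funs M \<longrightarrow>
        \<pi> as \<in> smooth_funs M \<and>
        (\<not> distinct as \<longrightarrow> \<pi> as = 0) \<and>
        (\<forall>i<p. \<forall>a\<in>smooth_funs M. \<forall>b\<in>smooth_funs M.
           \<pi> (as[i := a + b]) = \<pi> (as[i := a]) + \<pi> (as[i := b]) \<and>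
           (\<forall>z. \<pi> (as[i := z \<bullet>\<^sub>C a]) = z \<bullet>\<^sub>C \<pi> (as[i := a])) \<and>
           \<pi> (as[i := a * b]) = a * \<pi> (as[i := b]) + b * \<pi> (as[i := a])))}"

definition wedge :: "'p mvect \<Rightarrow> 'p mvect \<Rightarrow> 'p mvect" where
  "wedge \<pi> \<psi> = (\<lambda>as. \<Sum>S\<in>Pow {..<length as}.
     ksign (replicate (length as) 1) S \<bullet>\<^sub>C (\<pi> (nths as S) * \<psi> (nths as (- S))))"

definition fun_mvect :: "('p \<Rightarrow> complex) \<Rightarrow> 'p mvect" where
  "fun_mvect f = (\<lambda>as. if as = [] then f else 0)"

definition lie_mvect :: "'p mvect \<Rightarrow> 'p mvect \<Rightarrow> 'p mvect" where
  "lie_mvect X \<pi> = (\<lambda>as. X [\<pi> as] - (\<Sum>i<length as. \<pi> (as[i := X [as ! i]])))"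

definition mvect_deg :: "'p mfd \<Rightarrow> int \<Rightarrow> 'p mvect set" where
  "mvect_deg M i = (if i \<ge> -1 then mvects M (nat (i + 1)) else {0})"

definition is_schouten ::
    "'p mfd \<Rightarrow> (int \<Rightarrow> int \<Rightarrow> 'p mvect \<Rightarrow> 'p mvect \<Rightarrow> 'p mvect) \<Rightarrow> bool" where
  "is_schouten M br \<longleftrightarrow>
     is_dgla \<lparr>grd = mvect_deg M, dif = (\<lambda>_ _. 0), brk = br\<rparr> \<and>
     (\<forall>i j x y. \<not> (x \<in> mvect_deg M i \<and> y \<in> mvect_deg M j) \<longrightarrow> br i j x y = 0) \<and>
     (\<forall>j. \<forall>X\<in>mvect_deg M 0. \<forall>\<pi>\<in>mvect_deg M j. br 0 j X \<pi> = lie_mvect X \<pi>) \<and>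
     (\<forall>f\<in>mvect_deg M (-1). \<forall>h\<in>mvect_deg M (-1). br (-1) (-1) f h = 0) \<and>
     (\<forall>i j k. \<forall>\<pi>\<in>mvect_deg M i. \<forall>\<phi>\<in>mvect_deg M j. \<forall>\<psi>\<in>mvect_deg M k.
        j \<ge> -1 \<longrightarrow> k \<ge> -1 \<longrightarrow>
        br i (j + k + 1) \<pi> (wedge \<phi> \<psi>) =
          wedge (br i j \<pi> \<phi>) \<psi> + msign (i * (j + 1)) \<bullet>\<^sub>C wedge \<phi> (br i k \<pi> \<psi>))"

definition schouten :: "'p mfd \<Rightarrow> int \<Rightarrow> int \<Rightarrow> 'p mvect \<Rightarrow> 'p mvect \<Rightarrow> 'p mvect" where
  "schouten M = (THE br. is_schouten M br)"

definition g_S :: "'p mfd \<Rightarrow> 'p mvect dgla" where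
  "g_S M = \<lparr>grd = mvect_deg M, dif = (\<lambda>_ _. 0), brk = schouten M\<rparr>"

text \<open>The sequence \<open>\<pi>\<close> lists the coefficients at \<open>t\<^sup>m\<close>; the coefficient at \<open>t\<^sup>0\<close> vanishes.\<close>

definition formal_poisson :: "'p mfd \<Rightarrow> (nat \<Rightarrow> 'p mvect) \<Rightarrow> bool" where
  "formal_poisson M \<pi> \<longleftrightarrow> \<pi> 0 = 0 \<and> (\<forall>m. \<pi> m \<in> mvects M 2) \<and>
     (\<forall>m. (\<Sum>i\<le>m. schouten M 1 1 (\<pi> i) (\<pi> (m - i))) = 0)"

section \<open>Differential forms\<close>

text \<open>
  Forms of degree \<open>n\<close> are alternating \<open>C\<^sup>\<infinity>(M)\<close>-multilinear functions of \<open>n\<close> vector fields,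
  normalised such that \<open>(da\<^sub>1 \<dots> da\<^sub>n)(X\<^sub>1, \<dots>, X\<^sub>n) = det (X\<^sub>i a\<^sub>j)\<close>.
\<close>

type_synonym 'p dform = "'p mvect list \<Rightarrow> 'p \<Rightarrow> complex"

definition fscale :: "('p \<Rightarrow> complex) \<Rightarrow> ('b \<Rightarrow> 'p \<Rightarrow> complex) \<Rightarrow> 'b \<Rightarrow> 'p \<Rightarrow> complex" where
  "fscale f X = (\<lambda>as. f * X as)"

definition dforms :: "'p mfd \<Rightarrow> nat \<Rightarrow> 'p dform set" where
  "dforms M n = {\<omega>.
     (\<forall>Xs. \<not> (length Xs = n \<and> set Xs \<subseteq> mvects M 1) \<longrightarrow> \<omega> Xs = 0) \<and>
     (\<forall>Xs. length Xs = n \<longrightarrow> set Xs \<subseteq> mvects M 1 \<longrightarrow>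
        \<omega> Xs \<in> smooth_funs M \<and>
        (\<not> distinct Xs \<longrightarrow> \<omega> Xs = 0) \<and>
        (\<forall>i<n. \<forall>X\<in>mvects M 1. \<forall>Y\<in>mvects M 1. \<forall>f\<in>smooth_funs M.
           \<omega> (Xs[i := X + Y]) = \<omega> (Xs[i := X]) + \<omega> (Xs[i := Y]) \<and>
           \<omega> (Xs[i := fscale f X]) = f * \<omega> (Xs[i := X])))}"

definition forms :: "'p mfd \<Rightarrow> 'p dform gspace" where
  "forms M = plain (\<lambda>i. if i \<le> 0 then dforms M (nat (- i)) else {0})"

definition vf_bracket :: "'p mvect \<Rightarrow> 'p mvect \<Rightarrow> 'p mvect" where
  "vf_bracket X Y = (\<lambda>as. X [Y as] - Y [X as])"

definition ext_d :: "'p mfd \<Rightarrow> 'p dform \<Rightarrow> 'p dform" where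
  "ext_d M \<omega> = (\<lambda>Xs. if set Xs \<subseteq> mvects M 1 then
     (\<Sum>i<length Xs. (-1) ^ i \<bullet>\<^sub>C (Xs ! i) [\<omega> (nths Xs (- {i}))])
     + (\<Sum>(i, j)\<in>{(i, j). i < j \<and> j < length Xs}.
          (-1) ^ (i + j) \<bullet>\<^sub>C \<omega> (vf_bracket (Xs ! i) (Xs ! j) # nths Xs (- {i, j})))
     else 0)"

text \<open>
  Contraction: \<open>i\<^sub>\<pi>\<close> is additive in \<open>\<pi>\<close> and for \<open>\<pi> = f X\<^sub>1 \<and> \<dots> \<and> X\<^sub>p\<close> it is \<open>f i\<^sub>X\<^sub>1 \<cdots> i\<^sub>X\<^sub>p\<close>,
  where \<open>(i\<^sub>X \<omega>)(Y\<^sub>1, \<dots>) = \<omega>(X, Y\<^sub>1, \<dots>)\<close>; every multivector field is a finite sum of such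
  products.
\<close>

definition contract :: "'p mfd \<Rightarrow> 'p mvect \<Rightarrow> 'p dform \<Rightarrow> 'p dform" where
  "contract M \<pi> \<omega> = (THE \<eta>. \<exists>ts :: (('p \<Rightarrow> complex) \<times> 'p mvect list) list.
     (\<forall>(f, Xs)\<in>set ts. f \<in> smooth_funs M \<and> set Xs \<subseteq> mvects M 1) \<and>
     \<pi> = sum_list (map (\<lambda>(f, Xs). foldr wedge Xs (fun_mvect f)) ts) \<and>
     \<eta> = sum_list (map (\<lambda>(f, Xs). fscale f (\<lambda>Ys. \<omega> (rev Xs @ Ys))) ts))"

text \<open>\<open>L\<^sub>\<pi> = [d, i\<^sub>\<pi>]\<close> for \<open>\<pi>\<close> a section of \<open>\<And>\<^sup>p T\<close>.\<close>

definition lie_form :: "'p mfd \<Rightarrow> nat \<Rightarrow> 'p mvect \<Rightarrow> 'p dform \<Rightarrow> 'p dform" where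
  "lie_form M p \<pi> \<omega> =
     ext_d M (contract M \<pi> \<omega>) - (-1) ^ p \<bullet>\<^sub>C contract M \<pi> (ext_d M \<omega>)"

text \<open>
  Connes' map \<open>a\<^sub>0 \<otimes> \<dots> \<otimes> a\<^sub>n \<mapsto> a\<^sub>0 da\<^sub>1 \<dots> da\<^sub>n / n!\<close>: \<open>vf_at j X\<close> applies the vector field \<open>X\<close>
  to the \<open>j\<close>-th variable.
\<close>

definition vf_at :: "'p mfd \<Rightarrow> nat \<Rightarrow> 'p mvect \<Rightarrow> ('p list \<Rightarrow> complex) \<Rightarrow> 'p list \<Rightarrow> complex" where
  "vf_at M j X c =
     (\<lambda>ps. if j < length ps \<and> set ps \<subseteq> pts M
           then X [\<lambda>q. if q \<in> pts M then c (ps[j := q]) else 0] (ps ! j) else 0)"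

definition connes_mu :: "'p mfd \<Rightarrow> ('p list \<Rightarrow> complex) \<Rightarrow> 'p dform" where
  "connes_mu M c = (\<lambda>Xs p. if set Xs \<subseteq> mvects M 1 \<and> p \<in> pts M then
     let n = length Xs in
       (1 / fact n) * (\<Sum>\<sigma> | \<sigma> permutes {..<n}. of_int (sign \<sigma>) *
          foldr (\<lambda>j. vf_at M (j + 1) (Xs ! \<sigma> j)) [0..<n] c (replicate (n + 1) p))
     else 0)"

section \<open>Formality\<close>

text \<open>
  Naturality of a construction on manifolds is formulated with respect to a set \<open>E\<close> of open
  embeddings \<open>f : N \<rightarrow> M\<close>, through the usual relation of \<open>f\<close>-relatedness between objects on
  \<open>N\<close> and on \<open>M\<close>.
\<close>

definition pullback :: "'p mfd \<Rightarrow> ('p \<Rightarrow> 'p) \<Rightarrow> ('p list \<Rightarrow> complex) \<Rightarrow> 'p list \<Rightarrow> complex" where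
  "pullback N f c = (\<lambda>ps. if set ps \<subseteq> pts N then c (map f ps) else 0)"

definition pullback_fun :: "'p mfd \<Rightarrow> ('p \<Rightarrow> 'p) \<Rightarrow> ('p \<Rightarrow> complex) \<Rightarrow> 'p \<Rightarrow> complex" where
  "pullback_fun N f a = (\<lambda>p. if p \<in> pts N then a (f p) else 0)"

definition mvect_related :: "'p mfd \<Rightarrow> 'p mfd \<Rightarrow> ('p \<Rightarrow> 'p) \<Rightarrow> 'p mvect \<Rightarrow> 'p mvect \<Rightarrow> bool" where
  "mvect_related N M f \<pi> \<rho> \<longleftrightarrow> (\<forall>as. set as \<subseteq> smooth_funs M \<longrightarrow>
     \<pi> (map (pullback_fun N f) as) = pullback_fun N f (\<rho> as))"

definition cochain_related ::
    "'p mfd \<Rightarrow> 'p mfd \<Rightarrow> ('p \<Rightarrow> 'p) \<Rightarrow> 'p cochain \<Rightarrow> 'p cochain \<Rightarrow> bool" where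
  "cochain_related N M f D D' \<longleftrightarrow>
     (\<forall>d. \<forall>c\<in>Cinf M d. D (pullback N f c) = pullback_fun N f (D' c))"

definition form_related ::
    "'p mfd \<Rightarrow> 'p mfd \<Rightarrow> ('p \<Rightarrow> 'p) \<Rightarrow> 'p dform \<Rightarrow> 'p dform \<Rightarrow> bool" where
  "form_related N M f \<omega> \<omega>' \<longleftrightarrow> (\<forall>Xs Ys.
     list_all2 (\<lambda>X Y. X \<in> mvects N 1 \<and> Y \<in> mvects M 1 \<and> mvect_related N M f X Y) Xs Ys \<longrightarrow>
     \<omega> Xs = pullback_fun N f (\<omega>' Ys))"

definition args_related ::
    "'p mfd \<Rightarrow> 'p mfd \<Rightarrow> ('p \<Rightarrow> 'p) \<Rightarrow> (int \<times> 'p mvect) list \<Rightarrow> (int \<times> 'p mvect) list \<Rightarrow> bool" where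
  "args_related N M f xs ys \<longleftrightarrow>
     homog (g_S N) xs \<and> homog (g_S M) ys \<and>
     list_all2 (\<lambda>(i, x) (j, y). i = j \<and> mvect_related N M f x y) xs ys"

type_synonym 'p emb = "'p mfd \<times> 'p mfd \<times> ('p \<Rightarrow> 'p)"

text \<open>
  A Kontsevich morphism on all manifolds. The factor \<open>\<kappa> p\<close> is the normalisation of the pairing
  \<open>\<langle>\<pi>, da\<^sub>1 \<dots> da\<^sub>p\<rangle> = \<kappa> p \<cdot> \<pi>(a\<^sub>1, \<dots>, a\<^sub>p)\<close> between \<open>\<And>\<^sup>p T\<close> and \<open>p\<close>-forms, a sign
  times \<open>1/p!\<close>. With the signs of \<open>hoch_L\<close>, \<open>gerst\<close> and \<open>lie_form\<close> used here, compatibility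
  with the brackets and with Connes' map singles out \<open>\<kappa> p = (-1)^((p-1)(p+2)/2) / p!\<close>; \<open>\<kappa>\<close> is
  kept as a parameter in order not to fix a convention for the pairing.
\<close>

definition kontsevich_formality ::
    "(nat \<Rightarrow> complex) \<Rightarrow> 'p emb set
      \<Rightarrow> ('p mfd \<Rightarrow> (int \<times> 'p mvect) list \<Rightarrow> 'p cochain) \<Rightarrow> bool" where
  "kontsevich_formality \<kappa> E K \<longleftrightarrow>
     (\<forall>M. smooth_manifold M \<longrightarrow>
        Linf_quasi_iso (g_S M) (g_G M) (K M) \<and>
        (\<forall>p. \<forall>\<pi>\<in>mvects M p. \<forall>as. length as = p \<longrightarrow> set as \<subseteq> smooth_funs M \<longrightarrow>
           K M [(int p - 1, \<pi>)] (tensor as) = \<kappa> p \<bullet>\<^sub>C \<pi> as)) \<and>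
     (\<forall>(N, M, f)\<in>E. \<forall>xs ys. xs \<noteq> [] \<longrightarrow> args_related N M f xs ys \<longrightarrow>
        cochain_related N M f (K N xs) (K M ys))"

text \<open>The negative cyclic complex as an \<open>L\<^sub>\<infinity>\<close> module over \<open>g_S\<close> by means of \<open>K\<close>.\<close>

definition CC_action ::
    "'p mfd \<Rightarrow> ((int \<times> 'p mvect) list \<Rightarrow> 'p cochain) \<Rightarrow> (int \<times> 'p mvect) list
      \<Rightarrow> (nat \<Rightarrow> 'p list \<Rightarrow> complex) \<Rightarrow> nat \<Rightarrow> 'p list \<Rightarrow> complex" where
  "CC_action M K xs x =
     (if xs = [] then plus_u (hoch_b M (mult_cochain M)) (connes_B M) x
      else (\<lambda>k. msign (sdeg xs) \<bullet>\<^sub>C hoch_L M (nat (sdeg xs + 2)) (K xs) (x k)))"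

fun forms_action ::
    "'p mfd \<Rightarrow> (int \<times> 'p mvect) list \<Rightarrow> (nat \<Rightarrow> 'p dform) \<Rightarrow> nat \<Rightarrow> 'p dform" where
  "forms_action M [] x = plus_u (\<lambda>_. 0) (ext_d M) x"
| "forms_action M [(i, \<pi>)] x = (\<lambda>k. msign (i - 1) \<bullet>\<^sub>C lie_form M (nat (i + 1)) \<pi> (x k))"
| "forms_action M _ x = 0"

definition cyclic_formality ::
    "'p emb set \<Rightarrow> ('p mfd \<Rightarrow> (int \<times> 'p mvect) list \<Rightarrow> 'p cochain) \<Rightarrow> bool" where
  "cyclic_formality E K \<longleftrightarrow>
     (\<exists>\<phi> :: 'p mfd \<Rightarrow> (int \<times> 'p mvect) list \<Rightarrow> (nat \<Rightarrow> 'p list \<Rightarrow> complex) \<Rightarrow> nat \<Rightarrow> 'p dform.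
        (\<forall>M. smooth_manifold M \<longrightarrow>
           Linf_module_quasi_iso (g_S M) (useries (chains M)) (CC_action M (K M))
             (useries (forms M)) (forms_action M) (\<phi> M) \<and>
           (\<forall>xs. homog (g_S M) xs \<longrightarrow>
              u_linear (useries (chains M)) (useries (forms M)) (\<phi> M xs) (sdeg xs)) \<and>
           (\<forall>i. \<forall>x\<in>elems (useries (chains M)) i. \<phi> M [] x = (\<lambda>k. connes_mu M (x k)))) \<and>
        (\<forall>(N, M, f)\<in>E. \<forall>xs ys i k. \<forall>z\<in>elems (useries (chains M)) i.
           args_related N M f xs ys \<longrightarrow>
           form_related N M f (\<phi> N xs (\<lambda>l. pullback N f (z l)) k) (\<phi> M ys z k)))"

section \<open>Star products and the complexes of the deformed algebra\<close>

text \<open>A star product \<open>\<Sum>\<^sub>m t\<^sup>m P\<^sub>m\<close> is given by the sequence of its coefficients.\<close>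

definition star_product :: "'p mfd \<Rightarrow> (nat \<Rightarrow> 'p cochain) \<Rightarrow> bool" where
  "star_product M P \<longleftrightarrow>
     P 0 = mult_cochain M \<and> (\<forall>m. multidiff M 2 (P m)) \<and>
     (\<forall>m\<ge>1. \<forall>a\<in>smooth_funs M.
        P m (tensor [unit_fun M, a]) = 0 \<and> P m (tensor [a, unit_fun M]) = 0) \<and>
     (\<forall>m. \<forall>a\<in>smooth_funs M. \<forall>b\<in>smooth_funs M. \<forall>c\<in>smooth_funs M.
        (\<Sum>i\<le>m. P i (tensor [P (m - i) (tensor [a, b]), c])) =
        (\<Sum>i\<le>m. P i (tensor [a, P (m - i) (tensor [b, c])])))"

definition star_isomorphic :: "'p mfd \<Rightarrow> (nat \<Rightarrow> 'p cochain) \<Rightarrow> (nat \<Rightarrow> 'p cochain) \<Rightarrow> bool" where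
  "star_isomorphic M P Q \<longleftrightarrow> (\<exists>T :: nat \<Rightarrow> 'p cochain.
     (\<forall>a\<in>smooth_funs M. T 0 (tensor [a]) = a) \<and> (\<forall>m. multidiff M 1 (T m)) \<and>
     (\<forall>m. \<forall>a\<in>smooth_funs M. \<forall>b\<in>smooth_funs M.
        (\<Sum>i\<le>m. T i (tensor [P (m - i) (tensor [a, b])])) =
        (\<Sum>i\<le>m. \<Sum>j\<le>m - i.
           Q (m - i - j) (tensor [T i (tensor [a]), T j (tensor [b])]))))"

text \<open>\<open>ab + \<Sum>\<^sub>n K\<^sub>n(\<pi>, \<dots>, \<pi>) / n!\<close>; only \<open>n \<le> m\<close> contribute to \<open>t\<^sup>m\<close> since \<open>\<pi> 0 = 0\<close>.\<close>

definition kontsevich_star ::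
    "'p mfd \<Rightarrow> ((int \<times> 'p mvect) list \<Rightarrow> 'p cochain) \<Rightarrow> (nat \<Rightarrow> 'p mvect) \<Rightarrow> nat \<Rightarrow> 'p cochain" where
  "kontsevich_star M K \<pi> m =
     (if m = 0 then mult_cochain M
      else \<Sum>n\<in>{1..m}. (1 / fact n) \<bullet>\<^sub>C
        (\<Sum>ms\<in>{ms. length ms = n \<and> sum_list ms = m}. K (map (\<lambda>k. (1, \<pi> k)) ms)))"

definition star_chains :: "'p mfd \<Rightarrow> (nat \<Rightarrow> 'p list \<Rightarrow> complex) gspace" where
  "star_chains M = tseries (chains M)"

definition star_b ::
    "'p mfd \<Rightarrow> (nat \<Rightarrow> 'p cochain) \<Rightarrow> (nat \<Rightarrow> 'p list \<Rightarrow> complex) \<Rightarrow> nat \<Rightarrow> 'p list \<Rightarrow> complex" where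
  "star_b M P = tconv (\<lambda>m. hoch_b M (P m))"

definition star_CC :: "'p mfd \<Rightarrow> (nat \<Rightarrow> nat \<Rightarrow> 'p list \<Rightarrow> complex) gspace" where
  "star_CC M = useries (star_chains M)"

definition star_bB ::
    "'p mfd \<Rightarrow> (nat \<Rightarrow> 'p cochain)
      \<Rightarrow> (nat \<Rightarrow> nat \<Rightarrow> 'p list \<Rightarrow> complex) \<Rightarrow> nat \<Rightarrow> nat \<Rightarrow> 'p list \<Rightarrow> complex" where
  "star_bB M P = plus_u (star_b M P) (\<lambda>x m. connes_B M (x m))"

definition poisson_L ::
    "'p mfd \<Rightarrow> (nat \<Rightarrow> 'p mvect) \<Rightarrow> (nat \<Rightarrow> 'p dform) \<Rightarrow> nat \<Rightarrow> 'p dform" where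
  "poisson_L M \<pi> = tconv (\<lambda>m. lie_form M 2 (\<pi> m))"

definition poisson_Lud ::
    "'p mfd \<Rightarrow> (nat \<Rightarrow> 'p mvect) \<Rightarrow> (nat \<Rightarrow> nat \<Rightarrow> 'p dform) \<Rightarrow> nat \<Rightarrow> nat \<Rightarrow> 'p dform" where
  "poisson_Lud M \<pi> = plus_u (poisson_L M \<pi>) (\<lambda>x m. ext_d M (x m))"

end

theory Submission
  imports Defs "HOL-Computational_Algebra.Polynomial" "HOL-Computational_Algebra.Formal_Power_Series"
begin

text \<open>
  Conjecture (CF) twists. For a solution \<open>\<pi>\<close> of the Maurer--Cartan equation with coefficients in
  \<open>t\<complex>[[t]]\<close>, every \<open>L\<^sub>\<infinity>\<close> module \<open>r\<close> gives a differential \<open>\<Sum>\<^sub>n r\<^sub>n(\<pi>, \<dots>, \<pi>) / n!\<close> and every morphism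
  \<open>\<phi>\<close> of modules a chain map \<open>\<Sum>\<^sub>n \<phi>\<^sub>n(\<pi>, \<dots>, \<pi>) / n!\<close> between the twisted complexes; this is a
  rearrangement of exponential series over unshuffles (\<open>complex_twist\<close>, \<open>chain_map_twist\<close>). For a
  formal Poisson structure, the twist of the negative cyclic complex is \<open>b + uB\<close> for the product
  \<open>ab + \<Sum>\<^sub>n K\<^sub>n(\<pi>, \<dots>, \<pi>) / n!\<close>, because \<open>L\<^sub>D\<close> is linear in \<open>D\<close> and for a two-argument \<open>D\<close> is
  the Hochschild operator with the product replaced by \<open>D\<close>. The twist of the forms is \<open>L\<^sub>\<pi> + ud\<close>. At
  \<open>t = 0\<close> the twisted chain map is \<open>\<phi>\<^sub>0\<close>, a quasi-isomorphism by hypothesis, and a chain map of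
  \<open>t\<close>-adically complete complexes which is a quasi-isomorphism at \<open>t = 0\<close> is one
  (\<open>quasi_iso_tseries\<close>, an order by order lifting in the mapping cone).

  The algebra \<open>A(\<pi>)\<close> is only isomorphic to the one with Kontsevich's product. An isomorphism \<open>T\<close> of
  star products induces \<open>\<Theta> = T\<^sup>\<otimes>\<^sup>(\<^sup>n\<^sup>+\<^sup>1\<^sup>)\<close> on chains. Intertwining with \<open>b\<close> and \<open>B\<close> is immediate on
  products \<open>a\<^sub>0 \<otimes> \<dots> \<otimes> a\<^sub>n\<close>, but chains are arbitrary smooth functions on \<open>M\<^sup>n\<^sup>+\<^sup>1\<close>. All operators
  involved depend at each point only on finitely many jets of their argument (\<open>jetop\<close>), and every
  smooth function has, at finitely many points, the same jets of a given order as some finite sum of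
  products (\<open>tensor_density\<close>); so identities between such operators can be checked on products
  (\<open>jetop_eq_tensors\<close>). Since \<open>\<Theta> = id\<close> modulo \<open>t\<close>, the remaining facts about the differential of
  \<open>A(\<pi>)\<close>, that it respects degenerate chains and squares to zero, are transported along \<open>\<Theta>\<close>
  (\<open>conjugate_quasi_iso\<close>). It is used here that \<open>T\<close> preserves the unit (\<open>T_unit\<close>), which follows from
  multiplicativity.

  The map on \<open>C\<^sub>\<bullet>(A(\<pi>), A(\<pi>))\<close> is the reduction modulo \<open>u\<close> of the one on \<open>CC\<^sup>-\<close>: by
  \<open>u\<close>-linearity the mapping cone of the reduction is the quotient of an acyclic complex by an acyclic
  subcomplex (\<open>quasi_iso_mod_u\<close>).
\<close>

section \<open>Complexes modulo null elements\<close>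

lemma cscale_zero_left [simp]: "0 \<bullet>\<^sub>C x = (0::'a::cspace)"
  using cscale_add_left[of 0 0 x] by simp

lemma cscale_zero_right [simp]: "a \<bullet>\<^sub>C 0 = (0::'a::cspace)"
  using cscale_add_right[of a 0 "0::'a"] by simp

lemma cscale_minus_one: "(-1) \<bullet>\<^sub>C x = - (x::'a::cspace)"
proof -
  have "(-1) \<bullet>\<^sub>C x + x = (-1 + 1) \<bullet>\<^sub>C x" by (simp only: cscale_add_left cscale_one)
  then show ?thesis by (simp add: eq_neg_iff_add_eq_0)
qed

lemma cscale_minus_right: "a \<bullet>\<^sub>C (- x) = - (a \<bullet>\<^sub>C (x::'a::cspace))"
  by (metis cscale_add_right cscale_zero_right add.right_inverse add_eq_0_iff)

lemma cscale_diff_right: "a \<bullet>\<^sub>C (x - y) = a \<bullet>\<^sub>C x - a \<bullet>\<^sub>C (y::'a::cspace)"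
  by (metis cscale_add_right cscale_minus_right diff_conv_add_uminus)

lemma cscale_sum_right: "a \<bullet>\<^sub>C sum f A = (\<Sum>i\<in>A. a \<bullet>\<^sub>C (f i :: 'a::cspace))"
  by (induction A rule: infinite_finite_induct) (simp_all add: cscale_add_right)

lemma cscale_fun_apply [simp]: "(a \<bullet>\<^sub>C f) x = a \<bullet>\<^sub>C f x"
  by (simp add: cscale_fun_def)

lemma cscale_complex [simp]: "a \<bullet>\<^sub>C (x::complex) = a * x"
  by (simp add: cscale_complex_def)

lemma sum_fun_apply: "(\<Sum>i\<in>A. f i) x = (\<Sum>i\<in>A. f i x :: 'b::comm_monoid_add)"
  by (induction A rule: infinite_finite_induct) auto

context
  fixes V :: "'a::cspace set"
  assumes V: "csubspace V"
begin

lemma csub_zero: "0 \<in> V" using V by (simp add: csubspace_def)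
lemma csub_add: "x \<in> V \<Longrightarrow> y \<in> V \<Longrightarrow> x + y \<in> V" using V by (simp add: csubspace_def)
lemma csub_scale: "x \<in> V \<Longrightarrow> a \<bullet>\<^sub>C x \<in> V" using V by (simp add: csubspace_def)
lemma csub_minus: "x \<in> V \<Longrightarrow> - x \<in> V" using csub_scale[of x "-1"] by (simp add: cscale_minus_one)
lemma csub_diff: "x \<in> V \<Longrightarrow> y \<in> V \<Longrightarrow> x - y \<in> V"
  using csub_add[of x "- y"] csub_minus by simp
lemma csub_sum: "(\<And>i. i \<in> A \<Longrightarrow> f i \<in> V) \<Longrightarrow> sum f A \<in> V"
  by (induction A rule: infinite_finite_induct) (auto simp: csub_zero csub_add)

end

lemma gspace_elems: "is_gspace X \<Longrightarrow> csubspace (elems X i)"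
  and gspace_nulls: "is_gspace X \<Longrightarrow> csubspace (nulls X i)"
  and gspace_le: "is_gspace X \<Longrightarrow> x \<in> nulls X i \<Longrightarrow> x \<in> elems X i"
  by (auto simp: is_gspace_def)

lemmas gsub_e = csub_zero[OF gspace_elems] csub_add[OF gspace_elems] csub_diff[OF gspace_elems]
  csub_scale[OF gspace_elems] csub_minus[OF gspace_elems] csub_sum[OF gspace_elems]
lemmas gsub_n = csub_zero[OF gspace_nulls] csub_add[OF gspace_nulls] csub_diff[OF gspace_nulls]
  csub_scale[OF gspace_nulls] csub_minus[OF gspace_nulls] csub_sum[OF gspace_nulls]

text \<open>
  Identities hold modulo the null elements of the given degree, that is in the quotient.
\<close>

definition eqm :: "'v::cspace gspace \<Rightarrow> int \<Rightarrow> 'v \<Rightarrow> 'v \<Rightarrow> bool" where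
  "eqm X i x y \<longleftrightarrow> x - y \<in> nulls X i"

context
  fixes X :: "'v::cspace gspace"
  assumes X: "is_gspace X"
begin

lemma eqm_refl [simp]: "eqm X i x x" by (simp add: eqm_def gsub_n(1)[OF X])
lemma eqm_sym: "eqm X i x y \<Longrightarrow> eqm X i y x"
  using gsub_n(5)[OF X, of "x - y" i] by (simp add: eqm_def)
lemma eqm_trans: "eqm X i x y \<Longrightarrow> eqm X i y z \<Longrightarrow> eqm X i x z"
  using gsub_n(2)[OF X, of "x - y" i "y - z"] by (simp add: eqm_def)
lemma eqm_add: "eqm X i x y \<Longrightarrow> eqm X i x' y' \<Longrightarrow> eqm X i (x + x') (y + y')"
  using gsub_n(2)[OF X, of "x - y" i "x' - y'"] by (simp add: eqm_def algebra_simps)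
lemma eqm_diff: "eqm X i x y \<Longrightarrow> eqm X i x' y' \<Longrightarrow> eqm X i (x - x') (y - y')"
  using gsub_n(3)[OF X, of "x - y" i "x' - y'"] by (simp add: eqm_def algebra_simps)
lemma eqm_scale: "eqm X i x y \<Longrightarrow> eqm X i (a \<bullet>\<^sub>C x) (a \<bullet>\<^sub>C y)"
  using gsub_n(4)[OF X, of "x - y" i a] by (simp add: eqm_def cscale_diff_right)
lemma eqm_sum: "(\<And>j. j \<in> A \<Longrightarrow> eqm X i (f j) (g j)) \<Longrightarrow> eqm X i (sum f A) (sum g A)"
  by (induction A rule: infinite_finite_induct) (auto simp: eqm_add)
lemma eqm_comb:
  "eqm X i a b \<Longrightarrow> eqm X i c d \<Longrightarrow> x - y = (a - b) + (c - d) \<Longrightarrow> eqm X i x y"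
  using gsub_n(2)[OF X, of "a - b" i "c - d"] by (simp add: eqm_def)
lemma eqm_elem: "eqm X i x y \<Longrightarrow> y \<in> elems X i \<Longrightarrow> x \<in> elems X i"
  using gsub_e(2)[OF X, of "x - y" i y] gspace_le[OF X] by (simp add: eqm_def)
lemma eqm_zero: "eqm X i x 0 \<longleftrightarrow> x \<in> nulls X i" by (simp add: eqm_def)
lemma eqm_null: "eqm X i x y \<Longrightarrow> y \<in> nulls X i \<Longrightarrow> x \<in> nulls X i"
  using eqm_trans[of i x y 0] by (simp add: eqm_zero)

end

abbreviation gmap :: "'v::cspace gspace \<Rightarrow> 'w::cspace gspace \<Rightarrow> int \<Rightarrow> ('v \<Rightarrow> 'w) \<Rightarrow> bool" where
  "gmap X Y k f \<equiv> graded_map X Y k (\<lambda>_. f)"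

context
  fixes X :: "'v::cspace gspace" and Y :: "'w::cspace gspace" and k f
  assumes f: "gmap X Y k f" and X: "is_gspace X" and Y: "is_gspace Y"
begin

lemma gm_elem: "x \<in> elems X i \<Longrightarrow> f x \<in> elems Y (i + k)" using f by (auto simp: graded_map_def)
lemma gm_null: "x \<in> nulls X i \<Longrightarrow> f x \<in> nulls Y (i + k)" using f by (auto simp: graded_map_def)
lemma gm_add: "x \<in> elems X i \<Longrightarrow> y \<in> elems X i \<Longrightarrow> eqm Y (i + k) (f (x + y)) (f x + f y)"
  using f by (auto simp: graded_map_def eqm_def)
lemma gm_scale: "x \<in> elems X i \<Longrightarrow> eqm Y (i + k) (f (a \<bullet>\<^sub>C x)) (a \<bullet>\<^sub>C f x)"
  using f by (auto simp: graded_map_def eqm_def)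
lemma gm_diff:
  assumes x: "x \<in> elems X i" and y: "y \<in> elems X i"
  shows "eqm Y (i + k) (f (x - y)) (f x - f y)"
proof -
  have "eqm Y (i + k) (f ((x - y) + y)) (f (x - y) + f y)"
    using gm_add[of "x - y" i y] x y gsub_e(3)[OF X] by blast
  then have "eqm Y (i + k) (f (x - y) + f y) (f x)" using eqm_sym[OF Y] by simp
  from eqm_diff[OF Y this eqm_refl[OF Y, of _ "f y"]] show ?thesis by simp
qed
lemma gm_cong: "x \<in> elems X i \<Longrightarrow> y \<in> elems X i \<Longrightarrow> eqm X i x y \<Longrightarrow> eqm Y (i + k) (f x) (f y)"
  using gm_diff[of x i y] gm_null[of "x - y" i] eqm_null[OF Y eqm_sym[OF Y], of "i + k" "f (x - y)" "f x - f y"]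
  by (simp add: eqm_def)
lemma gm_zero: "f 0 \<in> nulls Y (i + k)" using gm_null gsub_n(1)[OF X] by blast
lemma gm_sum: "(\<And>j. j \<in> A \<Longrightarrow> x j \<in> elems X i) \<Longrightarrow> eqm Y (i + k) (f (sum x A)) (\<Sum>j\<in>A. f (x j))"
proof (induction A rule: infinite_finite_induct)
  case (insert a A)
  have "eqm Y (i + k) (f (x a + sum x A)) (f (x a) + f (sum x A))"
    using insert.prems gsub_e(6)[OF X, of A x i] by (intro gm_add) auto
  moreover have "eqm Y (i + k) (f (x a) + f (sum x A)) (f (x a) + (\<Sum>j\<in>A. f (x j)))"
    using insert by (intro eqm_add[OF Y] eqm_refl[OF Y]) auto
  ultimately show ?case using insert eqm_trans[OF Y] by auto
qed (auto simp: eqm_zero[OF Y] gm_zero)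

end

section \<open>The cone criterion\<close>

text \<open>
  Acyclicity of the mapping cone of \<open>f\<close>, written out for pairs: a cocycle \<open>(x, y)\<close>, with
  \<open>Dx = 0\<close> and \<open>f x = E y\<close>, is the boundary of some \<open>(x', y')\<close>. In this form the property can be
  lifted along filtrations, which is awkward for injectivity and surjectivity separately.
\<close>

definition cone_acyclic :: "'v::cspace gspace \<Rightarrow> ('v \<Rightarrow> 'v) \<Rightarrow> 'w::cspace gspace \<Rightarrow> ('w \<Rightarrow> 'w)
    \<Rightarrow> ('v \<Rightarrow> 'w) \<Rightarrow> bool" where
  "cone_acyclic X D Y E f \<longleftrightarrow> (\<forall>i. \<forall>x\<in>elems X i. \<forall>y\<in>elems Y (i - 1).
     eqm X (i + 1) (D x) 0 \<longrightarrow> eqm Y i (f x) (E y) \<longrightarrow>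
     (\<exists>x'\<in>elems X (i - 1). \<exists>y'\<in>elems Y (i - 2).
        eqm X i x (D x') \<and> eqm Y (i - 1) y (f x' - E y')))"

definition chain_map :: "'v::cspace gspace \<Rightarrow> ('v \<Rightarrow> 'v) \<Rightarrow> 'w::cspace gspace \<Rightarrow> ('w \<Rightarrow> 'w)
    \<Rightarrow> ('v \<Rightarrow> 'w) \<Rightarrow> bool" where
  "chain_map X D Y E f \<longleftrightarrow> is_complex X (\<lambda>_. D) \<and> is_complex Y (\<lambda>_. E) \<and> gmap X Y 0 f \<and>
     (\<forall>i. \<forall>x\<in>elems X i. eqm Y (i + 1) (f (D x)) (E (f x)))"

lemma complexD:
  assumes "is_complex X (\<lambda>_. D)"
  shows "is_gspace X" "gmap X X 1 D" "x \<in> elems X i \<Longrightarrow> eqm X (i + 2) (D (D x)) 0"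
  using assms by (auto simp: is_complex_def eqm_def)

lemma quasi_iso_chain_map:
  "quasi_iso X (\<lambda>_. D) Y (\<lambda>_. E) (\<lambda>_. f) \<Longrightarrow> chain_map X D Y E f"
  by (auto simp: quasi_iso_def chain_map_def eqm_def)

lemma quasi_iso_imp_cone:
  assumes q: "quasi_iso X (\<lambda>_. D) Y (\<lambda>_. E) (\<lambda>_. f)"
  shows "cone_acyclic X D Y E f"
  unfolding cone_acyclic_def
proof (intro allI ballI impI)
  fix i x y assume x: "x \<in> elems X i" and y: "y \<in> elems Y (i - 1)"
    and Dx: "eqm X (i + 1) (D x) 0" and fx: "eqm Y i (f x) (E y)"
  have cX: "is_complex X (\<lambda>_. D)" and cY: "is_complex Y (\<lambda>_. E)" and f: "gmap X Y 0 f"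
    and ch: "\<And>i x. x \<in> elems X i \<Longrightarrow> eqm Y (i + 1) (f (D x)) (E (f x))"
    using quasi_iso_chain_map[OF q] by (auto simp: chain_map_def)
  note X = complexD(1)[OF cX] and Y = complexD(1)[OF cY]
  note D = complexD(2)[OF cX] and E = complexD(2)[OF cY]
  have inj: "\<And>i x. x \<in> cocycles X (\<lambda>_. D) i \<Longrightarrow> f x \<in> coboundaries Y (\<lambda>_. E) i \<Longrightarrow> x \<in> coboundaries X (\<lambda>_. D) i"
    and sur: "\<And>i y. y \<in> cocycles Y (\<lambda>_. E) i \<Longrightarrow> \<exists>x\<in>cocycles X (\<lambda>_. D) i. f x - y \<in> coboundaries Y (\<lambda>_. E) i"
    using q unfolding quasi_iso_def by blast+
  have "x \<in> cocycles X (\<lambda>_. D) i" using x Dx by (simp add: cocycles_def eqm_def)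
  moreover have "f x \<in> coboundaries Y (\<lambda>_. E) i"
    using gm_elem[OF f X Y x] y fx by (auto simp: coboundaries_def eqm_def)
  ultimately have "x \<in> coboundaries X (\<lambda>_. D) i" by (rule inj)
  then obtain x1 where x1: "x1 \<in> elems X (i - 1)" "eqm X i x (D x1)"
    by (auto simp: coboundaries_def eqm_def)
  have fx1: "f x1 \<in> elems Y (i - 1)" using gm_elem[OF f X Y x1(1)] by simp
  have D1: "D x1 \<in> elems X i" using gm_elem[OF D X X x1(1)] by simp
  have w: "f x1 - y \<in> elems Y (i - 1)" using fx1 y gsub_e(3)[OF Y] by blast
  have "eqm Y i (E (f x1 - y)) (E (f x1) - E y)"
    using gm_diff[OF E Y Y fx1 y] by simp
  moreover have "eqm Y i (E (f x1)) (f (D x1))"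
    using ch[OF x1(1)] eqm_sym[OF Y] by simp
  moreover have "eqm Y i (f (D x1)) (f x)"
    using gm_cong[OF f X Y x D1 x1(2)] eqm_sym[OF Y] by simp
  moreover note fx
  ultimately have "eqm Y i (E (f x1)) (E y)" "eqm Y i (E (f x1 - y)) (E (f x1) - E y)"
    using eqm_trans[OF Y] by blast+
  then have "eqm Y i (E (f x1 - y)) (E y - E y)"
    by (rule eqm_comb[OF Y]) simp
  then have "f x1 - y \<in> cocycles Y (\<lambda>_. E) (i - 1)"
    using w by (simp add: cocycles_def eqm_def)
  from sur[OF this] obtain c e where c: "c \<in> elems X (i - 1)" "eqm X i (D c) 0"
    and e: "e \<in> elems Y (i - 2)" "eqm Y (i - 1) (f c - (f x1 - y)) (E e)"
    by (auto simp: cocycles_def coboundaries_def eqm_def)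
  have "eqm X i (D (x1 - c)) (D x1 - D c)" using gm_diff[OF D X X x1(1) c(1)] by simp
  then have "eqm X i (D x1 - D c) (D (x1 - c))" by (rule eqm_sym[OF X])
  then have "eqm X i (D x1) (D (x1 - c))" by (rule eqm_comb[OF X _ c(2)]) simp
  with x1(2) have A: "eqm X i x (D (x1 - c))" by (rule eqm_trans[OF X])
  have "eqm Y (i - 1) (f (x1 - c)) (f x1 - f c)" using gm_diff[OF f X Y x1(1) c(1)] by simp
  have "eqm Y (i - 1) (f c - (f x1 - y) + (f x1 - f c)) (E e + f (x1 - c))"
    by (rule eqm_add[OF Y e(2) eqm_sym[OF Y]]) fact
  then have "eqm Y (i - 1) y (E e + f (x1 - c))" by simp
  moreover have "eqm Y (i - 1) (E (- e)) (- E e)"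
    using gm_scale[OF E Y Y e(1), of "-1"] by (simp add: cscale_minus_one)
  ultimately have "eqm Y (i - 1) y (f (x1 - c) - E (- e))"
  proof -
    assume a: "eqm Y (i - 1) y (E e + f (x1 - c))" "eqm Y (i - 1) (E (- e)) (- E e)"
    have "eqm Y (i - 1) (f (x1 - c) - (- E e)) (f (x1 - c) - E (- e))"
      by (rule eqm_diff[OF Y eqm_refl[OF Y] eqm_sym[OF Y a(2)]])
    then have "eqm Y (i - 1) (E e + f (x1 - c)) (f (x1 - c) - E (- e))" by (simp add: add.commute)
    then show ?thesis using a(1) eqm_trans[OF Y] by blast
  qed
  then show "\<exists>x'\<in>elems X (i - 1). \<exists>y'\<in>elems Y (i - 2).
        eqm X i x (D x') \<and> eqm Y (i - 1) y (f x' - E y')"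
    using A gsub_e(3)[OF X x1(1) c(1)] gsub_e(5)[OF Y e(1)] by blast
qed

lemma quasi_isoI:
  assumes ch: "chain_map X D Y E f" and co: "cone_acyclic X D Y E f"
  shows "quasi_iso X (\<lambda>_. D) Y (\<lambda>_. E) (\<lambda>_. f)"
proof -
  have cX: "is_complex X (\<lambda>_. D)" and cY: "is_complex Y (\<lambda>_. E)" and f: "gmap X Y 0 f"
    using ch by (auto simp: chain_map_def)
  note X = complexD(1)[OF cX] and Y = complexD(1)[OF cY]
  note D = complexD(2)[OF cX] and E = complexD(2)[OF cY]
  have inj: "x \<in> coboundaries X (\<lambda>_. D) i"
    if "x \<in> cocycles X (\<lambda>_. D) i" "f x \<in> coboundaries Y (\<lambda>_. E) i" for i x
    using that co unfolding cone_acyclic_def by (force simp: cocycles_def coboundaries_def eqm_def)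
  have sur: "\<exists>x\<in>cocycles X (\<lambda>_. D) i. f x - y \<in> coboundaries Y (\<lambda>_. E) i"
    if y: "y \<in> cocycles Y (\<lambda>_. E) i" for i y
  proof -
    have y': "y \<in> elems Y i" "eqm Y (i + 1) (E y) 0" using y by (auto simp: cocycles_def eqm_def)
    have "eqm X (i + 1 + 1) (D 0) 0" using gm_zero[OF D X X, of "i+1"] by (simp add: eqm_def)
    moreover have "eqm Y (i + 1) (f 0) (E y)"
      using gm_zero[OF f X Y, of "i+1"] eqm_trans[OF Y, of "i+1" "f 0" 0 "E y"] eqm_sym[OF Y y'(2)]
      by (simp add: eqm_zero[OF Y])
    moreover have "y \<in> elems Y (i + 1 - 1)" using y'(1) by simp
    ultimately have "\<exists>x'\<in>elems X (i + 1 - 1). \<exists>z\<in>elems Y (i + 1 - 2).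
        eqm X (i + 1) 0 (D x') \<and> eqm Y (i + 1 - 1) y (f x' - E z)"
      using co gsub_e(1)[OF X, of "i+1"] unfolding cone_acyclic_def by blast
    then obtain x' z where x': "x' \<in> elems X i" "eqm X (i + 1) 0 (D x')"
      and z: "z \<in> elems Y (i - 1)" "eqm Y i y (f x' - E z)" by auto
    have "f x' - y \<in> elems Y i" using x' y' gm_elem[OF f X Y, of x' i] gsub_e(3)[OF Y] by force
    moreover have "eqm Y i (f x' - y) (E z)"
    proof -
      have "eqm Y i (f x' - y) (f x' - (f x' - E z))" by (rule eqm_diff[OF Y eqm_refl[OF Y] z(2)])
      then show ?thesis by simp
    qed
    ultimately show ?thesis
      using x'(1) z(1) eqm_sym[OF X x'(2)]
      by (intro bexI[of _ x']) (auto simp: cocycles_def coboundaries_def eqm_def)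
  qed
  show ?thesis
    using ch inj sur unfolding quasi_iso_def chain_map_def eqm_def by blast
qed

section \<open>Power series of complexes\<close>

lemma elems_tseries [simp]: "x \<in> elems (tseries X) i \<longleftrightarrow> (\<forall>m. x m \<in> elems X i)"
  and nulls_tseries [simp]: "x \<in> nulls (tseries X) i \<longleftrightarrow> (\<forall>m. x m \<in> nulls X i)"
  and elems_useries [simp]: "x \<in> elems (useries X) i \<longleftrightarrow> (\<forall>k. x k \<in> elems X (i - 2 * int k))"
  and nulls_useries [simp]: "x \<in> nulls (useries X) i \<longleftrightarrow> (\<forall>k. x k \<in> nulls X (i - 2 * int k))"
  by (simp_all add: tseries_def useries_def)

lemma gspace_tseries: "is_gspace X \<Longrightarrow> is_gspace (tseries X)"
  by (auto simp: is_gspace_def csubspace_def subset_iff)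

lemma gspace_useries: "is_gspace X \<Longrightarrow> is_gspace (useries X)"
  by (auto simp: is_gspace_def csubspace_def subset_iff)

lemma eqm_tseries: "eqm (tseries X) i x y \<longleftrightarrow> (\<forall>m. eqm X i (x m) (y m))"
  by (simp add: eqm_def)

lemma eqm_useries: "eqm (useries X) i x y \<longleftrightarrow> (\<forall>k. eqm X (i - 2 * int k) (x k) (y k))"
  by (simp add: eqm_def)

lemma gmap_tconv:
  assumes X: "is_gspace X" and Y: "is_gspace Y" and f: "\<And>m. gmap X Y k (f m)"
  shows "gmap (tseries X) (tseries Y) k (tconv f)"
  unfolding graded_map_def
proof (intro allI conjI ballI)
  fix i x assume x: "x \<in> elems (tseries X) i"
  then show "tconv f x \<in> elems (tseries Y) (i + k)"
    by (auto simp: tconv_def intro!: gsub_e(6)[OF Y] gm_elem[OF f X Y])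
  { fix y assume y: "y \<in> elems (tseries X) i"
    have "eqm Y (i + k) (tconv f (x + y) m) (\<Sum>j\<le>m. f j (x (m - j)) + f j (y (m - j)))" for m
      using x y by (auto simp: tconv_def intro!: eqm_sum[OF Y] gm_add[OF f X Y])
    then show "tconv f (x + y) - (tconv f x + tconv f y) \<in> nulls (tseries Y) (i + k)"
      by (simp add: eqm_def tconv_def sum.distrib) }
  fix a
  have "eqm Y (i + k) (tconv f (a \<bullet>\<^sub>C x) m) (\<Sum>j\<le>m. a \<bullet>\<^sub>C f j (x (m - j)))" for m
    using x by (auto simp: tconv_def intro!: eqm_sum[OF Y] gm_scale[OF f X Y])
  then show "tconv f (a \<bullet>\<^sub>C x) - a \<bullet>\<^sub>C tconv f x \<in> nulls (tseries Y) (i + k)"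
    by (simp add: eqm_def tconv_def cscale_sum_right)
next
  fix i x assume "x \<in> nulls (tseries X) i"
  then show "tconv f x \<in> nulls (tseries Y) (i + k)"
    by (auto simp: tconv_def intro!: gsub_n(6)[OF Y] gm_null[OF f X Y])
qed

lemma tconv_cong_le: "(\<And>j. j \<le> m \<Longrightarrow> x j = y j) \<Longrightarrow> tconv D x m = tconv D y m"
  by (simp add: tconv_def)

lemma tconv_lead:
  assumes X: "is_gspace X" and Y: "is_gspace Y" and f: "\<And>m. gmap X Y k (f m)"
    and r: "\<And>j. j < m \<Longrightarrow> eqm X i (r j) 0"
  shows "eqm Y (i + k) (tconv f r m) (f 0 (r m))"
proof -
  have "{..m} = insert 0 {1..m}" by auto
  then have "tconv f r m = f 0 (r m) + (\<Sum>j\<in>{1..m}. f j (r (m - j)))"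
    by (simp add: tconv_def)
  moreover have "(\<Sum>j\<in>{1..m}. f j (r (m - j))) \<in> nulls Y (i + k)"
    using r by (intro gsub_n(6)[OF Y] gm_null[OF f X Y]) (auto simp: eqm_def)
  ultimately show ?thesis by (simp add: eqm_def)
qed

lemma cone_acyclicD:
  assumes "cone_acyclic X D Y E f" "x \<in> elems X i" "y \<in> elems Y (i - 1)"
    "eqm X (i + 1) (D x) 0" "eqm Y i (f x) (E y)"
  obtains x' y' where "x' \<in> elems X (i - 1)" "y' \<in> elems Y (i - 2)"
    "eqm X i x (D x')" "eqm Y (i - 1) y (f x' - E y')"
  using assms unfolding cone_acyclic_def by blast

text \<open>
  The solution \<open>(x', y')\<close> is built coefficient by coefficient. If it solves the equations below
  order \<open>m\<close>, the error at order \<open>m\<close> is a cocycle of the cone at \<open>t = 0\<close>, because the full differential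
  squares to zero and its terms of positive order only see the vanishing lower errors; hence the error
  is removed by changing coefficient \<open>m\<close>.
\<close>

lemma cone_acyclic_tseries:
  assumes X: "is_gspace X" and Y: "is_gspace Y"
    and D: "\<And>m. gmap X X 1 (D m)" and E: "\<And>m. gmap Y Y 1 (E m)" and f: "\<And>m. gmap X Y 0 (f m)"
    and ch: "chain_map (tseries X) (tconv D) (tseries Y) (tconv E) (tconv f)"
    and co: "cone_acyclic X (D 0) Y (E 0) (f 0)"
  shows "cone_acyclic (tseries X) (tconv D) (tseries Y) (tconv E) (tconv f)"
  unfolding cone_acyclic_def
proof (intro allI ballI impI)
  fix i x y
  assume x: "x \<in> elems (tseries X) i" and y: "y \<in> elems (tseries Y) (i - 1)"
    and Dx: "eqm (tseries X) (i + 1) (tconv D x) 0" and fx: "eqm (tseries Y) i (tconv f x) (tconv E y)"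
  note TX = gspace_tseries[OF X] and TY = gspace_tseries[OF Y]
  note tD = gmap_tconv[OF X X D] and tE = gmap_tconv[OF Y Y E] and tf = gmap_tconv[OF X Y f]
  have DD: "eqm (tseries X) (i + 1) (tconv D (tconv D a)) 0" if "a \<in> elems (tseries X) (i - 1)" for a
    using ch complexD(3)[of "tseries X" "tconv D" a "i - 1"] that by (auto simp: chain_map_def add.commute)
  have EE: "eqm (tseries Y) i (tconv E (tconv E a)) 0" if "a \<in> elems (tseries Y) (i - 2)" for a
    using ch complexD(3)[of "tseries Y" "tconv E" a "i - 2"] that by (auto simp: chain_map_def)
  have fD: "eqm (tseries Y) i (tconv f (tconv D a)) (tconv E (tconv f a))" if "a \<in> elems (tseries X) (i - 1)" for a
    using ch that unfolding chain_map_def by (metis diff_add_cancel)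
  define P where "P = (\<lambda>m (a, b). a \<in> elems (tseries X) (i - 1) \<and> b \<in> elems (tseries Y) (i - 2) \<and>
    (\<forall>j<m. eqm X i (x j) (tconv D a j) \<and> eqm Y (i - 1) (y j) (tconv f a j - tconv E b j)))"
  define R where "R = (\<lambda>(m::nat) (a::nat\<Rightarrow>'a, b::nat\<Rightarrow>'b) (a', b'). \<forall>j<m. a' j = a j \<and> b' j = b j)"
  have "\<exists>g. \<forall>m. P m (g m) \<and> R m (g m) (g (Suc m))"
  proof (rule dependent_nat_choice)
    show "\<exists>ab. P 0 ab"
      using gsub_e(1)[OF X] gsub_e(1)[OF Y] by (intro exI[of _ "(0, 0)"]) (auto simp: P_def)
  next
    fix ab m assume Pm: "P m ab"
    obtain a b where ab: "ab = (a, b)" by (cases ab)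
    have a: "a \<in> elems (tseries X) (i - 1)" and b: "b \<in> elems (tseries Y) (i - 2)"
      and eq: "\<And>j. j < m \<Longrightarrow> eqm X i (x j) (tconv D a j)"
        "\<And>j. j < m \<Longrightarrow> eqm Y (i - 1) (y j) (tconv f a j - tconv E b j)"
      using Pm by (auto simp: P_def ab)
    have Da: "tconv D a \<in> elems (tseries X) i" using gm_elem[OF tD TX TX a] by simp
    have fa: "tconv f a \<in> elems (tseries Y) (i - 1)" using gm_elem[OF tf TX TY a] by simp
    have Eb: "tconv E b \<in> elems (tseries Y) (i - 1)" using gm_elem[OF tE TY TY b] by simp
    define r where "r = x - tconv D a"
    define s where "s = y - (tconv f a - tconv E b)"
    have fE: "tconv f a - tconv E b \<in> elems (tseries Y) (i - 1)" using fa Eb by (rule gsub_e(3)[OF TY])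
    have r: "r \<in> elems (tseries X) i" unfolding r_def by (rule gsub_e(3)[OF TX x Da])
    have s: "s \<in> elems (tseries Y) (i - 1)" unfolding s_def by (rule gsub_e(3)[OF TY y fE])
    have r0: "eqm X i (r j) 0" "eqm Y (i - 1) (s j) 0" if "j < m" for j
      using eq[OF that] by (simp_all add: eqm_def r_def s_def)
    have "eqm (tseries X) (i + 1) (tconv D r) (tconv D x - tconv D (tconv D a))"
      unfolding r_def by (rule gm_diff[OF tD TX TX x Da])
    then have "eqm (tseries X) (i + 1) (tconv D r) (0 - 0)"
      by (rule eqm_trans[OF TX _ eqm_diff[OF TX Dx DD[OF a]]])
    then have "eqm X (i + 1) (tconv D r m) 0" by (simp add: eqm_tseries)
    moreover have "eqm X (i + 1) (tconv D r m) (D 0 (r m))"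
      by (rule tconv_lead[where f=D, OF X X D r0(1)])
    ultimately have 1: "eqm X (i + 1) (D 0 (r m)) 0"
      using eqm_trans[OF X eqm_sym[OF X]] by blast
    have f1: "eqm (tseries Y) i (tconv f r) (tconv f x - tconv f (tconv D a))"
      unfolding r_def using gm_diff[OF tf TX TY x Da] by simp
    have f2: "eqm (tseries Y) i (tconv E s) (tconv E y - tconv E (tconv f a - tconv E b))"
      unfolding s_def using gm_diff[OF tE TY TY y fE] by simp
    have f3: "eqm (tseries Y) i (tconv E (tconv f a - tconv E b)) (tconv E (tconv f a) - tconv E (tconv E b))"
      using gm_diff[OF tE TY TY fa Eb] by simp
    have f4: "eqm (tseries Y) i (tconv f x - tconv f (tconv D a)) (tconv E y - tconv E (tconv f a))"
      by (rule eqm_diff[OF TY fx fD[OF a]])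
    have f5: "eqm (tseries Y) i (tconv E (tconv f a - tconv E b)) (tconv E (tconv f a))"
      by (rule eqm_comb[OF TY f3 eqm_sym[OF TY EE[OF b]]]) simp
    have f6: "eqm (tseries Y) i (tconv E y - tconv E (tconv f a)) (tconv E s)"
      using eqm_sym[OF TY eqm_trans[OF TY f2 eqm_diff[OF TY eqm_refl[OF TY] f5]]] .
    have "eqm (tseries Y) i (tconv f r) (tconv E s)"
      by (rule eqm_trans[OF TY f1 eqm_trans[OF TY f4 f6]])
    then have e: "eqm Y i (tconv f r m) (tconv E s m)" by (simp add: eqm_tseries)
    have e1: "eqm Y i (tconv f r m) (f 0 (r m))"
      using tconv_lead[where f=f, OF X Y f r0(1), of m] by simp
    have e2: "eqm Y i (tconv E s m) (E 0 (s m))"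
      using tconv_lead[where f=E, OF Y Y E r0(2), of m] by simp
    have 2: "eqm Y i (f 0 (r m)) (E 0 (s m))"
      by (rule eqm_trans[OF Y eqm_sym[OF Y e1] eqm_trans[OF Y e e2]])
    obtain a0 b0 where a0: "a0 \<in> elems X (i - 1)" and b0: "b0 \<in> elems Y (i - 2)"
      and ra: "eqm X i (r m) (D 0 a0)" and sb: "eqm Y (i - 1) (s m) (f 0 a0 - E 0 b0)"
      using cone_acyclicD[OF co _ _ 1 2] r s by auto
    define da where "da = (\<lambda>j. if j = m then a0 else 0)"
    define db where "db = (\<lambda>j. if j = m then b0 else 0)"
    have da: "da \<in> elems (tseries X) (i - 1)" and db: "db \<in> elems (tseries Y) (i - 2)"
      using a0 b0 gsub_e(1)[OF X] gsub_e(1)[OF Y] by (auto simp: da_def db_def)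
    have lead: "eqm X i (tconv D da m) (D 0 a0)" "eqm Y (i - 1) (tconv f da m) (f 0 a0)"
        "eqm Y (i - 1) (tconv E db m) (E 0 b0)"
      using tconv_lead[where f=D and r=da and m=m and i="i - 1", OF X X D] tconv_lead[where f=f and r=da and m=m and i="i - 1", OF X Y f]
        tconv_lead[where f=E and r=db and m=m and i="i - 2", OF Y Y E] by (simp_all add: da_def db_def X Y)
    have new: "eqm X i (x m) (tconv D (a + da) m)"
    proof -
      have "eqm X i (tconv D (a + da) m) (tconv D a m + tconv D da m)"
        using gm_add[OF tD TX TX a da] by (simp add: eqm_tseries)
      moreover have "eqm X i (tconv D a m + tconv D da m) (tconv D a m + r m)"
        using eqm_add[OF X eqm_refl[OF X] eqm_trans[OF X lead(1) eqm_sym[OF X ra]]] .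
      ultimately have "eqm X i (tconv D (a + da) m) (tconv D a m + r m)" by (rule eqm_trans[OF X])
      then show ?thesis using eqm_sym[OF X] by (simp add: r_def)
    qed
    have new2: "eqm Y (i - 1) (y m) (tconv f (a + da) m - tconv E (b + db) m)"
    proof -
      have g1: "eqm Y (i - 1) (tconv f (a + da) m) (tconv f a m + tconv f da m)"
        using gm_add[OF tf TX TY a da] by (simp add: eqm_tseries)
      have g2: "eqm Y (i - 1) (tconv E (b + db) m) (tconv E b m + tconv E db m)"
        using gm_add[OF tE TY TY b db] by (simp add: eqm_tseries)
      have g3: "eqm Y (i - 1) (tconv f da m - tconv E db m) (s m)"
        by (rule eqm_trans[OF Y eqm_diff[OF Y lead(2,3)] eqm_sym[OF Y sb]])
      have "eqm Y (i - 1) (tconv f (a + da) m - tconv E (b + db) m) (y m)"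
        by (rule eqm_comb[OF Y eqm_diff[OF Y g1 g2] g3]) (simp add: s_def)
      then show ?thesis by (rule eqm_sym[OF Y])
    qed
    have old: "tconv D (a + da) j = tconv D a j" "tconv f (a + da) j = tconv f a j"
      "tconv E (b + db) j = tconv E b j" if "j < m" for j
      using that by (intro tconv_cong_le; simp add: da_def db_def)+
    have "P (Suc m) (a + da, b + db)"
      using gsub_e(2)[OF TX a da] gsub_e(2)[OF TY b db] eq new new2 old
      by (auto simp: P_def less_Suc_eq)
    moreover have "R m (a, b) (a + da, b + db)"
      by (auto simp: R_def da_def db_def)
    ultimately show "\<exists>ab'. P (Suc m) ab' \<and> R m ab ab'" unfolding ab by blast
  qed
  then obtain g where g: "\<And>m. P m (g m)" and gR: "\<And>m. R m (g m) (g (Suc m))" by blast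
  define a where "a = (\<lambda>j. fst (g (Suc j)) j)"
  define b where "b = (\<lambda>j. snd (g (Suc j)) j)"
  have st: "fst (g m) j = a j \<and> snd (g m) j = b j" if "j < m" for m j
    using that
  proof (induction m)
    case (Suc m)
    show ?case
    proof (cases "j = m")
      case False
      then have "fst (g (Suc m)) j = fst (g m) j" "snd (g (Suc m)) j = snd (g m) j"
        using gR[of m] Suc.prems by (auto simp: R_def split_beta)
      then show ?thesis using Suc False by simp
    qed (simp add: a_def b_def)
  qed simp
  have "a \<in> elems (tseries X) (i - 1)" "b \<in> elems (tseries Y) (i - 2)"
    using g by (auto simp: P_def a_def b_def split_beta)
  moreover have "eqm X i (x j) (tconv D a j)" "eqm Y (i - 1) (y j) (tconv f a j - tconv E b j)" for j
  proof -
    have "tconv D (fst (g (Suc j))) j = tconv D a j" "tconv f (fst (g (Suc j))) j = tconv f a j"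
      "tconv E (snd (g (Suc j))) j = tconv E b j"
      using st by (intro tconv_cong_le; simp)+
    then show "eqm X i (x j) (tconv D a j)" "eqm Y (i - 1) (y j) (tconv f a j - tconv E b j)"
      using g[of "Suc j"] by (auto simp: P_def split_beta)
  qed
  ultimately show "\<exists>x'\<in>elems (tseries X) (i - 1). \<exists>y'\<in>elems (tseries Y) (i - 2).
        eqm (tseries X) i x (tconv D x') \<and> eqm (tseries Y) (i - 1) y (tconv f x' - tconv E y')"
    by (intro bexI[of _ a] bexI[of _ b]) (auto simp: eqm_tseries)
qed

lemma quasi_iso_tseries:
  assumes X: "is_gspace X" and Y: "is_gspace Y"
    and D: "\<And>m. gmap X X 1 (D m)" and E: "\<And>m. gmap Y Y 1 (E m)" and f: "\<And>m. gmap X Y 0 (f m)"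
    and ch: "chain_map (tseries X) (tconv D) (tseries Y) (tconv E) (tconv f)"
    and q: "quasi_iso X (\<lambda>_. D 0) Y (\<lambda>_. E 0) (\<lambda>_. f 0)"
  shows "quasi_iso (tseries X) (\<lambda>_. tconv D) (tseries Y) (\<lambda>_. tconv E) (\<lambda>_. tconv f)"
  using quasi_isoI[OF ch cone_acyclic_tseries[OF X Y D E f ch quasi_iso_imp_cone[OF q]]] .

section \<open>Reduction modulo \<open>u\<close>\<close>

definition uconst :: "'v::zero \<Rightarrow> nat \<Rightarrow> 'v" where
  "uconst x = (\<lambda>k. if k = 0 then x else 0)"

lemma uconst_0 [simp]: "uconst x 0 = x" "uconst x (Suc k) = 0"
  and mult_u_0 [simp]: "mult_u y 0 = 0" "mult_u y (Suc k) = y k"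
  and plus_u_0 [simp]: "plus_u D E y 0 = D (y 0)" "plus_u D E y (Suc k) = D (y (Suc k)) + E (y k)"
  by (simp_all add: uconst_def mult_u_def plus_u_def)

lemma all_nat_split: "(\<forall>k. P k) \<longleftrightarrow> P 0 \<and> (\<forall>k. P (Suc k))"
  by (metis nat.exhaust)

lemma elems_uconst: "is_gspace X \<Longrightarrow> uconst x \<in> elems (useries X) i \<longleftrightarrow> x \<in> elems X i"
  by (subst elems_useries, subst all_nat_split) (simp add: gsub_e(1))

lemma elems_mult_u: "is_gspace X \<Longrightarrow> mult_u x \<in> elems (useries X) i \<longleftrightarrow> x \<in> elems (useries X) (i - 2)"
  by (subst elems_useries, subst all_nat_split) (simp add: gsub_e(1) algebra_simps)

lemma nulls_uconst: "is_gspace X \<Longrightarrow> uconst x \<in> nulls (useries X) i \<longleftrightarrow> x \<in> nulls X i"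
  by (subst nulls_useries, subst all_nat_split) (simp add: gsub_n(1))

lemma nulls_mult_u: "is_gspace X \<Longrightarrow> mult_u x \<in> nulls (useries X) i \<longleftrightarrow> x \<in> nulls (useries X) (i - 2)"
  by (subst nulls_useries, subst all_nat_split) (simp add: gsub_n(1) algebra_simps)

lemma eqm_mult_u:
  assumes "is_gspace X"
  shows "eqm (useries X) i (mult_u x) (mult_u y) \<longleftrightarrow> eqm (useries X) (i - 2) x (y::nat \<Rightarrow> 'v::cspace)"
proof -
  have "mult_u x - mult_u y = mult_u (x - y)" by (rule ext) (auto simp: mult_u_def)
  then show ?thesis using nulls_mult_u[OF assms] by (simp add: eqm_def)
qed

lemma useries_at:
  "x \<in> elems (useries X) i \<Longrightarrow> x 0 \<in> elems X i" "x \<in> elems (useries X) i \<Longrightarrow> x (Suc 0) \<in> elems X (i - 2)"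
  "x \<in> nulls (useries X) i \<Longrightarrow> x 0 \<in> nulls X i" "x \<in> nulls (useries X) i \<Longrightarrow> x (Suc 0) \<in> nulls X (i - 2)"
  "eqm (useries X) i x y \<Longrightarrow> eqm X i (x 0) (y 0)" "eqm (useries X) i x y \<Longrightarrow> eqm X (i - 2) (x (Suc 0)) (y (Suc 0))"
  unfolding elems_useries nulls_useries eqm_useries
  by (erule allE[of _ 0] allE[of _ "Suc 0"], simp; fail)+

text \<open>
  Evaluating \<open>D + uE\<close> on constant series separates the two operators by the power of \<open>u\<close>.
\<close>

lemma gmap_of_plus_u:
  assumes X: "is_gspace X" and Y: "is_gspace Y"
    and g: "gmap (useries X) (useries Y) k (plus_u D E)"
  shows "gmap X Y k D" "gmap X Y (k - 2) E"
proof -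
  note UX = gspace_useries[OF X] and UY = gspace_useries[OF Y]
  have uc: "uconst x + uconst y = uconst (x + y)" "a \<bullet>\<^sub>C uconst x = uconst (a \<bullet>\<^sub>C x)" for x y :: 'a and a
    by (auto simp: uconst_def fun_eq_iff)
  have D: "D x \<in> elems Y (i + k)" "D 0 + E x \<in> elems Y (i + k - 2)" if "x \<in> elems X i" for x i
    using useries_at(1,2)[OF gm_elem[OF g UX UY, of "uconst x" i]] that elems_uconst[OF X, of x i] by simp_all
  have Dn: "D x \<in> nulls Y (i + k)" "D 0 + E x \<in> nulls Y (i + k - 2)" if "x \<in> nulls X i" for x i
    using useries_at(3,4)[OF gm_null[OF g UX UY, of "uconst x" i]] that nulls_uconst[OF X, of x i] by simp_all
  have D0: "D 0 \<in> nulls Y i" for i using Dn(1)[of 0 "i - k"] gsub_n(1)[OF X] by simp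
  have DE: "eqm Y i (D 0 + y) y" for y i using D0 by (simp add: eqm_def)
  have Da: "eqm Y (i + k) (D (x + y)) (D x + D y)" 
           "eqm Y (i + k - 2) (D 0 + E (x + y)) ((D 0 + E x) + (D 0 + E y))"
    if "x \<in> elems X i" "y \<in> elems X i" for x y i
    using useries_at(5,6)[OF gm_add[OF g UX UY, of "uconst x" i "uconst y"]] that elems_uconst[OF X, of _ i]
    by (simp_all add: uc)
  have Ds: "eqm Y (i + k) (D (a \<bullet>\<^sub>C x)) (a \<bullet>\<^sub>C D x)" 
           "eqm Y (i + k - 2) (D 0 + E (a \<bullet>\<^sub>C x)) (a \<bullet>\<^sub>C (D 0 + E x))"
    if "x \<in> elems X i" for x a i
    using useries_at(5,6)[OF gm_scale[OF g UX UY, of "uconst x" i a]] that elems_uconst[OF X, of _ i]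
    by (simp_all add: uc)
  show "gmap X Y k D"
    using D(1) Dn(1) Da(1) Ds(1) by (auto simp: graded_map_def eqm_def)
  have sh: "i + (k - 2) = i + k - 2" for i by simp
  have "E x \<in> elems Y (i + k - 2)" if "x \<in> elems X i" for x i
    using eqm_elem[OF Y eqm_sym[OF Y DE] D(2)[OF that]] .
  moreover have "E x \<in> nulls Y (i + k - 2)" if "x \<in> nulls X i" for x i
    using eqm_null[OF Y eqm_sym[OF Y DE] Dn(2)[OF that]] .
  moreover have "eqm Y (i + k - 2) (E (x + y)) (E x + E y)" if "x \<in> elems X i" "y \<in> elems X i" for x y i
    by (rule eqm_trans[OF Y eqm_trans[OF Y eqm_sym[OF Y DE] Da(2)[OF that]] eqm_add[OF Y DE DE]])
  moreover have "eqm Y (i + k - 2) (E (a \<bullet>\<^sub>C x)) (a \<bullet>\<^sub>C E x)" if "x \<in> elems X i" for x a i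
    by (rule eqm_trans[OF Y eqm_trans[OF Y eqm_sym[OF Y DE] Ds(2)[OF that]] eqm_scale[OF Y DE]])
  ultimately show "gmap X Y (k - 2) E"
    unfolding graded_map_def sh eqm_def by blast
qed

text \<open>
  The cone of \<open>F\<close> is acyclic, multiplication by \<open>u\<close> is injective on it, and the cone of the
  reduction is the quotient. Concretely: lift a cocycle of the quotient to a constant series, observe
  that its boundary is \<open>u\<close> times a cocycle, solve for the latter and correct the lift by \<open>u\<close> times the
  solution.
\<close>

lemma quasi_iso_mod_u:
  assumes X: "is_gspace X" and Y: "is_gspace Y"
    and q: "quasi_iso (useries X) (\<lambda>_. plus_u D E) (useries Y) (\<lambda>_. plus_u D' E') (\<lambda>_. F)"
    and u: "u_linear (useries X) (useries Y) F 0"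
  shows "quasi_iso X (\<lambda>_. D) Y (\<lambda>_. D') (\<lambda>_ x. F (uconst x) 0)"
    and "\<And>x i. x \<in> elems (useries X) i \<Longrightarrow> eqm Y i (F x 0) (F (uconst (x 0)) 0)"
proof -
  note UX = gspace_useries[OF X] and UY = gspace_useries[OF Y]
  define f where "f = (\<lambda>x. F (uconst x) 0)"
  have ch: "chain_map (useries X) (plus_u D E) (useries Y) (plus_u D' E') F"
    by (rule quasi_iso_chain_map[OF q])
  have co: "cone_acyclic (useries X) (plus_u D E) (useries Y) (plus_u D' E') F"
    by (rule quasi_iso_imp_cone[OF q])
  have cX: "is_complex (useries X) (\<lambda>_. plus_u D E)" and cY: "is_complex (useries Y) (\<lambda>_. plus_u D' E')"
    and F: "gmap (useries X) (useries Y) 0 F"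
    using ch by (auto simp: chain_map_def)
  note d = complexD(2)[OF cX] and e = complexD(2)[OF cY]
  note D = gmap_of_plus_u(1)[OF X X d] and E = gmap_of_plus_u(2)[OF X X d]
  note D' = gmap_of_plus_u(1)[OF Y Y e] and E' = gmap_of_plus_u(2)[OF Y Y e]
  have FU: "eqm (useries Y) (i + 2) (F (mult_u x)) (mult_u (F x))" if "x \<in> elems (useries X) i" for x i
    using u that unfolding u_linear_def eqm_def by auto
  have Fu: "eqm (useries Y) i (F (mult_u x)) (mult_u (F x))" if "x \<in> elems (useries X) (i - 2)" for x i
    using FU[OF that] by simp
  have uc: "uconst x + uconst y = uconst (x + y)" "a \<bullet>\<^sub>C uconst x = uconst (a \<bullet>\<^sub>C x)" for x y :: 'a and a
    by (auto simp: uconst_def fun_eq_iff)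
  note at0 = useries_at(5)[where X=Y] and at0X = useries_at(5)[where X=X]
  note el0 = useries_at(1)[where X=Y] and el0X = useries_at(1)[where X=X] and nu0 = useries_at(3)[where X=Y]
  have fgm: "gmap X Y 0 f"
    using el0[OF gm_elem[OF F UX UY]] nu0[OF gm_null[OF F UX UY]] elems_uconst[OF X] nulls_uconst[OF X]
      at0[OF gm_add[OF F UX UY]] at0[OF gm_scale[OF F UX UY]]
    unfolding graded_map_def f_def eqm_def uc[symmetric] by force
  have split: "x = uconst (x 0) + mult_u (\<lambda>k. x (Suc k))" for x :: "nat \<Rightarrow> 'a"
    by (rule ext) (auto simp: uconst_def mult_u_def)
  have sh: "(\<lambda>k. x (Suc k)) \<in> elems (useries X) (i - 2)" if "x \<in> elems (useries X) i" for x i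
    unfolding elems_useries
  proof
    fix k show "x (Suc k) \<in> elems X (i - 2 - 2 * int k)"
      using that[unfolded elems_useries, THEN spec[of _ "Suc k"]] by (simp add: algebra_simps)
  qed
  show red: "eqm Y i (F x 0) (F (uconst (x 0)) 0)" if x: "x \<in> elems (useries X) i" for x i
  proof -
    have c: "uconst (x 0) \<in> elems (useries X) i" using el0X[OF x] elems_uconst[OF X] by blast
    have m: "mult_u (\<lambda>k. x (Suc k)) \<in> elems (useries X) i" using sh[OF x] elems_mult_u[OF X] by blast
    have "eqm Y i (F (uconst (x 0) + mult_u (\<lambda>k. x (Suc k))) 0) (F (uconst (x 0)) 0 + F (mult_u (\<lambda>k. x (Suc k))) 0)"
      using at0[OF gm_add[OF F UX UY c m]] by simp
    moreover have "eqm Y i (F (mult_u (\<lambda>k. x (Suc k))) 0) 0"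
      using at0[OF Fu[OF sh[OF x]]] by simp
    ultimately show ?thesis
      unfolding split[of x, symmetric] by (rule eqm_comb[OF Y]) simp
  qed
  have f0: "eqm Y i (F x 0) (f (x 0))" if "x \<in> elems (useries X) i" for x i
    using red[OF that] by (simp add: f_def)
  have CX: "is_complex X (\<lambda>_. D)"
    unfolding is_complex_def
  proof (intro conjI allI ballI X D)
    fix i x assume "x \<in> elems X i"
    then have "eqm (useries X) (i + 2) (plus_u D E (plus_u D E (uconst x))) 0"
      by (intro complexD(3)[OF cX]) (simp only: elems_uconst[OF X])
    from at0X[OF this] show "D (D x) \<in> nulls X (i + 2)" by (simp add: eqm_def)
  qed
  have CY: "is_complex Y (\<lambda>_. D')"
    unfolding is_complex_def
  proof (intro conjI allI ballI Y D')
    fix i x assume "x \<in> elems Y i"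
    then have "eqm (useries Y) (i + 2) (plus_u D' E' (plus_u D' E' (uconst x))) 0"
      by (intro complexD(3)[OF cY]) (simp only: elems_uconst[OF Y])
    from at0[OF this] show "D' (D' x) \<in> nulls Y (i + 2)" by (simp add: eqm_def)
  qed
  have chf: "chain_map X D Y D' f"
    unfolding chain_map_def
  proof (intro conjI allI ballI CX CY fgm)
    fix i x assume x: "x \<in> elems X i"
    then have cx: "uconst x \<in> elems (useries X) i" by (simp only: elems_uconst[OF X])
    have "eqm (useries Y) (i + 1) (F (plus_u D E (uconst x))) (plus_u D' E' (F (uconst x)))"
      using ch cx unfolding chain_map_def by blast
    from at0[OF this] have "eqm Y (i + 1) (F (plus_u D E (uconst x)) 0) (D' (F (uconst x) 0))" by simp
    moreover have "eqm Y (i + 1) (F (plus_u D E (uconst x)) 0) (f (D x))"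
      using f0[OF gm_elem[OF d UX UX cx]] by simp
    ultimately show "eqm Y (i + 1) (f (D x)) (D' (f x))"
      unfolding f_def by (rule eqm_trans[OF Y eqm_sym[OF Y], rotated])
  qed
  have "cone_acyclic X D Y D' f"
    unfolding cone_acyclic_def
  proof (intro allI ballI impI)
    fix i x y assume x: "x \<in> elems X i" and y: "y \<in> elems Y (i - 1)"
      and Dx: "eqm X (i + 1) (D x) 0" and fx: "eqm Y i (f x) (D' y)"
    have cx: "uconst x \<in> elems (useries X) i" using x elems_uconst[OF X] by blast
    have cy: "uconst y \<in> elems (useries Y) (i - 1)" using y elems_uconst[OF Y] by blast
    have d0: "D 0 \<in> nulls X j" for j using gm_zero[OF D X X, of "j - 1"] by simp
    have e0: "E 0 \<in> nulls X j" for j using gm_zero[OF E X X, of "j + 1"] by simp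
    have d0': "D' 0 \<in> nulls Y j" for j using gm_zero[OF D' Y Y, of "j - 1"] by simp
    have e0': "E' 0 \<in> nulls Y j" for j using gm_zero[OF E' Y Y, of "j + 1"] by simp
    have pm: "eqm (useries X) j (plus_u D E (mult_u w)) (mult_u (plus_u D E w))" for j w
      using d0 e0 by (auto simp: eqm_def plus_u_def mult_u_def nulls_useries gsub_n(1)[OF X])
    have pm': "eqm (useries Y) j (plus_u D' E' (mult_u w)) (mult_u (plus_u D' E' w))" for j w
      using d0' e0' by (auto simp: eqm_def plus_u_def mult_u_def nulls_useries gsub_n(1)[OF Y])
    define z where "z = uconst (E x)"
    have z: "z \<in> elems (useries X) (i - 1)"
      unfolding z_def using gm_elem[OF E X X x] elems_uconst[OF X] by force
    have dx: "eqm (useries X) (i + 1) (plus_u D E (uconst x)) (mult_u z)"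
      unfolding eqm_useries
    proof
      fix k show "eqm X (i + 1 - 2 * int k) (plus_u D E (uconst x) k) (mult_u z k)"
      proof (cases k)
        case 0 then show ?thesis using Dx by simp
      next
        case (Suc j) then show ?thesis
          using d0 e0 gsub_n(2)[OF X] by (cases j) (auto simp: z_def eqm_def)
      qed
    qed
    define w where "w = F (uconst x) - plus_u D' E' (uconst y)"
    define v where "v = (\<lambda>k. w (Suc k))"
    have Fx: "F (uconst x) \<in> elems (useries Y) i" using gm_elem[OF F UX UY cx] by simp
    have ey: "plus_u D' E' (uconst y) \<in> elems (useries Y) i" using gm_elem[OF e UY UY cy] by simp
    have wel: "w \<in> elems (useries Y) i"
      unfolding w_def by (rule gsub_e(3)[OF UY Fx ey])
    have v: "v \<in> elems (useries Y) (i - 2)"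
      unfolding elems_useries
    proof
      fix k show "v k \<in> elems Y (i - 2 - 2 * int k)"
        using wel[unfolded elems_useries, THEN spec[of _ "Suc k"]] by (simp add: v_def algebra_simps)
    qed
    have wv: "eqm (useries Y) i w (mult_u v)"
      unfolding eqm_useries
    proof
      fix k show "eqm Y (i - 2 * int k) (w k) (mult_u v k)"
        using fx by (cases k) (auto simp: v_def w_def f_def eqm_def gsub_n(1)[OF Y])
    qed
    have uz: "mult_u z \<in> elems (useries X) (i + 1)" using z elems_mult_u[OF X, of z "i + 1"] by simp
    have uv: "mult_u v \<in> elems (useries Y) i" using v elems_mult_u[OF Y] by blast
    have dz: "eqm (useries X) i (plus_u D E z) 0"
    proof -
      have "eqm (useries X) (i + 2) (plus_u D E (plus_u D E (uconst x))) (plus_u D E (mult_u z))"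
        using gm_cong[OF d UX UX gm_elem[OF d UX UX cx] uz dx] by (simp add: add.commute)
      then have "eqm (useries X) (i + 2) (mult_u (plus_u D E z)) 0"
        by (intro eqm_trans[OF UX eqm_sym[OF UX pm] eqm_trans[OF UX eqm_sym[OF UX] complexD(3)[OF cX cx]]])
      moreover have "(0::nat \<Rightarrow> 'a) = mult_u 0" by (auto simp: mult_u_def fun_eq_iff)
      ultimately show ?thesis using eqm_mult_u[OF X, of "i+2" "plus_u D E z" 0] by simp
    qed
    have Fz: "eqm (useries Y) (i - 1) (F z) (plus_u D' E' v)"
    proof -
      have 1: "eqm (useries Y) (i + 1) (plus_u D' E' w) (plus_u D' E' (F (uconst x)) - plus_u D' E' (plus_u D' E' (uconst y)))"
        unfolding w_def by (rule gm_diff[OF e UY UY Fx ey])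
      have 2: "eqm (useries Y) (i + 1) (plus_u D' E' (plus_u D' E' (uconst y))) 0"
        using complexD(3)[OF cY cy] by (simp add: add.commute)
      have 3: "eqm (useries Y) (i + 1) (plus_u D' E' w) (plus_u D' E' (F (uconst x)))"
        by (rule eqm_comb[OF UY 1 eqm_sym[OF UY 2]]) simp
      have 4: "eqm (useries Y) (i + 1) (plus_u D' E' (F (uconst x))) (F (plus_u D E (uconst x)))"
        by (rule eqm_sym[OF UY]) (use ch cx in \<open>auto simp: chain_map_def\<close>)
      have 5: "eqm (useries Y) (i + 1) (F (plus_u D E (uconst x))) (F (mult_u z))"
        using gm_cong[OF F UX UY gm_elem[OF d UX UX cx] uz dx] by simp
      have 6: "eqm (useries Y) (i + 1) (F (mult_u z)) (mult_u (F z))"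
        using Fu[of z "i + 1"] z by simp
      have 7: "eqm (useries Y) (i + 1) (plus_u D' E' w) (plus_u D' E' (mult_u v))"
        by (rule gm_cong[OF e UY UY wel uv wv])
      have "eqm (useries Y) (i + 1) (mult_u (F z)) (mult_u (plus_u D' E' v))"
        by (rule eqm_trans[OF UY eqm_sym[OF UY 6] eqm_trans[OF UY eqm_sym[OF UY 5] eqm_trans[OF UY
              eqm_sym[OF UY 4] eqm_trans[OF UY eqm_sym[OF UY 3] eqm_trans[OF UY 7 pm']]]]])
      then show ?thesis using eqm_mult_u[OF Y, of "i+1"] by simp
    qed
    obtain z' v' where z': "z' \<in> elems (useries X) (i - 2)" and v': "v' \<in> elems (useries Y) (i - 3)"
      and zz: "eqm (useries X) (i - 1) z (plus_u D E z')" and vv: "eqm (useries Y) (i - 2) v (F z' - plus_u D' E' v')"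
      using cone_acyclicD[OF co z, of v] v dz Fz by auto
    define a where "a = uconst x - mult_u z'"
    define c where "c = uconst y - mult_u v'"
    have uz': "mult_u z' \<in> elems (useries X) i" using z' elems_mult_u[OF X] by blast
    have uv': "mult_u v' \<in> elems (useries Y) (i - 1)" using v' elems_mult_u[OF Y, of v' "i - 1"] by simp
    have a: "a \<in> elems (useries X) i" unfolding a_def by (rule gsub_e(3)[OF UX cx uz'])
    have c: "c \<in> elems (useries Y) (i - 1)" unfolding c_def by (rule gsub_e(3)[OF UY cy uv'])
    have da: "eqm (useries X) (i + 1) (plus_u D E a) 0"
    proof -
      have 1: "eqm (useries X) (i + 1) (plus_u D E a) (plus_u D E (uconst x) - plus_u D E (mult_u z'))"
        unfolding a_def by (rule gm_diff[OF d UX UX cx uz'])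
      have "eqm (useries X) (i + 1) (mult_u (plus_u D E z')) (mult_u z)"
        using eqm_sym[OF UX zz] eqm_mult_u[OF X, of "i+1"] by simp
      then have 2: "eqm (useries X) (i + 1) (plus_u D E (mult_u z')) (mult_u z)"
        by (rule eqm_trans[OF UX pm])
      show ?thesis by (rule eqm_comb[OF UX 1 eqm_diff[OF UX dx 2]]) simp
    qed
    have Fa: "eqm (useries Y) i (F a) (plus_u D' E' c)"
    proof -
      have 1: "eqm (useries Y) i (F a) (F (uconst x) - F (mult_u z'))"
        unfolding a_def using gm_diff[OF F UX UY cx uz'] by simp
      have 2: "eqm (useries Y) i (F (mult_u z')) (mult_u (F z'))" by (rule Fu[OF z'])
      have 3: "eqm (useries Y) i (plus_u D' E' c) (plus_u D' E' (uconst y) - plus_u D' E' (mult_u v'))"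
        unfolding c_def using gm_diff[OF e UY UY cy uv'] by simp
      have 4: "eqm (useries Y) i w (mult_u (F z') - mult_u (plus_u D' E' v'))"
      proof -
        have "mult_u (F z' - plus_u D' E' v') = mult_u (F z') - mult_u (plus_u D' E' v')"
          by (rule ext) (auto simp: mult_u_def)
        then show ?thesis using eqm_trans[OF UY wv] vv eqm_mult_u[OF Y, of i v "F z' - plus_u D' E' v'"] by simp
      qed
      have 5: "eqm (useries Y) i (plus_u D' E' c) (plus_u D' E' (uconst y) - mult_u (plus_u D' E' v'))"
        by (rule eqm_trans[OF UY 3 eqm_diff[OF UY eqm_refl[OF UY] pm']])
      have 6: "eqm (useries Y) i (F a) (F (uconst x) - mult_u (F z'))"
        by (rule eqm_trans[OF UY 1 eqm_diff[OF UY eqm_refl[OF UY] 2]])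
      have 7: "eqm (useries Y) i (w + (plus_u D' E' (uconst y) - mult_u (plus_u D' E' v')))
        ((mult_u (F z') - mult_u (plus_u D' E' v')) + plus_u D' E' c)"
        by (rule eqm_add[OF UY 4 eqm_sym[OF UY 5]])
      show ?thesis by (rule eqm_comb[OF UY 6 7]) (simp add: w_def algebra_simps)
    qed
    obtain x1 y1 where x1: "x1 \<in> elems (useries X) (i - 1)" and y1: "y1 \<in> elems (useries Y) (i - 2)"
      and ax: "eqm (useries X) i a (plus_u D E x1)" and cy: "eqm (useries Y) (i - 1) c (F x1 - plus_u D' E' y1)"
      using cone_acyclicD[OF co a c] da Fa by blast
    have "eqm X i x (D (x1 0))" using at0X[OF ax] by (simp add: a_def)
    moreover have "eqm Y (i - 1) y (f (x1 0) - D' (y1 0))"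
    proof -
      have "eqm Y (i - 1) y (F x1 0 - D' (y1 0))" using at0[OF cy] by (simp add: c_def)
      then show ?thesis
        by (rule eqm_trans[OF Y _ eqm_diff[OF Y f0[OF x1] eqm_refl[OF Y]]])
    qed
    ultimately show "\<exists>x'\<in>elems X (i - 1). \<exists>y'\<in>elems Y (i - 2).
        eqm X i x (D x') \<and> eqm Y (i - 1) y (f x' - D' y')"
      using el0X[OF x1] el0[OF y1] by blast
  qed
  from quasi_isoI[OF chf this] show "quasi_iso X (\<lambda>_. D) Y (\<lambda>_. D') (\<lambda>_ x. F (uconst x) 0)"
    by (simp add: f_def)
qed

section \<open>Exchanging the two variables\<close>

text \<open>
  The twisted maps live on series in \<open>t\<close> with coefficients in series in \<open>u\<close>, while the complexes of
  the deformed algebra are series in \<open>u\<close> of series in \<open>t\<close>.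
\<close>

definition swap :: "('a \<Rightarrow> 'b \<Rightarrow> 'c) \<Rightarrow> 'b \<Rightarrow> 'a \<Rightarrow> 'c" where
  "swap x = (\<lambda>b a. x a b)"

lemma swap_swap [simp]: "swap (swap x) = x"
  and swap_add: "swap (x + y) = swap x + swap y"
  and swap_diff: "swap (x - y) = swap x - swap y"
  and swap_scale: "swap (a \<bullet>\<^sub>C z) = a \<bullet>\<^sub>C swap z"
  for x y :: "'a \<Rightarrow> 'b \<Rightarrow> 'c::ab_group_add" and z :: "'a \<Rightarrow> 'b \<Rightarrow> 'd::cspace"
  by (simp_all add: swap_def fun_eq_iff)

lemma elems_swap: "swap x \<in> elems (useries (tseries X)) i \<longleftrightarrow> x \<in> elems (tseries (useries X)) i"
  and nulls_swap: "swap x \<in> nulls (useries (tseries X)) i \<longleftrightarrow> x \<in> nulls (tseries (useries X)) i"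
  by (auto simp: swap_def)

lemma quasi_iso_swap:
  assumes q: "quasi_iso (tseries (useries X)) (\<lambda>_. D) (tseries (useries Y)) (\<lambda>_. E) (\<lambda>_. f)"
    and X: "is_gspace X" and Y: "is_gspace Y"
  shows "quasi_iso (useries (tseries X)) (\<lambda>_ x. swap (D (swap x)))
    (useries (tseries Y)) (\<lambda>_ x. swap (E (swap x))) (\<lambda>_ x. swap (f (swap x)))"
proof -
  have el: "x \<in> elems (useries (tseries Z)) i \<longleftrightarrow> swap x \<in> elems (tseries (useries Z)) i"
    and nu: "x \<in> nulls (useries (tseries Z)) i \<longleftrightarrow> swap x \<in> nulls (tseries (useries Z)) i"
    for x :: "nat \<Rightarrow> nat \<Rightarrow> 'z::cspace" and Z i
    by (auto simp: swap_def)
  have eq: "eqm (useries (tseries Z)) i x y \<longleftrightarrow> eqm (tseries (useries Z)) i (swap x) (swap y)"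
    for x y :: "nat \<Rightarrow> nat \<Rightarrow> 'z::cspace" and Z i
    unfolding eqm_def nu swap_diff by simp
  have gm: "gmap (useries (tseries Z)) (useries (tseries W)) k (\<lambda>x. swap (g (swap x)))"
    if "gmap (tseries (useries Z)) (tseries (useries W)) k g"
    for Z :: "'z::cspace gspace" and W :: "'w::cspace gspace" and k g
    using that unfolding graded_map_def Ball_def el nu swap_add swap_diff swap_scale swap_swap by blast
  have sw: "(\<exists>x\<in>elems (useries (tseries Z)) i. P (swap x)) \<longleftrightarrow> (\<exists>x\<in>elems (tseries (useries Z)) i. P x)"
    for Z :: "'z::cspace gspace" and i P
    unfolding Bex_def el by (metis swap_swap)
  have ch: "chain_map (tseries (useries X)) D (tseries (useries Y)) E f"
    by (rule quasi_iso_chain_map[OF q])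
  have ch': "chain_map (useries (tseries X)) (\<lambda>x. swap (D (swap x))) (useries (tseries Y))
     (\<lambda>x. swap (E (swap x))) (\<lambda>x. swap (f (swap x)))"
  proof -
    have c: "is_complex (useries (tseries Z)) (\<lambda>_ x. swap (g (swap x)))"
      if "is_complex (tseries (useries Z)) (\<lambda>_. g)" and "is_gspace Z" for Z :: "'z::cspace gspace" and g
      using that gm[of Z Z 1 g] gspace_useries[OF gspace_tseries[OF that(2)]]
      unfolding is_complex_def Ball_def el nu swap_swap by blast
    show ?thesis
      using ch gm[of X Y 0 f] c[OF _ X] c[OF _ Y]
      unfolding chain_map_def Ball_def el nu eq swap_swap by blast
  qed
  have co: "cone_acyclic (tseries (useries X)) D (tseries (useries Y)) E f"
    by (rule quasi_iso_imp_cone[OF q])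
  have "cone_acyclic (useries (tseries X)) (\<lambda>x. swap (D (swap x))) (useries (tseries Y))
     (\<lambda>x. swap (E (swap x))) (\<lambda>x. swap (f (swap x)))"
    unfolding cone_acyclic_def
  proof (intro allI ballI impI)
    fix i x y
    assume "x \<in> elems (useries (tseries X)) i" "y \<in> elems (useries (tseries Y)) (i - 1)"
      "eqm (useries (tseries X)) (i + 1) (swap (D (swap x))) 0"
      "eqm (useries (tseries Y)) i (swap (f (swap x))) (swap (E (swap y)))"
    moreover have "swap (0 :: nat \<Rightarrow> nat \<Rightarrow> 'a) = 0" by (simp add: swap_def fun_eq_iff)
    ultimately obtain x' y' where "x' \<in> elems (tseries (useries X)) (i - 1)"
      "y' \<in> elems (tseries (useries Y)) (i - 2)"
      "eqm (tseries (useries X)) i (swap x) (D x')"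
      "eqm (tseries (useries Y)) (i - 1) (swap y) (f x' - E y')"
      using cone_acyclicD[OF co, of "swap x" i "swap y"] unfolding el eq swap_swap by metis
    then show "\<exists>x'\<in>elems (useries (tseries X)) (i - 1). \<exists>y'\<in>elems (useries (tseries Y)) (i - 2).
        eqm (useries (tseries X)) i x (swap (D (swap x'))) \<and>
        eqm (useries (tseries Y)) (i - 1) y (swap (f (swap x')) - swap (E (swap y')))"
      by (intro bexI[of _ "swap x'"] bexI[of _ "swap y'"]) (simp_all add: el eq swap_diff del: elems_tseries elems_useries)
  qed
  with ch' show ?thesis by (rule quasi_isoI)
qed

lemma quasi_iso_cong:
  assumes q: "quasi_iso X (\<lambda>_. D) Y (\<lambda>_. E) (\<lambda>_. f)"
    and D: "\<And>i x. x \<in> elems X i \<Longrightarrow> D' x = D x" and E: "\<And>i x. x \<in> elems Y i \<Longrightarrow> E' x = E x"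
    and f: "\<And>i x. x \<in> elems X i \<Longrightarrow> f' x = f x"
  shows "quasi_iso X (\<lambda>_. D') Y (\<lambda>_. E') (\<lambda>_. f')"
proof -
  have ch: "chain_map X D Y E f" by (rule quasi_iso_chain_map[OF q])
  have cX: "is_complex X (\<lambda>_. D)" and cY: "is_complex Y (\<lambda>_. E)" and F: "gmap X Y 0 f"
    using ch by (auto simp: chain_map_def)
  note X = complexD(1)[OF cX] and Y = complexD(1)[OF cY]
  note d = complexD(2)[OF cX] and e = complexD(2)[OF cY]
  have gc: "gmap Z W k g'"
    if g: "gmap Z W k g" and Z: "is_gspace Z" and eq: "\<And>i x. x \<in> elems Z i \<Longrightarrow> g' x = g x"
    for Z :: "'z::cspace gspace" and W :: "'w::cspace gspace" and k g g'
  proof -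
    have "g' (x + y) = g (x + y)" if "x \<in> elems Z i" "y \<in> elems Z i" for x y i
      using eq[OF gsub_e(2)[OF Z that]] .
    moreover have "g' (a \<bullet>\<^sub>C x) = g (a \<bullet>\<^sub>C x)" if "x \<in> elems Z i" for x a i
      using eq[OF gsub_e(4)[OF Z that]] .
    moreover have "g' x = g x" if "x \<in> nulls Z i" for x i
      using eq[OF gspace_le[OF Z that]] .
    ultimately show ?thesis using g unfolding graded_map_def by (simp add: eq)
  qed
  have "is_complex X (\<lambda>_. D')"
    using X gc[OF d X D] cX D[OF gm_elem[OF d X X]] D by (simp add: is_complex_def)
  moreover have "is_complex Y (\<lambda>_. E')"
    using Y gc[OF e Y E] cY E[OF gm_elem[OF e Y Y]] E by (simp add: is_complex_def)
  moreover have "eqm Y (i + 1) (f' (D' x)) (E' (f' x))" if x: "x \<in> elems X i" for x i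
  proof -
    have "f' (D' x) = f (D x)" using f[OF gm_elem[OF d X X x]] D[OF x] by simp
    moreover have "E' (f' x) = E (f x)" using E[OF gm_elem[OF F X Y x]] f[OF x] by simp
    ultimately show ?thesis using ch x unfolding chain_map_def by metis
  qed
  ultimately have ch': "chain_map X D' Y E' f'"
    using gc[OF F X, of f'] f unfolding chain_map_def by blast
  have co: "cone_acyclic X D Y E f" by (rule quasi_iso_imp_cone[OF q])
  have "cone_acyclic X D' Y E' f'"
    unfolding cone_acyclic_def
  proof (intro allI ballI impI)
    fix i x y assume x: "x \<in> elems X i" and y: "y \<in> elems Y (i - 1)"
      and "eqm X (i + 1) (D' x) 0" "eqm Y i (f' x) (E' y)"
    then obtain x' y' where "x' \<in> elems X (i - 1)" "y' \<in> elems Y (i - 2)"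
      "eqm X i x (D x')" "eqm Y (i - 1) y (f x' - E y')"
      using cone_acyclicD[OF co x y] D[OF x] E[OF y] f[OF x] by metis
    then show "\<exists>x'\<in>elems X (i - 1). \<exists>y'\<in>elems Y (i - 2).
        eqm X i x (D' x') \<and> eqm Y (i - 1) y (f' x' - E' y')"
      using D E f by (intro bexI[of _ x'] bexI[of _ y']) auto
  qed
  with ch' show ?thesis by (rule quasi_isoI)
qed

section \<open>Sums over compositions\<close>

abbreviation words :: "'a set \<Rightarrow> nat \<Rightarrow> 'a list set" where
  "words A n \<equiv> {ws. set ws \<subseteq> A \<and> length ws = n}"

lemma sum_words_Suc:
  assumes "finite A"
  shows "sum h (words A (Suc n)) = (\<Sum>k\<in>A. \<Sum>ws\<in>words A n. h (k # ws))"
proof -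
  let ?f = "\<lambda>p. fst p # snd p"
  have eq: "words A (Suc n) = ?f ` (A \<times> words A n)"
    by (auto simp: length_Suc_conv image_iff)
  have inj: "inj_on ?f (A \<times> words A n)"
    by (auto simp: inj_on_def)
  show ?thesis
    unfolding eq sum.reindex[OF inj] by (simp add: sum.cartesian_product comp_def case_prod_unfold)
qed

text \<open>
  A word is the same as its restrictions to \<open>S\<close> and to the complement of \<open>S\<close>.
\<close>

lemma sum_words_nths:
  assumes A: "finite A" and S: "S \<subseteq> {..<n}"
  shows "(\<Sum>ws\<in>words A n. G (nths ws S) (nths ws (- S)))
    = (\<Sum>as\<in>words A (card S). \<Sum>bs\<in>words A (n - card S). G as bs)"
  using S
proof (induction n arbitrary: S G)
  case 0
  then have "S = {}" by simp
  moreover have "words A 0 = {[]}" by auto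
  ultimately show ?case by simp
next
  case (Suc n)
  define S' where "S' = {j. Suc j \<in> S}"
  have S': "S' \<subseteq> {..<n}" using Suc.prems by (auto simp: S'_def)
  have fin: "finite S'" using S' finite_subset by blast
  have compl: "{j. Suc j \<in> - S} = - S'" by (auto simp: S'_def)
  have S_eq: "S = (if 0 \<in> S then insert 0 (Suc ` S') else Suc ` S')"
    by (auto simp: S'_def image_iff) (metis not0_implies_Suc)+
  have cS: "card S = (if 0 \<in> S then Suc (card S') else card S')"
    by (subst S_eq) (auto simp: card_image fin)
  have le: "card S' \<le> n" using card_mono[OF _ S'] by simp
  show ?case
  proof (cases "0 \<in> S")
    case True
    have "(\<Sum>ws\<in>words A (Suc n). G (nths ws S) (nths ws (- S)))
        = (\<Sum>k\<in>A. \<Sum>ws\<in>words A n. G (k # nths ws S') (nths ws (- S')))"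
      unfolding sum_words_Suc[OF A] nths_Cons compl using True by (simp add: S'_def)
    also have "\<dots> = (\<Sum>k\<in>A. \<Sum>as\<in>words A (card S'). \<Sum>bs\<in>words A (n - card S'). G (k # as) bs)"
      by (rule sum.cong[OF refl], rule Suc.IH[OF S', of "\<lambda>as. G (k # as)" for k])
    also have "\<dots> = (\<Sum>as\<in>words A (Suc (card S')). \<Sum>bs\<in>words A (n - card S'). G as bs)"
      by (simp only: sum_words_Suc[OF A])
    finally show ?thesis using True cS by simp
  next
    case False
    have "(\<Sum>ws\<in>words A (Suc n). G (nths ws S) (nths ws (- S)))
        = (\<Sum>k\<in>A. \<Sum>ws\<in>words A n. G (nths ws S') (k # nths ws (- S')))"
      unfolding sum_words_Suc[OF A] nths_Cons compl using False by (simp add: S'_def)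
    also have "\<dots> = (\<Sum>k\<in>A. \<Sum>as\<in>words A (card S'). \<Sum>bs\<in>words A (n - card S'). G as (k # bs))"
      by (rule sum.cong[OF refl], rule Suc.IH[OF S', of "\<lambda>as bs. G as (k # bs)" for k])
    also have "\<dots> = (\<Sum>as\<in>words A (card S'). \<Sum>k\<in>A. \<Sum>bs\<in>words A (n - card S'). G as (k # bs))"
      by (rule sum.swap)
    also have "\<dots> = (\<Sum>as\<in>words A (card S'). \<Sum>bs\<in>words A (Suc (n - card S')). G as bs)"
      by (simp only: sum_words_Suc[OF A])
    finally show ?thesis using False cS le by (simp add: Suc_diff_le)
  qed
qed

text \<open>
  Compositions of \<open>m\<close>: the exponents that contribute to \<open>t\<^sup>m\<close> in \<open>(\<pi>, \<dots>, \<pi>)\<close> when \<open>\<pi>\<close> has no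
  constant term.
\<close>

definition comps :: "nat \<Rightarrow> nat list set" where
  "comps m = {ms. (\<forall>k\<in>set ms. 1 \<le> k) \<and> sum_list ms = m}"

lemma length_le_sum_list: "(\<forall>k\<in>set ms. 1 \<le> k) \<Longrightarrow> length ms \<le> sum_list (ms :: nat list)"
  by (induction ms) auto

lemma member_le_sum_list: "k \<in> set ms \<Longrightarrow> k \<le> sum_list (ms :: nat list)"
  by (induction ms) auto

lemma comps_words:
  assumes "k \<le> m"
  shows "comps k = (\<Union>n\<le>m. {ms\<in>words {1..m} n. sum_list ms = k})"
proof (intro set_eqI iffI)
  fix ms assume "ms \<in> comps k"
  then have ms: "\<forall>j\<in>set ms. 1 \<le> j" "sum_list ms = k" by (auto simp: comps_def)
  then have "length ms \<le> m" "set ms \<subseteq> {1..m}"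
    using length_le_sum_list[OF ms(1)] member_le_sum_list[of _ ms] assms by fastforce+
  with ms show "ms \<in> (\<Union>n\<le>m. {ms\<in>words {1..m} n. sum_list ms = k})" by auto
qed (auto simp: comps_def)

lemma finite_words: "finite A \<Longrightarrow> finite (words A n)"
  by (rule finite_lists_length_eq)

lemma finite_words_sum: "finite {ms \<in> words {1..m::nat} n. sum_list ms = k}"
  by (rule finite_subset[OF _ finite_words[of "{1..m}" n]]) auto

lemma finite_comps [simp]: "finite (comps m)"
  unfolding comps_words[OF order_refl] by (intro finite_UN_I finite_atMost finite_words_sum)

lemma comps_0 [simp]: "comps 0 = {[]}"
  unfolding comps_words[OF order_refl] by auto

text \<open>
  This is \<open>exp(a + b) = exp a exp b\<close> in the form needed for \<open>L\<^sub>\<infinity>\<close> identities: the \<open>n choose k\<close>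
  subsets of size \<open>k\<close> turn \<open>1/n!\<close> into \<open>1/(k! (n-k)!)\<close>.
\<close>

lemma sum_comps_unshuffle:
  fixes G :: "nat list \<Rightarrow> nat list \<Rightarrow> 'a::cspace"
  shows "(\<Sum>ms\<in>comps m. (1 / fact (length ms)) \<bullet>\<^sub>C
            (\<Sum>S\<in>Pow {..<length ms}. G (nths ms S) (nths ms (- S))))
    = (\<Sum>i\<le>m. \<Sum>as\<in>comps i. \<Sum>bs\<in>comps (m - i).
         (1 / fact (length as) * (1 / fact (length bs))) \<bullet>\<^sub>C G as bs)"
proof -
  let ?A = "{1..m}"
  define H where "H = (\<lambda>as bs. if sum_list as + sum_list bs = m then G as bs else 0)"
  define c where "c = (\<lambda>k l. 1 / fact k * (1 / fact l) :: complex)"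
  have sum_split: "sum_list (nths ms S) + sum_list (nths ms (- S)) = sum_list ms" for ms :: "nat list" and S
  proof (induction ms arbitrary: S)
    case (Cons x ms)
    have "{j. Suc j \<in> - S} = - {j. Suc j \<in> S}" by auto
    with Cons[of "{j. Suc j \<in> S}"] show ?case by (auto simp: nths_Cons)
  qed simp
  have disj: "(\<Sum>ms\<in>comps k. h ms) = (\<Sum>n\<le>m. \<Sum>ms\<in>words ?A n. if sum_list ms = k then h ms else 0)"
    if "k \<le> m" for k and h :: "nat list \<Rightarrow> 'a"
  proof -
    have "(\<Sum>ms\<in>comps k. h ms) = (\<Sum>n\<le>m. \<Sum>ms\<in>{ms\<in>words ?A n. sum_list ms = k}. h ms)"
      unfolding comps_words[OF that]
      by (rule sum.UNION_disjoint[OF finite_atMost]) (use finite_words_sum in blast, auto)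
    also have "\<dots> = (\<Sum>n\<le>m. \<Sum>ms\<in>words ?A n. if sum_list ms = k then h ms else 0)"
      by (intro sum.cong refl sum.inter_filter finite_words) simp
    finally show ?thesis .
  qed
  have "(\<Sum>ms\<in>comps m. (1 / fact (length ms)) \<bullet>\<^sub>C
            (\<Sum>S\<in>Pow {..<length ms}. G (nths ms S) (nths ms (- S))))
      = (\<Sum>n\<le>m. \<Sum>ms\<in>words ?A n. (1 / fact n) \<bullet>\<^sub>C
            (\<Sum>S\<in>Pow {..<n}. H (nths ms S) (nths ms (- S))))"
    unfolding disj[OF order_refl] H_def sum_split by (intro sum.cong refl) auto
  also have "\<dots> = (\<Sum>n\<le>m. (1 / fact n) \<bullet>\<^sub>C (\<Sum>S\<in>Pow {..<n}. \<Sum>ms\<in>words ?A n. H (nths ms S) (nths ms (- S))))"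
    by (simp only: cscale_sum_right[symmetric] sum.swap[of _ "Pow _"])
  also have "\<dots> = (\<Sum>n\<le>m. (1 / fact n) \<bullet>\<^sub>C (\<Sum>S\<in>Pow {..<n}.
      \<Sum>as\<in>words ?A (card S). \<Sum>bs\<in>words ?A (n - card S). H as bs))"
    by (intro sum.cong refl arg_cong[where f="(\<bullet>\<^sub>C) _"] sum_words_nths) auto
  also have "\<dots> = (\<Sum>n\<le>m. \<Sum>k\<le>n. c k (n - k) \<bullet>\<^sub>C (\<Sum>as\<in>words ?A k. \<Sum>bs\<in>words ?A (n - k). H as bs))"
  proof (intro sum.cong refl)
    fix n
    let ?h = "\<lambda>k. \<Sum>as\<in>words ?A k. \<Sum>bs\<in>words ?A (n - k). H as bs"
    have "(\<Sum>S\<in>Pow {..<n}. ?h (card S)) = (\<Sum>k\<le>n. \<Sum>S\<in>{S\<in>Pow {..<n}. card S = k}. ?h (card S))"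
      by (rule sum.group[symmetric]) (auto intro: order_trans[OF card_mono[of "{..<n}"]])
    also have "\<dots> = (\<Sum>k\<le>n. of_nat (n choose k) \<bullet>\<^sub>C ?h k)"
    proof (intro sum.cong refl)
      fix k
      have "card {S \<in> Pow {..<n}. card S = k} = n choose k"
        using n_subsets[of "{..<n}" k] by simp
      moreover have "(\<Sum>S\<in>T. y) = of_nat (card T) \<bullet>\<^sub>C y" if "finite T" for T :: "nat set set" and y :: 'a
        using that by (induction T) (simp_all add: cscale_add_left cscale_one)
      ultimately show "(\<Sum>S\<in>{S\<in>Pow {..<n}. card S = k}. ?h (card S)) = of_nat (n choose k) \<bullet>\<^sub>C ?h k"
        by simp
    qed
    finally show "(1 / fact n) \<bullet>\<^sub>C (\<Sum>S\<in>Pow {..<n}. ?h (card S)) = (\<Sum>k\<le>n. c k (n - k) \<bullet>\<^sub>C ?h k)"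
      by (simp add: cscale_sum_right cscale_cscale c_def binomial_fact)
  qed
  also have "\<dots> = (\<Sum>n\<le>m. \<Sum>k\<le>n. \<Sum>as\<in>words ?A k. \<Sum>bs\<in>words ?A (n - k).
      c (length as) (length bs) \<bullet>\<^sub>C H as bs)"
    by (simp add: cscale_sum_right)
  also have "\<dots> = (\<Sum>k\<le>m. \<Sum>l\<le>m - k. \<Sum>as\<in>words ?A k. \<Sum>bs\<in>words ?A l. c (length as) (length bs) \<bullet>\<^sub>C H as bs)"
  proof -
    have "(\<Sum>n\<le>m. \<Sum>k\<le>n. f k (n - k)) = (\<Sum>k\<le>m. \<Sum>l\<le>m - k. f k l)" for f :: "nat \<Rightarrow> nat \<Rightarrow> 'a"
      by (subst sum.triangle_reindex_eq[symmetric], subst sum.Sigma) (auto intro!: sum.cong)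
    then show ?thesis .
  qed
  also have "\<dots> = (\<Sum>k\<le>m. \<Sum>l\<le>m. \<Sum>as\<in>words ?A k. \<Sum>bs\<in>words ?A l. c (length as) (length bs) \<bullet>\<^sub>C H as bs)"
  proof (rule sum.cong[OF refl], rule sum.mono_neutral_left)
    fix k assume "k \<in> {..m}"
    show "\<forall>l\<in>{..m} - {..m - k}. (\<Sum>as\<in>words ?A k. \<Sum>bs\<in>words ?A l. c (length as) (length bs) \<bullet>\<^sub>C H as bs) = 0"
    proof
    fix l assume "l \<in> {..m} - {..m - k}"
    then have "m < k + l" by auto
    have "H as bs = 0" if "as \<in> words ?A k" "bs \<in> words ?A l" for as bs
      using that length_le_sum_list[of as] length_le_sum_list[of bs] \<open>m < k + l\<close> by (force simp: H_def)
    then show "(\<Sum>as\<in>words ?A k. \<Sum>bs\<in>words ?A l. c (length as) (length bs) \<bullet>\<^sub>C H as bs) = 0"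
      by (auto intro!: sum.neutral)
    qed
  qed auto
  also have "\<dots> = (\<Sum>k\<le>m. \<Sum>as\<in>words ?A k. \<Sum>l\<le>m. \<Sum>bs\<in>words ?A l. c (length as) (length bs) \<bullet>\<^sub>C H as bs)"
    by (intro sum.cong refl sum.swap)
  also have "\<dots> = (\<Sum>k\<le>m. \<Sum>as\<in>words ?A k. \<Sum>i\<le>m. if sum_list as = i then
      (\<Sum>bs\<in>comps (m - i). c (length as) (length bs) \<bullet>\<^sub>C G as bs) else 0)"
  proof (rule sum.cong[OF refl], rule sum.cong[OF refl])
    fix k as
    show "(\<Sum>l\<le>m. \<Sum>bs\<in>words ?A l. c (length as) (length bs) \<bullet>\<^sub>C H as bs)
      = (\<Sum>i\<le>m. if sum_list as = i then (\<Sum>bs\<in>comps (m - i). c (length as) (length bs) \<bullet>\<^sub>C G as bs) else 0)"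
    proof (cases "sum_list as \<le> m")
      case True
      then show ?thesis
        unfolding disj[OF diff_le_self] by (auto simp: H_def intro!: sum.cong)
    qed (auto simp: H_def intro!: sum.neutral)
  qed
  also have "\<dots> = (\<Sum>i\<le>m. \<Sum>k\<le>m. \<Sum>as\<in>words ?A k. if sum_list as = i then
      (\<Sum>bs\<in>comps (m - i). c (length as) (length bs) \<bullet>\<^sub>C G as bs) else 0)"
    by (simp only: sum.swap[of _ "{..m}" "words _ _"]) (rule sum.swap)
  also have "\<dots> = (\<Sum>i\<le>m. \<Sum>as\<in>comps i. \<Sum>bs\<in>comps (m - i). c (length as) (length bs) \<bullet>\<^sub>C G as bs)"
    by (intro sum.cong refl disj[symmetric]) simp
  finally show ?thesis by (simp add: c_def)
qed

section \<open>Twisting by a formal Maurer--Cartan element\<close>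

definition mc_args :: "(nat \<Rightarrow> 'a) \<Rightarrow> nat list \<Rightarrow> (int \<times> 'a) list" where
  "mc_args \<pi> ms = map (\<lambda>k. (1, \<pi> k)) ms"

text \<open>
  Coefficient at \<open>t\<^sup>m\<close> of \<open>\<Sum>\<^sub>n r\<^sub>n(\<pi>, \<dots>, \<pi>) / n!\<close>.
\<close>

definition twist :: "(nat \<Rightarrow> 'a) \<Rightarrow> ((int \<times> 'a) list \<Rightarrow> 'v \<Rightarrow> 'w::cspace) \<Rightarrow> nat \<Rightarrow> 'v \<Rightarrow> 'w" where
  "twist \<pi> r m x = (\<Sum>ms\<in>comps m. (1 / fact (length ms)) \<bullet>\<^sub>C r (mc_args \<pi> ms) x)"

lemma twist_0: "twist \<pi> r 0 x = r [] x"
  by (simp add: twist_def mc_args_def cscale_one)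

lemma sdegs_mc_args: "sdegs (mc_args \<pi> ms) = replicate (length ms) 0"
  by (simp add: mc_args_def sdegs_def map_replicate_const comp_def)

lemma sdeg_mc_args [simp]: "sdeg (mc_args \<pi> ms) = 0"
  by (simp add: sdeg_def sdegs_mc_args sum_list_replicate)

lemma nths_mc_args: "nths (mc_args \<pi> ms) S = mc_args \<pi> (nths ms S)"
  by (simp add: mc_args_def nths_map)

lemma ksign_mc_args [simp]: "ksign (sdegs (mc_args \<pi> ms)) S = 1"
proof -
  have "{(i, j). i < j \<and> j < length (sdegs (mc_args \<pi> ms)) \<and> i \<notin> S \<and> j \<in> S \<and>
      odd (sdegs (mc_args \<pi> ms) ! i) \<and> odd (sdegs (mc_args \<pi> ms) ! j)} = {}"
    by (auto simp: sdegs_mc_args)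
  then show ?thesis unfolding ksign_def by (simp only: card.empty power_0)
qed

lemma length_mc_args [simp]: "length (mc_args \<pi> ms) = length ms"
  by (simp add: mc_args_def)

lemma length_nths_subset: "S \<subseteq> {..<length ms} \<Longrightarrow> length (nths ms S) = card S"
proof -
  assume "S \<subseteq> {..<length ms}"
  then have "{i. i < length ms \<and> i \<in> S} = S" by auto
  then show ?thesis by (simp add: length_nths)
qed

lemma sum_comps_len:
  fixes h :: "nat list \<Rightarrow> 'a::cspace"
  assumes "\<And>ms. length ms \<notin> {1, 2} \<Longrightarrow> h ms = 0"
  shows "sum h (comps i) = (if i = 0 then 0 else h [i]) + (\<Sum>a\<in>{1..<i}. h [a, i - a])"
proof -
  let ?B = "(if i = 0 then {} else {[i]})" and ?C = "(\<lambda>a. [a, i - a]) ` {1..<i}"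
  have sub: "?B \<union> ?C \<subseteq> comps i" by (auto simp: comps_def)
  have "sum h (comps i) = sum h (?B \<union> ?C)"
  proof (rule sum.mono_neutral_right[OF _ sub], simp, rule ballI)
    fix ms assume ms: "ms \<in> comps i - (?B \<union> ?C)"
    show "h ms = 0"
    proof (rule ccontr)
      assume "h ms \<noteq> 0"
      then have "length ms = 1 \<or> length ms = 2" using assms by auto
      then obtain a b where "ms = [a] \<or> ms = [a, b]"
        by (auto simp: length_Suc_conv numeral_2_eq_2)
      then show False
      proof
        assume "ms = [a]" with ms show False by (auto simp: comps_def split: if_splits)
      next
        assume "ms = [a, b]"
        with ms have "a \<in> {1..<i}" "ms = [a, i - a]" by (auto simp: comps_def)
        with ms show False by blast
      qed
    qed
  qed
  also have "\<dots> = sum h ?B + sum h ?C" by (rule sum.union_disjoint) auto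
  also have "sum h ?C = (\<Sum>a\<in>{1..<i}. h [a, i - a])"
    by (subst sum.reindex) (auto simp: inj_on_def)
  finally show ?thesis by simp
qed

text \<open>
  Maurer--Cartan elements of \<open>t g[[t]]\<close> in a dg Lie algebra whose differential vanishes in degree
  one, as for multivector fields. Each \<open>\<pi> k\<close> has degree \<open>0\<close> in \<open>g[1]\<close>, so no Koszul signs occur.
\<close>

locale formal_mc =
  fixes g :: "'a::cspace dgla" and \<pi> :: "nat \<Rightarrow> 'a"
  assumes dgla: "is_dgla g"
    and dif_zero: "\<And>x. x \<in> grd g 1 \<Longrightarrow> dif g 1 x = 0"
    and grd: "\<And>k. \<pi> k \<in> grd g 1"
    and zero: "\<pi> 0 = 0"
    and mc: "\<And>m. (\<Sum>i\<le>m. brk g 1 1 (\<pi> i) (\<pi> (m - i))) = 0"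
begin

lemma homog_args: "homog g (mc_args \<pi> ms)"
  using grd by (auto simp: homog_def mc_args_def)

lemma plain_space: "is_gspace (plain (grd g))"
  using dgla by (auto simp: is_dgla_def is_complex_def)

lemma grd_subspace: "csubspace (grd g i)"
  using gspace_elems[OF plain_space, of i] by (simp add: plain_def)

lemma brk_grd: "x \<in> grd g i \<Longrightarrow> y \<in> grd g j \<Longrightarrow> brk g i j x y \<in> grd g (i + j)"
proof -
  assume x: "x \<in> grd g i" and y: "y \<in> grd g j"
  then have "graded_map (plain (grd g)) (plain (grd g)) i (\<lambda>j. brk g i j x)"
    using dgla by (auto simp: is_dgla_def)
  with y have "brk g i j x y \<in> grd g (j + i)" by (auto simp: graded_map_def plain_def)
  then show ?thesis by (simp add: add.commute)
qed

lemma brk_zero_right: "x \<in> grd g i \<Longrightarrow> brk g i j x 0 = 0"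
proof -
  assume x: "x \<in> grd g i"
  then have "graded_map (plain (grd g)) (plain (grd g)) i (\<lambda>j. brk g i j x)"
    using dgla by (auto simp: is_dgla_def)
  then show ?thesis by (auto simp: graded_map_def plain_def)
qed

lemma brk_zero_left: "y \<in> grd g 1 \<Longrightarrow> brk g 1 1 0 y = 0"
proof -
  assume y: "y \<in> grd g 1"
  have "brk g 1 1 0 y = - (msign (1 * 1) \<bullet>\<^sub>C brk g 1 1 y 0)"
    using dgla y csub_zero[OF grd_subspace[of 1]] unfolding is_dgla_def by blast
  then show ?thesis using brk_zero_right[OF y] by simp
qed

lemma mc_inner: "(\<Sum>a\<in>{1..<i}. brk g 1 1 (\<pi> a) (\<pi> (i - a))) = 0"
proof -
  have "(\<Sum>a\<in>{1..<i}. brk g 1 1 (\<pi> a) (\<pi> (i - a))) = (\<Sum>a\<le>i. brk g 1 1 (\<pi> a) (\<pi> (i - a)))"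
  proof (rule sum.mono_neutral_left)
    show "\<forall>a\<in>{..i} - {1..<i}. brk g 1 1 (\<pi> a) (\<pi> (i - a)) = 0"
    proof
      fix a assume "a \<in> {..i} - {1..<i}"
      then have "a = 0 \<or> a = i" by auto
      then show "brk g 1 1 (\<pi> a) (\<pi> (i - a)) = 0"
        using brk_zero_left[OF grd] brk_zero_right[OF grd] zero by auto
    qed
  qed auto
  with mc show ?thesis by simp
qed

lemma multilinear_zero:
  assumes Y: "is_gspace Y" and F: "sym_multilinear g Y k F" and us: "homog g us" and vs: "homog g vs"
  shows "F (us @ (i, 0) # vs) \<in> nulls Y (k + sdeg (us @ (i, 0::'a) # vs))"
proof -
  have "0 \<in> grd g i" by (rule csub_zero[OF grd_subspace])
  then have "F (us @ (i, 0 \<bullet>\<^sub>C 0) # vs) - 0 \<bullet>\<^sub>C F (us @ (i, 0) # vs) \<in> nulls Y (k + sdeg (us @ (i, 0::'a) # vs))"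
    using F us vs unfolding sym_multilinear_def by blast
  then show ?thesis by simp
qed

lemma multilinear_sum:
  assumes Y: "is_gspace Y" and F: "sym_multilinear g Y k F" and vs: "homog g vs" and fin: "finite A"
    and x: "\<And>a. a \<in> A \<Longrightarrow> x a \<in> grd g i"
  shows "eqm Y (k + (i - 1) + sdeg vs) (F ((i, sum x A) # vs)) (\<Sum>a\<in>A. F ((i, x a) # vs))"
  using fin x
proof (induction A)
  case empty
  show ?case using multilinear_zero[OF Y F _ vs, of "[]" i] by (simp add: eqm_def homog_def sdeg_def sdegs_def add.assoc)
next
  case (insert a A)
  have hom_nil: "homog g []" by (simp add: homog_def)
  have "sum x A \<in> grd g i" using insert.prems by (intro csub_sum[OF grd_subspace]) auto
  moreover have "x a \<in> grd g i" using insert.prems by auto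
  ultimately have "F ([] @ (i, x a + sum x A) # vs) - (F ([] @ (i, x a) # vs) + F ([] @ (i, sum x A) # vs))
      \<in> nulls Y (k + sdeg ([] @ (i, x a) # vs))"
    using F vs hom_nil unfolding sym_multilinear_def by blast
  then have "eqm Y (k + (i - 1) + sdeg vs) (F ((i, x a + sum x A) # vs)) (F ((i, x a) # vs) + F ((i, sum x A) # vs))"
    by (simp add: eqm_def sdeg_def sdegs_def add.assoc)
  moreover have "eqm Y (k + (i - 1) + sdeg vs) (F ((i, x a) # vs) + F ((i, sum x A) # vs))
      (F ((i, x a) # vs) + (\<Sum>a\<in>A. F ((i, x a) # vs)))"
    using insert by (intro eqm_add[OF Y] eqm_refl[OF Y]) auto
  ultimately show ?case using insert eqm_trans[OF Y] by auto
qed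

text \<open>
  The terms of an \<open>L\<^sub>\<infinity>\<close> identity that involve the structure of \<open>g\<close> itself contract two arguments
  to their bracket; by the exponential formula they add up to \<open>F\<close> evaluated with
  \<open>[\<pi>, \<pi>] / 2 = 0\<close> in the first position.
\<close>

lemma brackets_cancel:
  assumes Y: "is_gspace Y" and F: "sym_multilinear g Y k F"
  shows "(\<Sum>ms\<in>comps m. (1 / fact (length ms)) \<bullet>\<^sub>C
      (\<Sum>S\<in>{S. S \<subseteq> {..<length (mc_args \<pi> ms)} \<and> card S \<in> {1, 2}}.
        ksign (sdegs (mc_args \<pi> ms)) S \<bullet>\<^sub>C F (coder g (nths (mc_args \<pi> ms) S) # nths (mc_args \<pi> ms) (- S))))
    \<in> nulls Y (k + 1)"
proof -
  define G where "G = (\<lambda>as bs. if length as \<in> {1, 2} then F (coder g (mc_args \<pi> as) # mc_args \<pi> bs) else 0)"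
  have "(\<Sum>S\<in>{S. S \<subseteq> {..<length (mc_args \<pi> ms)} \<and> card S \<in> {1, 2}}.
        ksign (sdegs (mc_args \<pi> ms)) S \<bullet>\<^sub>C F (coder g (nths (mc_args \<pi> ms) S) # nths (mc_args \<pi> ms) (- S)))
      = (\<Sum>S\<in>Pow {..<length ms}. G (nths ms S) (nths ms (- S)))" for ms
  proof -
    have "{S. S \<subseteq> {..<length (mc_args \<pi> ms)} \<and> card S \<in> {1, 2}} = {S\<in>Pow {..<length ms}. card S \<in> {1, 2}}"
      by auto
    then show ?thesis
      by (simp only: sum.inter_filter[OF finite_Pow_iff[THEN iffD2, OF finite_lessThan]])
         (auto simp: G_def length_nths_subset nths_mc_args cscale_one intro!: sum.cong)
  qed
  then have "(\<Sum>ms\<in>comps m. (1 / fact (length ms)) \<bullet>\<^sub>C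
      (\<Sum>S\<in>{S. S \<subseteq> {..<length (mc_args \<pi> ms)} \<and> card S \<in> {1, 2}}.
        ksign (sdegs (mc_args \<pi> ms)) S \<bullet>\<^sub>C F (coder g (nths (mc_args \<pi> ms) S) # nths (mc_args \<pi> ms) (- S))))
    = (\<Sum>i\<le>m. \<Sum>bs\<in>comps (m - i). \<Sum>as\<in>comps i.
         (1 / fact (length as) * (1 / fact (length bs))) \<bullet>\<^sub>C G as bs)"
    by (simp only: sum_comps_unshuffle sum.swap[of _ "comps (m - _)"])
  moreover have "(\<Sum>as\<in>comps i. (1 / fact (length as) * (1 / fact (length bs))) \<bullet>\<^sub>C G as bs) \<in> nulls Y (k + 1)" for i bs
  proof -
    have one: "F ((2, 0) # mc_args \<pi> bs) \<in> nulls Y (k + 1)"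
      using multilinear_zero[OF Y F _ homog_args, of "[]" 2] by (simp add: homog_def sdeg_def sdegs_def sdegs_mc_args[unfolded sdegs_def] sum_list_replicate)
    have "eqm Y (k + (2 - 1) + sdeg (mc_args \<pi> bs)) (F ((2, \<Sum>a\<in>{1..<i}. brk g 1 1 (\<pi> a) (\<pi> (i - a))) # mc_args \<pi> bs))
        (\<Sum>a\<in>{1..<i}. F ((2, brk g 1 1 (\<pi> a) (\<pi> (i - a))) # mc_args \<pi> bs))"
      using brk_grd[OF grd grd] by (intro multilinear_sum[OF Y F homog_args]) auto
    then have two: "(\<Sum>a\<in>{1..<i}. F ((2, brk g 1 1 (\<pi> a) (\<pi> (i - a))) # mc_args \<pi> bs)) \<in> nulls Y (k + 1)"
      using one eqm_null[OF Y eqm_sym[OF Y], of "k + 1"] unfolding mc_inner by simp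
    have "(\<Sum>as\<in>comps i. (1 / fact (length as) * (1 / fact (length bs))) \<bullet>\<^sub>C G as bs)
      = (if i = 0 then 0 else (1 / fact (length bs)) \<bullet>\<^sub>C F ((2, 0) # mc_args \<pi> bs))
        + (1 / 2 * (1 / fact (length bs))) \<bullet>\<^sub>C (\<Sum>a\<in>{1..<i}. F ((2, brk g 1 1 (\<pi> a) (\<pi> (i - a))) # mc_args \<pi> bs))"
      by (subst sum_comps_len)
         (auto simp: G_def mc_args_def dif_zero[OF grd] cscale_one cscale_sum_right numeral_2_eq_2)
    with one two show ?thesis using gsub_n(1,2,4)[OF Y] by simp
  qed
  ultimately show ?thesis by (simp add: gsub_n(6)[OF Y])
qed

lemma gmap_sum_scale:
  assumes X: "is_gspace X" and Y: "is_gspace Y" and f: "\<And>s. s \<in> A \<Longrightarrow> gmap X Y k (f s)"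
  shows "gmap X Y k (\<lambda>x. \<Sum>s\<in>A. c s \<bullet>\<^sub>C f s x)"
  unfolding graded_map_def
proof (intro allI conjI ballI)
  fix i x assume x: "x \<in> elems X i"
  show "(\<Sum>s\<in>A. c s \<bullet>\<^sub>C f s x) \<in> elems Y (i + k)"
    using x by (intro gsub_e(6)[OF Y] gsub_e(4)[OF Y] gm_elem[OF f X Y]) auto
  { fix y assume y: "y \<in> elems X i"
    have "eqm Y (i + k) (\<Sum>s\<in>A. c s \<bullet>\<^sub>C f s (x + y)) (\<Sum>s\<in>A. c s \<bullet>\<^sub>C (f s x + f s y))"
      using x y by (intro eqm_sum[OF Y] eqm_scale[OF Y] gm_add[OF f X Y]) auto
    then show "(\<Sum>s\<in>A. c s \<bullet>\<^sub>C f s (x + y)) - ((\<Sum>s\<in>A. c s \<bullet>\<^sub>C f s x) + (\<Sum>s\<in>A. c s \<bullet>\<^sub>C f s y)) \<in> nulls Y (i + k)"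
      by (simp add: eqm_def sum.distrib cscale_add_right) }
  fix a
  have "eqm Y (i + k) (\<Sum>s\<in>A. c s \<bullet>\<^sub>C f s (a \<bullet>\<^sub>C x)) (\<Sum>s\<in>A. c s \<bullet>\<^sub>C (a \<bullet>\<^sub>C f s x))"
    using x by (intro eqm_sum[OF Y] eqm_scale[OF Y] gm_scale[OF f X Y]) auto
  then show "(\<Sum>s\<in>A. c s \<bullet>\<^sub>C f s (a \<bullet>\<^sub>C x)) - a \<bullet>\<^sub>C (\<Sum>s\<in>A. c s \<bullet>\<^sub>C f s x) \<in> nulls Y (i + k)"
    by (simp add: eqm_def cscale_sum_right cscale_cscale mult.commute)
next
  fix i x assume "x \<in> nulls X i"
  then show "(\<Sum>s\<in>A. c s \<bullet>\<^sub>C f s x) \<in> nulls Y (i + k)"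
    by (intro gsub_n(6)[OF Y] gsub_n(4)[OF Y] gm_null[OF f X Y]) auto
qed

lemma gmap_twist:
  assumes X: "is_gspace X" and Y: "is_gspace Y"
    and f: "\<And>xs. homog g xs \<Longrightarrow> gmap X Y (sdeg xs + k) (f xs)"
  shows "gmap X Y k (twist \<pi> f m)"
proof -
  have "gmap X Y k (\<lambda>x. \<Sum>ms\<in>comps m. (1 / fact (length ms)) \<bullet>\<^sub>C f (mc_args \<pi> ms) x)"
    using f[OF homog_args] by (intro gmap_sum_scale[OF X Y]) simp
  then show ?thesis by (simp add: twist_def[abs_def])
qed

text \<open>
  Compositions of multilinear operations over all unshuffles become products of the exponential
  series.
\<close>

lemma twist_compose:
  assumes X: "is_gspace X" and Y: "is_gspace Y" and Z: "is_gspace Z"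
    and r: "\<And>xs. homog g xs \<Longrightarrow> gmap X Y (sdeg xs + k) (r xs)"
    and q: "\<And>xs. homog g xs \<Longrightarrow> gmap Y Z (sdeg xs + l) (q xs)"
    and n: "n \<in> elems X i"
  shows "eqm Z (i + k + l) (\<Sum>ms\<in>comps m. (1 / fact (length ms)) \<bullet>\<^sub>C
      (\<Sum>S\<in>Pow {..<length ms}. q (mc_args \<pi> (nths ms S)) (r (mc_args \<pi> (nths ms (- S))) n)))
    (\<Sum>j\<le>m. twist \<pi> q j (twist \<pi> r (m - j) n))"
proof -
  have rn: "r (mc_args \<pi> bs) n \<in> elems Y (i + k)" for bs
    using gm_elem[OF r[OF homog_args] X Y n] by simp
  have qg: "gmap Y Z l (q (mc_args \<pi> as))" for as using q[OF homog_args, of as] by simp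
  have "eqm Z (i + k + l) (\<Sum>bs\<in>comps j. (1 / fact (length bs)) \<bullet>\<^sub>C q (mc_args \<pi> as) (r (mc_args \<pi> bs) n))
      (q (mc_args \<pi> as) (twist \<pi> r j n))" for as j
  proof -
    have "eqm Z (i + k + l) (q (mc_args \<pi> as) (\<Sum>bs\<in>comps j. (1 / fact (length bs)) \<bullet>\<^sub>C r (mc_args \<pi> bs) n))
        (\<Sum>bs\<in>comps j. q (mc_args \<pi> as) ((1 / fact (length bs)) \<bullet>\<^sub>C r (mc_args \<pi> bs) n))"
      by (rule gm_sum[OF qg Y Z]) (rule gsub_e(4)[OF Y rn])
    moreover have "eqm Z (i + k + l) (\<Sum>bs\<in>comps j. q (mc_args \<pi> as) ((1 / fact (length bs)) \<bullet>\<^sub>C r (mc_args \<pi> bs) n))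
        (\<Sum>bs\<in>comps j. (1 / fact (length bs)) \<bullet>\<^sub>C q (mc_args \<pi> as) (r (mc_args \<pi> bs) n))"
      by (rule eqm_sum[OF Z]) (rule gm_scale[OF qg Y Z rn])
    ultimately show ?thesis
      unfolding twist_def by (rule eqm_sym[OF Z eqm_trans[OF Z]])
  qed
  then have "eqm Z (i + k + l) (\<Sum>j\<le>m. \<Sum>as\<in>comps j. (1 / fact (length as)) \<bullet>\<^sub>C
      (\<Sum>bs\<in>comps (m - j). (1 / fact (length bs)) \<bullet>\<^sub>C q (mc_args \<pi> as) (r (mc_args \<pi> bs) n)))
    (\<Sum>j\<le>m. \<Sum>as\<in>comps j. (1 / fact (length as)) \<bullet>\<^sub>C q (mc_args \<pi> as) (twist \<pi> r (m - j) n))"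
    by (intro eqm_sum[OF Z] eqm_scale[OF Z])
  moreover have "(\<Sum>ms\<in>comps m. (1 / fact (length ms)) \<bullet>\<^sub>C
      (\<Sum>S\<in>Pow {..<length ms}. q (mc_args \<pi> (nths ms S)) (r (mc_args \<pi> (nths ms (- S))) n)))
    = (\<Sum>j\<le>m. \<Sum>as\<in>comps j. (1 / fact (length as)) \<bullet>\<^sub>C
      (\<Sum>bs\<in>comps (m - j). (1 / fact (length bs)) \<bullet>\<^sub>C q (mc_args \<pi> as) (r (mc_args \<pi> bs) n)))"
    unfolding sum_comps_unshuffle[where G="\<lambda>as bs. q (mc_args \<pi> as) (r (mc_args \<pi> bs) n)"]
    by (simp add: cscale_sum_right cscale_cscale)
  ultimately show ?thesis by (simp only: twist_def[of \<pi> q])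
qed

end

lemma tconv_tconv:
  assumes X: "is_gspace X" and Y: "is_gspace Y" and Z: "is_gspace Z"
    and f: "\<And>m. gmap X Y k (f m)" and h: "\<And>m. gmap Y Z l (h m)"
    and x: "x \<in> elems (tseries X) i"
  shows "eqm Z (i + k + l) (tconv h (tconv f x) m) (\<Sum>n\<le>m. \<Sum>j\<le>n. h j (f (n - j) (x (m - n))))"
proof -
  have "eqm Z (i + k + l) (tconv h (tconv f x) m) (\<Sum>j\<le>m. \<Sum>n\<le>m - j. h j (f n (x (m - j - n))))"
    unfolding tconv_def
    using x by (intro eqm_sum[OF Z] gm_sum[OF h Y Z] gm_elem[OF f X Y]) simp
  also have "(\<Sum>j\<le>m. \<Sum>n\<le>m - j. h j (f n (x (m - j - n)))) = (\<Sum>n\<le>m. \<Sum>j\<le>n. h j (f (n - j) (x (m - n))))"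
  proof -
    have "(\<Sum>j\<le>m. \<Sum>n\<le>m - j. G j n) = (\<Sum>n\<le>m. \<Sum>j\<le>n. G j (n - j))" for G :: "nat \<Rightarrow> nat \<Rightarrow> 'c"
      by (subst sum.triangle_reindex_eq[symmetric], subst sum.Sigma) (auto intro!: sum.cong)
    from this[of "\<lambda>j n. h j (f n (x (m - j - n)))"] show ?thesis by (simp add: diff_diff_left)
  qed
  finally show ?thesis .
qed

context formal_mc
begin

text \<open>
  The square-zero identity of the module, evaluated on \<open>(\<pi>, \<dots>, \<pi>)\<close> and summed with weights
  \<open>1/n!\<close>.
\<close>

lemma complex_twist:
  assumes N: "Linf_module g N r"
  shows "is_complex (tseries N) (\<lambda>_. tconv (twist \<pi> r))" "\<And>m. gmap N N 1 (twist \<pi> r m)"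
proof -
  have G: "is_gspace N" and r: "\<And>xs. homog g xs \<Longrightarrow> gmap N N (sdeg xs + 1) (r xs)"
    and ml: "\<And>i n. n \<in> elems N i \<Longrightarrow> sym_multilinear g N (i + 1) (\<lambda>xs. r xs n)"
    using N by (auto simp: Linf_module_def)
  show gm: "gmap N N 1 (twist \<pi> r m)" for m by (rule gmap_twist[OF G G r])
  have sq: "(\<Sum>j\<le>m. twist \<pi> r j (twist \<pi> r (m - j) n)) \<in> nulls N (i + 2)" if n: "n \<in> elems N i" for m n i
  proof -
    have "(\<Sum>S\<in>{S. S \<subseteq> {..<length (mc_args \<pi> ms)} \<and> card S \<in> {1, 2}}.
           ksign (sdegs (mc_args \<pi> ms)) S \<bullet>\<^sub>C r (coder g (nths (mc_args \<pi> ms) S) # nths (mc_args \<pi> ms) (- S)) n)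
        + (\<Sum>S\<in>Pow {..<length (mc_args \<pi> ms)}.
             (ksign (sdegs (mc_args \<pi> ms)) S * msign (sdeg (nths (mc_args \<pi> ms) S))) \<bullet>\<^sub>C
               r (nths (mc_args \<pi> ms) S) (r (nths (mc_args \<pi> ms) (- S)) n))
        \<in> nulls N (i + sdeg (mc_args \<pi> ms) + 2)" for ms
      using N n homog_args unfolding Linf_module_def by blast
    then have "(1 / fact (length ms)) \<bullet>\<^sub>C ((\<Sum>S\<in>{S. S \<subseteq> {..<length (mc_args \<pi> ms)} \<and> card S \<in> {1, 2}}.
           ksign (sdegs (mc_args \<pi> ms)) S \<bullet>\<^sub>C r (coder g (nths (mc_args \<pi> ms) S) # nths (mc_args \<pi> ms) (- S)) n)
        + (\<Sum>S\<in>Pow {..<length ms}. r (mc_args \<pi> (nths ms S)) (r (mc_args \<pi> (nths ms (- S))) n)))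
        \<in> nulls N (i + 2)" for ms
      using gsub_n(4)[OF G] by (simp add: nths_mc_args cscale_one)
    then have "(\<Sum>ms\<in>comps m. (1 / fact (length ms)) \<bullet>\<^sub>C ((\<Sum>S\<in>{S. S \<subseteq> {..<length (mc_args \<pi> ms)} \<and> card S \<in> {1, 2}}.
           ksign (sdegs (mc_args \<pi> ms)) S \<bullet>\<^sub>C r (coder g (nths (mc_args \<pi> ms) S) # nths (mc_args \<pi> ms) (- S)) n)
        + (\<Sum>S\<in>Pow {..<length ms}. r (mc_args \<pi> (nths ms S)) (r (mc_args \<pi> (nths ms (- S))) n))))
        \<in> nulls N (i + 2)"
      by (intro gsub_n(6)[OF G])
    with brackets_cancel[OF G ml[OF n], of m]
    have "(\<Sum>ms\<in>comps m. (1 / fact (length ms)) \<bullet>\<^sub>C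
        (\<Sum>S\<in>Pow {..<length ms}. r (mc_args \<pi> (nths ms S)) (r (mc_args \<pi> (nths ms (- S))) n))) \<in> nulls N (i + 2)"
      using gsub_n(3)[OF G] unfolding cscale_add_right sum.distrib
      by (smt (verit, del_insts) add_diff_cancel_left' add.assoc one_add_one)
    moreover have "eqm N (i + 1 + 1) (\<Sum>ms\<in>comps m. (1 / fact (length ms)) \<bullet>\<^sub>C
        (\<Sum>S\<in>Pow {..<length ms}. r (mc_args \<pi> (nths ms S)) (r (mc_args \<pi> (nths ms (- S))) n)))
      (\<Sum>j\<le>m. twist \<pi> r j (twist \<pi> r (m - j) n))"
      by (rule twist_compose[OF G G G r r n])
    ultimately show ?thesis
      using eqm_null[OF G eqm_sym[OF G]] by (simp add: add.assoc)
  qed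
  show "is_complex (tseries N) (\<lambda>_. tconv (twist \<pi> r))"
    unfolding is_complex_def
  proof (intro conjI gspace_tseries[OF G] gmap_tconv[OF G G gm] allI ballI)
    fix i x assume x: "x \<in> elems (tseries N) i"
    have "tconv (twist \<pi> r) (tconv (twist \<pi> r) x) m \<in> nulls N (i + 2)" for m
    proof (rule eqm_null[OF G])
      show "eqm N (i + 2) (tconv (twist \<pi> r) (tconv (twist \<pi> r) x) m)
         (\<Sum>n\<le>m. \<Sum>j\<le>n. twist \<pi> r j (twist \<pi> r (n - j) (x (m - n))))"
        using tconv_tconv[where m=m, OF G G G gm gm x] by (simp add: add.assoc)
      show "(\<Sum>n\<le>m. \<Sum>j\<le>n. twist \<pi> r j (twist \<pi> r (n - j) (x (m - n)))) \<in> nulls N (i + 2)"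
        using x by (intro gsub_n(6)[OF G] sq) simp
    qed
    then show "tconv (twist \<pi> r) (tconv (twist \<pi> r) x) \<in> nulls (tseries N) (i + 2)" by simp
  qed
qed

text \<open>
  As for \<open>complex_twist\<close>, with the identity of the morphism: its two sums over unshuffles become the
  two compositions with the twisted differentials.
\<close>

lemma chain_map_twist:
  assumes "Linf_module_morphism g N r P q \<phi>"
  shows "chain_map (tseries N) (tconv (twist \<pi> r)) (tseries P) (tconv (twist \<pi> q)) (tconv (twist \<pi> \<phi>))"
    and "\<And>m. gmap N P 0 (twist \<pi> \<phi> m)"
proof -
  have N: "Linf_module g N r" and P: "Linf_module g P q"
    and f: "\<And>xs. homog g xs \<Longrightarrow> gmap N P (sdeg xs) (\<phi> xs)"
    and ml: "\<And>i n. n \<in> elems N i \<Longrightarrow> sym_multilinear g P i (\<lambda>xs. \<phi> xs n)"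
    using assms by (auto simp: Linf_module_morphism_def)
  have G: "is_gspace N" and r: "\<And>xs. homog g xs \<Longrightarrow> gmap N N (sdeg xs + 1) (r xs)"
    using N by (auto simp: Linf_module_def)
  have H: "is_gspace P" and q: "\<And>xs. homog g xs \<Longrightarrow> gmap P P (sdeg xs + 1) (q xs)"
    using P by (auto simp: Linf_module_def)
  have f': "\<And>xs. homog g xs \<Longrightarrow> gmap N P (sdeg xs + 0) (\<phi> xs)" using f by simp
  show gm: "gmap N P 0 (twist \<pi> \<phi> m)" for m by (rule gmap_twist[OF G H f'])
  note gr = complex_twist(2)[OF N] and gq = complex_twist(2)[OF P]
  have key: "eqm P (i + 1) (\<Sum>j\<le>m. twist \<pi> \<phi> j (twist \<pi> r (m - j) n)) (\<Sum>j\<le>m. twist \<pi> q j (twist \<pi> \<phi> (m - j) n))"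
    if n: "n \<in> elems N i" for m n i
  proof -
    let ?b = "\<lambda>ms. (\<Sum>S\<in>{S. S \<subseteq> {..<length (mc_args \<pi> ms)} \<and> card S \<in> {1, 2}}.
           ksign (sdegs (mc_args \<pi> ms)) S \<bullet>\<^sub>C \<phi> (coder g (nths (mc_args \<pi> ms) S) # nths (mc_args \<pi> ms) (- S)) n)"
    let ?l = "\<lambda>ms. \<Sum>S\<in>Pow {..<length ms}. \<phi> (mc_args \<pi> (nths ms S)) (r (mc_args \<pi> (nths ms (- S))) n)"
    let ?r = "\<lambda>ms. \<Sum>S\<in>Pow {..<length ms}. q (mc_args \<pi> (nths ms S)) (\<phi> (mc_args \<pi> (nths ms (- S))) n)"
    have "?b ms
        + (\<Sum>S\<in>Pow {..<length (mc_args \<pi> ms)}.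
             (ksign (sdegs (mc_args \<pi> ms)) S * msign (sdeg (nths (mc_args \<pi> ms) S))) \<bullet>\<^sub>C
               \<phi> (nths (mc_args \<pi> ms) S) (r (nths (mc_args \<pi> ms) (- S)) n))
        - (\<Sum>S\<in>Pow {..<length (mc_args \<pi> ms)}.
             ksign (sdegs (mc_args \<pi> ms)) S \<bullet>\<^sub>C q (nths (mc_args \<pi> ms) S) (\<phi> (nths (mc_args \<pi> ms) (- S)) n))
        \<in> nulls P (i + sdeg (mc_args \<pi> ms) + 1)" for ms
      using assms n homog_args unfolding Linf_module_morphism_def by blast
    then have "(1 / fact (length ms)) \<bullet>\<^sub>C (?b ms + ?l ms - ?r ms) \<in> nulls P (i + 1)" for ms
      using gsub_n(4)[OF H] by (simp add: nths_mc_args cscale_one)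
    then have "(\<Sum>ms\<in>comps m. (1 / fact (length ms)) \<bullet>\<^sub>C (?b ms + ?l ms - ?r ms)) \<in> nulls P (i + 1)"
      by (intro gsub_n(6)[OF H])
    moreover have "(\<Sum>ms\<in>comps m. (1 / fact (length ms)) \<bullet>\<^sub>C ?b ms) \<in> nulls P (i + 1)"
      by (rule brackets_cancel[OF H ml[OF n]])
    ultimately have "(\<Sum>ms\<in>comps m. (1 / fact (length ms)) \<bullet>\<^sub>C (?b ms + ?l ms - ?r ms))
        - (\<Sum>ms\<in>comps m. (1 / fact (length ms)) \<bullet>\<^sub>C ?b ms) \<in> nulls P (i + 1)"
      by (rule gsub_n(3)[OF H])
    then have 1: "eqm P (i + 1) (\<Sum>ms\<in>comps m. (1 / fact (length ms)) \<bullet>\<^sub>C ?l ms) (\<Sum>ms\<in>comps m. (1 / fact (length ms)) \<bullet>\<^sub>C ?r ms)"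
      by (simp add: eqm_def cscale_add_right cscale_diff_right sum.distrib sum_subtractf)
    have 2: "eqm P (i + 1) (\<Sum>ms\<in>comps m. (1 / fact (length ms)) \<bullet>\<^sub>C ?l ms) (\<Sum>j\<le>m. twist \<pi> \<phi> j (twist \<pi> r (m - j) n))"
      using twist_compose[OF G G H r f' n] by simp
    have 3: "eqm P (i + 1) (\<Sum>ms\<in>comps m. (1 / fact (length ms)) \<bullet>\<^sub>C ?r ms) (\<Sum>j\<le>m. twist \<pi> q j (twist \<pi> \<phi> (m - j) n))"
      using twist_compose[OF G H H f' q n] by simp
    show ?thesis by (rule eqm_trans[OF H eqm_sym[OF H 2] eqm_trans[OF H 1 3]])
  qed
  show "chain_map (tseries N) (tconv (twist \<pi> r)) (tseries P) (tconv (twist \<pi> q)) (tconv (twist \<pi> \<phi>))"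
    unfolding chain_map_def
  proof (intro conjI complex_twist(1)[OF N] complex_twist(1)[OF P] gmap_tconv[OF G H gm] allI ballI)
    fix i x assume x: "x \<in> elems (tseries N) i"
    have "eqm P (i + 1) (tconv (twist \<pi> \<phi>) (tconv (twist \<pi> r) x) m) (tconv (twist \<pi> q) (tconv (twist \<pi> \<phi>) x) m)" for m
    proof -
      have 1: "eqm P (i + 1) (tconv (twist \<pi> \<phi>) (tconv (twist \<pi> r) x) m) (\<Sum>n\<le>m. \<Sum>j\<le>n. twist \<pi> \<phi> j (twist \<pi> r (n - j) (x (m - n))))"
        using tconv_tconv[where m=m, OF G G H gr gm x] by simp
      have 2: "eqm P (i + 1) (tconv (twist \<pi> q) (tconv (twist \<pi> \<phi>) x) m) (\<Sum>n\<le>m. \<Sum>j\<le>n. twist \<pi> q j (twist \<pi> \<phi> (n - j) (x (m - n))))"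
        using tconv_tconv[where m=m, OF G H H gm gq x] by simp
      have 3: "eqm P (i + 1) (\<Sum>n\<le>m. \<Sum>j\<le>n. twist \<pi> \<phi> j (twist \<pi> r (n - j) (x (m - n))))
          (\<Sum>n\<le>m. \<Sum>j\<le>n. twist \<pi> q j (twist \<pi> \<phi> (n - j) (x (m - n))))"
        using x by (intro eqm_sum[OF H] key) simp
      show ?thesis by (rule eqm_trans[OF H 1 eqm_trans[OF H 3 eqm_sym[OF H 2]]])
    qed
    then show "eqm (tseries P) (i + 1) (tconv (twist \<pi> \<phi>) (tconv (twist \<pi> r) x)) (tconv (twist \<pi> q) (tconv (twist \<pi> \<phi>) x))"
      by (simp add: eqm_tseries)
  qed
qed

end

section \<open>Smooth functions of coordinates\<close>

type_synonym pt = "nat \<Rightarrow> nat \<Rightarrow> real"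

text \<open>
  Points of \<open>(\<real>\<^sup>n)\<^sup>m\<close> are embedded in a space of functions, so openness is relative to this
  subspace.
\<close>

definition coords :: "nat \<Rightarrow> nat \<Rightarrow> pt set" where
  "coords m n = {x. \<forall>j i. \<not> (j < m \<and> i < n) \<longrightarrow> x j i = 0}"

definition rel_open :: "nat \<Rightarrow> nat \<Rightarrow> pt set \<Rightarrow> bool" where
  "rel_open m n W \<longleftrightarrow> (\<exists>U. open U \<and> W = U \<inter> coords m n)"

abbreviation put :: "nat \<Rightarrow> nat \<Rightarrow> real \<Rightarrow> pt \<Rightarrow> pt" where
  "put j i s x \<equiv> x(j := (x j)(i := s))"

lemma continuous_on_pt:
  fixes \<gamma> :: "'b::topological_space \<Rightarrow> pt"
  assumes "\<And>j i. continuous_on S (\<lambda>t. \<gamma> t j i)"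
  shows "continuous_on S \<gamma>"
  by (intro continuous_on_coordinatewise_then_product assms)

lemma continuous_on_entry: "continuous_on S (\<lambda>x :: pt. x j i)"
proof -
  have "continuous_on S (\<lambda>x::pt. x j)"
    using continuous_on_product_then_coordinatewise[OF continuous_on_id, of S j] by simp
  from continuous_on_product_then_coordinatewise[OF this, of i] show ?thesis .
qed

lemma continuous_on_entry_compose:
  fixes g :: "'b::topological_space \<Rightarrow> pt"
  shows "continuous_on S g \<Longrightarrow> continuous_on S (\<lambda>t. g t j i)"
  by (rule continuous_on_compose2[OF continuous_on_entry[of UNIV]]) auto

lemma continuous_on_put:
  fixes g :: "'b::topological_space \<Rightarrow> pt"
  assumes f: "continuous_on S f" and g: "continuous_on S g"
  shows "continuous_on S (\<lambda>t. put j i (f t) (g t))"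
proof (rule continuous_on_pt)
  fix a b
  show "continuous_on S (\<lambda>t. (put j i (f t) (g t)) a b)"
    using f continuous_on_entry_compose[OF g, of a b] by (cases "a = j"; cases "b = i") simp_all
qed

lemma rel_open_near:
  fixes \<gamma> :: "'b::topological_space \<Rightarrow> pt"
  assumes W: "rel_open m n W" and c: "continuous_on UNIV \<gamma>" and t: "\<gamma> t0 \<in> W"
    and co: "\<And>t. \<gamma> t \<in> coords m n"
  obtains V where "open V" "t0 \<in> V" "\<And>t. t \<in> V \<Longrightarrow> \<gamma> t \<in> W"
proof -
  obtain U where U: "open U" "W = U \<inter> coords m n" using W by (auto simp: rel_open_def)
  have "open (\<gamma> -` U)" using c U(1) by (simp add: continuous_on_open_vimage)
  then show ?thesis using t U(2) co by (intro that[of "\<gamma> -` U"]) auto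
qed

lemma rel_open_coords: "rel_open m n W \<Longrightarrow> x \<in> W \<Longrightarrow> x \<in> coords m n"
  by (auto simp: rel_open_def)

lemma put_coords: "x \<in> coords m n \<Longrightarrow> j < m \<Longrightarrow> i < n \<Longrightarrow> put j i s x \<in> coords m n"
  by (auto simp: coords_def)

lemma eventually_put:
  assumes W: "rel_open m n W" and x: "x \<in> W" and "j < m" "i < n"
  shows "\<forall>\<^sub>F s in nhds (x j i). put j i s x \<in> W"
proof -
  have "continuous_on UNIV (\<lambda>s. put j i s x)"
    by (intro continuous_on_put continuous_on_id continuous_on_const)
  then obtain V where V: "open V" "x j i \<in> V" "\<And>s. s \<in> V \<Longrightarrow> put j i s x \<in> W"
    using rel_open_near[OF W, of "\<lambda>s. put j i s x" "x j i"] put_coords[OF rel_open_coords[OF W x] assms(3,4)] x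
    by auto
  then show ?thesis by (auto simp: eventually_nhds)
qed

definition has_partials :: "nat \<Rightarrow> nat \<Rightarrow> pt set \<Rightarrow> (pt \<Rightarrow> complex) \<Rightarrow> bool" where
  "has_partials j i W F \<longleftrightarrow> (\<forall>x\<in>W. (\<lambda>s. F (put j i s x)) differentiable (at (x j i)))"

lemma Ck_Suc: "Ck_coords m n W (Suc k) F \<longleftrightarrow> continuous_on W F \<and>
    (\<forall>j<m. \<forall>i<n. has_partials j i W F \<and> Ck_coords m n W k (partial_der j i F))"
  by (simp add: has_partials_def)

declare Ck_coords.simps(2) [simp del]

lemma partial_derI:
  "((\<lambda>s. F (put j i s x)) has_vector_derivative D) (at (x j i)) \<Longrightarrow> partial_der j i F x = D"
  unfolding partial_der_def by (rule vector_derivative_at)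

lemma has_partialsI:
  "(\<And>x. x \<in> W \<Longrightarrow> ((\<lambda>s. F (put j i s x)) has_vector_derivative D x) (at (x j i))) \<Longrightarrow> has_partials j i W F"
  unfolding has_partials_def by (meson differentiableI_vector)

lemma has_partialsD:
  "has_partials j i W F \<Longrightarrow> x \<in> W \<Longrightarrow>
    ((\<lambda>s. F (put j i s x)) has_vector_derivative partial_der j i F x) (at (x j i))"
  unfolding has_partials_def partial_der_def using vector_derivative_works by blast

lemma vector_derivative_put_cong:
  assumes W: "rel_open m n W" and x: "x \<in> W" and ji: "j < m" "i < n"
    and eq: "\<And>y. y \<in> W \<Longrightarrow> F y = G y"
    and G: "((\<lambda>s. G (put j i s x)) has_vector_derivative D) (at (x j i))"
  shows "((\<lambda>s. F (put j i s x)) has_vector_derivative D) (at (x j i))"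
proof -
  obtain S where S: "open S" "x j i \<in> S" "\<And>s. s \<in> S \<Longrightarrow> put j i s x \<in> W"
    using eventually_put[OF W x ji] unfolding eventually_nhds by blast
  show ?thesis
    by (rule has_vector_derivative_transform_within_open[OF G S(1,2)]) (simp add: eq S(3))
qed

lemma has_partials_cong:
  assumes W: "rel_open m n W" and ji: "j < m" "i < n"
    and eq: "\<And>y. y \<in> W \<Longrightarrow> F y = G y" and G: "has_partials j i W G"
  shows "has_partials j i W F" "\<And>x. x \<in> W \<Longrightarrow> partial_der j i F x = partial_der j i G x"
proof -
  have *: "((\<lambda>s. F (put j i s x)) has_vector_derivative partial_der j i G x) (at (x j i))" if "x \<in> W" for x
    using vector_derivative_put_cong[OF W that ji eq has_partialsD[OF G that]] by blast
  from has_partialsI[OF *] show "has_partials j i W F" .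
  show "partial_der j i F x = partial_der j i G x" if "x \<in> W" for x
    by (rule partial_derI[OF *[OF that]])
qed

lemma Ck_cong:
  assumes W: "rel_open m n W" and eq: "\<And>y. y \<in> W \<Longrightarrow> F y = G y" and G: "Ck_coords m n W k G"
  shows "Ck_coords m n W k F"
  using eq G
proof (induction k arbitrary: F G)
  case 0
  have "continuous_on W F"
    by (rule continuous_on_eq[of W G]) (use 0 in simp_all)
  then show ?case by simp
next
  case (Suc k)
  have "continuous_on W G" using Suc.prems(2) by (simp add: Ck_Suc)
  then have "continuous_on W F"
    by (rule continuous_on_eq) (simp add: Suc.prems(1))
  moreover have "has_partials j i W F \<and> Ck_coords m n W k (partial_der j i F)" if ji: "j < m" "i < n" for j i
  proof -
    have G: "has_partials j i W G" "Ck_coords m n W k (partial_der j i G)"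
      using Suc.prems(2) ji by (auto simp: Ck_Suc)
    have "\<And>y. y \<in> W \<Longrightarrow> partial_der j i F y = partial_der j i G y"
      by (rule has_partials_cong(2)[OF W ji Suc.prems(1) G(1)])
    from Suc.IH[OF this G(2)] has_partials_cong(1)[OF W ji Suc.prems(1) G(1)] show ?thesis by blast
  qed
  ultimately show ?case by (simp add: Ck_Suc)
qed

lemma Ck_cont: "Ck_coords m n W k F \<Longrightarrow> continuous_on W F"
  by (cases k) (auto simp: Ck_Suc)

lemma Ck_Suc_imp: "Ck_coords m n W (Suc k) F \<Longrightarrow> Ck_coords m n W k F"
proof (induction k arbitrary: F)
  case 0
  then show ?case by (simp add: Ck_cont)
next
  case (Suc k)
  then have "continuous_on W F" "\<forall>j<m. \<forall>i<n. has_partials j i W F \<and> Ck_coords m n W (Suc k) (partial_der j i F)"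
    using Ck_Suc by blast+
  with Suc.IH have "continuous_on W F \<and> (\<forall>j<m. \<forall>i<n. has_partials j i W F \<and> Ck_coords m n W k (partial_der j i F))"
    by blast
  then show ?case using Ck_Suc by blast
qed

text \<open>The shape of all closure proofs: a formula for the first partial derivatives.\<close>

lemma Ck_SucI:
  assumes W: "rel_open m n W" and c: "continuous_on W F"
    and d: "\<And>j i x. j < m \<Longrightarrow> i < n \<Longrightarrow> x \<in> W \<Longrightarrow>
      ((\<lambda>s. F (put j i s x)) has_vector_derivative D j i x) (at (x j i))"
    and D: "\<And>j i. j < m \<Longrightarrow> i < n \<Longrightarrow> Ck_coords m n W k (D j i)"
  shows "Ck_coords m n W (Suc k) F"
proof -
  have "has_partials j i W F \<and> Ck_coords m n W k (partial_der j i F)" if ji: "j < m" "i < n" for j i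
  proof
    show "has_partials j i W F" by (rule has_partialsI[OF d[OF ji]])
    show "Ck_coords m n W k (partial_der j i F)"
      by (rule Ck_cong[OF W _ D[OF ji]]) (rule partial_derI[OF d[OF ji]])
  qed
  with c show ?thesis by (simp add: Ck_Suc)
qed

lemma Ck_SucD:
  assumes "Ck_coords m n W (Suc k) F" "j < m" "i < n" "x \<in> W"
  shows "((\<lambda>s. F (put j i s x)) has_vector_derivative partial_der j i F x) (at (x j i))"
  using assms by (auto simp: Ck_Suc intro: has_partialsD)

lemma Ck_const: "rel_open m n W \<Longrightarrow> Ck_coords m n W k (\<lambda>_. c)"
proof (induction k arbitrary: c)
  case (Suc k)
  show ?case by (rule Ck_SucI[OF Suc.prems, where D="\<lambda>_ _ _. 0"]) (auto intro: Suc)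
qed auto

lemma Ck_add:
  assumes W: "rel_open m n W"
  shows "Ck_coords m n W k F \<Longrightarrow> Ck_coords m n W k G \<Longrightarrow> Ck_coords m n W k (\<lambda>x. F x + G x)"
proof (induction k arbitrary: F G)
  case (Suc k)
  show ?case
  proof (rule Ck_SucI[OF W, where D="\<lambda>j i x. partial_der j i F x + partial_der j i G x"])
    show "continuous_on W (\<lambda>x. F x + G x)"
      using Suc.prems by (intro continuous_on_add) (auto dest: Ck_cont)
    show "((\<lambda>s. F (put j i s x) + G (put j i s x)) has_vector_derivative
        partial_der j i F x + partial_der j i G x) (at (x j i))" if "j < m" "i < n" "x \<in> W" for j i x
      by (intro has_vector_derivative_add Ck_SucD[OF Suc.prems(1) that] Ck_SucD[OF Suc.prems(2) that])
    show "Ck_coords m n W k (\<lambda>x. partial_der j i F x + partial_der j i G x)" if "j < m" "i < n" for j i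
      using Suc.prems that by (intro Suc.IH) (auto simp: Ck_Suc)
  qed
qed (auto intro!: continuous_intros)

lemma Ck_sum:
  assumes W: "rel_open m n W"
  shows "(\<And>a. a \<in> A \<Longrightarrow> Ck_coords m n W k (F a)) \<Longrightarrow> Ck_coords m n W k (\<lambda>x. \<Sum>a\<in>A. F a x)"
  by (induction A rule: infinite_finite_induct) (auto simp: Ck_const[OF W] intro!: Ck_add[OF W])

lemma Ck_mult:
  assumes W: "rel_open m n W"
  shows "Ck_coords m n W k F \<Longrightarrow> Ck_coords m n W k G \<Longrightarrow> Ck_coords m n W k (\<lambda>x. F x * G x)"
proof (induction k arbitrary: F G)
  case (Suc k)
  have c: "continuous_on W F" "continuous_on W G" using Suc.prems by (auto simp: Ck_Suc)
  show ?case
  proof (rule Ck_SucI[OF W, where D="\<lambda>j i x. F x * partial_der j i G x + partial_der j i F x * G x"])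
    show "((\<lambda>s. F (put j i s x) * G (put j i s x)) has_vector_derivative
        F x * partial_der j i G x + partial_der j i F x * G x) (at (x j i))"
      if "j < m" "i < n" "x \<in> W" for j i x
      using has_vector_derivative_mult[OF Ck_SucD[OF Suc.prems(1) that] Ck_SucD[OF Suc.prems(2) that]]
      by (simp only: fun_upd_triv)
    show "Ck_coords m n W k (\<lambda>x. F x * partial_der j i G x + partial_der j i F x * G x)"
      if "j < m" "i < n" for j i
      using Suc.prems that Ck_Suc_imp[OF Suc.prems(1)] Ck_Suc_imp[OF Suc.prems(2)]
      by (intro Ck_add[OF W] Suc.IH) (auto simp: Ck_Suc)
  qed (use c in \<open>auto intro!: continuous_intros\<close>)
qed (auto intro!: continuous_intros)

lemma Ck_Re:
  assumes W: "rel_open m n W"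
  shows "Ck_coords m n W k F \<Longrightarrow> Ck_coords m n W k (\<lambda>x. complex_of_real (Re (F x)))"
proof (induction k arbitrary: F)
  case (Suc k)
  show ?case
  proof (rule Ck_SucI[OF W, where D="\<lambda>j i x. complex_of_real (Re (partial_der j i F x))"])
    show "((\<lambda>s. complex_of_real (Re (F (put j i s x)))) has_vector_derivative
        complex_of_real (Re (partial_der j i F x))) (at (x j i))" if "j < m" "i < n" "x \<in> W" for j i x
      using bounded_linear.has_vector_derivative[OF bounded_linear_compose[OF bounded_linear_of_real bounded_linear_Re]
          Ck_SucD[OF Suc.prems that]] .
  qed (use Suc in \<open>auto intro!: continuous_intros Suc.IH simp: Ck_Suc\<close>)
qed (auto intro!: continuous_intros)

text \<open>A smooth function on the line, given together with all its derivatives.\<close>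

definition derivs :: "(nat \<Rightarrow> real \<Rightarrow> real) \<Rightarrow> bool" where
  "derivs H \<longleftrightarrow> (\<forall>l s. (H l has_real_derivative H (Suc l) s) (at s))"

text \<open>
  Induction on the order needs all derivatives of the outer function at once, hence the sequence
  \<open>H\<close>.
\<close>

lemma Ck_compose:
  assumes W: "rel_open m n W" and H: "derivs H"
  shows "Ck_coords m n W k F \<Longrightarrow> Ck_coords m n W k (\<lambda>x. complex_of_real (H l (Re (F x))))"
proof (induction k arbitrary: l)
  case 0
  have "continuous_on UNIV (H l)" using H by (auto simp: derivs_def intro!: DERIV_continuous_on)
  then show ?case using 0 by (auto intro!: continuous_intros continuous_on_compose2[of UNIV "H l" W "\<lambda>x. Re (F x)"])
next
  case (Suc k)
  have cH: "continuous_on UNIV (H l)" using H by (auto simp: derivs_def intro!: DERIV_continuous_on)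
  show ?case
  proof (rule Ck_SucI[OF W, where D="\<lambda>j i x. complex_of_real (H (Suc l) (Re (F x))) * complex_of_real (Re (partial_der j i F x))"])
    show "continuous_on W (\<lambda>x. complex_of_real (H l (Re (F x))))"
      using Ck_cont[OF Suc.prems] by (auto intro!: continuous_intros continuous_on_compose2[OF cH])
    show "((\<lambda>s. complex_of_real (H l (Re (F (put j i s x))))) has_vector_derivative
      complex_of_real (H (Suc l) (Re (F x))) * complex_of_real (Re (partial_der j i F x))) (at (x j i))"
      if "j < m" "i < n" "x \<in> W" for j i x
    proof -
      have "((\<lambda>s. Re (F (put j i s x))) has_vector_derivative Re (partial_der j i F x)) (at (x j i))"
        by (rule bounded_linear.has_vector_derivative[OF bounded_linear_Re Ck_SucD[OF Suc.prems that]])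
      then have "((\<lambda>s. Re (F (put j i s x))) has_real_derivative Re (partial_der j i F x)) (at (x j i))"
        by (simp add: has_real_derivative_iff_has_vector_derivative)
      moreover have "(H l has_real_derivative H (Suc l) (Re (F (put j i (x j i) x)))) (at (Re (F (put j i (x j i) x))))"
        using H by (simp add: derivs_def)
      ultimately have "((\<lambda>s. H l (Re (F (put j i s x)))) has_real_derivative H (Suc l) (Re (F x)) * Re (partial_der j i F x)) (at (x j i))"
        using DERIV_chain2[where f="H l" and g="\<lambda>s. Re (F (put j i s x))" and x="x j i"] by simp
      from has_vector_derivative_of_real[OF this] show ?thesis by simp
    qed
    show "Ck_coords m n W k (\<lambda>x. complex_of_real (H (Suc l) (Re (F x))) * complex_of_real (Re (partial_der j i F x)))"
      if "j < m" "i < n" for j i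
      using Suc.prems that Ck_Suc_imp[OF Suc.prems]
      by (intro Ck_mult[OF W] Suc.IH Ck_Re[OF W]) (auto simp: Ck_Suc)
  qed
qed

lemma Ck_Un:
  assumes W1: "rel_open m n W1" and W2: "rel_open m n W2"
  shows "Ck_coords m n W1 k F \<Longrightarrow> Ck_coords m n W2 k F \<Longrightarrow> Ck_coords m n (W1 \<union> W2) k F"
proof (induction k arbitrary: F)
  case 0
  have "openin (top_of_set (W1 \<union> W2)) W1" "openin (top_of_set (W1 \<union> W2)) W2"
    using W1 W2 unfolding rel_open_def openin_open by blast+
  then show ?case using 0 continuous_on_Un_local_open by auto
next
  case (Suc k)
  have "continuous_on (W1 \<union> W2) F"
  proof -
    have "openin (top_of_set (W1 \<union> W2)) W1" "openin (top_of_set (W1 \<union> W2)) W2"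
      using W1 W2 unfolding rel_open_def openin_open by blast+
    then show ?thesis using Suc continuous_on_Un_local_open by (auto simp: Ck_Suc)
  qed
  then show ?case using Suc by (auto simp: Ck_Suc has_partials_def)
qed

section \<open>The chain rule for substitution of variables\<close>

text \<open>
  Moves the \<open>i\<close>-th coordinates of several vectors simultaneously; this is the path along which a
  repeated variable is differentiated.
\<close>

definition put_on :: "nat set \<Rightarrow> nat \<Rightarrow> real \<Rightarrow> pt \<Rightarrow> pt" where
  "put_on A i s y = (\<lambda>k. if k \<in> A then (y k)(i := s) else y k)"

lemma continuous_on_put_on:
  fixes g :: "'b::topological_space \<Rightarrow> pt"
  assumes f: "continuous_on S f" and g: "continuous_on S g"
  shows "continuous_on S (\<lambda>t. put_on A i (f t) (g t))"
proof (rule continuous_on_pt)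
  fix a b
  show "continuous_on S (\<lambda>t. (put_on A i (f t) (g t)) a b)"
    using f continuous_on_entry_compose[OF g, of a b] by (cases "a \<in> A"; cases "b = i") (simp_all add: put_on_def)
qed

lemma put_on_coords: "y \<in> coords m n \<Longrightarrow> A \<subseteq> {..<m} \<Longrightarrow> i < n \<Longrightarrow> put_on A i s y \<in> coords m n"
  by (auto simp: coords_def put_on_def)

text \<open>
  The chain rule along a diagonal, obtained by adding one moving variable at a time and using
  continuity of the partial derivatives.
\<close>

lemma has_vector_derivative_put_on:
  assumes W: "rel_open m n W" and y: "y \<in> W" and i: "i < n"
    and A: "finite A" "A \<subseteq> {..<m}" and s0: "\<And>k. k \<in> A \<Longrightarrow> y k i = s0"
    and d: "\<And>k. k \<in> A \<Longrightarrow> has_partials k i W F" and c: "\<And>k. k \<in> A \<Longrightarrow> continuous_on W (partial_der k i F)"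
  shows "((\<lambda>s. F (put_on A i s y)) has_vector_derivative (\<Sum>k\<in>A. partial_der k i F y)) (at s0)"
  using A s0 d c
proof (induction A)
  case empty
  then show ?case by (simp add: put_on_def)
next
  case (insert k A)
  define G where "G = (\<lambda>s t. F (put_on A i s (put k i t y)))"
  define \<gamma> where "\<gamma> = (\<lambda>(s, t). put_on A i s (put k i t y))"
  have yk: "y k i = s0" using insert.prems by auto
  have \<gamma>0: "\<gamma> (s0, s0) = y"
    using insert.prems by (auto simp: \<gamma>_def put_on_def fun_eq_iff)
  have kA: "k \<notin> A" by fact
  have cont: "continuous_on UNIV \<gamma>"
    unfolding \<gamma>_def split_beta
    by (intro continuous_on_put_on continuous_on_put continuous_on_fst continuous_on_snd continuous_on_id continuous_on_const)
  have co: "\<gamma> t \<in> coords m n" for t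
    using insert.prems(1) i rel_open_coords[OF W y]
    by (auto simp: \<gamma>_def split_beta intro!: put_on_coords put_coords)
  obtain V where V: "open V" "(s0, s0) \<in> V" "\<And>t. t \<in> V \<Longrightarrow> \<gamma> t \<in> W"
    using rel_open_near[OF W cont _ co, of "(s0, s0)"] y \<gamma>0 by auto
  obtain A1 A2 where "open A1" "open A2" and mem: "(s0, s0) \<in> A1 \<times> A2" and "A1 \<times> A2 \<subseteq> V"
    using open_prod_elim[OF V(1,2)] by blast
  then have A12: "open A1" "open A2" "s0 \<in> A1" "s0 \<in> A2" "A1 \<times> A2 \<subseteq> V" by auto
  obtain e1 where e1: "e1 > 0" "ball s0 e1 \<subseteq> A1" using openE[OF A12(1,3)] by blast
  obtain e2 where e2: "e2 > 0" "ball s0 e2 \<subseteq> A2" using openE[OF A12(2,4)] by blast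
  define B where "B = ball s0 (min e1 e2)"
  have B: "open B" "s0 \<in> B" "convex B" using e1 e2 by (auto simp: B_def)
  have BW: "\<gamma> (s, t) \<in> W" if "s \<in> B" "t \<in> B" for s t
    using that V(3) A12(5) e1(2) e2(2) by (force simp: B_def)
  have "((\<lambda>s. F (put_on A i s y)) has_vector_derivative (\<Sum>k\<in>A. partial_der k i F y)) (at s0)"
    using insert by auto
  moreover have "put k i s0 y = y" using yk by (auto simp: fun_eq_iff)
  ultimately have fx: "((\<lambda>s. G s s0) has_derivative (\<lambda>h. h *\<^sub>R (\<Sum>k\<in>A. partial_der k i F y))) (at s0 within B)"
    unfolding G_def has_vector_derivative_def by (auto intro: has_derivative_at_withinI)
  have fy: "((\<lambda>t. G s t) has_derivative blinfun_apply (blinfun_scaleR_left (partial_der k i F (\<gamma> (s, t))))) (at t within B)"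
    if "s \<in> B" "t \<in> B" for s t
  proof -
    have "((\<lambda>u. F (put k i u (\<gamma> (s, t)))) has_vector_derivative partial_der k i F (\<gamma> (s, t))) (at ((\<gamma> (s, t)) k i))"
      using insert.prems(3) BW[OF that] by (intro has_partialsD) auto
    moreover have "(\<lambda>u. F (put k i u (\<gamma> (s, t)))) = (\<lambda>u. G s u)"
    proof
      fix u
      have "put k i u (\<gamma> (s, t)) = put_on A i s (put k i u y)" using kA by (auto simp: \<gamma>_def put_on_def fun_eq_iff)
      then show "F (put k i u (\<gamma> (s, t))) = G s u" by (simp add: G_def)
    qed
    moreover have "(\<gamma> (s, t)) k i = t" using kA by (simp add: \<gamma>_def put_on_def)
    ultimately show ?thesis by (auto simp: has_vector_derivative_def intro: has_derivative_at_withinI)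
  qed
  have "continuous_on (B \<times> B) (\<lambda>p. partial_der k i F (\<gamma> p))"
    using insert.prems(4) BW by (intro continuous_on_compose2[OF _ continuous_on_subset[OF cont]]) auto
  then have "continuous_on (B \<times> B) (\<lambda>p. blinfun_scaleR_left (partial_der k i F (\<gamma> p)))"
    by (rule bounded_linear.continuous_on[OF bounded_linear_blinfun_scaleR_left])
  then have fc: "continuous (at (s0, s0) within B \<times> B) (\<lambda>(s, t). blinfun_scaleR_left (partial_der k i F (\<gamma> (s, t))))"
    using B(2) by (simp add: continuous_on_eq_continuous_within case_prod_unfold)
  have "((\<lambda>(s, t). G s t) has_derivative (\<lambda>(hs, ht). hs *\<^sub>R (\<Sum>k\<in>A. partial_der k i F y)
      + blinfun_apply (blinfun_scaleR_left (partial_der k i F (\<gamma> (s0, s0)))) ht)) (at (s0, s0) within B \<times> B)"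
    by (rule has_derivative_partialsI[OF fx fy fc B(2,3)])
  then have D: "((\<lambda>(s, t). G s t) has_derivative (\<lambda>(hs, ht). hs *\<^sub>R (\<Sum>k\<in>A. partial_der k i F y)
      + ht *\<^sub>R partial_der k i F y)) (at (s0, s0))"
    using B by (simp add: \<gamma>0 at_within_open[of _ "B \<times> B"] open_Times)
  have "((\<lambda>s. (s, s)) has_derivative (\<lambda>h. (h, h))) (at s0)"
    by (intro derivative_eq_intros) auto
  from has_derivative_compose[OF this D]
  have "((\<lambda>s. G s s) has_derivative (\<lambda>h. h *\<^sub>R (\<Sum>k\<in>A. partial_der k i F y) + h *\<^sub>R partial_der k i F y)) (at s0)"
    by simp
  moreover have "put_on (insert k A) i s y = put_on A i s (put k i s y)" for s
    using kA by (auto simp: put_on_def fun_eq_iff)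
  ultimately show ?case
    using insert(1) kA by (simp add: has_vector_derivative_def G_def scaleR_add_right add.commute)
qed

text \<open>Substitutions: the \<open>k\<close>-th variable becomes \<open>x (\<sigma> k)\<close> for \<open>k \<in> S\<close> and the constant \<open>z k\<close> otherwise.\<close>

definition subst_vars :: "nat \<Rightarrow> nat set \<Rightarrow> (nat \<Rightarrow> nat) \<Rightarrow> pt \<Rightarrow> pt \<Rightarrow> pt" where
  "subst_vars L S \<sigma> z x = (\<lambda>k. if k < L then (if k \<in> S then x (\<sigma> k) else z k) else (\<lambda>_. 0))"

lemma continuous_on_subst_vars: "continuous_on T (subst_vars L S \<sigma> z)"
proof (rule continuous_on_pt)
  fix j i
  show "continuous_on T (\<lambda>x. subst_vars L S \<sigma> z x j i)"
    by (cases "j < L"; cases "j \<in> S") (simp_all add: subst_vars_def continuous_on_entry)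
qed

lemma has_vector_derivative_subst_vars:
  assumes W: "rel_open L n W" and x: "subst_vars L S \<sigma> z x \<in> W" and i: "i < n"
    and d: "\<And>k. k < L \<Longrightarrow> has_partials k i W F" and c: "\<And>k. k < L \<Longrightarrow> continuous_on W (partial_der k i F)"
  shows "((\<lambda>s. F (subst_vars L S \<sigma> z (put j i s x))) has_vector_derivative
    (\<Sum>k\<in>{k. k < L \<and> k \<in> S \<and> \<sigma> k = j}. partial_der k i F (subst_vars L S \<sigma> z x))) (at (x j i))"
proof -
  let ?A = "{k. k < L \<and> k \<in> S \<and> \<sigma> k = j}"
  have "subst_vars L S \<sigma> z (put j i s x) = put_on ?A i s (subst_vars L S \<sigma> z x)" for s
    by (auto simp: subst_vars_def put_on_def fun_eq_iff)
  then show ?thesis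
    by (simp only:) (rule has_vector_derivative_put_on[OF W x i], auto simp: subst_vars_def intro: d c)
qed

lemma Ck_subst_vars:
  assumes W: "rel_open L n W" and W': "rel_open m n W'"
    and sub: "\<And>x. x \<in> W' \<Longrightarrow> subst_vars L S \<sigma> z x \<in> W"
  shows "Ck_coords L n W k F \<Longrightarrow> Ck_coords m n W' k (\<lambda>x. F (subst_vars L S \<sigma> z x))"
proof (induction k arbitrary: F)
  case 0
  then have "continuous_on W F" by simp
  then show ?case
    using continuous_on_compose2[OF _ continuous_on_subst_vars[of W' L S \<sigma> z], of W F] sub by auto
next
  case (Suc k)
  show ?case
  proof (rule Ck_SucI[OF W', where D="\<lambda>j i x. \<Sum>k\<in>{k. k < L \<and> k \<in> S \<and> \<sigma> k = j}. partial_der k i F (subst_vars L S \<sigma> z x)"])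
    show "continuous_on W' (\<lambda>x. F (subst_vars L S \<sigma> z x))"
      using continuous_on_compose2[OF Ck_cont[OF Suc.prems] continuous_on_subst_vars[of W' L S \<sigma> z]] sub by auto
    show "((\<lambda>s. F (subst_vars L S \<sigma> z (put j i s x))) has_vector_derivative
        (\<Sum>k\<in>{k. k < L \<and> k \<in> S \<and> \<sigma> k = j}. partial_der k i F (subst_vars L S \<sigma> z x))) (at (x j i))"
      if "j < m" "i < n" "x \<in> W'" for j i x
      using Suc.prems that(2)
      by (intro has_vector_derivative_subst_vars[OF W sub[OF that(3)] that(2)]) (auto simp: Ck_Suc intro: Ck_cont)
    show "Ck_coords m n W' k (\<lambda>x. \<Sum>k\<in>{k. k < L \<and> k \<in> S \<and> \<sigma> k = j}. partial_der k i F (subst_vars L S \<sigma> z x))"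
      if "j < m" "i < n" for j i
      using Suc.prems that by (intro Ck_sum[OF W'] Suc.IH) (auto simp: Ck_Suc)
  qed
qed

section \<open>Symmetry of second derivatives\<close>

text \<open>
  Differentiation under the integral sign: write the inner derivative through the fundamental
  theorem of calculus and apply the Leibniz rule.
\<close>

lemma partial_der_commute:
  assumes W: "rel_open m n W" and F: "Ck_coords m n W 2 F" and x: "x \<in> W"
    and ji: "j < m" "i < n" and kl: "k < m" "l < n"
  shows "partial_der j i (partial_der k l F) x = partial_der k l (partial_der j i F) x"
proof (cases "(j, i) = (k, l)")
  case False
  define \<gamma> where "\<gamma> = (\<lambda>(s, t). put j i s (put k l t x))"
  define s0 where "s0 = x j i"
  define t0 where "t0 = x k l"
  have \<gamma>0: "\<gamma> (s0, t0) = x" by (auto simp: \<gamma>_def s0_def t0_def fun_eq_iff)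
  have cont: "continuous_on UNIV \<gamma>"
    unfolding \<gamma>_def split_beta
    by (intro continuous_on_put continuous_on_fst continuous_on_snd continuous_on_id continuous_on_const)
  have co: "\<gamma> t \<in> coords m n" for t
    using rel_open_coords[OF W x] ji kl put_coords[of "put k l (snd t) x" m n j i "fst t"] put_coords[of x m n k l "snd t"]
    by (auto simp: \<gamma>_def split_beta)
  obtain V where V: "open V" "(s0, t0) \<in> V" "\<And>t. t \<in> V \<Longrightarrow> \<gamma> t \<in> W"
    using rel_open_near[OF W cont _ co, of "(s0, t0)"] x \<gamma>0 by auto
  obtain A1 A2 where "open A1" "open A2" and mem: "(s0, t0) \<in> A1 \<times> A2" and "A1 \<times> A2 \<subseteq> V"
    using open_prod_elim[OF V(1,2)] by blast
  then have A12: "open A1" "open A2" "s0 \<in> A1" "t0 \<in> A2" "A1 \<times> A2 \<subseteq> V" by auto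
  obtain e1 where e1: "e1 > 0" "cball s0 e1 \<subseteq> A1"
    using A12(1,3) unfolding open_contains_cball by blast
  obtain e2 where e2: "e2 > 0" "cball t0 e2 \<subseteq> A2"
    using A12(2,4) unfolding open_contains_cball by blast
  define a where "a = t0 - e2"
  define b where "b = t0 + e2"
  define I where "I = {s0 - e1..s0 + e1}"
  have W\<gamma>: "\<gamma> (s, t) \<in> W" if "s \<in> I" "t \<in> {a..b}" for s t
  proof (rule V(3), rule subsetD[OF A12(5)], rule SigmaI)
    show "s \<in> A1" using that e1(2) by (auto simp: I_def dist_real_def subset_iff)
    show "t \<in> A2" using that e2(2) by (auto simp: a_def b_def dist_real_def subset_iff)
  qed
  have pk: "has_partials k l W F" and pj: "has_partials j i W F"
    and pjk: "has_partials j i W (partial_der k l F)" and pkj: "has_partials k l W (partial_der j i F)"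
    and cP: "continuous_on W (partial_der j i (partial_der k l F))" and cQ: "continuous_on W (partial_der k l (partial_der j i F))"
    and ck: "continuous_on W (partial_der k l F)"
    using F ji kl by (auto simp: numeral_2_eq_2 Ck_Suc)
  have puts: "put j i u (\<gamma> (s, t)) = \<gamma> (u, t)" "put k l u (\<gamma> (s, t)) = \<gamma> (s, u)"
      "\<gamma> (s, t) j i = s" "\<gamma> (s, t) k l = t" for s t u
    using False by (auto simp: \<gamma>_def fun_eq_iff)
  have dt: "((\<lambda>u. H (\<gamma> (s, u))) has_vector_derivative partial_der k l H (\<gamma> (s, t))) (at t)"
    if "s \<in> I" "t \<in> {a..b}" "has_partials k l W H" for s t H
    using has_partialsD[OF that(3) W\<gamma>[OF that(1,2)]] by (simp add: puts)
  have ds: "((\<lambda>u. H (\<gamma> (u, t))) has_vector_derivative partial_der j i H (\<gamma> (s, t))) (at s)"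
    if "s \<in> I" "t \<in> {a..b}" "has_partials j i W H" for s t H
    using has_partialsD[OF that(3) W\<gamma>[OF that(1,2)]] by (simp add: puts)
  have c2: "continuous_on (I \<times> {a..b}) (\<lambda>p. H (\<gamma> p))" if "continuous_on W H" for H :: "pt \<Rightarrow> complex"
    using W\<gamma> by (intro continuous_on_compose2[OF that continuous_on_subset[OF cont]]) auto
  have c1: "continuous_on {a..b} (\<lambda>t. H (\<gamma> (s, t)))" if "continuous_on W H" "s \<in> I" for s and H :: "pt \<Rightarrow> complex"
    using that(2) by (intro continuous_on_compose2[OF c2[OF that(1)]]) (auto intro!: continuous_intros)
  define P where "P = (\<lambda>t. partial_der j i (partial_der k l F) (\<gamma> (s0, t)))"
  define Q where "Q = (\<lambda>t. partial_der k l (partial_der j i F) (\<gamma> (s0, t)))"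
  have s0I: "s0 \<in> I" using e1 by (simp add: I_def)
  have ab: "a < t0" "t0 < b" "a < b" using e2 by (auto simp: a_def b_def)
  have at_I: "at s0 within I = at s0"
    using e1 by (intro at_within_interior) (auto simp: I_def)
  have key: "integral {a..t} P = integral {a..t} Q" if t: "t \<in> {a..b}" for t
  proof -
    have sub: "{a..t} \<subseteq> {a..b}" using t by auto
    have ftc: "((\<lambda>u. partial_der k l H (\<gamma> (s, u))) has_integral (H (\<gamma> (s, t)) - H (\<gamma> (s, a)))) {a..t}"
      if "s \<in> I" "has_partials k l W H" for s H
      using that t sub by (intro fundamental_theorem_of_calculus has_vector_derivative_at_within[OF dt]) auto
    have "((\<lambda>s. integral (cbox a t) (\<lambda>u. partial_der k l F (\<gamma> (s, u)))) has_vector_derivative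
        integral (cbox a t) (\<lambda>u. partial_der j i (partial_der k l F) (\<gamma> (s0, u)))) (at s0 within I)"
    proof (rule leibniz_rule_vector_derivative)
      show "((\<lambda>s. partial_der k l F (\<gamma> (s, u))) has_vector_derivative partial_der j i (partial_der k l F) (\<gamma> (s, u))) (at s within I)"
        if "s \<in> I" "u \<in> cbox a t" for s u
        using that sub pjk by (intro has_vector_derivative_at_within[OF ds]) auto
      show "(\<lambda>u. partial_der k l F (\<gamma> (s, u))) integrable_on cbox a t" if "s \<in> I" for s
        using ftc[OF that pk] by auto
      show "continuous_on (I \<times> cbox a t) (\<lambda>(s, u). partial_der j i (partial_der k l F) (\<gamma> (s, u)))"
      proof -
        have "I \<times> cbox a t \<subseteq> I \<times> {a..b}" using sub by auto
        from continuous_on_subset[OF c2[OF cP] this] show ?thesis by (simp add: case_prod_unfold)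
      qed
    qed (auto simp: s0I, simp add: I_def)
    then have 1: "((\<lambda>s. integral {a..t} (\<lambda>u. partial_der k l F (\<gamma> (s, u)))) has_vector_derivative integral {a..t} P) (at s0 within I)"
      by (simp add: P_def)
    have 2: "((\<lambda>s. F (\<gamma> (s, t)) - F (\<gamma> (s, a))) has_vector_derivative integral {a..t} P) (at s0 within I)"
      by (rule has_vector_derivative_transform[OF s0I _ 1]) (metis ftc[OF _ pk] integral_unique)
    have 3: "((\<lambda>s. F (\<gamma> (s, t)) - F (\<gamma> (s, a))) has_vector_derivative
        partial_der j i F (\<gamma> (s0, t)) - partial_der j i F (\<gamma> (s0, a))) (at s0)"
      using t ab s0I pj by (intro has_vector_derivative_diff ds) auto
    have "partial_der j i F (\<gamma> (s0, t)) - partial_der j i F (\<gamma> (s0, a)) = integral {a..t} P"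
      using vector_derivative_unique_at[OF 3] 2 at_I by simp
    moreover have "integral {a..t} Q = partial_der j i F (\<gamma> (s0, t)) - partial_der j i F (\<gamma> (s0, a))"
      using ftc[OF s0I pkj] by (simp add: Q_def integral_unique)
    ultimately show ?thesis by simp
  qed
  have "continuous_on {a..b} P" "continuous_on {a..b} Q"
    unfolding P_def Q_def using c1[OF cP s0I] c1[OF cQ s0I] by auto
  then have "((\<lambda>t. integral {a..t} P) has_vector_derivative P t0) (at t0 within {a..b})"
    "((\<lambda>t. integral {a..t} Q) has_vector_derivative Q t0) (at t0 within {a..b})"
    using ab by (auto intro!: integral_has_vector_derivative)
  moreover have "((\<lambda>t. integral {a..t} Q) has_vector_derivative P t0) (at t0 within {a..b})"
    using ab key by (intro has_vector_derivative_transform[OF _ _ calculation(1)]) auto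
  ultimately have "P t0 = Q t0"
    using vector_derivative_unique_at[of "\<lambda>t. integral {a..t} Q" "P t0" t0 "Q t0"] ab
      at_within_interior[of t0 "{a..b}"] by (simp add: interior_atLeastAtMost_real)
  then show ?thesis by (simp add: P_def Q_def \<gamma>0)
qed simp

section \<open>Order of vanishing and Taylor polynomials\<close>

lemma partial_der_cong:
  assumes W: "rel_open m n W" and x: "x \<in> W" and ji: "j < m" "i < n"
    and eq: "\<And>y. y \<in> W \<Longrightarrow> F y = G y"
  shows "partial_der j i F x = partial_der j i G x"
proof -
  have "((\<lambda>s. F (put j i s x)) has_vector_derivative D) (at (x j i)) \<longleftrightarrow>
      ((\<lambda>s. G (put j i s x)) has_vector_derivative D) (at (x j i))" for D
    using vector_derivative_put_cong[OF W x ji, of F G D] vector_derivative_put_cong[OF W x ji, of G F D] eq by auto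
  then show ?thesis by (simp add: partial_der_def vector_derivative_def)
qed

text \<open>
  All partial derivatives of order at most \<open>r\<close> vanish at \<open>x\<close>.
\<close>

primrec van :: "nat \<Rightarrow> nat \<Rightarrow> nat \<Rightarrow> (pt \<Rightarrow> complex) \<Rightarrow> pt \<Rightarrow> bool" where
  "van m n 0 F x \<longleftrightarrow> F x = 0"
| "van m n (Suc r) F x \<longleftrightarrow> F x = 0 \<and> (\<forall>j<m. \<forall>i<n. van m n r (partial_der j i F) x)"

lemma van_value: "van m n r F x \<Longrightarrow> F x = 0"
  by (cases r) auto

lemma van_mono: "van m n r F x \<Longrightarrow> r' \<le> r \<Longrightarrow> van m n r' F x"
proof (induction r' arbitrary: r F)
  case (Suc r')
  then show ?case by (cases r) auto
qed (simp add: van_value)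

lemma van_cong:
  assumes W: "rel_open m n W" and x: "x \<in> W" and eq: "\<And>y. y \<in> W \<Longrightarrow> F y = G y" and F: "van m n r F x"
  shows "van m n r G x"
  using eq F
proof (induction r arbitrary: F G)
  case 0 then show ?case using x by simp
next
  case (Suc r)
  have "van m n r (partial_der j i G) x" if ji: "j < m" "i < n" for j i
  proof (rule Suc.IH)
    show "partial_der j i F y = partial_der j i G y" if "y \<in> W" for y
      by (rule partial_der_cong[OF W that ji Suc.prems(1)])
    show "van m n r (partial_der j i F) x" using Suc.prems(2) ji by simp
  qed
  moreover have "G x = 0" using Suc.prems x by simp
  ultimately show ?case by simp
qed

lemma smooth_Ck: "smooth_coords m n W F \<Longrightarrow> Ck_coords m n W k F"
  by (simp add: smooth_coords_def)

lemma smooth_partial: "smooth_coords m n W F \<Longrightarrow> j < m \<Longrightarrow> i < n \<Longrightarrow> smooth_coords m n W (partial_der j i F)"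
  unfolding smooth_coords_def using Ck_Suc by blast

lemma smooth_derivative:
  "smooth_coords m n W F \<Longrightarrow> j < m \<Longrightarrow> i < n \<Longrightarrow> x \<in> W \<Longrightarrow>
    ((\<lambda>s. F (put j i s x)) has_vector_derivative partial_der j i F x) (at (x j i))"
  using Ck_SucD[of m n W 0 F j i x] by (simp add: smooth_coords_def)

lemma smooth_cong: "rel_open m n W \<Longrightarrow> (\<And>y. y \<in> W \<Longrightarrow> F y = G y) \<Longrightarrow> smooth_coords m n W G \<Longrightarrow> smooth_coords m n W F"
  unfolding smooth_coords_def using Ck_cong by blast

lemma smooth_const: "rel_open m n W \<Longrightarrow> smooth_coords m n W (\<lambda>_. c)"
  by (simp add: smooth_coords_def Ck_const)

lemma smooth_add: "rel_open m n W \<Longrightarrow> smooth_coords m n W F \<Longrightarrow> smooth_coords m n W G \<Longrightarrow> smooth_coords m n W (\<lambda>x. F x + G x)"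
  by (simp add: smooth_coords_def Ck_add)

lemma smooth_mult: "rel_open m n W \<Longrightarrow> smooth_coords m n W F \<Longrightarrow> smooth_coords m n W G \<Longrightarrow> smooth_coords m n W (\<lambda>x. F x * G x)"
  by (simp add: smooth_coords_def Ck_mult)

lemma smooth_sum: "rel_open m n W \<Longrightarrow> (\<And>a. a \<in> A \<Longrightarrow> smooth_coords m n W (F a)) \<Longrightarrow> smooth_coords m n W (\<lambda>x. \<Sum>a\<in>A. F a x)"
  by (simp add: smooth_coords_def Ck_sum)

lemma smooth_compose:
  "rel_open m n W \<Longrightarrow> derivs H \<Longrightarrow> smooth_coords m n W F \<Longrightarrow> smooth_coords m n W (\<lambda>x. complex_of_real (H l (Re (F x))))"
  by (simp add: smooth_coords_def Ck_compose)

lemma smooth_subst_vars: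
  "rel_open L n W \<Longrightarrow> rel_open m n W' \<Longrightarrow> (\<And>x. x \<in> W' \<Longrightarrow> subst_vars L S \<sigma> z x \<in> W) \<Longrightarrow>
    smooth_coords L n W F \<Longrightarrow> smooth_coords m n W' (\<lambda>x. F (subst_vars L S \<sigma> z x))"
  unfolding smooth_coords_def using Ck_subst_vars by blast

lemma smooth_partials:
  "smooth_coords m n W F \<Longrightarrow> set \<alpha> \<subseteq> {..<m} \<times> {..<n} \<Longrightarrow> smooth_coords m n W (partials \<alpha> F)"
  by (induction \<alpha>) (auto simp: partials_def intro: smooth_partial)

context
  fixes m n W x
  assumes W: "rel_open m n W" and x: "x \<in> W"
begin

lemma van_step:
  assumes "F x = 0"
    and d: "\<And>j i y. j < m \<Longrightarrow> i < n \<Longrightarrow> y \<in> W \<Longrightarrow>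
      ((\<lambda>s. F (put j i s y)) has_vector_derivative D j i y) (at (y j i))"
    and D: "\<And>j i. j < m \<Longrightarrow> i < n \<Longrightarrow> van m n r (D j i) x"
  shows "van m n (Suc r) F x"
proof -
  have "van m n r (partial_der j i F) x" if ji: "j < m" "i < n" for j i
    by (rule van_cong[OF W x _ D[OF ji]]) (rule partial_derI[OF d[OF ji], symmetric])
  with assms(1) show ?thesis by simp
qed

lemma van_zero: "van m n r (\<lambda>_. 0) x"
proof (induction r)
  case (Suc r)
  show ?case by (rule van_step[where D="\<lambda>_ _ _. 0"]) (auto intro: Suc)
qed simp

lemma van_add:
  "smooth_coords m n W F \<Longrightarrow> smooth_coords m n W G \<Longrightarrow> van m n r F x \<Longrightarrow> van m n r G x \<Longrightarrow> van m n r (\<lambda>y. F y + G y) x"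
proof (induction r arbitrary: F G)
  case (Suc r)
  show ?case
  proof (rule van_step[where D="\<lambda>j i y. partial_der j i F y + partial_der j i G y"])
    fix j i assume ji: "j < m" "i < n"
    show "((\<lambda>s. F (put j i s y) + G (put j i s y)) has_vector_derivative partial_der j i F y + partial_der j i G y) (at (y j i))"
      if "y \<in> W" for y
      by (intro has_vector_derivative_add smooth_derivative[OF Suc.prems(1) ji that] smooth_derivative[OF Suc.prems(2) ji that])
    show "van m n r (\<lambda>y. partial_der j i F y + partial_der j i G y) x"
      using Suc.prems(3,4) ji by (intro Suc.IH smooth_partial[OF Suc.prems(1)] smooth_partial[OF Suc.prems(2)]) auto
  qed (use Suc.prems in \<open>auto dest: van_value\<close>)
qed simp

lemma van_sum:
  "(\<And>a. a \<in> A \<Longrightarrow> smooth_coords m n W (F a)) \<Longrightarrow> (\<And>a. a \<in> A \<Longrightarrow> van m n r (F a) x) \<Longrightarrow> van m n r (\<lambda>y. \<Sum>a\<in>A. F a y) x"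
  by (induction A rule: infinite_finite_induct) (auto simp: van_zero intro!: van_add smooth_sum[OF W])

lemma van_mult:
  "smooth_coords m n W F \<Longrightarrow> smooth_coords m n W G \<Longrightarrow> van m n r G x \<Longrightarrow> van m n r (\<lambda>y. F y * G y) x"
proof (induction r arbitrary: F G)
  case (Suc r)
  show ?case
  proof (rule van_step[where D="\<lambda>j i y. F y * partial_der j i G y + partial_der j i F y * G y"])
    fix j i assume ji: "j < m" "i < n"
    note pF = smooth_partial[OF Suc.prems(1) ji] and pG = smooth_partial[OF Suc.prems(2) ji]
    show "((\<lambda>s. F (put j i s y) * G (put j i s y)) has_vector_derivative
        F y * partial_der j i G y + partial_der j i F y * G y) (at (y j i))" if "y \<in> W" for y
      using has_vector_derivative_mult[OF smooth_derivative[OF Suc.prems(1) ji that] smooth_derivative[OF Suc.prems(2) ji that]]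
      by (simp only: fun_upd_triv)
    have "van m n r G x" using van_mono[OF Suc.prems(3), of r] by simp
    then show "van m n r (\<lambda>y. F y * partial_der j i G y + partial_der j i F y * G y) x"
      using Suc.prems ji pF pG by (intro van_add smooth_mult[OF W] Suc.IH) auto
  qed (use Suc.prems in auto)
qed simp

lemma van_subst_vars:
  assumes V: "rel_open L n V" and sub: "\<And>y. y \<in> W \<Longrightarrow> subst_vars L S \<sigma> z y \<in> V"
  shows "smooth_coords L n V F \<Longrightarrow> van L n r F (subst_vars L S \<sigma> z x) \<Longrightarrow> van m n r (\<lambda>y. F (subst_vars L S \<sigma> z y)) x"
proof (induction r arbitrary: F)
  case (Suc r)
  let ?K = "\<lambda>j. {k. k < L \<and> k \<in> S \<and> \<sigma> k = j}"
  show ?case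
  proof (rule van_step[where D="\<lambda>j i y. \<Sum>k\<in>?K j. partial_der k i F (subst_vars L S \<sigma> z y)"])
    fix j i assume ji: "j < m" "i < n"
    show "((\<lambda>s. F (subst_vars L S \<sigma> z (put j i s y))) has_vector_derivative
        (\<Sum>k\<in>?K j. partial_der k i F (subst_vars L S \<sigma> z y))) (at (y j i))" if "y \<in> W" for y
    proof (rule has_vector_derivative_subst_vars[OF V sub[OF that] ji(2)])
      show "has_partials k i V F" if "k < L" for k
        using smooth_Ck[OF Suc.prems(1), of "Suc 0"] that ji(2) by (simp add: Ck_Suc)
      show "continuous_on V (partial_der k i F)" if "k < L" for k
        using smooth_Ck[OF smooth_partial[OF Suc.prems(1) that ji(2)], of 0] by simp
    qed
    show "van m n r (\<lambda>y. \<Sum>k\<in>?K j. partial_der k i F (subst_vars L S \<sigma> z y)) x"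
    proof (rule van_sum)
      fix k assume k: "k \<in> ?K j"
      then have "smooth_coords L n V (partial_der k i F)" using smooth_partial[OF Suc.prems(1) _ ji(2)] by blast
      then show "smooth_coords m n W (\<lambda>y. partial_der k i F (subst_vars L S \<sigma> z y))"
        and "van m n r (\<lambda>y. partial_der k i F (subst_vars L S \<sigma> z y)) x"
        using k Suc.prems(2) ji(2) by (auto intro!: smooth_subst_vars[OF V W sub] Suc.IH)
    qed
  qed (use Suc.prems in auto)
qed simp

end

lemma van_partials:
  "van m n (r + length \<alpha>) F x \<Longrightarrow> set \<alpha> \<subseteq> {..<m} \<times> {..<n} \<Longrightarrow> van m n r (partials \<alpha> F) x"
proof (induction \<alpha> arbitrary: r)
  case (Cons ji \<alpha>)
  obtain j i where ji: "ji = (j, i)" by (cases ji)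
  have "van m n (Suc r) (partials \<alpha> F) x"
    using Cons.IH[of "Suc r"] Cons.prems by (simp del: van.simps)
  then show ?case using Cons.prems(2) by (auto simp: ji partials_def)
qed (simp add: partials_def)

text \<open>
  Euler's formula expresses the homogeneous Taylor polynomial of degree \<open>R + 1\<close> through those of
  degree \<open>R\<close> of the first derivatives. This recursion has no multi-indices or factorials of them.
\<close>

primrec tay :: "nat \<Rightarrow> nat \<Rightarrow> pt \<Rightarrow> nat \<Rightarrow> (pt \<Rightarrow> complex) \<Rightarrow> pt \<Rightarrow> complex" where
  "tay m n x0 0 F = (\<lambda>x. F x0)"
| "tay m n x0 (Suc R) F = (\<lambda>x. (1 / of_nat (Suc R)) *
     (\<Sum>j<m. \<Sum>i<n. complex_of_real (x j i - x0 j i) * tay m n x0 R (partial_der j i F) x))"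

lemma tay_cong:
  assumes W: "rel_open m n W" and x0: "x0 \<in> W" and eq: "\<And>y. y \<in> W \<Longrightarrow> F y = G y"
  shows "tay m n x0 R F = tay m n x0 R G"
  using eq
proof (induction R arbitrary: F G)
  case (Suc R)
  have "tay m n x0 R (partial_der j i F) = tay m n x0 R (partial_der j i G)" if ji: "j < m" "i < n" for j i
    by (rule Suc.IH) (rule partial_der_cong[OF W _ ji Suc.prems])
  then show ?case by (auto intro!: sum.cong)
qed (use x0 in simp)

lemma sum_slot:
  assumes "k < (m::nat)" "l < (n::nat)"
  shows "(\<Sum>j<m. \<Sum>i<n. if k = j \<and> l = i then f j i else 0) = (f k l :: complex)"
proof -
  have "(\<Sum>i<n. if k = j \<and> l = i then f j i else 0) = (if k = j then f j l else 0)" for j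
    using assms(2) by (cases "k = j") simp_all
  then show ?thesis using assms(1) by simp
qed

text \<open>
  The recursion in the definition is compatible with differentiation since second derivatives
  commute.
\<close>

lemma tay_derivative:
  assumes W: "rel_open m n W" and x0: "x0 \<in> W" and kl: "k < m" "l < n"
  shows "smooth_coords m n W F \<Longrightarrow> ((\<lambda>s. tay m n x0 R F (put k l s x)) has_vector_derivative
    (case R of 0 \<Rightarrow> 0 | Suc R' \<Rightarrow> tay m n x0 R' (partial_der k l F) x)) (at (x k l))"
proof (induction R arbitrary: F)
  case (Suc R)
  define D where "D = (\<lambda>G. case R of 0 \<Rightarrow> 0 | Suc R' \<Rightarrow> tay m n x0 R' (partial_der k l G) x)"
  define e where "e = (\<lambda>j i. if k = j \<and> l = i then 1 else (0::complex))"
  have lin: "((\<lambda>s. complex_of_real ((put k l s x) j i - x0 j i)) has_vector_derivative e j i) (at (x k l))" for j i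
  proof (cases "k = j \<and> l = i")
    case True
    have "((\<lambda>s. s - x0 j i) has_real_derivative 1) (at (x k l))" by (auto intro!: derivative_eq_intros)
    from has_vector_derivative_of_real[OF this] True show ?thesis by (simp add: e_def)
  next
    case False
    then have "(\<lambda>s. complex_of_real ((put k l s x) j i - x0 j i)) = (\<lambda>s. complex_of_real (x j i - x0 j i))" by auto
    moreover have "e j i = 0" using False by (auto simp: e_def)
    ultimately show ?thesis by (simp only: has_vector_derivative_const)
  qed
  have prod: "((\<lambda>s. complex_of_real ((put k l s x) j i - x0 j i) * tay m n x0 R (partial_der j i F) (put k l s x))
      has_vector_derivative (complex_of_real (x j i - x0 j i) * D (partial_der j i F)
        + e j i * tay m n x0 R (partial_der j i F) x)) (at (x k l))" if ji: "j < m" "i < n" for j i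
    using has_vector_derivative_mult[OF lin[of j i] Suc.IH[OF smooth_partial[OF Suc.prems ji]]]
    by (simp only: fun_upd_triv D_def)
  have total: "((\<lambda>s. tay m n x0 (Suc R) F (put k l s x)) has_vector_derivative
      (1 / of_nat (Suc R)) * (\<Sum>j<m. \<Sum>i<n. complex_of_real (x j i - x0 j i) * D (partial_der j i F)
        + e j i * tay m n x0 R (partial_der j i F) x)) (at (x k l))"
    unfolding tay.simps
    by (intro has_vector_derivative_mult_right has_vector_derivative_sum prod) auto
  have eq: "(\<Sum>j<m. \<Sum>i<n. complex_of_real (x j i - x0 j i) * D (partial_der j i F)) = of_nat R * tay m n x0 R (partial_der k l F) x"
  proof (cases R)
    case (Suc R')
    have "D (partial_der j i F) = tay m n x0 R' (partial_der j i (partial_der k l F)) x" if ji: "j < m" "i < n" for j i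
      unfolding D_def Suc nat.case
      by (rule fun_cong[OF tay_cong[OF W x0]]) (rule partial_der_commute[OF W smooth_Ck[OF Suc.prems] _ kl ji])
    then have "(\<Sum>j<m. \<Sum>i<n. complex_of_real (x j i - x0 j i) * D (partial_der j i F))
        = (\<Sum>j<m. \<Sum>i<n. complex_of_real (x j i - x0 j i) * tay m n x0 R' (partial_der j i (partial_der k l F)) x)"
      by (auto intro!: sum.cong)
    also have "\<dots> = of_nat (Suc R') * tay m n x0 (Suc R') (partial_der k l F) x"
      by (simp del: of_nat_Suc)
    finally show ?thesis by (simp add: Suc)
  qed (simp add: D_def)
  have eq2: "(\<Sum>j<m. \<Sum>i<n. e j i * tay m n x0 R (partial_der j i F) x) = tay m n x0 R (partial_der k l F) x"
  proof -
    have "(\<Sum>j<m. \<Sum>i<n. e j i * tay m n x0 R (partial_der j i F) x)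
        = (\<Sum>j<m. \<Sum>i<n. if k = j \<and> l = i then tay m n x0 R (partial_der j i F) x else 0)"
      by (intro sum.cong refl) (simp add: e_def)
    then show ?thesis using sum_slot[OF kl] by simp
  qed
  have "(1 / of_nat (Suc R)) * (\<Sum>j<m. \<Sum>i<n. complex_of_real (x j i - x0 j i) * D (partial_der j i F)
        + e j i * tay m n x0 R (partial_der j i F) x) = tay m n x0 R (partial_der k l F) x"
  proof -
    have "of_nat (Suc R) \<noteq> (0::complex)" using of_nat_neq_0 by blast
    moreover have "(of_nat R * y + y :: complex) = of_nat (Suc R) * y" for y by (simp add: algebra_simps)
    ultimately show ?thesis unfolding sum.distrib eq eq2 by simp
  qed
  with total show ?case by (simp only: nat.case)
qed simp

lemma tay_at: "tay m n x0 R F x0 = (if R = 0 then F x0 else 0)"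
  by (cases R) simp_all

text \<open>
  Differentiating the Taylor polynomial of order \<open>r + 1\<close> gives the one of order \<open>r\<close> of the
  derivative, so induction on \<open>r\<close> applies.
\<close>

lemma van_taylor:
  assumes W: "rel_open m n W" and x0: "x0 \<in> W"
  shows "smooth_coords m n W F \<Longrightarrow> van m n r (\<lambda>x. F x - (\<Sum>R\<le>r. tay m n x0 R F x)) x0"
proof (induction r arbitrary: F)
  case 0
  then show ?case by simp
next
  case (Suc r)
  show ?case
  proof (rule van_step[OF W x0, where D="\<lambda>j i x. partial_der j i F x - (\<Sum>R\<le>r. tay m n x0 R (partial_der j i F) x)"])
    show "F x0 - (\<Sum>R\<le>Suc r. tay m n x0 R F x0) = 0"
      by (simp only: tay_at) (simp add: sum.delta)
    fix j i assume ji: "j < m" "i < n"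
    show "((\<lambda>s. F (put j i s y) - (\<Sum>R\<le>Suc r. tay m n x0 R F (put j i s y))) has_vector_derivative
       partial_der j i F y - (\<Sum>R\<le>r. tay m n x0 R (partial_der j i F) y)) (at (y j i))" if "y \<in> W" for y
    proof -
      have "((\<lambda>s. F (put j i s y) - (\<Sum>R\<le>Suc r. tay m n x0 R F (put j i s y))) has_vector_derivative
         partial_der j i F y - (\<Sum>R\<le>Suc r. case R of 0 \<Rightarrow> 0 | Suc R' \<Rightarrow> tay m n x0 R' (partial_der j i F) y)) (at (y j i))"
        by (intro has_vector_derivative_diff has_vector_derivative_sum tay_derivative[OF W x0 ji Suc.prems]
            smooth_derivative[OF Suc.prems ji that])
      then show ?thesis by (simp only: sum.atMost_Suc_shift) simp
    qed
    show "van m n r (\<lambda>x. partial_der j i F x - (\<Sum>R\<le>r. tay m n x0 R (partial_der j i F) x)) x0"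
      by (rule Suc.IH[OF smooth_partial[OF Suc.prems ji]])
  qed
qed

section \<open>A smooth cutoff on the line\<close>

text \<open>
  The functions \<open>p(1/s) exp(-1/s)\<close> are closed under differentiation, which proves smoothness at
  \<open>0\<close> for all of them together.
\<close>

definition flat :: "real poly \<Rightarrow> real \<Rightarrow> real" where
  "flat p s = (if s > 0 then poly p (1 / s) * exp (- (1 / s)) else 0)"

lemma poly_exp_tendsto_0: "((\<lambda>y. poly p y * exp (- y :: real)) \<longlongrightarrow> 0) at_top"
proof -
  have "((\<lambda>y. \<Sum>i\<le>degree p. coeff p i * (y ^ i / exp y)) \<longlongrightarrow> (\<Sum>i\<le>degree p. coeff p i * 0)) at_top"
    by (intro tendsto_sum tendsto_mult_left tendsto_power_div_exp_0)
  moreover have "(\<lambda>y. poly p y * exp (- y)) = (\<lambda>y. \<Sum>i\<le>degree p. coeff p i * (y ^ i / exp y))"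
    by (auto simp: poly_altdef sum_divide_distrib exp_minus divide_inverse sum_distrib_right mult.assoc)
  ultimately show ?thesis by simp
qed

lemma flat_derivative: "(flat p has_real_derivative flat (monom 1 2 * (p - pderiv p)) s) (at s)"
proof -
  consider "s > 0" | "s < 0" | "s = 0" by linarith
  then show ?thesis
  proof cases
    case 1
    have "((\<lambda>s. poly p (1 / s) * exp (- (1 / s))) has_real_derivative
        flat (monom 1 2 * (p - pderiv p)) s) (at s)"
      using 1 by (auto intro!: derivative_eq_intros simp: flat_def poly_monom power2_eq_square field_simps)
    then show ?thesis
      by (rule has_field_derivative_transform_within_open[of _ _ _ "{0<..}"]) (use 1 in \<open>auto simp: flat_def\<close>)
  next
    case 2
    have "((\<lambda>s. 0) has_real_derivative flat (monom 1 2 * (p - pderiv p)) s) (at s)"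
      using 2 by (simp add: flat_def)
    then show ?thesis
      by (rule has_field_derivative_transform_within_open[of _ _ _ "{..<0}"]) (use 2 in \<open>auto simp: flat_def\<close>)
  next
    case 3
    have "((\<lambda>s. flat p s / s) \<longlongrightarrow> 0) (at_left 0)"
      by (rule Lim_transform_eventually[OF tendsto_const[of 0]])
         (auto simp: flat_def eventually_at_filter)
    moreover have "((\<lambda>s. flat p s / s) \<longlongrightarrow> 0) (at_right 0)"
    proof -
      have "((\<lambda>y. flat p (inverse y) / inverse y) \<longlongrightarrow> 0) at_top"
      proof (rule Lim_transform_eventually[OF poly_exp_tendsto_0[of "pCons 0 p"]])
        show "\<forall>\<^sub>F y in at_top. poly (pCons 0 p) y * exp (- y) = flat p (inverse y) / inverse y"
          using eventually_gt_at_top[of 0] by eventually_elim (simp add: flat_def field_simps)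
      qed
      then show ?thesis by (simp add: filterlim_at_right_to_top)
    qed
    ultimately have "((\<lambda>s. flat p s / s) \<longlongrightarrow> 0) (at 0)"
      by (simp add: filterlim_at_split)
    then show ?thesis using 3 by (simp add: has_field_derivative_iff flat_def)
  qed
qed

text \<open>
  Successive derivatives of \<open>exp(-1/s)\<close>: the derivative of \<open>p(1/s) exp(-1/s)\<close> belongs to the
  polynomial \<open>X\<^sup>2 (p - p')\<close>.
\<close>

definition flats :: "nat \<Rightarrow> real \<Rightarrow> real" where
  "flats k = flat (((\<lambda>p. monom 1 2 * (p - pderiv p)) ^^ k) 1)"

lemma derivs_flats: "derivs flats"
  unfolding derivs_def flats_def using flat_derivative by simp

lemma flats_0: "flats 0 s = (if s > 0 then exp (- (1 / s)) else 0)"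
  by (simp add: flats_def flat_def)

text \<open>
  With \<open>g(s) = e exp(-1/s)\<close> for \<open>s > 0\<close> and \<open>g(s) = 0\<close> otherwise, \<open>g(1) = 1\<close>, so \<open>g(1 - g(s))\<close> is
  \<open>1\<close> for \<open>s \<le> 0\<close> and \<open>0\<close> for \<open>s \<ge> 1\<close>.
\<close>

definition cutoff :: "real \<Rightarrow> real" where
  "cutoff s = exp 1 * flats 0 (1 - exp 1 * flats 0 s)"

lemma cutoff_one: "s \<le> 0 \<Longrightarrow> cutoff s = 1"
  by (simp add: cutoff_def flats_0 exp_minus)

lemma cutoff_zero: "1 \<le> s \<Longrightarrow> cutoff s = 0"
proof -
  assume s: "1 \<le> s"
  then have "exp (- 1) \<le> exp (- (1 / s))" by simp
  then have "1 \<le> exp 1 * exp (- (1 / s))" by (simp add: exp_minus field_simps)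
  then show ?thesis using s by (simp add: cutoff_def flats_0)
qed

lemma smooth_cutoff:
  assumes W: "rel_open m n W" and F: "smooth_coords m n W F"
  shows "smooth_coords m n W (\<lambda>x. complex_of_real (cutoff (Re (F x))))"
proof -
  have "smooth_coords m n W (\<lambda>x. complex_of_real (flats 0 (Re (F x))))"
    by (rule smooth_compose[OF W derivs_flats F])
  then have "smooth_coords m n W (\<lambda>x. 1 + (- complex_of_real (exp 1)) * complex_of_real (flats 0 (Re (F x))))"
    by (intro smooth_add[OF W] smooth_mult[OF W] smooth_const[OF W])
  then have "smooth_coords m n W (\<lambda>x. complex_of_real (exp 1) *
      complex_of_real (flats 0 (Re (1 + (- complex_of_real (exp 1)) * complex_of_real (flats 0 (Re (F x)))))))"
    by (intro smooth_mult[OF W] smooth_const[OF W] smooth_compose[OF W derivs_flats])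
  moreover have "(\<lambda>x. complex_of_real (exp 1) *
      complex_of_real (flats 0 (Re (1 + (- complex_of_real (exp 1)) * complex_of_real (flats 0 (Re (F x)))))))
    = (\<lambda>x. complex_of_real (cutoff (Re (F x))))"
    by (simp add: cutoff_def)
  ultimately show ?thesis by simp
qed

section \<open>Charts\<close>

lemma open_entry_vimage: "open T \<Longrightarrow> open {x :: pt. x j \<in> T}"
proof -
  assume T: "open T"
  have "continuous_on UNIV (\<lambda>x::pt. x j)"
    using continuous_on_product_then_coordinatewise[OF continuous_on_id, of UNIV j] by simp
  then have "open ((\<lambda>x::pt. x j) -` T)" by (rule open_vimage[OF T])
  then show ?thesis by (simp add: vimage_def)
qed

lemma openin_Euclidean_space:
  "openin (Euclidean_space n) V \<longleftrightarrow> (\<exists>T. open T \<and> V = T \<inter> {v. \<forall>i\<ge>n. v i = 0})"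
  by (simp add: Euclidean_space_def openin_subtopology euclidean_product_topology open_openin[symmetric])

lemma rel_open_box:
  assumes "\<And>j. j < m \<Longrightarrow> openin (Euclidean_space n) (V j)"
  shows "rel_open m n (coord_box m V)"
proof -
  have "\<forall>j. \<exists>T. j < m \<longrightarrow> open T \<and> V j = T \<inter> {v. \<forall>i\<ge>n. v i = 0}"
    using assms by (auto simp: openin_Euclidean_space)
  then obtain T where T: "\<And>j. j < m \<Longrightarrow> open (T j)" "\<And>j. j < m \<Longrightarrow> V j = T j \<inter> {v. \<forall>i\<ge>n. v i = 0}"
    by metis
  have "open (\<Inter>j<m. {x :: pt. x j \<in> T j})" using T(1) by (intro open_INT ballI open_entry_vimage) auto
  moreover have "coord_box m V = (\<Inter>j<m. {x. x j \<in> T j}) \<inter> coords m n"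
  proof (intro set_eqI iffI)
    fix x assume x: "x \<in> coord_box m V"
    have T': "x j \<in> T j" "\<forall>i\<ge>n. x j i = 0" if "j < m" for j
      using x that T(2)[OF that] by (auto simp: coord_box_def)
    have "x j i = 0" if "\<not> (j < m \<and> i < n)" for j i
      using x T'(2)[of j] that by (cases "j < m") (auto simp: coord_box_def not_less)
    with T'(1) show "x \<in> (\<Inter>j<m. {x. x j \<in> T j}) \<inter> coords m n" by (auto simp: coords_def)
  next
    fix x assume x: "x \<in> (\<Inter>j<m. {x. x j \<in> T j}) \<inter> coords m n"
    have "x j \<in> V j" if "j < m" for j using x T(2)[OF that] that by (auto simp: coords_def)
    then show "x \<in> coord_box m V" using x by (auto simp: coord_box_def coords_def fun_eq_iff)
  qed
  ultimately show ?thesis unfolding rel_open_def by blast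
qed

abbreviation cbox_of :: "nat \<Rightarrow> (nat \<Rightarrow> 'p chart) \<Rightarrow> pt set" where
  "cbox_of m ch \<equiv> coord_box m (\<lambda>j. snd (ch j) ` fst (ch j))"

abbreviation unch :: "'p chart \<Rightarrow> (nat \<Rightarrow> real) \<Rightarrow> 'p" where
  "unch ch \<equiv> inv_into (fst ch) (snd ch)"

locale smooth_mfd =
  fixes M :: "'p mfd"
  assumes mfd: "smooth_manifold M"
begin

abbreviation dm :: nat where "dm \<equiv> mdim M"

lemma chart:
  assumes "ch \<in> atlas M"
  shows chart_open: "openin (mtop M) (fst ch)" and chart_sub: "fst ch \<subseteq> pts M"
    and chart_img: "openin (Euclidean_space dm) (snd ch ` fst ch)"
    and chart_homeo: "homeomorphic_map (subtopology (mtop M) (fst ch))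
      (subtopology (Euclidean_space dm) (snd ch ` fst ch)) (snd ch)"
    and chart_inj: "inj_on (snd ch) (fst ch)"
proof -
  obtain U \<phi> where ch: "ch = (U, \<phi>)" by (cases ch)
  have *: "openin (mtop M) U" "openin (Euclidean_space dm) (\<phi> ` U)"
    "homeomorphic_map (subtopology (mtop M) U) (subtopology (Euclidean_space dm) (\<phi> ` U)) \<phi>"
    using mfd assms unfolding smooth_manifold_def ch by auto
  then show "openin (mtop M) (fst ch)" "openin (Euclidean_space dm) (snd ch ` fst ch)"
    "homeomorphic_map (subtopology (mtop M) (fst ch)) (subtopology (Euclidean_space dm) (snd ch ` fst ch)) (snd ch)"
    by (simp_all add: ch)
  show sub: "fst ch \<subseteq> pts M" using openin_subset[OF *(1)] by (simp add: ch)
  have "inj_on \<phi> (topspace (subtopology (mtop M) U))"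
    using homeomorphic_imp_injective_map[OF *(3)] .
  moreover have "topspace (subtopology (mtop M) U) = U" using sub by (auto simp: ch)
  ultimately show "inj_on (snd ch) (fst ch)" by (simp add: ch)
qed

lemma chart_open_img:
  assumes ch: "ch \<in> atlas M" and A: "openin (mtop M) A" "A \<subseteq> fst ch"
  shows "openin (Euclidean_space dm) (snd ch ` A)"
proof -
  have "openin (subtopology (mtop M) (fst ch)) A"
    using A by (simp add: openin_open_subtopology[OF chart_open[OF ch]])
  then have "openin (subtopology (Euclidean_space dm) (snd ch ` fst ch)) (snd ch ` A)"
    using homeomorphic_imp_open_map[OF chart_homeo[OF ch]] by (auto simp: open_map_def)
  then show ?thesis by (simp add: openin_open_subtopology[OF chart_img[OF ch]])
qed

lemma unch_mem: "ch \<in> atlas M \<Longrightarrow> v \<in> snd ch ` fst ch \<Longrightarrow> unch ch v \<in> fst ch \<and> unch ch v \<in> pts M \<and> snd ch (unch ch v) = v"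
  using chart_sub[of ch] by (auto simp: inv_into_into f_inv_into_f)

lemma unch_chart: "ch \<in> atlas M \<Longrightarrow> p \<in> fst ch \<Longrightarrow> unch ch (snd ch p) = p"
  using chart_inj by (simp add: inv_into_f_f)

definition chart_at :: "'p \<Rightarrow> 'p chart" where
  "chart_at p = (SOME ch. ch \<in> atlas M \<and> p \<in> fst ch)"

lemma chart_at: "p \<in> pts M \<Longrightarrow> chart_at p \<in> atlas M" "p \<in> pts M \<Longrightarrow> p \<in> fst (chart_at p)"
proof -
  assume p: "p \<in> pts M"
  have "(\<Union>(U, \<phi>)\<in>atlas M. U) = pts M" using mfd by (simp add: smooth_manifold_def)
  then have "\<exists>ch. ch \<in> atlas M \<and> p \<in> fst ch" using p by fastforce
  then have "chart_at p \<in> atlas M \<and> p \<in> fst (chart_at p)" unfolding chart_at_def by (rule someI_ex)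
  then show "chart_at p \<in> atlas M" "p \<in> fst (chart_at p)" by auto
qed

lemma rel_open_cbox: "(\<And>j. j < m \<Longrightarrow> ch j \<in> atlas M) \<Longrightarrow> rel_open m dm (cbox_of m ch)"
  by (intro rel_open_box chart_img)

section \<open>Smooth functions on powers of the manifold\<close>

definition tuples :: "nat \<Rightarrow> 'p list set" where
  "tuples m = {ps. length ps = m \<and> set ps \<subseteq> pts M}"

lemma CinfD: "c \<in> Cinf M m \<Longrightarrow> ps \<notin> tuples m \<Longrightarrow> c ps = 0"
  by (auto simp: Cinf_def tuples_def)

lemma Cinf_smooth: "c \<in> Cinf M m \<Longrightarrow> (\<And>j. j < m \<Longrightarrow> ch j \<in> atlas M) \<Longrightarrow>
    smooth_coords m dm (cbox_of m ch) (in_charts m ch c)"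
  by (auto simp: Cinf_def)

lemma CinfI: "(\<And>ps. ps \<notin> tuples m \<Longrightarrow> c ps = 0) \<Longrightarrow>
   (\<And>ch. (\<And>j. j < m \<Longrightarrow> ch j \<in> atlas M) \<Longrightarrow> smooth_coords m dm (cbox_of m ch) (in_charts m ch c)) \<Longrightarrow> c \<in> Cinf M m"
  by (auto simp: Cinf_def tuples_def)

lemma Cinf_subspace: "csubspace (Cinf M m)"
  unfolding csubspace_def
proof (intro conjI ballI allI)
  show "0 \<in> Cinf M m"
  proof (rule CinfI)
    fix ch :: "nat \<Rightarrow> 'p chart" assume ch: "\<And>j. j < m \<Longrightarrow> ch j \<in> atlas M"
    have "rel_open m dm (cbox_of m ch)" by (rule rel_open_cbox[OF ch])
    from smooth_const[OF this, of 0]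
    show "smooth_coords m dm (cbox_of m ch) (in_charts m ch 0)" by (simp add: in_charts_def[abs_def])
  qed simp
next
  fix c c' assume c: "c \<in> Cinf M m" "c' \<in> Cinf M m"
  show "c + c' \<in> Cinf M m"
  proof (rule CinfI)
    fix ch :: "nat \<Rightarrow> 'p chart" assume ch: "\<And>j. j < m \<Longrightarrow> ch j \<in> atlas M"
    have W: "rel_open m dm (cbox_of m ch)" by (rule rel_open_cbox[OF ch])
    have 1: "smooth_coords m dm (cbox_of m ch) (in_charts m ch c)" by (rule Cinf_smooth[OF c(1) ch])
    have 2: "smooth_coords m dm (cbox_of m ch) (in_charts m ch c')" by (rule Cinf_smooth[OF c(2) ch])
    from smooth_add[OF W 1 2]
    show "smooth_coords m dm (cbox_of m ch) (in_charts m ch (c + c'))" by (simp add: in_charts_def[abs_def])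
  qed (simp add: CinfD[OF c(1)] CinfD[OF c(2)])
next
  fix a c assume c: "c \<in> Cinf M m"
  show "a \<bullet>\<^sub>C c \<in> Cinf M m"
  proof (rule CinfI)
    fix ch :: "nat \<Rightarrow> 'p chart" assume ch: "\<And>j. j < m \<Longrightarrow> ch j \<in> atlas M"
    have W: "rel_open m dm (cbox_of m ch)" by (rule rel_open_cbox[OF ch])
    have "smooth_coords m dm (cbox_of m ch) (in_charts m ch c)" by (rule Cinf_smooth[OF c ch])
    from smooth_mult[OF W smooth_const[OF W, where c=a] this]
    show "smooth_coords m dm (cbox_of m ch) (in_charts m ch (a \<bullet>\<^sub>C c))" by (simp add: in_charts_def[abs_def])
  qed (simp add: CinfD[OF c])
qed

lemmas Cinf_closed = csub_zero[OF Cinf_subspace] csub_add[OF Cinf_subspace] csub_diff[OF Cinf_subspace]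
  csub_scale[OF Cinf_subspace] csub_minus[OF Cinf_subspace] csub_sum[OF Cinf_subspace]

lemma in_charts_points:
  assumes ch: "\<And>j. j < m \<Longrightarrow> ch j \<in> atlas M" and x: "x \<in> cbox_of m ch"
  shows "map (\<lambda>j. unch (ch j) (x j)) [0..<m] \<in> tuples m"
proof -
  have "unch (ch j) (x j) \<in> pts M" if "j < m" for j
    using unch_mem[OF ch[OF that], of "x j"] x that unfolding coord_box_def by blast
  then show ?thesis by (auto simp: tuples_def)
qed

text \<open>
  Restrictions to diagonals, permutations of the variables and evaluation of some variables at fixed
  points all have this form.
\<close>

lemma Cinf_subst:
  assumes c: "c \<in> Cinf M L" and \<sigma>: "\<And>k. k < L \<Longrightarrow> k \<in> S \<Longrightarrow> \<sigma> k < m"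
    and qs: "\<And>k. k < L \<Longrightarrow> k \<notin> S \<Longrightarrow> qs k \<in> pts M"
  shows "(\<lambda>ps. if ps \<in> tuples m then c (map (\<lambda>k. if k \<in> S then ps ! \<sigma> k else qs k) [0..<L]) else 0) \<in> Cinf M m"
    (is "?c \<in> _")
proof (rule CinfI)
  fix ch :: "nat \<Rightarrow> 'p chart" assume ch: "\<And>j. j < m \<Longrightarrow> ch j \<in> atlas M"
  define ch' where "ch' = (\<lambda>k. if k \<in> S then ch (\<sigma> k) else chart_at (qs k))"
  define z where "z = (\<lambda>k. snd (chart_at (qs k)) (qs k))"
  have ch': "ch' k \<in> atlas M" if "k < L" for k
    using that ch \<sigma> chart_at(1)[OF qs] by (simp add: ch'_def)
  have sub: "subst_vars L S \<sigma> z x \<in> cbox_of L ch'" if "x \<in> cbox_of m ch" for x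
    using that \<sigma> chart_at(2)[OF qs] by (auto simp: coord_box_def subst_vars_def ch'_def z_def)
  have eqx: "in_charts m ch ?c x = in_charts L ch' c (subst_vars L S \<sigma> z x)" if x: "x \<in> cbox_of m ch" for x
  proof -
    let ?ps = "map (\<lambda>j. unch (ch j) (x j)) [0..<m]"
    have eq: "map (\<lambda>k. if k \<in> S then ?ps ! \<sigma> k else qs k) [0..<L] = map (\<lambda>k. unch (ch' k) (subst_vars L S \<sigma> z x k)) [0..<L]"
      using \<sigma> unch_chart[OF chart_at(1)[OF qs] chart_at(2)[OF qs]]
      by (auto simp: ch'_def subst_vars_def z_def)
    have "in_charts m ch ?c x = c (map (\<lambda>k. if k \<in> S then ?ps ! \<sigma> k else qs k) [0..<L])"
      using in_charts_points[OF ch x] by (simp add: in_charts_def)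
    then show ?thesis unfolding eq by (simp add: in_charts_def)
  qed
  have W: "rel_open m dm (cbox_of m ch)" by (rule rel_open_cbox[OF ch])
  have W': "rel_open L dm (cbox_of L ch')" by (rule rel_open_cbox[OF ch'])
  have "smooth_coords L dm (cbox_of L ch') (in_charts L ch' c)" by (rule Cinf_smooth[OF c ch'])
  then have "smooth_coords m dm (cbox_of m ch) (\<lambda>x. in_charts L ch' c (subst_vars L S \<sigma> z x))"
    by (rule smooth_subst_vars[OF W' W, rotated]) (rule sub)
  then show "smooth_coords m dm (cbox_of m ch) (in_charts m ch ?c)"
    by (rule smooth_cong[OF W, rotated]) (rule eqx)
qed simp

lemma smooth_funs_zero: "a \<in> smooth_funs M \<Longrightarrow> p \<notin> pts M \<Longrightarrow> a p = 0"
  using CinfD[of "tensor [a]" 1 "[p]"] by (auto simp: smooth_funs_def tuples_def tensor_def)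

section \<open>Differential operators in one slot\<close>

text \<open>
  Applies \<open>D\<close> to the arguments \<open>i, \<dots>, i + d - 1\<close> of \<open>c\<close> and evaluates at the \<open>i\<close>-th point. The
  faces of the Hochschild differential and the factors of a tensor power of an operator have this
  form.
\<close>

definition ins :: "'p cochain \<Rightarrow> nat \<Rightarrow> ('p list \<Rightarrow> complex) \<Rightarrow> 'p list \<Rightarrow> complex" where
  "ins D i c = (\<lambda>ps. if i < length ps then D (\<lambda>ys. c (take i ps @ ys @ drop (i + 1) ps)) (ps ! i) else 0)"

text \<open>
  The arguments of \<open>c\<close> that are evaluated at point \<open>i\<close> of the result are \<open>i, \<dots>, i + d - 1\<close>;
  the others are shifted.
\<close>

definition spread :: "nat \<Rightarrow> nat \<Rightarrow> nat \<Rightarrow> nat" where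
  "spread i d k = (if k < i then k else if k < i + d then i else k + 1 - d)"

lemma spread_less: "k < N + d - 1 \<Longrightarrow> i < N \<Longrightarrow> spread i d k < N"
  by (auto simp: spread_def)

lemma take_drop_nth:
  assumes "length ps = N" "i < N" "length ys = d" "k < N + d - 1"
  shows "(take i ps @ ys @ drop (i + 1) ps) ! k = (if i \<le> k \<and> k < i + d then ys ! (k - i) else ps ! spread i d k)"
  using assms by (auto simp: nth_append spread_def min_def not_less Suc_diff_le)

lemma ins_inner:
  assumes c: "c \<in> Cinf M (N + d - 1)" and ps: "ps \<in> tuples N" and i: "i < N"
  shows "(\<lambda>ys. c (take i ps @ ys @ drop (i + 1) ps)) \<in> Cinf M d"
proof -
  let ?L = "N + d - 1" and ?S = "{k. i \<le> k \<and> k < i + d}"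
  let ?c = "(\<lambda>ys. if ys \<in> tuples d then c (map (\<lambda>k. if k \<in> ?S then ys ! (k - i) else ps ! spread i d k) [0..<?L]) else 0)"
  have "?c \<in> Cinf M d"
  proof (rule Cinf_subst[OF c])
    fix k assume k: "k < ?L" "k \<notin> ?S"
    have "spread i d k < length ps" using spread_less[OF k(1) i] ps by (simp add: tuples_def)
    then show "ps ! spread i d k \<in> pts M" using ps nth_mem by (auto simp: tuples_def)
  qed auto
  moreover have "(\<lambda>ys. c (take i ps @ ys @ drop (i + 1) ps)) = ?c"
  proof
    fix ys
    show "c (take i ps @ ys @ drop (i + 1) ps) = ?c ys"
    proof (cases "ys \<in> tuples d")
      case True
      have "take i ps @ ys @ drop (i + 1) ps = map (\<lambda>k. if k \<in> ?S then ys ! (k - i) else ps ! spread i d k) [0..<?L]"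
      proof (rule nth_equalityI)
        show "length (take i ps @ ys @ drop (i + 1) ps) = length (map (\<lambda>k. if k \<in> ?S then ys ! (k - i) else ps ! spread i d k) [0..<?L])"
          using True ps i by (simp add: tuples_def)
        fix k assume "k < length (take i ps @ ys @ drop (i + 1) ps)"
        then have k: "k < ?L" using True ps i by (simp add: tuples_def)
        show "(take i ps @ ys @ drop (i + 1) ps) ! k = map (\<lambda>k. if k \<in> ?S then ys ! (k - i) else ps ! spread i d k) [0..<?L] ! k"
          using True ps i k take_drop_nth[of ps N i ys d k] by (simp add: tuples_def)
      qed
      then show ?thesis using True by simp
    next
      case False
      then have "take i ps @ ys @ drop (i + 1) ps \<notin> tuples ?L"
        using ps i by (auto simp: tuples_def)
      then show ?thesis using CinfD[OF c] False by simp
    qed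
  qed
  ultimately show ?thesis by simp
qed

definition shift :: "nat \<Rightarrow> (nat \<times> nat) list \<Rightarrow> (nat \<times> nat) list" where
  "shift i \<alpha> = map (\<lambda>(j, l). (i + j, l)) \<alpha>"

lemma length_shift [simp]: "length (shift i \<alpha>) = length \<alpha>"
  by (simp add: shift_def)

lemma shift_midx: "\<alpha> \<in> midx d dm k \<Longrightarrow> i < N \<Longrightarrow> set (shift i \<alpha>) \<subseteq> {..<N + d - 1} \<times> {..<dm}"
  by (auto simp: midx_def shift_def)

lemma finite_midx: "finite (midx d n k)"
proof -
  have "midx d n k \<subseteq> {\<alpha>. set \<alpha> \<subseteq> {..<d} \<times> {..<n} \<and> length \<alpha> \<le> k}" by (auto simp: midx_def)
  then show ?thesis by (rule finite_subset) (intro finite_lists_length_le, simp)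
qed

text \<open>
  In charts, a multidifferential operator in one slot is a combination of partial derivatives
  evaluated on a partial diagonal.
\<close>

lemma ins_local:
  assumes D: "multidiff M d D" and i: "i < N"
  shows "\<exists>k. \<forall>ch. (\<forall>j<N. ch j \<in> atlas M) \<longrightarrow>
    (\<exists>h. (\<forall>\<alpha>\<in>midx d dm k. smooth_coords 1 dm (cbox_of 1 (\<lambda>_. ch i)) (h \<alpha>)) \<and>
      (\<forall>c\<in>Cinf M (N + d - 1). \<forall>x\<in>cbox_of N ch. in_charts N ch (ins D i c) x =
        (\<Sum>\<alpha>\<in>midx d dm k. h \<alpha> (subst_vars 1 UNIV (\<lambda>_. i) 0 x) *
          partials (shift i \<alpha>) (in_charts (N + d - 1) (\<lambda>k. ch (spread i d k)) c)
            (subst_vars (N + d - 1) UNIV (spread i d) 0 x))))"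
proof -
  let ?L = "N + d - 1"
  obtain k where k: "\<forall>(U, \<phi>)\<in>atlas M. \<exists>h.
        (\<forall>\<alpha>\<in>midx d dm k. smooth_coords 1 dm (coord_box 1 (\<lambda>_. \<phi> ` U)) (h \<alpha>)) \<and>
        (\<forall>c\<in>Cinf M d. \<forall>p\<in>U. D c p = (\<Sum>\<alpha>\<in>midx d dm k.
              h \<alpha> (repeat_vec 1 (\<phi> p)) * partials \<alpha> (in_charts d (\<lambda>_. (U, \<phi>)) c) (repeat_vec d (\<phi> p))))"
    using D unfolding multidiff_def by blast
  show ?thesis
  proof (rule exI[of _ k], intro allI impI)
    fix ch :: "nat \<Rightarrow> 'p chart" assume "\<forall>j<N. ch j \<in> atlas M"
    then have ch: "ch j \<in> atlas M" if "j < N" for j using that by blast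
    obtain h where h: "\<forall>\<alpha>\<in>midx d dm k. smooth_coords 1 dm (cbox_of 1 (\<lambda>_. ch i)) (h \<alpha>)"
      and hD: "\<And>c p. c \<in> Cinf M d \<Longrightarrow> p \<in> fst (ch i) \<Longrightarrow> D c p = (\<Sum>\<alpha>\<in>midx d dm k.
        h \<alpha> (repeat_vec 1 (snd (ch i) p)) * partials \<alpha> (in_charts d (\<lambda>_. ch i) c) (repeat_vec d (snd (ch i) p)))"
      using bspec[OF k ch[OF i]] by (auto simp: split_beta)
    have "in_charts N ch (ins D i c) x = (\<Sum>\<alpha>\<in>midx d dm k. h \<alpha> (subst_vars 1 UNIV (\<lambda>_. i) 0 x) *
          partials (shift i \<alpha>) (in_charts ?L (\<lambda>k. ch (spread i d k)) c) (subst_vars ?L UNIV (spread i d) 0 x))"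
      if c: "c \<in> Cinf M ?L" and x: "x \<in> cbox_of N ch" for c x
    proof -
      define ps where "ps = map (\<lambda>j. unch (ch j) (x j)) [0..<N]"
      have ps: "ps \<in> tuples N" unfolding ps_def by (rule in_charts_points[OF ch x])
      have xi: "x i \<in> snd (ch i) ` fst (ch i)" using x i by (auto simp: coord_box_def)
      have psi: "ps ! i = unch (ch i) (x i)" using i by (simp add: ps_def)
      have p: "ps ! i \<in> fst (ch i)" "snd (ch i) (ps ! i) = x i"
        using unch_mem[OF ch[OF i] xi] by (auto simp: psi)
      define inner where "inner = (\<lambda>ys. c (take i ps @ ys @ drop (i + 1) ps))"
      have inner: "inner \<in> Cinf M d" unfolding inner_def by (rule ins_inner[OF c ps i])
      define C where "C = in_charts ?L (\<lambda>k. ch (spread i d k)) c"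
      define glue where "glue = (\<lambda>y :: pt. \<lambda>k. if i \<le> k \<and> k < i + d then y (k - i) else if k < ?L then x (spread i d k) else (\<lambda>_. 0))"
      have in_glue: "in_charts d (\<lambda>_. ch i) inner = (\<lambda>y. C (glue y))"
      proof
        fix y
        let ?ys = "map (\<lambda>j. unch (ch i) (y j)) [0..<d]"
        have "take i ps @ ?ys @ drop (i + 1) ps = map (\<lambda>k. unch (ch (spread i d k)) (glue y k)) [0..<?L]"
        proof (rule nth_equalityI)
          show "length (take i ps @ ?ys @ drop (i + 1) ps) = length (map (\<lambda>k. unch (ch (spread i d k)) (glue y k)) [0..<?L])"
            using ps i by (simp add: tuples_def)
          fix l assume "l < length (take i ps @ ?ys @ drop (i + 1) ps)"
          then have l: "l < ?L" using ps i by (simp add: tuples_def)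
          have "ps ! spread i d l = unch (ch (spread i d l)) (x (spread i d l))"
            using spread_less[OF l i] by (simp add: ps_def)
          moreover have "spread i d l = i" if "i \<le> l" "l < i + d" using that by (simp add: spread_def)
          ultimately show "(take i ps @ ?ys @ drop (i + 1) ps) ! l = map (\<lambda>k. unch (ch (spread i d k)) (glue y k)) [0..<?L] ! l"
            using l i ps take_drop_nth[of ps N i ?ys d l] by (auto simp: tuples_def glue_def)
        qed
        then show "in_charts d (\<lambda>_. ch i) inner y = C (glue y)"
          by (simp add: in_charts_def inner_def C_def)
      qed
      have pd: "partial_der j l (\<lambda>y. G (glue y)) y = partial_der (i + j) l G (glue y)" if "j < d" for j l G y
      proof -
        have "glue (put j l s y) = put (i + j) l s (glue y)" for s
          using that by (auto simp: glue_def fun_eq_iff)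
        moreover have "glue y (i + j) l = y j l" using that by (simp add: glue_def)
        ultimately show ?thesis by (simp add: partial_der_def)
      qed
      have pds: "partials \<alpha> (\<lambda>y. C (glue y)) = (\<lambda>y. partials (shift i \<alpha>) C (glue y))" if "set \<alpha> \<subseteq> {..<d} \<times> {..<dm}" for \<alpha>
        using that
      proof (induction \<alpha>)
        case (Cons jl \<alpha>)
        obtain j l where jl: "jl = (j, l)" by (cases jl)
        have "partials (jl # \<alpha>) (\<lambda>y. C (glue y)) = partial_der j l (\<lambda>y. partials (shift i \<alpha>) C (glue y))"
          using Cons by (simp add: partials_def jl)
        also have "\<dots> = (\<lambda>y. partials (shift i (jl # \<alpha>)) C (glue y))"
          using pd[of j l "partials (shift i \<alpha>) C"] Cons.prems by (auto simp: partials_def jl shift_def)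
        finally show ?case .
      qed (simp add: partials_def shift_def)
      have g: "glue (repeat_vec d (x i)) = subst_vars ?L UNIV (spread i d) 0 x"
        using i by (auto simp: glue_def repeat_vec_def subst_vars_def spread_def fun_eq_iff)
      have r1: "repeat_vec 1 (x i) = subst_vars 1 UNIV (\<lambda>_. i) 0 x"
        by (auto simp: repeat_vec_def subst_vars_def fun_eq_iff)
      have "in_charts N ch (ins D i c) x = D inner (ps ! i)"
        using i by (simp add: in_charts_def ins_def ps_def[symmetric] inner_def) (simp add: ps_def)
      also have "\<dots> = (\<Sum>\<alpha>\<in>midx d dm k. h \<alpha> (repeat_vec 1 (x i)) * partials \<alpha> (in_charts d (\<lambda>_. ch i) inner) (repeat_vec d (x i)))"
        using hD[OF inner p(1)] by (simp add: p(2))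
      also have "\<dots> = (\<Sum>\<alpha>\<in>midx d dm k. h \<alpha> (subst_vars 1 UNIV (\<lambda>_. i) 0 x) * partials (shift i \<alpha>) C (subst_vars ?L UNIV (spread i d) 0 x))"
        by (intro sum.cong refl) (simp add: in_glue pds midx_def g r1 del: One_nat_def)
      finally show ?thesis by (simp add: C_def)
    qed
    with h show "\<exists>h. (\<forall>\<alpha>\<in>midx d dm k. smooth_coords 1 dm (cbox_of 1 (\<lambda>_. ch i)) (h \<alpha>)) \<and>
      (\<forall>c\<in>Cinf M ?L. \<forall>x\<in>cbox_of N ch. in_charts N ch (ins D i c) x =
        (\<Sum>\<alpha>\<in>midx d dm k. h \<alpha> (subst_vars 1 UNIV (\<lambda>_. i) 0 x) *
          partials (shift i \<alpha>) (in_charts ?L (\<lambda>k. ch (spread i d k)) c)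
            (subst_vars ?L UNIV (spread i d) 0 x)))"
      by blast
  qed
qed

section \<open>Operators that are continuous for the topology of jets\<close>

definition crd :: "'p list \<Rightarrow> pt" where
  "crd zs = (\<lambda>j. if j < length zs then snd (chart_at (zs ! j)) (zs ! j) else (\<lambda>_. 0))"

text \<open>
  The jet is taken in one chosen chart at each point; it is only used to compare functions at the same
  points.
\<close>

definition jet0 :: "nat \<Rightarrow> ('p list \<Rightarrow> complex) \<Rightarrow> 'p list \<Rightarrow> bool" where
  "jet0 r c zs \<longleftrightarrow> van (length zs) dm r (in_charts (length zs) (\<lambda>j. chart_at (zs ! j)) c) (crd zs)"

text \<open>
  Linear operators that are continuous for the topology of jets at finite sets of points. Only this
  weak form of locality is stable under composition, under reindexing of points and under inserting
  differential operators, and it determines an operator by its values on a dense subspace.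
\<close>

definition jetop :: "nat \<Rightarrow> nat \<Rightarrow> (('p list \<Rightarrow> complex) \<Rightarrow> 'p list \<Rightarrow> complex) \<Rightarrow> bool" where
  "jetop N K A \<longleftrightarrow> (\<forall>c\<in>Cinf M N. A c \<in> Cinf M K) \<and>
    (\<forall>c\<in>Cinf M N. \<forall>c'\<in>Cinf M N. A (c + c') = A c + A c') \<and>
    (\<forall>a. \<forall>c\<in>Cinf M N. A (a \<bullet>\<^sub>C c) = a \<bullet>\<^sub>C A c) \<and>
    (\<forall>zs\<in>tuples K. \<forall>r. \<exists>Z k. finite Z \<and> Z \<subseteq> tuples N \<and>
       (\<forall>c\<in>Cinf M N. (\<forall>w\<in>Z. jet0 k c w) \<longrightarrow> jet0 r (A c) zs))"

lemma tuples_nth: "zs \<in> tuples N \<Longrightarrow> j < N \<Longrightarrow> zs ! j \<in> pts M"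
  using nth_mem by (auto simp: tuples_def)

lemma tuples_length: "zs \<in> tuples N \<Longrightarrow> length zs = N"
  by (simp add: tuples_def)

lemma crd_mem: "zs \<in> tuples N \<Longrightarrow> crd zs \<in> cbox_of N (\<lambda>j. chart_at (zs ! j))"
proof -
  assume zs: "zs \<in> tuples N"
  have "zs ! j \<in> fst (chart_at (zs ! j))" if "j < N" for j
    by (rule chart_at(2)[OF tuples_nth[OF zs that]])
  then show ?thesis by (auto simp: coord_box_def crd_def tuples_length[OF zs])
qed

lemma chart_at_atlas: "zs \<in> tuples N \<Longrightarrow> j < N \<Longrightarrow> chart_at (zs ! j) \<in> atlas M"
  by (rule chart_at(1)[OF tuples_nth])

lemma in_charts_crd:
  assumes zs: "zs \<in> tuples N"
  shows "in_charts N (\<lambda>j. chart_at (zs ! j)) c (crd zs) = c zs"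
proof -
  have "unch (chart_at (zs ! j)) (crd zs j) = zs ! j" if "j < N" for j
    using unch_chart[OF chart_at(1)[OF tuples_nth[OF zs that]] chart_at(2)[OF tuples_nth[OF zs that]]] that
    by (simp add: crd_def tuples_length[OF zs])
  then have "map (\<lambda>j. unch (chart_at (zs ! j)) (crd zs j)) [0..<N] = zs"
    by (intro nth_equalityI) (auto simp: tuples_length[OF zs])
  then show ?thesis by (simp add: in_charts_def)
qed

lemma jet0_value:
  assumes zs: "zs \<in> tuples N" and j: "jet0 r c zs"
  shows "c zs = 0"
proof -
  have "van N dm r (in_charts N (\<lambda>j. chart_at (zs ! j)) c) (crd zs)"
    using j by (simp only: jet0_def tuples_length[OF zs])
  from van_value[OF this] show ?thesis by (simp only: in_charts_crd[OF zs])
qed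

lemma jet0_mono: "jet0 r c zs \<Longrightarrow> r' \<le> r \<Longrightarrow> jet0 r' c zs"
  using van_mono by (simp add: jet0_def)

lemma jetopD:
  assumes "jetop N K A"
  shows "c \<in> Cinf M N \<Longrightarrow> A c \<in> Cinf M K"
    "c \<in> Cinf M N \<Longrightarrow> c' \<in> Cinf M N \<Longrightarrow> A (c + c') = A c + A c'"
    "c \<in> Cinf M N \<Longrightarrow> A (a \<bullet>\<^sub>C c) = a \<bullet>\<^sub>C A c"
  using assms by (auto simp: jetop_def)

lemma jetop_jets:
  "jetop N K A \<Longrightarrow> zs \<in> tuples K \<Longrightarrow> \<exists>Z k. finite Z \<and> Z \<subseteq> tuples N \<and>
     (\<forall>c\<in>Cinf M N. (\<forall>w\<in>Z. jet0 k c w) \<longrightarrow> jet0 r (A c) zs)"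
  unfolding jetop_def by blast

lemma jetop_zero_value: "jetop N K A \<Longrightarrow> A 0 = 0"
proof -
  assume A: "jetop N K A"
  have "A (0 \<bullet>\<^sub>C 0) = 0 \<bullet>\<^sub>C A 0" by (rule jetopD(3)[OF A Cinf_closed(1)])
  then show ?thesis by simp
qed

lemma jetop_diff_value: "jetop N K A \<Longrightarrow> c \<in> Cinf M N \<Longrightarrow> c' \<in> Cinf M N \<Longrightarrow> A (c - c') = A c - A c'"
proof -
  assume A: "jetop N K A" and c: "c \<in> Cinf M N" "c' \<in> Cinf M N"
  have "A (c - c' + c') = A (c - c') + A c'" using c by (intro jetopD(2)[OF A] Cinf_closed(3))
  then show ?thesis by simp
qed

lemma jetop_sum_value: "jetop N K A \<Longrightarrow> (\<And>a. a \<in> T \<Longrightarrow> f a \<in> Cinf M N) \<Longrightarrow> A (sum f T) = (\<Sum>a\<in>T. A (f a))"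
  by (induction T rule: infinite_finite_induct)
     (auto simp: jetop_zero_value jetopD(2) Cinf_closed(6))

lemma jetop_compose:
  assumes A: "jetop N K A" and B: "jetop K L B"
  shows "jetop N L (\<lambda>c. B (A c))"
  unfolding jetop_def
proof (intro conjI ballI allI)
  fix zs r assume zs: "zs \<in> tuples L"
  obtain Z k where Z0: "finite Z" "Z \<subseteq> tuples K"
    "\<forall>c\<in>Cinf M K. (\<forall>w\<in>Z. jet0 k c w) \<longrightarrow> jet0 r (B c) zs"
    using jetop_jets[OF B zs, of r] by blast
  then have Z: "finite Z" "Z \<subseteq> tuples K"
    "\<And>c. c \<in> Cinf M K \<Longrightarrow> (\<And>w. w \<in> Z \<Longrightarrow> jet0 k c w) \<Longrightarrow> jet0 r (B c) zs" by blast+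
  have "\<forall>w\<in>Z. \<exists>Y l. finite Y \<and> Y \<subseteq> tuples N \<and> (\<forall>c\<in>Cinf M N. (\<forall>y\<in>Y. jet0 l c y) \<longrightarrow> jet0 k (A c) w)"
    using jetop_jets[OF A subsetD[OF Z(2)]] by simp
  then obtain Y l where Yl: "\<forall>w\<in>Z. finite (Y w) \<and> Y w \<subseteq> tuples N \<and>
      (\<forall>c\<in>Cinf M N. (\<forall>y\<in>Y w. jet0 (l w) c y) \<longrightarrow> jet0 k (A c) w)"
    by metis
  then have Y: "\<And>w. w \<in> Z \<Longrightarrow> finite (Y w)" "\<And>w. w \<in> Z \<Longrightarrow> Y w \<subseteq> tuples N"
    "\<And>w c. w \<in> Z \<Longrightarrow> c \<in> Cinf M N \<Longrightarrow> (\<And>y. y \<in> Y w \<Longrightarrow> jet0 (l w) c y) \<Longrightarrow> jet0 k (A c) w"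
    by blast+
  show "\<exists>Z k. finite Z \<and> Z \<subseteq> tuples N \<and> (\<forall>c\<in>Cinf M N. (\<forall>w\<in>Z. jet0 k c w) \<longrightarrow> jet0 r (B (A c)) zs)"
  proof (intro exI[of _ "\<Union>w\<in>Z. Y w"] exI[of _ "sum l Z"] conjI ballI impI)
    fix c assume c: "c \<in> Cinf M N" and j: "\<forall>w\<in>\<Union>w\<in>Z. Y w. jet0 (sum l Z) c w"
    have "jet0 k (A c) w" if w: "w \<in> Z" for w
    proof (rule Y(3)[OF w c])
      fix y assume "y \<in> Y w"
      then have "jet0 (sum l Z) c y" using j w by blast
      moreover have "l w \<le> sum l Z" using w Z(1) by (simp add: member_le_sum)
      ultimately show "jet0 (l w) c y" by (rule jet0_mono)
    qed
    then show "jet0 r (B (A c)) zs" using jetopD(1)[OF A c] by (intro Z(3))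
  qed (use Z(1) Y(1) in simp, use Y(2) in blast)
qed (use jetopD[OF A] jetopD[OF B] in auto)

lemma jetop_add:
  assumes A: "jetop N K A" and B: "jetop N K B"
  shows "jetop N K (\<lambda>c. A c + B c)"
  unfolding jetop_def
proof (intro conjI ballI allI)
  fix zs r assume zs: "zs \<in> tuples K"
  obtain Z k where Z0: "finite Z" "Z \<subseteq> tuples N"
    "\<forall>c\<in>Cinf M N. (\<forall>w\<in>Z. jet0 k c w) \<longrightarrow> jet0 r (A c) zs"
    using jetop_jets[OF A zs, of r] by blast
  then have Z: "finite Z" "Z \<subseteq> tuples N"
    "\<And>c. c \<in> Cinf M N \<Longrightarrow> (\<And>w. w \<in> Z \<Longrightarrow> jet0 k c w) \<Longrightarrow> jet0 r (A c) zs" by blast+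
  obtain Y l where Y0: "finite Y" "Y \<subseteq> tuples N"
    "\<forall>c\<in>Cinf M N. (\<forall>w\<in>Y. jet0 l c w) \<longrightarrow> jet0 r (B c) zs"
    using jetop_jets[OF B zs, of r] by blast
  then have Y: "finite Y" "Y \<subseteq> tuples N"
    "\<And>c. c \<in> Cinf M N \<Longrightarrow> (\<And>w. w \<in> Y \<Longrightarrow> jet0 l c w) \<Longrightarrow> jet0 r (B c) zs" by blast+
  show "\<exists>Z k. finite Z \<and> Z \<subseteq> tuples N \<and> (\<forall>c\<in>Cinf M N. (\<forall>w\<in>Z. jet0 k c w) \<longrightarrow> jet0 r (A c + B c) zs)"
  proof (intro exI[of _ "Z \<union> Y"] exI[of _ "k + l"] conjI ballI impI)
    fix c assume c: "c \<in> Cinf M N" and j: "\<forall>w\<in>Z \<union> Y. jet0 (k + l) c w"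
    let ?ch = "\<lambda>j. chart_at (zs ! j)"
    have jA: "jet0 r (A c) zs" using j by (intro Z(3)[OF c]) (auto intro: jet0_mono[of "k + l"])
    have jB: "jet0 r (B c) zs" using j by (intro Y(3)[OF c]) (auto intro: jet0_mono[of "k + l"])
    have ch: "?ch j \<in> atlas M" if "j < K" for j by (rule chart_at_atlas[OF zs that])
    have W: "rel_open K dm (cbox_of K ?ch)" by (rule rel_open_cbox[OF ch])
    have s1: "smooth_coords K dm (cbox_of K ?ch) (in_charts K ?ch (A c))" by (rule Cinf_smooth[OF jetopD(1)[OF A c] ch])
    have s2: "smooth_coords K dm (cbox_of K ?ch) (in_charts K ?ch (B c))" by (rule Cinf_smooth[OF jetopD(1)[OF B c] ch])
    from van_add[OF W crd_mem[OF zs] s1 s2] jA jB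
    show "jet0 r (A c + B c) zs"
      by (simp add: jet0_def tuples_length[OF zs] in_charts_def[abs_def])
  qed (use Z Y in auto)
qed (use jetopD[OF A] jetopD[OF B] Cinf_closed(2) in \<open>auto simp: cscale_add_right\<close>)

lemma jetop_scale:
  assumes A: "jetop N K A"
  shows "jetop N K (\<lambda>c. a \<bullet>\<^sub>C A c)"
  unfolding jetop_def
proof (intro conjI ballI allI)
  fix zs r assume zs: "zs \<in> tuples K"
  obtain Z k where Z0: "finite Z" "Z \<subseteq> tuples N"
    "\<forall>c\<in>Cinf M N. (\<forall>w\<in>Z. jet0 k c w) \<longrightarrow> jet0 r (A c) zs"
    using jetop_jets[OF A zs, of r] by blast
  then have Z: "finite Z" "Z \<subseteq> tuples N"
    "\<And>c. c \<in> Cinf M N \<Longrightarrow> (\<And>w. w \<in> Z \<Longrightarrow> jet0 k c w) \<Longrightarrow> jet0 r (A c) zs" by blast+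
  show "\<exists>Z k. finite Z \<and> Z \<subseteq> tuples N \<and> (\<forall>c\<in>Cinf M N. (\<forall>w\<in>Z. jet0 k c w) \<longrightarrow> jet0 r (a \<bullet>\<^sub>C A c) zs)"
  proof (intro exI[of _ Z] exI[of _ k] conjI ballI impI)
    fix c assume c: "c \<in> Cinf M N" and j: "\<forall>w\<in>Z. jet0 k c w"
    let ?ch = "\<lambda>j. chart_at (zs ! j)"
    have jA: "jet0 r (A c) zs" using j by (intro Z(3)[OF c]) auto
    have ch: "?ch j \<in> atlas M" if "j < K" for j by (rule chart_at_atlas[OF zs that])
    have W: "rel_open K dm (cbox_of K ?ch)" by (rule rel_open_cbox[OF ch])
    have s1: "smooth_coords K dm (cbox_of K ?ch) (in_charts K ?ch (A c))" by (rule Cinf_smooth[OF jetopD(1)[OF A c] ch])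
    from van_mult[OF W crd_mem[OF zs] smooth_const[OF W] s1] jA
    show "jet0 r (a \<bullet>\<^sub>C A c) zs"
      by (simp add: jet0_def tuples_length[OF zs] in_charts_def[abs_def])
  qed (use Z in auto)
qed (use jetopD[OF A] Cinf_closed(4) in \<open>auto simp: cscale_add_right cscale_cscale mult.commute\<close>)

lemma jetop_const_zero: "jetop N K (\<lambda>_. 0)"
  unfolding jetop_def
proof (intro conjI ballI allI)
  fix zs r assume zs: "zs \<in> tuples K"
  have W: "rel_open K dm (cbox_of K (\<lambda>j. chart_at (zs ! j)))"
    by (rule rel_open_cbox) (rule chart_at_atlas[OF zs])
  have "jet0 r 0 zs"
    using van_zero[OF W crd_mem[OF zs]] by (simp add: jet0_def tuples_length[OF zs] in_charts_def[abs_def])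
  then show "\<exists>Z k. finite Z \<and> Z \<subseteq> tuples N \<and> (\<forall>c\<in>Cinf M N. (\<forall>w\<in>Z. jet0 k c w) \<longrightarrow> jet0 r 0 zs)" by blast
qed (auto simp: Cinf_closed(1))

lemma jetop_sum: "(\<And>a. a \<in> T \<Longrightarrow> jetop N K (A a)) \<Longrightarrow> jetop N K (\<lambda>c. \<Sum>a\<in>T. A a c)"
  by (induction T rule: infinite_finite_induct) (auto intro: jetop_const_zero jetop_add)

lemma jetop_id: "jetop N N (\<lambda>c. c)"
  unfolding jetop_def
proof (intro conjI ballI allI)
  fix zs r assume "zs \<in> tuples N"
  then show "\<exists>Z k. finite Z \<and> Z \<subseteq> tuples N \<and> (\<forall>c\<in>Cinf M N. (\<forall>w\<in>Z. jet0 k c w) \<longrightarrow> jet0 r c zs)"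
    by (intro exI[of _ "{zs}"] exI[of _ r]) auto
qed auto

lemma jetop_cong:
  assumes A: "jetop N K A" and eq: "\<And>c. c \<in> Cinf M N \<Longrightarrow> B c = A c"
  shows "jetop N K B"
proof -
  have "B (c + c') = A (c + c')" if "c \<in> Cinf M N" "c' \<in> Cinf M N" for c c'
    using that by (intro eq Cinf_closed(2))
  moreover have "B (a \<bullet>\<^sub>C c) = A (a \<bullet>\<^sub>C c)" if "c \<in> Cinf M N" for a c
    using that by (intro eq Cinf_closed(4))
  ultimately show ?thesis using A unfolding jetop_def by (simp add: eq cong: ball_cong)
qed

lemma partials_linear:
  assumes W: "rel_open m n W" and F: "smooth_coords m n W F" and G: "smooth_coords m n W G"
  shows "set \<alpha> \<subseteq> {..<m} \<times> {..<n} \<Longrightarrow> x \<in> W \<Longrightarrow>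
    partials \<alpha> (\<lambda>y. a * F y + G y) x = a * partials \<alpha> F x + partials \<alpha> G x"
proof (induction \<alpha> arbitrary: x)
  case (Cons ji \<alpha>)
  obtain j i where ji: "ji = (j, i)" by (cases ji)
  have sl: "j < m" "i < n" and al: "set \<alpha> \<subseteq> {..<m} \<times> {..<n}" using Cons.prems by (auto simp: ji)
  have "partial_der j i (partials \<alpha> (\<lambda>y. a * F y + G y)) x = partial_der j i (\<lambda>y. a * partials \<alpha> F y + partials \<alpha> G y) x"
    by (rule partial_der_cong[OF W Cons.prems(2) sl]) (rule Cons.IH[OF al])
  also have "\<dots> = a * partial_der j i (partials \<alpha> F) x + partial_der j i (partials \<alpha> G) x"
  proof -
    have sF: "smooth_coords m n W (partials \<alpha> F)" and sG: "smooth_coords m n W (partials \<alpha> G)"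
      by (rule smooth_partials[OF F al], rule smooth_partials[OF G al])
    have dF: "((\<lambda>s. partials \<alpha> F (put j i s x)) has_vector_derivative partial_der j i (partials \<alpha> F) x) (at (x j i))"
      by (rule smooth_derivative[OF sF sl Cons.prems(2)])
    have dG: "((\<lambda>s. partials \<alpha> G (put j i s x)) has_vector_derivative partial_der j i (partials \<alpha> G) x) (at (x j i))"
      by (rule smooth_derivative[OF sG sl Cons.prems(2)])
    show ?thesis
      by (rule partial_derI) (rule has_vector_derivative_add[OF has_vector_derivative_mult_right[OF dF] dG])
  qed
  finally show ?case by (simp add: partials_def ji)
qed (simp add: partials_def)

text \<open>
  A combination of derivatives of order at most \<open>R\<close> along a reindexed tuple: the \<open>r\<close>-jet of the
  result at \<open>zs\<close> depends on the \<open>(r + R)\<close>-jet of the argument at the reindexed tuple, by Leibniz and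
  chain rule.
\<close>

lemma jetopI_local:
  assumes supp: "\<And>c ps. c \<in> Cinf M N \<Longrightarrow> ps \<notin> tuples K \<Longrightarrow> A c ps = 0"
    and \<sigma>: "\<And>k. k < N \<Longrightarrow> \<sigma> k < K" and fin: "finite \<Lambda>"
    and \<beta>: "\<And>\<alpha>. \<alpha> \<in> \<Lambda> \<Longrightarrow> set (\<beta> \<alpha>) \<subseteq> {..<N} \<times> {..<dm}"
    and loc: "\<And>ch. \<forall>j<K. ch j \<in> atlas M \<Longrightarrow> \<exists>h.
      (\<forall>\<alpha>\<in>\<Lambda>. smooth_coords K dm (cbox_of K ch) (h \<alpha>)) \<and>
      (\<forall>c\<in>Cinf M N. \<forall>x\<in>cbox_of K ch. in_charts K ch (A c) x =
        (\<Sum>\<alpha>\<in>\<Lambda>. h \<alpha> x * partials (\<beta> \<alpha>) (in_charts N (\<lambda>k. ch (\<sigma> k)) c) (subst_vars N UNIV \<sigma> 0 x)))"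
  shows "jetop N K A"
proof -
  have bound: "\<exists>R. \<forall>\<alpha>\<in>\<Lambda>. length (\<beta> \<alpha>) \<le> R"
    using fin by (intro exI[of _ "\<Sum>\<alpha>\<in>\<Lambda>. length (\<beta> \<alpha>)"]) (auto intro: member_le_sum)
  then obtain R where R: "\<And>\<alpha>. \<alpha> \<in> \<Lambda> \<Longrightarrow> length (\<beta> \<alpha>) \<le> R" by auto
  have sub: "subst_vars N UNIV \<sigma> 0 x \<in> cbox_of N (\<lambda>k. ch (\<sigma> k))" if "x \<in> cbox_of K ch" for x ch
    using that \<sigma> by (auto simp: coord_box_def subst_vars_def)
  have cont: "A c \<in> Cinf M K" if c: "c \<in> Cinf M N" for c
  proof (rule CinfI)
    fix ch :: "nat \<Rightarrow> 'p chart" assume ch: "\<And>j. j < K \<Longrightarrow> ch j \<in> atlas M"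
    obtain h where h: "\<And>\<alpha>. \<alpha> \<in> \<Lambda> \<Longrightarrow> smooth_coords K dm (cbox_of K ch) (h \<alpha>)"
      and eq: "\<And>x. x \<in> cbox_of K ch \<Longrightarrow> in_charts K ch (A c) x =
        (\<Sum>\<alpha>\<in>\<Lambda>. h \<alpha> x * partials (\<beta> \<alpha>) (in_charts N (\<lambda>k. ch (\<sigma> k)) c) (subst_vars N UNIV \<sigma> 0 x))"
      using loc[of ch] ch c by blast
    have ch': "ch (\<sigma> k) \<in> atlas M" if "k < N" for k using ch[OF \<sigma>[OF that]] .
    have W: "rel_open K dm (cbox_of K ch)" by (rule rel_open_cbox[OF ch])
    have W': "rel_open N dm (cbox_of N (\<lambda>k. ch (\<sigma> k)))" by (rule rel_open_cbox[OF ch'])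
    have s: "smooth_coords N dm (cbox_of N (\<lambda>k. ch (\<sigma> k))) (in_charts N (\<lambda>k. ch (\<sigma> k)) c)" by (rule Cinf_smooth[OF c ch'])
    have "smooth_coords K dm (cbox_of K ch) (\<lambda>x. \<Sum>\<alpha>\<in>\<Lambda>. h \<alpha> x * partials (\<beta> \<alpha>) (in_charts N (\<lambda>k. ch (\<sigma> k)) c) (subst_vars N UNIV \<sigma> 0 x))"
      by (intro smooth_sum[OF W] smooth_mult[OF W] h smooth_subst_vars[OF W' W sub] smooth_partials[OF s] \<beta>)
    then show "smooth_coords K dm (cbox_of K ch) (in_charts K ch (A c))"
      by (rule smooth_cong[OF W, rotated]) (rule eq)
  qed (rule supp[OF c])
  have lin: "A (a \<bullet>\<^sub>C c + c') = a \<bullet>\<^sub>C A c + A c'" if c: "c \<in> Cinf M N" and c': "c' \<in> Cinf M N" for a c c'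
  proof
    fix ps
    have cc: "a \<bullet>\<^sub>C c + c' \<in> Cinf M N" using c c' by (intro Cinf_closed)
    show "A (a \<bullet>\<^sub>C c + c') ps = (a \<bullet>\<^sub>C A c + A c') ps"
    proof (cases "ps \<in> tuples K")
      case True
      let ?ch = "\<lambda>j. chart_at (ps ! j)"
      have ch: "?ch j \<in> atlas M" if "j < K" for j by (rule chart_at_atlas[OF True that])
      have ch': "?ch (\<sigma> k) \<in> atlas M" if "k < N" for k using ch[OF \<sigma>[OF that]] .
      obtain h where eq: "\<And>c. c \<in> Cinf M N \<Longrightarrow> in_charts K ?ch (A c) (crd ps) =
        (\<Sum>\<alpha>\<in>\<Lambda>. h \<alpha> (crd ps) * partials (\<beta> \<alpha>) (in_charts N (\<lambda>k. ?ch (\<sigma> k)) c) (subst_vars N UNIV \<sigma> 0 (crd ps)))"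
        using loc[of ?ch] ch crd_mem[OF True] by blast
      have W': "rel_open N dm (cbox_of N (\<lambda>k. ?ch (\<sigma> k)))" by (rule rel_open_cbox[OF ch'])
      have s: "smooth_coords N dm (cbox_of N (\<lambda>k. ?ch (\<sigma> k))) (in_charts N (\<lambda>k. ?ch (\<sigma> k)) c)" by (rule Cinf_smooth[OF c ch'])
      have s': "smooth_coords N dm (cbox_of N (\<lambda>k. ?ch (\<sigma> k))) (in_charts N (\<lambda>k. ?ch (\<sigma> k)) c')" by (rule Cinf_smooth[OF c' ch'])
      have pl: "partials (\<beta> \<alpha>) (in_charts N (\<lambda>k. ?ch (\<sigma> k)) (a \<bullet>\<^sub>C c + c')) (subst_vars N UNIV \<sigma> 0 (crd ps))
        = a * partials (\<beta> \<alpha>) (in_charts N (\<lambda>k. ?ch (\<sigma> k)) c) (subst_vars N UNIV \<sigma> 0 (crd ps))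
          + partials (\<beta> \<alpha>) (in_charts N (\<lambda>k. ?ch (\<sigma> k)) c') (subst_vars N UNIV \<sigma> 0 (crd ps))"
        if "\<alpha> \<in> \<Lambda>" for \<alpha>
        using partials_linear[OF W' s s' \<beta>[OF that] sub[of "crd ps" ?ch, OF crd_mem[OF True]], of a]
        by (simp add: in_charts_def[abs_def])
      have "in_charts K ?ch (A (a \<bullet>\<^sub>C c + c')) (crd ps) = a * in_charts K ?ch (A c) (crd ps) + in_charts K ?ch (A c') (crd ps)"
        unfolding eq[OF cc] eq[OF c] eq[OF c'] sum_distrib_left sum.distrib[symmetric]
        by (rule sum.cong[OF refl]) (simp only: pl distrib_left mult.left_commute)
      then show ?thesis by (simp add: in_charts_crd[OF True])
    qed (simp add: supp[OF cc] supp[OF c] supp[OF c'])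
  qed
  have zero: "A 0 = 0"
    using lin[OF Cinf_closed(1) Cinf_closed(1), of 1] by (simp add: cscale_one)
  show ?thesis
    unfolding jetop_def
  proof (intro conjI ballI allI)
    fix zs r assume zs: "zs \<in> tuples K"
    let ?ch = "\<lambda>j. chart_at (zs ! j)"
    define w where "w = map (\<lambda>k. zs ! \<sigma> k) [0..<N]"
    have w: "w \<in> tuples N" using tuples_nth[OF zs \<sigma>] by (auto simp: w_def tuples_def)
    have crd_w: "crd w = subst_vars N UNIV \<sigma> 0 (crd zs)"
      using \<sigma> by (auto simp: crd_def w_def subst_vars_def tuples_length[OF zs] fun_eq_iff)
    have ch: "?ch j \<in> atlas M" if "j < K" for j by (rule chart_at_atlas[OF zs that])
    have ch': "?ch (\<sigma> k) \<in> atlas M" if "k < N" for k using ch[OF \<sigma>[OF that]] .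
    obtain h where h: "\<And>\<alpha>. \<alpha> \<in> \<Lambda> \<Longrightarrow> smooth_coords K dm (cbox_of K ?ch) (h \<alpha>)"
      and eq: "\<And>c x. c \<in> Cinf M N \<Longrightarrow> x \<in> cbox_of K ?ch \<Longrightarrow> in_charts K ?ch (A c) x =
        (\<Sum>\<alpha>\<in>\<Lambda>. h \<alpha> x * partials (\<beta> \<alpha>) (in_charts N (\<lambda>k. ?ch (\<sigma> k)) c) (subst_vars N UNIV \<sigma> 0 x))"
      using loc[of ?ch] ch by blast
    have W: "rel_open K dm (cbox_of K ?ch)" by (rule rel_open_cbox[OF ch])
    have W': "rel_open N dm (cbox_of N (\<lambda>k. ?ch (\<sigma> k)))" by (rule rel_open_cbox[OF ch'])
    have "jet0 r (A c) zs" if c: "c \<in> Cinf M N" and j: "jet0 (r + R) c w" for c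
    proof -
      let ?C = "in_charts N (\<lambda>k. ?ch (\<sigma> k)) c"
      have s: "smooth_coords N dm (cbox_of N (\<lambda>k. ?ch (\<sigma> k))) ?C" by (rule Cinf_smooth[OF c ch'])
      have "in_charts N (\<lambda>k. chart_at (w ! k)) c = ?C"
        by (auto simp: in_charts_def w_def fun_eq_iff intro!: arg_cong[of _ _ c])
      then have v: "van N dm (r + R) ?C (subst_vars N UNIV \<sigma> 0 (crd zs))"
        using j by (simp add: jet0_def tuples_length[OF w] crd_w)
      have "van K dm r (\<lambda>x. \<Sum>\<alpha>\<in>\<Lambda>. h \<alpha> x * partials (\<beta> \<alpha>) ?C (subst_vars N UNIV \<sigma> 0 x)) (crd zs)"
      proof (rule van_sum[OF W crd_mem[OF zs]])
        fix \<alpha> assume \<alpha>: "\<alpha> \<in> \<Lambda>"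
        have sp: "smooth_coords N dm (cbox_of N (\<lambda>k. ?ch (\<sigma> k))) (partials (\<beta> \<alpha>) ?C)"
          by (rule smooth_partials[OF s \<beta>[OF \<alpha>]])
        have ss: "smooth_coords K dm (cbox_of K ?ch) (\<lambda>x. partials (\<beta> \<alpha>) ?C (subst_vars N UNIV \<sigma> 0 x))"
          by (rule smooth_subst_vars[OF W' W sub sp])
        show "smooth_coords K dm (cbox_of K ?ch) (\<lambda>x. h \<alpha> x * partials (\<beta> \<alpha>) ?C (subst_vars N UNIV \<sigma> 0 x))"
          by (rule smooth_mult[OF W h[OF \<alpha>] ss])
        have "van N dm (r + length (\<beta> \<alpha>)) ?C (subst_vars N UNIV \<sigma> 0 (crd zs))"
          using van_mono[OF v] R[OF \<alpha>] by simp
        then have vp: "van N dm r (partials (\<beta> \<alpha>) ?C) (subst_vars N UNIV \<sigma> 0 (crd zs))"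
          by (rule van_partials[OF _ \<beta>[OF \<alpha>]])
        have sub': "\<And>x. x \<in> cbox_of K ?ch \<Longrightarrow> subst_vars N UNIV \<sigma> 0 x \<in> cbox_of N (\<lambda>k. ?ch (\<sigma> k))" by (rule sub)
        from sub' sp vp have "van K dm r (\<lambda>x. partials (\<beta> \<alpha>) ?C (subst_vars N UNIV \<sigma> 0 x)) (crd zs)"
          by (rule van_subst_vars[OF W crd_mem[OF zs] W'])
        then show "van K dm r (\<lambda>x. h \<alpha> x * partials (\<beta> \<alpha>) ?C (subst_vars N UNIV \<sigma> 0 x)) (crd zs)"
          by (rule van_mult[OF W crd_mem[OF zs] h[OF \<alpha>] ss])
      qed
      then have "van K dm r (in_charts K ?ch (A c)) (crd zs)"
        by (rule van_cong[OF W crd_mem[OF zs], rotated]) (simp add: eq[OF c])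
      then show ?thesis by (simp add: jet0_def tuples_length[OF zs])
    qed
    then show "\<exists>Z k. finite Z \<and> Z \<subseteq> tuples N \<and> (\<forall>c\<in>Cinf M N. (\<forall>w\<in>Z. jet0 k c w) \<longrightarrow> jet0 r (A c) zs)"
      using w by (intro exI[of _ "{w}"] exI[of _ "r + R"]) auto
  next
    fix c c' assume "c \<in> Cinf M N" "c' \<in> Cinf M N"
    then show "A (c + c') = A c + A c'" using lin[of c c' 1] by (simp add: cscale_one)
  next
    fix a c assume "c \<in> Cinf M N"
    then show "A (a \<bullet>\<^sub>C c) = a \<bullet>\<^sub>C A c" using lin[OF _ Cinf_closed(1), of c a] by (simp add: zero)
  qed (rule cont)
qed

lemma cochain_zero: "multidiff M d D \<Longrightarrow> c \<notin> Cinf M d \<Longrightarrow> D c = 0"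
  and cochain_smooth: "multidiff M d D \<Longrightarrow> c \<in> Cinf M d \<Longrightarrow> D c \<in> smooth_funs M"
  by (auto simp: multidiff_def)

lemma partials_zero: "partials \<alpha> (\<lambda>_. 0) = (\<lambda>_. 0)"
  by (induction \<alpha>) (auto simp: partials_def partial_der_def)

text \<open>
  The local formula determines \<open>D 0\<close> on every chart, and smooth functions vanish off the
  manifold by convention.
\<close>

lemma cochain_null: assumes D: "multidiff M d D" shows "D 0 = 0"
proof
  fix p
  show "D 0 p = (0 :: 'p \<Rightarrow> complex) p"
  proof (cases "p \<in> pts M")
    case True
    obtain k where k: "\<forall>(U, \<phi>)\<in>atlas M. \<exists>h.
        (\<forall>\<alpha>\<in>midx d dm k. smooth_coords 1 dm (coord_box 1 (\<lambda>_. \<phi> ` U)) (h \<alpha>)) \<and>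
        (\<forall>c\<in>Cinf M d. \<forall>p\<in>U. D c p = (\<Sum>\<alpha>\<in>midx d dm k.
              h \<alpha> (repeat_vec 1 (\<phi> p)) * partials \<alpha> (in_charts d (\<lambda>_. (U, \<phi>)) c) (repeat_vec d (\<phi> p))))"
      using D unfolding multidiff_def by blast
    obtain U \<phi> where U: "chart_at p = (U, \<phi>)" by (cases "chart_at p")
    have mem: "(U, \<phi>) \<in> atlas M" "p \<in> U" using chart_at[OF True] by (simp_all add: U)
    have "in_charts d (\<lambda>_. (U, \<phi>)) 0 = (\<lambda>_. 0)" by (simp add: in_charts_def[abs_def])
    then show ?thesis
      using bspec[OF k mem(1)] mem(2) Cinf_closed(1) by (auto simp: partials_zero)
  next
    case False
    then show ?thesis using smooth_funs_zero[OF cochain_smooth[OF D Cinf_closed(1)]] by simp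
  qed
qed

lemma ins_support:
  assumes D: "multidiff M d D" and c: "c \<in> Cinf M (N + d - 1)" and ps: "ps \<notin> tuples N" and i: "i < N"
  shows "ins D i c ps = 0"
proof (cases "i < length ps")
  case True
  let ?f = "\<lambda>ys. c (take i ps @ ys @ drop (i + 1) ps)"
  have "D ?f (ps ! i) = 0"
  proof (cases "?f \<in> Cinf M d \<and> ?f \<noteq> 0")
    case f: True
    then obtain ys where ys: "?f ys \<noteq> 0" by (auto simp: fun_eq_iff)
    then have t: "take i ps @ ys @ drop (i + 1) ps \<in> tuples (N + d - 1)" "ys \<in> tuples d"
      using CinfD[OF c] CinfD[of ?f d] f by blast+
    then have l: "length ps = N" using True i by (auto simp: tuples_def)
    have "set ps = set (take i ps @ ps ! i # drop (Suc i) ps)"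
      by (rule arg_cong[OF id_take_nth_drop[OF True]])
    then have "ps ! i \<notin> pts M" using t ps l by (auto simp: tuples_def)
    then show ?thesis using smooth_funs_zero[OF cochain_smooth[OF D]] f by blast
  next
    case False
    then have "D ?f = 0" using cochain_zero[OF D] cochain_null[OF D] by metis
    then show ?thesis by simp
  qed
  then show ?thesis using True by (simp add: ins_def)
qed (simp add: ins_def)

lemma jetop_ins:
  assumes D: "multidiff M d D" and i: "i < N"
  shows "jetop (N + d - 1) N (ins D i)"
proof -
  let ?L = "N + d - 1"
  obtain k where k: "\<forall>ch. (\<forall>j<N. ch j \<in> atlas M) \<longrightarrow>
    (\<exists>h. (\<forall>\<alpha>\<in>midx d dm k. smooth_coords 1 dm (cbox_of 1 (\<lambda>_. ch i)) (h \<alpha>)) \<and>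
      (\<forall>c\<in>Cinf M (N + d - 1). \<forall>x\<in>cbox_of N ch. in_charts N ch (ins D i c) x =
        (\<Sum>\<alpha>\<in>midx d dm k. h \<alpha> (subst_vars 1 UNIV (\<lambda>_. i) 0 x) *
          partials (shift i \<alpha>) (in_charts (N + d - 1) (\<lambda>k. ch (spread i d k)) c)
            (subst_vars (N + d - 1) UNIV (spread i d) 0 x))))"
    using ins_local[OF D i] by blast
  show ?thesis
  proof (rule jetopI_local[where \<sigma>="spread i d" and \<Lambda>="midx d dm k" and \<beta>="shift i"])
    fix ch :: "nat \<Rightarrow> 'p chart" assume ch0: "\<forall>j<N. ch j \<in> atlas M"
    then have ch: "ch j \<in> atlas M" if "j < N" for j using that by blast
    obtain h where h: "\<And>\<alpha>. \<alpha> \<in> midx d dm k \<Longrightarrow> smooth_coords 1 dm (cbox_of 1 (\<lambda>_. ch i)) (h \<alpha>)"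
      and eq: "\<forall>c\<in>Cinf M ?L. \<forall>x\<in>cbox_of N ch. in_charts N ch (ins D i c) x =
        (\<Sum>\<alpha>\<in>midx d dm k. h \<alpha> (subst_vars 1 UNIV (\<lambda>_. i) 0 x) *
          partials (shift i \<alpha>) (in_charts ?L (\<lambda>k. ch (spread i d k)) c) (subst_vars ?L UNIV (spread i d) 0 x))"
      using k ch0 by blast
    have W: "rel_open N dm (cbox_of N ch)" by (rule rel_open_cbox[OF ch])
    have W1: "rel_open 1 dm (cbox_of 1 (\<lambda>_. ch i))" by (rule rel_open_cbox) (rule ch[OF i])
    have sub1: "subst_vars 1 UNIV (\<lambda>_. i) 0 x \<in> cbox_of 1 (\<lambda>_. ch i)" if "x \<in> cbox_of N ch" for x
      using that i by (auto simp: coord_box_def subst_vars_def)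
    have "smooth_coords N dm (cbox_of N ch) (\<lambda>x. h \<alpha> (subst_vars 1 UNIV (\<lambda>_. i) 0 x))" if "\<alpha> \<in> midx d dm k" for \<alpha>
      by (rule smooth_subst_vars[OF W1 W sub1 h[OF that]])
    with eq show "\<exists>h. (\<forall>\<alpha>\<in>midx d dm k. smooth_coords N dm (cbox_of N ch) (h \<alpha>)) \<and>
      (\<forall>c\<in>Cinf M ?L. \<forall>x\<in>cbox_of N ch. in_charts N ch (ins D i c) x =
        (\<Sum>\<alpha>\<in>midx d dm k. h \<alpha> x * partials (shift i \<alpha>) (in_charts ?L (\<lambda>k. ch (spread i d k)) c) (subst_vars ?L UNIV (spread i d) 0 x)))"
      by (intro exI[of _ "\<lambda>\<alpha> x. h \<alpha> (subst_vars 1 UNIV (\<lambda>_. i) 0 x)"]) blast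
  qed (use spread_less[OF _ i] shift_midx[OF _ i] finite_midx ins_support[OF D _ _ i] in auto)
qed

definition reindex :: "nat \<Rightarrow> nat \<Rightarrow> (nat \<Rightarrow> nat) \<Rightarrow> ('p list \<Rightarrow> complex) \<Rightarrow> 'p list \<Rightarrow> complex" where
  "reindex N K \<sigma> c = (\<lambda>ps. if ps \<in> tuples K then c (map (\<lambda>k. ps ! \<sigma> k) [0..<N]) else 0)"

lemma jetop_reindex:
  assumes \<sigma>: "\<And>k. k < N \<Longrightarrow> \<sigma> k < K"
  shows "jetop N K (reindex N K \<sigma>)"
proof (rule jetopI_local[where \<sigma>=\<sigma> and \<Lambda>="{()}" and \<beta>="\<lambda>_. []"])
  fix ch :: "nat \<Rightarrow> 'p chart" assume "\<forall>j<K. ch j \<in> atlas M"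
  then have ch: "ch j \<in> atlas M" if "j < K" for j using that by blast
  have W: "rel_open K dm (cbox_of K ch)" by (rule rel_open_cbox[OF ch])
  have "in_charts K ch (reindex N K \<sigma> c) x = in_charts N (\<lambda>k. ch (\<sigma> k)) c (subst_vars N UNIV \<sigma> 0 x)"
    if "x \<in> cbox_of K ch" for c x
  proof -
    let ?ps = "map (\<lambda>j. unch (ch j) (x j)) [0..<K]"
    have "map (\<lambda>k. ?ps ! \<sigma> k) [0..<N] = map (\<lambda>k. unch (ch (\<sigma> k)) (subst_vars N UNIV \<sigma> 0 x k)) [0..<N]"
      using \<sigma> by (simp add: subst_vars_def)
    then show ?thesis
      using in_charts_points[of K ch x, OF ch that] by (simp only: in_charts_def reindex_def if_True)
  qed
  then show "\<exists>h. (\<forall>\<alpha>\<in>{()}. smooth_coords K dm (cbox_of K ch) (h \<alpha>)) \<and>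
      (\<forall>c\<in>Cinf M N. \<forall>x\<in>cbox_of K ch. in_charts K ch (reindex N K \<sigma> c) x =
        (\<Sum>\<alpha>\<in>{()}. h \<alpha> x * partials [] (in_charts N (\<lambda>k. ch (\<sigma> k)) c) (subst_vars N UNIV \<sigma> 0 x)))"
    by (intro exI[of _ "\<lambda>_ _. 1"]) (auto simp: partials_def smooth_const[OF W])
qed (use \<sigma> in \<open>auto simp: reindex_def\<close>)

end

section \<open>Density of tensors\<close>

inductive cpoly :: "((nat \<Rightarrow> real) \<Rightarrow> complex) \<Rightarrow> bool" where
  cpoly_const: "cpoly (\<lambda>_. c)"
| cpoly_coord: "cpoly (\<lambda>v. complex_of_real (v i))"
| cpoly_add: "cpoly p \<Longrightarrow> cpoly q \<Longrightarrow> cpoly (\<lambda>v. p v + q v)"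
| cpoly_mult: "cpoly p \<Longrightarrow> cpoly q \<Longrightarrow> cpoly (\<lambda>v. p v * q v)"

lemma cpoly_sum: "(\<And>i. i \<in> A \<Longrightarrow> cpoly (f i)) \<Longrightarrow> cpoly (\<lambda>v. \<Sum>i\<in>A. f i v)"
  by (induction A rule: infinite_finite_induct) (auto intro: cpoly_const cpoly_add)

lemma small_box:
  assumes T: "open (T :: (nat \<Rightarrow> real) set)" and v: "v \<in> T"
  obtains s where "s > 0" "\<And>w. (\<And>i. i < n \<Longrightarrow> \<bar>w i - v i\<bar> \<le> s) \<Longrightarrow> (\<And>i. n \<le> i \<Longrightarrow> w i = v i) \<Longrightarrow> w \<in> T"
proof -
  have "openin (product_topology (\<lambda>i. euclidean) UNIV) T" using T by (simp add: euclidean_product_topology)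
  from product_topology_open_contains_basis[OF this v] obtain X where
    X: "v \<in> (\<Pi>\<^sub>E i\<in>UNIV. X i)" "\<And>i. open (X i)" "(\<Pi>\<^sub>E i\<in>UNIV. X i) \<subseteq> T" by auto
  have vX: "v i \<in> X i" for i using X(1) by auto
  have "\<exists>e>0. cball (v i) e \<subseteq> X i" for i using X(2) vX open_contains_cball by blast
  then obtain e where e: "\<And>i. e i > 0" "\<And>i. cball (v i) (e i) \<subseteq> X i" by metis
  define s where "s = Min (insert 1 (e ` {..<n}))"
  have s0: "s > 0" using e(1) by (auto simp: s_def)
  have se: "s \<le> e i" if "i < n" for i using that by (auto simp: s_def intro!: Min_le)
  show ?thesis
  proof (rule that[OF s0])
    fix w :: "nat \<Rightarrow> real" assume w: "\<And>i. i < n \<Longrightarrow> \<bar>w i - v i\<bar> \<le> s" "\<And>i. n \<le> i \<Longrightarrow> w i = v i"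
    have "w i \<in> X i" for i
    proof (cases "i < n")
      case True
      then have "w i \<in> cball (v i) (e i)" using w(1)[OF True] se[OF True] by (simp add: dist_real_def abs_minus_commute)
      then show ?thesis using e(2) by blast
    next
      case False
      then show ?thesis using w(2) vX by simp
    qed
    then show "w \<in> T" using X(3) by auto
  qed
qed

lemma rel_open_Int: "rel_open m n W \<Longrightarrow> rel_open m n V \<Longrightarrow> rel_open m n (W \<inter> V)"
proof -
  assume "rel_open m n W" "rel_open m n V"
  then obtain S T where "open S" "open T" "W = S \<inter> coords m n" "V = T \<inter> coords m n"
    by (auto simp: rel_open_def)
  then have "open (S \<inter> T) \<and> W \<inter> V = (S \<inter> T) \<inter> coords m n" by auto
  then show ?thesis unfolding rel_open_def by blast
qed

lemma smooth_Un:
  "rel_open m n W1 \<Longrightarrow> rel_open m n W2 \<Longrightarrow> smooth_coords m n W1 F \<Longrightarrow> smooth_coords m n W2 F \<Longrightarrow>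
    smooth_coords m n (W1 \<union> W2) F"
  by (simp add: smooth_coords_def Ck_Un)

lemma smooth_prod:
  assumes W: "rel_open m n W"
  shows "(\<And>a. a \<in> A \<Longrightarrow> smooth_coords m n W (F a)) \<Longrightarrow> smooth_coords m n W (\<lambda>x. \<Prod>a\<in>A. F a x)"
  by (induction A rule: infinite_finite_induct) (auto simp: smooth_const[OF W] intro!: smooth_mult[OF W])

context smooth_mfd
begin

lemma rel_open_image_box:
  assumes "\<And>j. j < m \<Longrightarrow> ch j \<in> atlas M" "\<And>j. j < m \<Longrightarrow> openin (mtop M) (G j)" "\<And>j. j < m \<Longrightarrow> G j \<subseteq> fst (ch j)"
  shows "rel_open m dm (coord_box m (\<lambda>j. snd (ch j) ` G j))"
  by (rule rel_open_box) (rule chart_open_img[OF assms])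

lemma smooth_transition:
  assumes ch: "ch \<in> atlas M" and ch': "ch' \<in> atlas M" and q: "cpoly q"
  shows "smooth_coords 1 dm (coord_box 1 (\<lambda>_. snd ch' ` (fst ch' \<inter> fst ch))) (\<lambda>x. q (snd ch (unch ch' (x 0))))"
proof -
  let ?W = "coord_box 1 (\<lambda>_. snd ch' ` (fst ch' \<inter> fst ch))"
  have W: "rel_open 1 dm ?W"
    by (rule rel_open_box, rule chart_open_img[OF ch'])
       (auto intro: openin_Int chart_open[OF ch] chart_open[OF ch'])
  show ?thesis
    using q
  proof induction
    case (cpoly_coord i)
    show ?case
    proof (cases "i < dm")
      case True
      have "smooth_in_charts M M (\<lambda>p. p)" using mfd by (simp add: smooth_manifold_def)
      then have "smooth_coords 1 dm (coord_box 1 (\<lambda>_. snd ch' ` {p \<in> fst ch'. p \<in> fst ch}))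
          (\<lambda>x. complex_of_real (snd ch (unch ch' (x 0)) i))"
        using ch ch' True unfolding smooth_in_charts_def by fastforce
      then show ?thesis by (simp add: Int_def)
    next
      case False
      have z: "snd ch (unch ch' (x 0)) i = 0" if x: "x \<in> ?W" for x
      proof -
        obtain p where p: "p \<in> fst ch'" "p \<in> fst ch" "x 0 = snd ch' p" using x by (auto simp: coord_box_def)
        have "snd ch p \<in> topspace (Euclidean_space dm)"
          using openin_subset[OF chart_img[OF ch]] p(2) by blast
        then show ?thesis using False p unch_chart[OF ch' p(1)] by (simp add: topspace_Euclidean_space)
      qed
      show ?thesis by (rule smooth_cong[OF W _ smooth_const[OF W, of 0]]) (simp add: z)
    qed
  qed (auto simp del: One_nat_def intro: smooth_const[OF W] smooth_add[OF W] smooth_mult[OF W])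
qed

text \<open>
  A function that is \<open>1\<close> near \<open>p\<close> and \<open>0\<close> near the points of \<open>Y\<close>, supported in a chart, times an
  arbitrary polynomial in the coordinates of that chart. The cutoff is applied to the squared
  coordinate distance from \<open>p\<close>. Its support lies in the preimage \<open>K\<close> of a compact box, and \<open>K\<close> is
  closed since the manifold is Hausdorff; this makes the extension by zero smooth.
\<close>

lemma bump:
  assumes p: "p \<in> pts M" and Y: "finite Y" "Y \<subseteq> pts M" "p \<notin> Y"
  shows "\<exists>\<theta> G Q. openin (mtop M) G \<and> p \<in> G \<and> G \<subseteq> fst (chart_at p) \<and>
     openin (mtop M) Q \<and> Y \<subseteq> Q \<and>
     (\<forall>q. cpoly q \<longrightarrow> (\<lambda>y. if y \<in> fst (chart_at p) then \<theta> y * q (snd (chart_at p) y) else 0) \<in> smooth_funs M) \<and>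
     (\<forall>y\<in>G. \<theta> y = 1) \<and> (\<forall>y\<in>Q. y \<in> fst (chart_at p) \<longrightarrow> \<theta> y = (0 :: complex))"
proof -
  define ch where "ch = chart_at p"
  have ch: "ch \<in> atlas M" and pU: "p \<in> fst ch" using chart_at[OF p] by (auto simp: ch_def)
  define v where "v = snd ch p"
  let ?E = "{v :: nat \<Rightarrow> real. \<forall>i\<ge>dm. v i = 0}"
  obtain T where T: "open T" "snd ch ` fst ch = T \<inter> ?E" using chart_img[OF ch] by (auto simp: openin_Euclidean_space)
  have vT: "v \<in> T" and vE: "v \<in> ?E" using pU T(2) by (auto simp: v_def)
  obtain s1 where s1: "s1 > 0" "\<And>w. (\<And>i. i < dm \<Longrightarrow> \<bar>w i - v i\<bar> \<le> s1) \<Longrightarrow> (\<And>i. dm \<le> i \<Longrightarrow> w i = v i) \<Longrightarrow> w \<in> T"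
    using small_box[OF T(1) vT, of dm] by metis
  have "\<exists>e>0. \<exists>i<dm. \<bar>snd ch y i - v i\<bar> > e" if y: "y \<in> Y \<inter> fst ch" for y
  proof -
    have "snd ch y \<noteq> v" using y Y(3) pU chart_inj[OF ch] by (auto simp: v_def inj_on_def)
    moreover have "snd ch y \<in> ?E" using y T(2) by blast
    ultimately obtain i where "i < dm" "snd ch y i \<noteq> v i" using vE by (auto simp: fun_eq_iff) (metis not_less)
    then show ?thesis by (intro exI[of _ "\<bar>snd ch y i - v i\<bar> / 2"]) auto
  qed
  then obtain e where e: "\<And>y. y \<in> Y \<inter> fst ch \<Longrightarrow> e y > 0" "\<And>y. y \<in> Y \<inter> fst ch \<Longrightarrow> \<exists>i<dm. \<bar>snd ch y i - v i\<bar> > e y"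
    by metis
  define s where "s = Min (insert s1 (e ` (Y \<inter> fst ch)))"
  have s0: "s > 0" using s1(1) e(1) Y(1) by (auto simp: s_def)
  have ss1: "s \<le> s1" and se: "\<And>y. y \<in> Y \<inter> fst ch \<Longrightarrow> s \<le> e y" using Y(1) by (auto simp: s_def intro!: Min_le)
  define B where "B = {w. (\<forall>i<dm. \<bar>w i - v i\<bar> \<le> s) \<and> (\<forall>i\<ge>dm. w i = 0)}"
  have BU: "B \<subseteq> snd ch ` fst ch"
  proof
    fix w assume w: "w \<in> B"
    have "w \<in> T" using w vE ss1 by (intro s1(2)) (auto simp: B_def intro: order_trans)
    then show "w \<in> snd ch ` fst ch" using w T(2) by (auto simp: B_def)
  qed
  define K where "K = {y \<in> fst ch. \<forall>i<dm. \<bar>snd ch y i - v i\<bar> \<le> s}"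
  have "compactin (mtop M) K"
  proof -
    have "B = (\<Pi>\<^sub>E i\<in>UNIV. if i < dm then {v i - s..v i + s} else {0})"
      unfolding B_def by (auto simp: PiE_iff abs_le_iff algebra_simps split: if_splits)
    then have "compactin (powertop_real UNIV) B"
      by (simp add: compactin_PiE)
    then have "compactin (Euclidean_space dm) B"
      by (auto simp: Euclidean_space_def compactin_subtopology B_def)
    then have cB: "compactin (subtopology (Euclidean_space dm) (snd ch ` fst ch)) B"
      using BU by (simp add: compactin_subtopology)
    obtain g where g: "homeomorphic_maps (subtopology (mtop M) (fst ch)) (subtopology (Euclidean_space dm) (snd ch ` fst ch)) (snd ch) g"
      using chart_homeo[OF ch] homeomorphic_map_maps by blast
    have ts: "topspace (subtopology (mtop M) (fst ch)) = fst ch" using chart_sub[OF ch] by auto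
    have "continuous_map (subtopology (Euclidean_space dm) (snd ch ` fst ch)) (subtopology (mtop M) (fst ch)) g"
      and gi: "\<And>y. y \<in> fst ch \<Longrightarrow> g (snd ch y) = y" using g ts by (auto simp: homeomorphic_maps_def)
    then have "compactin (subtopology (mtop M) (fst ch)) (g ` B)" using image_compactin[OF cB] by blast
    moreover have "g ` B = K"
    proof (intro set_eqI iffI)
      fix y assume "y \<in> g ` B"
      then obtain w where w: "w \<in> B" "y = g w" by auto
      then obtain y' where "y' \<in> fst ch" "w = snd ch y'" using BU by auto
      then show "y \<in> K" using w gi by (auto simp: K_def B_def)
    next
      fix y assume y: "y \<in> K"
      then have "snd ch y \<in> T \<inter> ?E" using T(2) by (auto simp: K_def)
      then have "snd ch y \<in> B" using y by (auto simp: B_def K_def)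
      then show "y \<in> g ` B" using gi[of y] y by (force simp: K_def)
    qed
    ultimately show ?thesis by (simp add: compactin_subtopology)
  qed
  then have clK: "closedin (mtop M) K"
    using compactin_imp_closedin mfd by (auto simp: smooth_manifold_def)
  define d where "d = (\<lambda>w :: nat \<Rightarrow> real. (\<Sum>i<dm. (w i - v i)\<^sup>2))"
  define \<theta>0 where "\<theta>0 = (\<lambda>w. cutoff (2 * d w / s\<^sup>2 - 1))"
  define \<theta> where "\<theta> = (\<lambda>y. complex_of_real (\<theta>0 (snd ch y)))"
  define Q where "Q = pts M - K"
  define G where "G = {y \<in> fst ch. d (snd ch y) < s\<^sup>2 / 2}"
  have \<theta>K: "\<theta> y = 0" if y: "y \<in> fst ch" "y \<notin> K" for y
  proof -
    obtain i where i: "i < dm" "\<bar>snd ch y i - v i\<bar> > s" using y by (auto simp: K_def not_le)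
    have "s\<^sup>2 \<le> (snd ch y i - v i)\<^sup>2" using i(2) s0 by (simp add: abs_le_square_iff[symmetric])
    also have "\<dots> \<le> d (snd ch y)" unfolding d_def using i(1) by (intro member_le_sum) auto
    finally have "1 \<le> 2 * d (snd ch y) / s\<^sup>2 - 1" using s0 by (simp add: field_simps)
    then show ?thesis by (simp add: \<theta>_def \<theta>0_def cutoff_zero)
  qed
  have \<theta>G: "\<theta> y = 1" if "y \<in> G" for y
  proof -
    have "2 * d (snd ch y) / s\<^sup>2 - 1 \<le> 0" using that s0 by (simp add: G_def field_simps)
    then show ?thesis by (simp add: \<theta>_def \<theta>0_def cutoff_one)
  qed
  have pG: "p \<in> G" using pU s0 by (simp add: G_def d_def v_def)
  have oQ: "openin (mtop M) Q" using clK by (auto simp: Q_def)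
  have YQ: "Y \<subseteq> Q"
  proof
    fix y assume y: "y \<in> Y"
    have "y \<notin> K"
    proof
      assume yK: "y \<in> K"
      then have "y \<in> Y \<inter> fst ch" using y by (auto simp: K_def)
      with e(2)[OF this] se[OF this] yK show False by (force simp: K_def)
    qed
    then show "y \<in> Q" using y Y(2) by (auto simp: Q_def)
  qed
  have oG: "openin (mtop M) G"
  proof -
    have "continuous_on UNIV d"
      unfolding d_def by (intro continuous_intros continuous_on_product_then_coordinatewise[OF continuous_on_id, of UNIV, simplified id_def])
    then have "open {w. d w < s\<^sup>2 / 2}" by (intro open_Collect_less) auto
    then have "openin (Euclidean_space dm) ({w. d w < s\<^sup>2 / 2} \<inter> ?E)" by (auto simp: openin_Euclidean_space)
    then have "openin (subtopology (Euclidean_space dm) (snd ch ` fst ch)) (snd ch ` fst ch \<inter> ({w. d w < s\<^sup>2 / 2} \<inter> ?E))"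
      by (rule openin_subtopology_Int2)
    moreover have "continuous_map (subtopology (mtop M) (fst ch)) (subtopology (Euclidean_space dm) (snd ch ` fst ch)) (snd ch)"
      by (rule homeomorphic_imp_continuous_map[OF chart_homeo[OF ch]])
    ultimately have "openin (subtopology (mtop M) (fst ch))
        {y \<in> topspace (subtopology (mtop M) (fst ch)). snd ch y \<in> snd ch ` fst ch \<inter> ({w. d w < s\<^sup>2 / 2} \<inter> ?E)}"
      by (rule openin_continuous_map_preimage[rotated])
    moreover have "{y \<in> topspace (subtopology (mtop M) (fst ch)). snd ch y \<in> snd ch ` fst ch \<inter> ({w. d w < s\<^sup>2 / 2} \<inter> ?E)} = G"
      using chart_sub[OF ch] T(2) by (auto simp: G_def)
    ultimately show ?thesis by (simp add: openin_open_subtopology[OF chart_open[OF ch]])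
  qed
  have sm: "(\<lambda>y. if y \<in> fst ch then \<theta> y * q (snd ch y) else 0) \<in> smooth_funs M" (is "?a \<in> _") if q: "cpoly q" for q
    unfolding smooth_funs_def mem_Collect_eq
  proof (rule CinfI)
    fix ps assume "ps \<notin> tuples 1"
    then show "tensor [?a] ps = 0" using chart_sub[OF ch] by (cases ps) (auto simp: tensor_def tuples_def)
  next
    fix chs :: "nat \<Rightarrow> 'p chart" assume chs: "\<And>j. j < 1 \<Longrightarrow> chs j \<in> atlas M"
    define ch' where "ch' = chs 0"
    have ch': "ch' \<in> atlas M" using chs by (simp add: ch'_def)
    let ?W1 = "coord_box 1 (\<lambda>_. snd ch' ` (fst ch' \<inter> fst ch))"
    let ?W2 = "coord_box 1 (\<lambda>_. snd ch' ` (fst ch' - K))"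
    have box: "cbox_of 1 chs = ?W1 \<union> ?W2"
    proof -
      have "K \<subseteq> fst ch" by (auto simp: K_def)
      then have "fst ch' = (fst ch' \<inter> fst ch) \<union> (fst ch' - K)" by blast
      then have "snd ch' ` fst ch' = snd ch' ` (fst ch' \<inter> fst ch) \<union> snd ch' ` (fst ch' - K)" by blast
      then show ?thesis by (auto simp: coord_box_def ch'_def)
    qed
    have W1: "rel_open 1 dm ?W1"
      by (rule rel_open_box, rule chart_open_img[OF ch']) (auto intro: openin_Int chart_open[OF ch] chart_open[OF ch'])
    have W2: "rel_open 1 dm ?W2"
      by (rule rel_open_box, rule chart_open_img[OF ch']) (auto intro: openin_diff chart_open[OF ch'] clK)
    have val: "in_charts 1 chs (tensor [?a]) x = ?a (unch ch' (x 0))" for x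
      by (simp add: in_charts_def tensor_def ch'_def)
    let ?F = "\<lambda>w. complex_of_real (2 / s\<^sup>2) * (\<Sum>i<dm. (complex_of_real (w i) + (- complex_of_real (v i))) * (complex_of_real (w i) + (- complex_of_real (v i)))) + (- 1)"
    have F: "cpoly ?F" by (intro cpoly_add cpoly_mult cpoly_sum cpoly_const cpoly_coord)
    have ReF: "Re (?F w) = 2 * d w / s\<^sup>2 - 1" for w
    proof -
      have "?F w = complex_of_real (2 * d w / s\<^sup>2 - 1)" by (simp add: d_def power2_eq_square)
      then show ?thesis by (simp only: Re_complex_of_real)
    qed
    have "smooth_coords 1 dm ?W1 (\<lambda>x. complex_of_real (cutoff (Re (?F (snd ch (unch ch' (x 0)))))) * q (snd ch (unch ch' (x 0))))"
      by (intro smooth_mult[OF W1] smooth_cutoff[OF W1] smooth_transition[OF ch ch' F] smooth_transition[OF ch ch' q])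
    then have S1: "smooth_coords 1 dm ?W1 (in_charts 1 chs (tensor [?a]))"
    proof (rule smooth_cong[OF W1, rotated])
      fix x assume "x \<in> ?W1"
      then obtain y where "y \<in> fst ch'" "y \<in> fst ch" "x 0 = snd ch' y" by (auto simp: coord_box_def)
      then have "unch ch' (x 0) \<in> fst ch" by (simp add: unch_chart[OF ch'])
      then show "in_charts 1 chs (tensor [?a]) x
          = complex_of_real (cutoff (Re (?F (snd ch (unch ch' (x 0)))))) * q (snd ch (unch ch' (x 0)))"
        by (subst val) (simp only: ReF \<theta>_def \<theta>0_def if_True)
    qed
    have S2: "smooth_coords 1 dm ?W2 (in_charts 1 chs (tensor [?a]))"
    proof (rule smooth_cong[OF W2 _ smooth_const[OF W2, of 0]])
      fix x assume "x \<in> ?W2"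
      then obtain y where "y \<in> fst ch'" "y \<notin> K" "x 0 = snd ch' y" by (auto simp: coord_box_def)
      then have "unch ch' (x 0) \<notin> K" by (simp add: unch_chart[OF ch'])
      then show "in_charts 1 chs (tensor [?a]) x = 0" using \<theta>K by (subst val) auto
    qed
    show "smooth_coords 1 dm (cbox_of 1 chs) (in_charts 1 chs (tensor [?a]))"
      unfolding box by (rule smooth_Un[OF W1 W2 S1 S2])
  qed
  show ?thesis
    unfolding ch_def[symmetric]
  proof (rule exI[of _ \<theta>], rule exI[of _ G], rule exI[of _ Q], intro conjI allI ballI impI)
    show "\<theta> y = 0" if "y \<in> Q" "y \<in> fst ch" for y using that \<theta>K by (auto simp: Q_def)
    show "G \<subseteq> fst ch" by (auto simp: G_def)
  qed (fact oG pG oQ YQ sm \<theta>G | rule sm \<theta>G, assumption)+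
qed

lemma tensor_Cinf:
  assumes "length as = N" "set as \<subseteq> smooth_funs M"
  shows "tensor as \<in> Cinf M N"
proof (rule CinfI)
  fix ps assume ps: "ps \<notin> tuples N"
  show "tensor as ps = 0"
  proof (cases "length ps = N")
    case True
    then obtain p where "p \<in> set ps" "p \<notin> pts M" using ps by (auto simp: tuples_def)
    then obtain i where i: "i < N" "ps ! i \<notin> pts M" using True by (auto simp: in_set_conv_nth)
    have "(as ! i) (ps ! i) = 0" using i assms by (intro smooth_funs_zero) auto
    then show ?thesis using True i(1) assms(1) by (auto simp: tensor_def intro!: prod_zero)
  qed (simp add: tensor_def assms)
next
  fix ch :: "nat \<Rightarrow> 'p chart" assume ch: "\<And>j. j < N \<Longrightarrow> ch j \<in> atlas M"
  have W: "rel_open N dm (cbox_of N ch)" by (rule rel_open_cbox[OF ch])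
  have "smooth_coords N dm (cbox_of N ch) (\<lambda>x. \<Prod>i<N. in_charts 1 (\<lambda>_. ch i) (tensor [as ! i]) (subst_vars 1 UNIV (\<lambda>_. i) 0 x))"
  proof (rule smooth_prod[OF W])
    fix i assume "i \<in> {..<N}"
    then have i: "i < N" by simp
    have W1: "rel_open 1 dm (cbox_of 1 (\<lambda>_. ch i))" by (rule rel_open_cbox) (rule ch[OF i])
    have "tensor [as ! i] \<in> Cinf M 1" using assms i by (auto simp: smooth_funs_def subset_iff)
    then have s: "smooth_coords 1 dm (cbox_of 1 (\<lambda>_. ch i)) (in_charts 1 (\<lambda>_. ch i) (tensor [as ! i]))"
      using ch[OF i] by (rule Cinf_smooth)
    show "smooth_coords N dm (cbox_of N ch) (\<lambda>x. in_charts 1 (\<lambda>_. ch i) (tensor [as ! i]) (subst_vars 1 UNIV (\<lambda>_. i) 0 x))"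
    proof (rule smooth_subst_vars[OF W1 W _ s])
      show "subst_vars 1 UNIV (\<lambda>_. i) 0 x \<in> cbox_of 1 (\<lambda>_. ch i)" if "x \<in> cbox_of N ch" for x
        using that i by (auto simp: coord_box_def subst_vars_def)
    qed
  qed
  then show "smooth_coords N dm (cbox_of N ch) (in_charts N ch (tensor as))"
    by (rule smooth_cong[OF W, rotated])
       (auto simp: in_charts_def tensor_def assms subst_vars_def intro!: prod.cong)
qed

definition tensor_span :: "nat \<Rightarrow> ('p list \<Rightarrow> complex) \<Rightarrow> bool" where
  "tensor_span N c \<longleftrightarrow> (\<exists>ass. (\<forall>as\<in>set ass. length as = N \<and> set as \<subseteq> smooth_funs M) \<and> c = sum_list (map tensor ass))"

lemma tensor_span_zero: "tensor_span N 0"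
  unfolding tensor_span_def by (intro exI[of _ "[]"]) simp

lemma tensor_span_step:
  assumes "tensor_span N c" "length as = N" "set as \<subseteq> smooth_funs M"
  shows "tensor_span N (c + tensor as)"
proof -
  obtain ass where "\<forall>as\<in>set ass. length as = N \<and> set as \<subseteq> smooth_funs M" "c = sum_list (map tensor ass)"
    using assms(1) by (auto simp: tensor_span_def)
  with assms(2,3) have "(\<forall>as\<in>set (as # ass). length as = N \<and> set as \<subseteq> smooth_funs M) \<and>
      c + tensor as = sum_list (map tensor (as # ass))"
    by (simp only: list.map sum_list.Cons add.commute) auto
  then show ?thesis unfolding tensor_span_def by blast
qed

lemma tensor_span_induct [consumes 1, case_names zero step]:
  assumes "tensor_span N c" and "P 0"
    and "\<And>c as. tensor_span N c \<Longrightarrow> P c \<Longrightarrow> length as = N \<Longrightarrow> set as \<subseteq> smooth_funs M \<Longrightarrow> P (c + tensor as)"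
  shows "P c"
proof -
  have "P (sum_list (map tensor ass)) \<and> tensor_span N (sum_list (map tensor ass))"
    if "\<forall>as\<in>set ass. length as = N \<and> set as \<subseteq> smooth_funs M" for ass
    using that
  proof (induction ass)
    case (Cons as ass)
    then have "P (sum_list (map tensor ass) + tensor as) \<and> tensor_span N (sum_list (map tensor ass) + tensor as)"
      using assms(3) tensor_span_step by simp
    then show ?case by (simp only: list.map sum_list.Cons add.commute)
  qed (simp only: assms(2) tensor_span_zero list.map sum_list.Nil simp_thms)
  moreover obtain ass where "\<forall>as\<in>set ass. length as = N \<and> set as \<subseteq> smooth_funs M" "c = sum_list (map tensor ass)"
    using assms(1) unfolding tensor_span_def by blast
  ultimately show ?thesis by blast
qed

lemma tensor_span_Cinf: "tensor_span N c \<Longrightarrow> c \<in> Cinf M N"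
proof (induction rule: tensor_span_induct)
  case zero show ?case by (rule Cinf_closed(1))
next
  case (step c as)
  then show ?case by (intro Cinf_closed(2) tensor_Cinf)
qed

lemma tensor_span_add: "tensor_span N c' \<Longrightarrow> tensor_span N c \<Longrightarrow> tensor_span N (c + c')"
proof (induction rule: tensor_span_induct)
  case zero then show ?case by (simp only: add.right_neutral)
next
  case (step c' as)
  then show ?case by (simp only: add.assoc[symmetric] tensor_span_step)
qed

lemma tensor_span_sum: "(\<And>a. a \<in> A \<Longrightarrow> tensor_span N (f a)) \<Longrightarrow> tensor_span N (sum f A)"
  by (induction A rule: infinite_finite_induct) (auto intro: tensor_span_zero tensor_span_add)

lemma tensor_span_eq:
  assumes A: "jetop N K A" and B: "jetop N K B"
    and eq: "\<And>as. length as = N \<Longrightarrow> set as \<subseteq> smooth_funs M \<Longrightarrow> A (tensor as) = B (tensor as)"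
  shows "tensor_span N c \<Longrightarrow> A c = B c"
proof (induction rule: tensor_span_induct)
  case (step c as)
  have t: "tensor as \<in> Cinf M N" using step by (intro tensor_Cinf)
  have "A (c + tensor as) = A c + A (tensor as)"
    by (rule jetopD(2)[OF A tensor_span_Cinf[OF step(1)] t])
  moreover have "B (c + tensor as) = B c + B (tensor as)"
    by (rule jetopD(2)[OF B tensor_span_Cinf[OF step(1)] t])
  moreover have "A (tensor as) = B (tensor as)" "A c = B c" using step eq by blast+
  ultimately show ?case by (simp only:)
qed (simp only: jetop_zero_value[OF A] jetop_zero_value[OF B])

end

text \<open>Local counterpart: spans of products of polynomials in the separate variables.\<close>

inductive tspan :: "nat \<Rightarrow> (pt \<Rightarrow> complex) \<Rightarrow> bool" for N where
  tspan_zero: "tspan N (\<lambda>_. 0)"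
| tspan_step: "tspan N T \<Longrightarrow> (\<And>j. j < N \<Longrightarrow> cpoly (qs j)) \<Longrightarrow> tspan N (\<lambda>x. T x + (\<Prod>j<N. qs j (x j)))"

lemma tspan_add: "tspan N T' \<Longrightarrow> tspan N T \<Longrightarrow> tspan N (\<lambda>x. T x + T' x)"
proof (induction rule: tspan.induct)
  case (tspan_step T' qs)
  then have "tspan N (\<lambda>x. (T x + T' x) + (\<Prod>j<N. qs j (x j)))" by (intro tspan.tspan_step) auto
  then show ?case by (simp add: add.assoc)
qed simp

lemma tspan_sum: "(\<And>a. a \<in> A \<Longrightarrow> tspan N (f a)) \<Longrightarrow> tspan N (\<lambda>x. \<Sum>a\<in>A. f a x)"
proof (induction A rule: infinite_finite_induct)
  case (insert a A)
  then show ?case using tspan_add[of N "\<lambda>x. \<Sum>a\<in>A. f a x" "f a"] by simp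
qed (auto intro: tspan_zero)

lemma tspan_mult:
  assumes j: "j < N" and p: "cpoly p"
  shows "tspan N T \<Longrightarrow> tspan N (\<lambda>x. p (x j) * T x)"
proof (induction rule: tspan.induct)
  case tspan_zero
  then show ?case by (simp add: tspan.tspan_zero)
next
  case (tspan_step T qs)
  have prod: "(\<Prod>k<N. (qs(j := (\<lambda>v. p v * qs j v))) k (x k)) = p (x j) * (\<Prod>k<N. qs k (x k))" for x
  proof -
    have "(\<Prod>k<N. (qs(j := (\<lambda>v. p v * qs j v))) k (x k)) = (\<Prod>k<N. (if k = j then p (x j) else 1) * qs k (x k))"
      by (intro prod.cong) auto
    then show ?thesis using j by (simp add: prod.distrib prod.delta)
  qed
  have "tspan N (\<lambda>x. p (x j) * T x + (\<Prod>k<N. (qs(j := (\<lambda>v. p v * qs j v))) k (x k)))"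
    using tspan_step by (intro tspan.tspan_step) (auto intro: cpoly_mult p)
  then show ?case by (simp only: prod distrib_left)
qed

lemma tspan_tay:
  assumes N: "0 < N"
  shows "tspan N (tay N n x0 R F)"
proof (induction R arbitrary: F)
  case 0
  have "tspan N (\<lambda>x. 0 + (\<Prod>j<N. (\<lambda>_. 1) (x j)))" by (intro tspan_step tspan_zero cpoly_const)
  then have "tspan N (\<lambda>x. (\<lambda>_. F x0) (x 0) * (0 + (\<Prod>j<N. (\<lambda>_. 1) (x j))))" by (rule tspan_mult[OF N cpoly_const])
  then show ?case by simp
next
  case (Suc R)
  have "tspan N (\<lambda>x. \<Sum>j<N. \<Sum>i<n. (complex_of_real (x j i) + (- complex_of_real (x0 j i))) * tay N n x0 R (partial_der j i F) x)"
  proof (intro tspan_sum)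
    fix j i assume "j \<in> {..<N}"
    then show "tspan N (\<lambda>x. (complex_of_real (x j i) + (- complex_of_real (x0 j i))) * tay N n x0 R (partial_der j i F) x)"
      using tspan_mult[OF _ cpoly_add[OF cpoly_coord[of i] cpoly_const[of "- complex_of_real (x0 j i)"]] Suc[of "partial_der j i F"], of j]
      by simp
  qed
  from tspan_mult[OF N cpoly_const this, of "1 / of_nat (Suc R)"]
  show ?case by (simp del: of_nat_Suc)
qed

context smooth_mfd
begin

lemma jet0_add:
  assumes zs: "zs \<in> tuples N" and c: "c \<in> Cinf M N" "c' \<in> Cinf M N" and j: "jet0 r c zs" "jet0 r c' zs"
  shows "jet0 r (c + c') zs"
proof -
  let ?ch = "\<lambda>j. chart_at (zs ! j)"
  have ch: "?ch j \<in> atlas M" if "j < N" for j by (rule chart_at_atlas[OF zs that])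
  have W: "rel_open N dm (cbox_of N ?ch)" by (rule rel_open_cbox[OF ch])
  have 1: "smooth_coords N dm (cbox_of N ?ch) (in_charts N ?ch c)" by (rule Cinf_smooth[OF c(1) ch])
  have 2: "smooth_coords N dm (cbox_of N ?ch) (in_charts N ?ch c')" by (rule Cinf_smooth[OF c(2) ch])
  show ?thesis
    using van_add[OF W crd_mem[OF zs] 1 2] j by (simp add: jet0_def tuples_length[OF zs] in_charts_def[abs_def])
qed

lemma jet0_minus:
  assumes zs: "zs \<in> tuples N" and c: "c \<in> Cinf M N" and j: "jet0 r c zs"
  shows "jet0 r (- c) zs"
proof -
  let ?ch = "\<lambda>j. chart_at (zs ! j)"
  have ch: "?ch j \<in> atlas M" if "j < N" for j by (rule chart_at_atlas[OF zs that])
  have W: "rel_open N dm (cbox_of N ?ch)" by (rule rel_open_cbox[OF ch])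
  have 1: "smooth_coords N dm (cbox_of N ?ch) (in_charts N ?ch c)" by (rule Cinf_smooth[OF c ch])
  show ?thesis
    using van_mult[OF W crd_mem[OF zs] smooth_const[OF W, of "-1"] 1] j
    by (simp add: jet0_def tuples_length[OF zs] in_charts_def[abs_def])
qed

lemma jet0_zero: "zs \<in> tuples N \<Longrightarrow> jet0 r 0 zs"
proof -
  assume zs: "zs \<in> tuples N"
  let ?ch = "\<lambda>j. chart_at (zs ! j)"
  have ch: "?ch j \<in> atlas M" if "j < N" for j by (rule chart_at_atlas[OF zs that])
  have W: "rel_open N dm (cbox_of N ?ch)" by (rule rel_open_cbox[OF ch])
  show ?thesis
    using van_zero[OF W crd_mem[OF zs]] by (simp add: jet0_def tuples_length[OF zs] in_charts_def[abs_def])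
qed

lemma jet0_sum:
  assumes zs: "zs \<in> tuples N"
  shows "(\<And>a. a \<in> A \<Longrightarrow> f a \<in> Cinf M N) \<Longrightarrow> (\<And>a. a \<in> A \<Longrightarrow> jet0 r (f a) zs) \<Longrightarrow> jet0 r (sum f A) zs"
  by (induction A rule: infinite_finite_induct)
     (auto simp: jet0_zero[OF zs] intro!: jet0_add[OF zs] Cinf_closed(6))

text \<open>
  Multiply each polynomial factor by a bump function at the corresponding point. A point \<open>y\<close> of
  \<open>Z\<close> other than \<open>z\<close> differs from \<open>z\<close> in some coordinate, and there the bump function vanishes
  identically.
\<close>

lemma tensor_span_local:
  assumes Z: "finite Z" "Z \<subseteq> tuples N" and z: "z \<in> Z"
  shows "tspan N T \<Longrightarrow> \<exists>c W. tensor_span N c \<and> rel_open N dm W \<and> crd z \<in> W \<and>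
    (\<forall>x\<in>W. in_charts N (\<lambda>j. chart_at (z ! j)) c x = T x) \<and> (\<forall>y\<in>Z - {z}. \<forall>r. jet0 r c y)"
proof (induction rule: tspan.induct)
  case tspan_zero
  have zt: "z \<in> tuples N" using Z z by blast
  have W: "rel_open N dm (cbox_of N (\<lambda>j. chart_at (z ! j)))"
    by (rule rel_open_cbox) (rule chart_at_atlas[OF zt])
  have j0: "jet0 r 0 y" if "y \<in> Z - {z}" for r y
    using that Z(2) jet0_zero[of y N r] by blast
  show ?case
  proof (rule exI[of _ "0 :: 'p list \<Rightarrow> complex"], rule exI[of _ "cbox_of N (\<lambda>j. chart_at (z ! j))"], intro conjI ballI allI)
    show "in_charts N (\<lambda>j. chart_at (z ! j)) 0 x = 0" for x by (simp add: in_charts_def)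
  qed (use W crd_mem[OF zt] j0 tensor_span_zero in blast)+
next
  case (tspan_step T qs)
  have zt: "z \<in> tuples N" using Z z by blast
  obtain c W where c: "tensor_span N c" and W: "rel_open N dm W" "crd z \<in> W"
    and cT: "\<And>x. x \<in> W \<Longrightarrow> in_charts N (\<lambda>j. chart_at (z ! j)) c x = T x"
    and cj: "\<And>y r. y \<in> Z - {z} \<Longrightarrow> jet0 r c y"
    using tspan_step.IH by blast
  define Y where "Y = (\<Union>y\<in>Z. set y)"
  have Y: "finite Y" "Y \<subseteq> pts M" using Z by (auto simp: Y_def tuples_def)
  define PP where "PP = (\<lambda>j \<theta> G Q. openin (mtop M) G \<and> z ! j \<in> G \<and> G \<subseteq> fst (chart_at (z ! j)) \<and>
     openin (mtop M) Q \<and> Y - {z ! j} \<subseteq> Q \<and>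
     (\<forall>q. cpoly q \<longrightarrow> (\<lambda>y. if y \<in> fst (chart_at (z ! j)) then \<theta> y * q (snd (chart_at (z ! j)) y) else 0) \<in> smooth_funs M) \<and>
     (\<forall>y\<in>G. \<theta> y = 1) \<and> (\<forall>y\<in>Q. y \<in> fst (chart_at (z ! j)) \<longrightarrow> \<theta> y = (0::complex)))"
  have "\<exists>\<theta> G Q. PP j \<theta> G Q" if "j < N" for j
    unfolding PP_def
    by (rule bump[OF tuples_nth[OF zt that]]) (use Y in auto)
  then have "\<exists>\<theta> G Q. \<forall>j<N. PP j (\<theta> j) (G j) (Q j)" by metis
  then obtain \<theta> G Q where "\<forall>j<N. PP j (\<theta> j) (G j) (Q j)" by blast
  then have PP: "PP j (\<theta> j) (G j) (Q j)" if "j < N" for j using that by blast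
  have G: "\<And>j. j < N \<Longrightarrow> openin (mtop M) (G j)" "\<And>j. j < N \<Longrightarrow> z ! j \<in> G j"
      "\<And>j. j < N \<Longrightarrow> G j \<subseteq> fst (chart_at (z ! j))"
    and Q: "\<And>j. j < N \<Longrightarrow> openin (mtop M) (Q j)" "\<And>j. j < N \<Longrightarrow> Y - {z ! j} \<subseteq> Q j"
    and sm: "\<And>j q. j < N \<Longrightarrow> cpoly q \<Longrightarrow>
      (\<lambda>y. if y \<in> fst (chart_at (z ! j)) then \<theta> j y * q (snd (chart_at (z ! j)) y) else 0) \<in> smooth_funs M"
    and \<theta>1: "\<And>j y. j < N \<Longrightarrow> y \<in> G j \<Longrightarrow> \<theta> j y = (1::complex)"
    and \<theta>0: "\<And>j y. j < N \<Longrightarrow> y \<in> Q j \<Longrightarrow> y \<in> fst (chart_at (z ! j)) \<Longrightarrow> \<theta> j y = 0"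
    using PP unfolding PP_def by blast+
  define a where "a = (\<lambda>j y. if y \<in> fst (chart_at (z ! j)) then \<theta> j y * qs j (snd (chart_at (z ! j)) y) else 0)"
  define as where "as = map a [0..<N]"
  have as: "length as = N" "set as \<subseteq> smooth_funs M"
    using sm tspan_step.hyps(2) by (auto simp: as_def a_def)
  let ?ch = "\<lambda>j. chart_at (z ! j)"
  have ch: "?ch j \<in> atlas M" if "j < N" for j by (rule chart_at_atlas[OF zt that])
  have ten: "in_charts N chs (tensor as) x = (\<Prod>j<N. a j (unch (chs j) (x j)))" for chs x
    by (simp add: in_charts_def tensor_def as_def)
  define W0 where "W0 = coord_box N (\<lambda>j. snd (?ch j) ` G j)"
  have W0: "rel_open N dm W0" unfolding W0_def by (rule rel_open_image_box[OF ch G(1,3)])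
  have zW0: "crd z \<in> W0" using G(2) by (auto simp: W0_def coord_box_def crd_def tuples_length[OF zt])
  have near: "in_charts N ?ch (tensor as) x = (\<Prod>j<N. qs j (x j))" if x: "x \<in> W0" for x
    unfolding ten
  proof (rule prod.cong[OF refl])
    fix j assume "j \<in> {..<N}"
    then have j: "j < N" by simp
    then obtain y where y: "y \<in> G j" "x j = snd (?ch j) y" using x by (auto simp: W0_def coord_box_def)
    then show "a j (unch (?ch j) (x j)) = qs j (x j)"
      using \<theta>1[OF j y(1)] G(3)[OF j] unch_chart[OF ch[OF j], of y] by (auto simp: a_def)
  qed
  have far: "jet0 r (tensor as) y" if y: "y \<in> Z - {z}" for y r
  proof -
    have yt: "y \<in> tuples N" using y Z(2) by blast
    obtain j where j: "j < N" "y ! j \<noteq> z ! j"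
      using y nth_equalityI[of y z] tuples_length[OF yt] tuples_length[OF zt] by auto
    have "y ! j \<in> Y" using y j(1) tuples_length[OF yt] by (auto simp: Y_def intro!: bexI[of _ y])
    then have yQ: "y ! j \<in> Q j" using Q(2)[OF j(1)] j(2) by blast
    let ?chy = "\<lambda>j. chart_at (y ! j)"
    have chy: "?chy j \<in> atlas M" if "j < N" for j by (rule chart_at_atlas[OF yt that])
    define H where "H = (\<lambda>l. if l = j then fst (?chy l) \<inter> Q j else fst (?chy l))"
    have H: "openin (mtop M) (H l)" "H l \<subseteq> fst (?chy l)" if "l < N" for l
      using chart_open[OF chy[OF that]] Q(1)[OF j(1)] by (auto simp: H_def)
    define V where "V = coord_box N (\<lambda>l. snd (?chy l) ` H l)"
    have V: "rel_open N dm V" unfolding V_def by (rule rel_open_image_box[OF chy H])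
    have yV: "crd y \<in> V"
      using chart_at(2)[OF tuples_nth[OF yt]] yQ by (auto simp: V_def coord_box_def crd_def tuples_length[OF yt] H_def)
    have z0: "in_charts N ?chy (tensor as) x = 0" if x: "x \<in> V" for x
    proof -
      obtain w where w: "w \<in> H j" "x j = snd (?chy j) w" using x j(1) by (auto simp: V_def coord_box_def)
      then have "unch (?chy j) (x j) = w" using H(2)[OF j(1)] unch_chart[OF chy[OF j(1)], of w] by auto
      then have "a j (unch (?chy j) (x j)) = 0" using \<theta>0[OF j(1)] w(1) by (auto simp: a_def H_def)
      then show ?thesis unfolding ten using j(1) by (auto intro!: prod_zero)
    qed
    have "van N dm r (in_charts N ?chy (tensor as)) (crd y)"
      by (rule van_cong[OF V yV _ van_zero[OF V yV]]) (simp add: z0)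
    then show ?thesis by (simp add: jet0_def tuples_length[OF yt])
  qed
  have WW: "rel_open N dm (W \<inter> W0)"
    by (rule rel_open_Int[OF W(1) W0])
  have sum_ch: "in_charts N ?ch (c + tensor as) x = T x + (\<Prod>j<N. qs j (x j))" if "x \<in> W \<inter> W0" for x
  proof -
    have "in_charts N ?ch (c + tensor as) x = in_charts N ?ch c x + in_charts N ?ch (tensor as) x"
      by (simp only: in_charts_def plus_fun_apply)
    moreover have "x \<in> W" "x \<in> W0" using that by auto
    ultimately show ?thesis by (simp only: cT near)
  qed
  have "jet0 r (c + tensor as) y" if "y \<in> Z - {z}" for y r
  proof -
    have "y \<in> tuples N" using that Z(2) by blast
    then show ?thesis by (rule jet0_add[OF _ tensor_span_Cinf[OF c] tensor_Cinf[OF as] cj[OF that] far[OF that]])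
  qed
  moreover have "crd z \<in> W \<inter> W0" using W(2) zW0 by blast
  ultimately show ?case
    using tensor_span_step[OF c as] WW sum_ch by blast
qed

text \<open>
  Taylor polynomials are sums of products of polynomials in the separate variables; realize them
  near each point of \<open>Z\<close> without disturbing the others, and add up.
\<close>

lemma tensor_density:
  assumes N: "0 < N" and Z: "finite Z" "Z \<subseteq> tuples N" and c: "c \<in> Cinf M N"
  obtains c' where "tensor_span N c'" "\<And>z. z \<in> Z \<Longrightarrow> jet0 r (c - c') z"
proof -
  define T where "T = (\<lambda>z x. \<Sum>R\<le>r. tay N dm (crd z) R (in_charts N (\<lambda>j. chart_at (z ! j)) c) x)"
  have "\<exists>c'. tensor_span N c' \<and> jet0 r (c - c') z \<and> (\<forall>y\<in>Z - {z}. jet0 r c' y)" if z: "z \<in> Z" for z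
  proof -
    have zt: "z \<in> tuples N" using z Z by blast
    let ?ch = "\<lambda>j. chart_at (z ! j)"
    have ch: "?ch j \<in> atlas M" if "j < N" for j by (rule chart_at_atlas[OF zt that])
    have "tspan N (T z)" unfolding T_def by (intro tspan_sum tspan_tay[OF N])
    from tensor_span_local[OF Z z this] obtain c' W where c': "tensor_span N c'" and W: "rel_open N dm W" "crd z \<in> W"
      and eq: "\<And>x. x \<in> W \<Longrightarrow> in_charts N ?ch c' x = T z x" and far: "\<And>y r. y \<in> Z - {z} \<Longrightarrow> jet0 r c' y" by blast
    have B: "rel_open N dm (cbox_of N ?ch)" by (rule rel_open_cbox[OF ch])
    have "smooth_coords N dm (cbox_of N ?ch) (in_charts N ?ch c)" by (rule Cinf_smooth[OF c ch])
    from van_taylor[OF B crd_mem[OF zt] this, of r]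
    have "van N dm r (\<lambda>x. in_charts N ?ch c x - T z x) (crd z)" by (simp add: T_def)
    then have "van N dm r (in_charts N ?ch (c - c')) (crd z)"
      by (rule van_cong[OF W, rotated]) (simp add: eq[symmetric] in_charts_def)
    then show ?thesis using c' far by (auto simp: jet0_def tuples_length[OF zt])
  qed
  then obtain f where f: "\<And>z. z \<in> Z \<Longrightarrow> tensor_span N (f z)" "\<And>z. z \<in> Z \<Longrightarrow> jet0 r (c - f z) z"
    "\<And>z y. z \<in> Z \<Longrightarrow> y \<in> Z - {z} \<Longrightarrow> jet0 r (f z) y" by metis
  show ?thesis
  proof (rule that[of "sum f Z"])
    show "tensor_span N (sum f Z)" by (rule tensor_span_sum[OF f(1)])
    fix z assume z: "z \<in> Z"
    have zt: "z \<in> tuples N" using z Z by blast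
    have fC: "f y \<in> Cinf M N" if "y \<in> Z" for y using tensor_span_Cinf[OF f(1)[OF that]] .
    have rest: "sum f (Z - {z}) \<in> Cinf M N" using fC by (intro Cinf_closed(6)) auto
    have "jet0 r (sum f (Z - {z})) z" using f(3) z fC by (intro jet0_sum[OF zt]) auto
    then have "jet0 r ((c - f z) + (- sum f (Z - {z}))) z"
      using c fC[OF z] rest by (intro jet0_add[OF zt] f(2)[OF z] jet0_minus[OF zt] Cinf_closed(3,5))
    moreover have "c - sum f Z = (c - f z) + (- sum f (Z - {z}))"
      using sum.remove[OF Z(1) z, of f] by simp
    ultimately show "jet0 r (c - sum f Z) z" by (simp only:)
  qed
qed

text \<open>
  At a given point both values depend on finitely many jets only, and these are matched by a
  finite sum of tensors.
\<close>

theorem jetop_eq_tensors: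
  assumes N: "0 < N" and A: "jetop N K A" and B: "jetop N K B"
    and eq: "\<And>as. length as = N \<Longrightarrow> set as \<subseteq> smooth_funs M \<Longrightarrow> A (tensor as) = B (tensor as)"
    and c: "c \<in> Cinf M N"
  shows "A c = B c"
proof
  fix ps
  show "A c ps = B c ps"
  proof (cases "ps \<in> tuples K")
    case True
    obtain Z k where Z: "finite Z" "Z \<subseteq> tuples N" and Zk: "\<forall>c\<in>Cinf M N. (\<forall>w\<in>Z. jet0 k c w) \<longrightarrow> jet0 0 (A c) ps"
      using jetop_jets[OF A True, of 0] by blast
    obtain Y l where Y: "finite Y" "Y \<subseteq> tuples N" and Yl: "\<forall>c\<in>Cinf M N. (\<forall>w\<in>Y. jet0 l c w) \<longrightarrow> jet0 0 (B c) ps"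
      using jetop_jets[OF B True, of 0] by blast
    have ZY: "finite (Z \<union> Y)" "Z \<union> Y \<subseteq> tuples N" using Z Y by auto
    obtain c' where c': "tensor_span N c'" and j: "\<And>z. z \<in> Z \<union> Y \<Longrightarrow> jet0 (k + l) (c - c') z"
      using tensor_density[OF N ZY c, of "k + l"] by blast
    have C: "c' \<in> Cinf M N" "c - c' \<in> Cinf M N" using tensor_span_Cinf[OF c'] c Cinf_closed(3) by auto
    have "jet0 0 (A (c - c')) ps"
      using Zk C(2) jet0_mono[OF j, of _ k] by simp
    moreover have "jet0 0 (B (c - c')) ps"
      using Yl C(2) jet0_mono[OF j, of _ l] by simp
    ultimately have "A (c - c') ps = 0" "B (c - c') ps = 0"
      using jet0_value[OF True] by blast+
    then have "A c ps - A c' ps = 0" "B c ps - B c' ps = 0"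
      using jetop_diff_value[OF A c C(1)] jetop_diff_value[OF B c C(1)] by simp_all
    moreover have "A c' = B c'" by (rule tensor_span_eq[OF A B eq c'])
    ultimately show ?thesis by simp
  next
    case False
    then show ?thesis using CinfD[OF jetopD(1)[OF A c]] CinfD[OF jetopD(1)[OF B c]] by simp
  qed
qed

end

section \<open>Hochschild and cyclic operators on tensors\<close>

context smooth_mfd
begin

lemma tensor_map2:
  "tensor as ps = (if length ps = length as then prod_list (map2 (\<lambda>a p. a p) as ps) else 0)"
  by (auto simp: tensor_def prod.list_conv_set_nth atLeast0LessThan)

lemma tensor_append:
  "length ps = length us \<Longrightarrow> tensor (us @ ws) (ps @ qs) = tensor us ps * tensor ws qs"
  by (auto simp: tensor_map2)

lemma tensor_single: "tensor [a] [p] = a p"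
  by (simp add: tensor_map2)

lemma tensor_zero: "0 \<in> set as \<Longrightarrow> tensor as = 0"
proof
  fix ps assume "0 \<in> set as"
  then obtain i where "i < length as" "as ! i = 0" by (auto simp: in_set_conv_nth)
  then show "tensor as ps = 0 ps" by (auto simp: tensor_def intro!: prod_zero bexI[of _ i])
qed

lemma unit_smooth: "unit_fun M \<in> smooth_funs M"
proof -
  have "tensor [] \<in> Cinf M 0" by (rule tensor_Cinf) auto
  then have "reindex 0 1 (\<lambda>k. k) (tensor []) \<in> Cinf M 1"
    by (rule jetopD(1)[OF jetop_reindex, rotated]) simp
  also have "reindex 0 1 (\<lambda>k. k) (tensor []) = tensor [unit_fun M]"
  proof
    fix ps :: "'p list"
    show "reindex 0 1 (\<lambda>k. k) (tensor []) ps = tensor [unit_fun M] ps"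
      by (cases ps) (auto simp: reindex_def tuples_def tensor_def unit_fun_def)
  qed
  finally show ?thesis by (simp add: smooth_funs_def)
qed

lemma Cinf_one:
  assumes c: "c \<in> Cinf M 1"
  shows "c = tensor [\<lambda>p. c [p]]" "(\<lambda>p. c [p]) \<in> smooth_funs M"
proof -
  show eq: "c = tensor [\<lambda>p. c [p]]"
  proof
    fix ps show "c ps = tensor [\<lambda>p. c [p]] ps"
      using CinfD[OF c, of ps] by (cases ps) (auto simp: tensor_def tuples_def)
  qed
  show "(\<lambda>p. c [p]) \<in> smooth_funs M" using c eq by (simp add: smooth_funs_def)
qed

lemma ins_single: "ins D 0 c [p] = D c p"
  by (simp add: ins_def)

lemma multidiff_linear:
  assumes D: "multidiff M d D"
  shows "c \<in> Cinf M d \<Longrightarrow> c' \<in> Cinf M d \<Longrightarrow> D (c + c') = D c + D c'"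
    and "c \<in> Cinf M d \<Longrightarrow> D (a \<bullet>\<^sub>C c) = a \<bullet>\<^sub>C D c"
    and "(\<And>s. s \<in> S \<Longrightarrow> h s \<in> Cinf M d) \<Longrightarrow> D (\<Sum>s\<in>S. h s) = (\<Sum>s\<in>S. D (h s))"
proof -
  have J: "jetop d 1 (ins D 0)" using jetop_ins[OF D, of 0 1] by simp
  show "D (c + c') = D c + D c'" if "c \<in> Cinf M d" "c' \<in> Cinf M d"
  proof
    fix p show "D (c + c') p = (D c + D c') p"
      using fun_cong[OF jetopD(2)[OF J that], of "[p]"] unfolding plus_fun_apply ins_single .
  qed
  show "D (a \<bullet>\<^sub>C c) = a \<bullet>\<^sub>C D c" if "c \<in> Cinf M d"
  proof
    fix p show "D (a \<bullet>\<^sub>C c) p = (a \<bullet>\<^sub>C D c) p"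
      using fun_cong[OF jetopD(3)[OF J that, of a], of "[p]"] unfolding cscale_fun_apply ins_single .
  qed
  show "D (\<Sum>s\<in>S. h s) = (\<Sum>s\<in>S. D (h s))" if "\<And>s. s \<in> S \<Longrightarrow> h s \<in> Cinf M d"
  proof
    fix p
    have "ins D 0 (\<Sum>s\<in>S. h s) [p] = (\<Sum>s\<in>S. ins D 0 (h s)) [p]"
      by (rule fun_cong[OF jetop_sum_value[OF J that]])
    then show "D (\<Sum>s\<in>S. h s) p = (\<Sum>s\<in>S. D (h s)) p"
      unfolding sum_fun_apply ins_single .
  qed
qed

lemma ins_append: "length ps = i \<Longrightarrow> ins D i c (ps @ p # qs) = D (\<lambda>ys. c (ps @ ys @ qs)) p"
  by (auto simp: ins_def)

text \<open>
  Functions of the wrong number of points vanish, so partial evaluations can be compared on tuples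
  of the right length only.
\<close>

lemma slice_eq:
  assumes c: "c \<in> Cinf M L" and g: "g \<in> Cinf M d" and L: "length ps + d + length qs = L"
    and eq: "\<And>ys. ys \<in> tuples d \<Longrightarrow> c (ps @ ys @ qs) = g ys"
  shows "(\<lambda>ys. c (ps @ ys @ qs)) = g"
proof
  fix ys show "c (ps @ ys @ qs) = g ys"
  proof (cases "ys \<in> tuples d")
    case False
    then have "ps @ ys @ qs \<notin> tuples L" using L by (auto simp: tuples_def)
    then show ?thesis using CinfD[OF c] CinfD[OF g False] by simp
  qed (rule eq)
qed

lemma ins_tensor:
  assumes D: "multidiff M (length vs) D" and S: "set (us @ vs @ ws) \<subseteq> smooth_funs M"
  shows "ins D (length us) (tensor (us @ vs @ ws)) = tensor (us @ D (tensor vs) # ws)"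
proof
  fix rs
  let ?N = "length us + 1 + length ws"
  have cs: "tensor (us @ vs @ ws) \<in> Cinf M (?N + length vs - 1)" by (rule tensor_Cinf) (use S in auto)
  have cv: "tensor vs \<in> Cinf M (length vs)" by (rule tensor_Cinf) (use S in auto)
  have ct: "tensor (us @ D (tensor vs) # ws) \<in> Cinf M ?N"
    by (rule tensor_Cinf) (use S cochain_smooth[OF D cv] in auto)
  show "ins D (length us) (tensor (us @ vs @ ws)) rs = tensor (us @ D (tensor vs) # ws) rs"
  proof (cases "rs \<in> tuples ?N")
    case False
    then show ?thesis using ins_support[OF D cs False] CinfD[OF ct False] by simp
  next
    case True
    then obtain ps p qs where rs: "rs = ps @ p # qs" "length ps = length us" "length qs = length ws"
      using id_take_nth_drop[of "length us" rs] by (auto simp: tuples_def intro!: that[of "take (length us) rs"])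
    have "(\<lambda>ys. tensor (us @ vs @ ws) (ps @ ys @ qs)) = (tensor us ps * tensor ws qs) \<bullet>\<^sub>C tensor vs"
    proof (rule slice_eq[OF cs Cinf_closed(4)[OF cv]])
      show "length ps + length vs + length qs = ?N + length vs - 1" using rs by simp
      show "tensor (us @ vs @ ws) (ps @ ys @ qs) = ((tensor us ps * tensor ws qs) \<bullet>\<^sub>C tensor vs) ys"
        if "ys \<in> tuples (length vs)" for ys
        using that rs by (simp add: tensor_append tuples_length)
    qed
    then have "ins D (length us) (tensor (us @ vs @ ws)) rs = ((tensor us ps * tensor ws qs) \<bullet>\<^sub>C D (tensor vs)) p"
      unfolding rs(1) ins_append[OF rs(2)] multidiff_linear(2)[OF D cv, symmetric] by simp
    also have "\<dots> = tensor (us @ D (tensor vs) # ws) rs"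
      using rs tensor_append[of "[p]" "[D (tensor vs)]" ws qs] by (simp add: tensor_append tensor_single)
    finally show ?thesis .
  qed
qed

text \<open>
  \<open>a\<^sub>0 \<otimes> \<dots> \<otimes> a\<^sub>n \<mapsto> a\<^sub>n \<otimes> a\<^sub>0 \<otimes> \<dots> \<otimes> a\<^sub>n\<^sub>-\<^sub>1\<close>; it turns the last face of the Hochschild
  differential into a face with adjacent arguments.
\<close>

definition rot :: "nat \<Rightarrow> ('p list \<Rightarrow> complex) \<Rightarrow> 'p list \<Rightarrow> complex" where
  "rot N = reindex N N (\<lambda>k. (k + 1) mod N)"

lemma jetop_rot: "jetop N N (rot N)"
  unfolding rot_def by (rule jetop_reindex) auto

lemma hoch_b_off:
  assumes D: "multidiff M 2 D" and c: "c \<in> Cinf M (n + 1)" and ps: "ps \<notin> tuples n"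
  shows "hoch_b M D c ps = 0"
proof (cases "ps = [] \<or> \<not> set ps \<subseteq> pts M")
  case True then show ?thesis by (simp add: hoch_b_def)
next
  case False
  then have len: "length ps \<noteq> n" and ne: "ps \<noteq> []" using ps by (auto simp: tuples_def)
  have z: "D h = 0" if h: "\<And>ys. ys \<in> tuples 2 \<Longrightarrow> h ys = 0" for h
  proof (cases "h \<in> Cinf M 2")
    case True
    have "h = 0" by (rule ext) (use h CinfD[OF True] in \<open>auto simp del: One_nat_def\<close>)
    then show ?thesis by (simp add: cochain_null[OF D])
  qed (rule cochain_zero[OF D])
  have v: "c rs = 0" if "length rs = length ps + 1" for rs
    by (rule CinfD[OF c]) (use that len in \<open>auto simp: tuples_def\<close>)
  have a: "D (\<lambda>ys. c (drop 1 ys @ tl ps @ take 1 ys)) = 0"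
    by (rule z, rule v) (use ne in \<open>auto simp: tuples_def Suc_le_eq\<close>)
  have b: "D (\<lambda>ys. c (take i ps @ ys @ drop (i + 1) ps)) = 0" if "i < length ps" for i
    by (rule z, rule v) (use ne that in \<open>auto simp: tuples_def\<close>)
  show ?thesis unfolding hoch_b_def Let_def using False a b by simp
qed

text \<open>
  A chain of degree zero has no faces: the result would be evaluated at the empty tuple, where
  \<open>hoch_b\<close> vanishes.
\<close>

lemma hoch_b_zero:
  assumes D: "multidiff M 2 D" and c: "c \<in> Cinf M 1"
  shows "hoch_b M D c = 0"
proof
  fix ps show "hoch_b M D c ps = 0 ps"
  proof (cases "ps = []")
    case False
    then show ?thesis using hoch_b_off[OF D, of c 0 ps] c by (simp add: tuples_def)
  qed (simp add: hoch_b_def)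
qed

lemma hoch_b_faces:
  assumes D: "multidiff M 2 D" and c: "c \<in> Cinf M (n + 1)" and n: "0 < n"
  shows "hoch_b M D c = (\<Sum>i<n. (-1) ^ i \<bullet>\<^sub>C ins D i c) + (-1) ^ n \<bullet>\<^sub>C ins D 0 (rot (n + 1) c)"
proof
  fix ps
  have c2: "c \<in> Cinf M (n + 2 - 1)" using c by simp
  have rc: "rot (n + 1) c \<in> Cinf M (n + 1)" by (rule jetopD(1)[OF jetop_rot c])
  then have rc2: "rot (n + 1) c \<in> Cinf M (n + 2 - 1)" by simp
  show "hoch_b M D c ps = ((\<Sum>i<n. (-1) ^ i \<bullet>\<^sub>C ins D i c) + (-1) ^ n \<bullet>\<^sub>C ins D 0 (rot (n + 1) c)) ps"
  proof (cases "ps \<in> tuples n")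
    case False
    have "ins D i c ps = 0" if "i < n" for i by (rule ins_support[OF D c2 False that])
    then show ?thesis
      using ins_support[OF D rc2 False n] hoch_b_off[OF D c False] by (simp add: sum_fun_apply)
  next
    case True
    then have len: "length ps = n" and sub: "set ps \<subseteq> pts M" by (auto simp: tuples_def)
    then have ne: "ps \<noteq> []" using n by auto
    have "c (drop 1 ys @ tl ps @ take 1 ys) = rot (n + 1) c (take 0 ps @ ys @ drop (0 + 1) ps)" for ys
    proof (cases "ys \<in> tuples 2")
      case ys: True
      then obtain y z where yz: "ys = [y, z]" "y \<in> pts M" "z \<in> pts M"
        by (auto simp: tuples_def length_Suc_conv numeral_2_eq_2)
      have t: "y # z # tl ps \<in> tuples (n + 1)" using yz len sub n set_drop_subset[of 1 ps]
        by (auto simp: tuples_def drop_Suc)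
      have "map (\<lambda>k. (y # z # tl ps) ! ((k + 1) mod (n + 1))) [0..<n + 1] = z # tl ps @ [y]" (is "?l = ?r")
      proof (rule nth_equalityI)
        show "length ?l = length ?r" using len n by simp
        show "?l ! i = ?r ! i" if "i < length ?l" for i
        proof (cases "i = n")
          case True then show ?thesis using len n by (simp add: nth_Cons' nth_append del: upt_Suc)
        next
          case False
          then have "i < n" using that by simp
          then show ?thesis using len n by (auto simp: nth_Cons' nth_append nth_tl simp del: upt_Suc)
        qed
      qed
      then show ?thesis using t yz by (simp add: rot_def reindex_def drop_Suc)
    next
      case False
      have "drop 1 ys @ tl ps @ take 1 ys \<notin> tuples (n + 1)"
      proof
        assume "drop 1 ys @ tl ps @ take 1 ys \<in> tuples (n + 1)"
        then have "length ys = 2" "set (drop 1 ys @ take 1 ys) \<subseteq> pts M" using len n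
          by (cases ys; auto simp: tuples_def; fail)+
        then show False using False by (cases ys) (auto simp: tuples_def)
      qed
      moreover have "ys @ drop 1 ps \<notin> tuples (n + 1)" using False len n by (auto simp: tuples_def)
      ultimately show ?thesis using CinfD[OF c] CinfD[OF rc] by simp
    qed
    then have "D (\<lambda>ys. c (drop 1 ys @ tl ps @ take 1 ys)) (ps ! 0) = ins D 0 (rot (n + 1) c) ps"
      using ne by (simp add: ins_def)
    then show ?thesis using len sub ne
      by (simp add: hoch_b_def Let_def sum_fun_apply ins_def)
  qed
qed

lemma jetop_hoch_b:
  assumes D: "multidiff M 2 D" and n: "0 < n"
  shows "jetop (n + 1) n (hoch_b M D)"
proof (rule jetop_cong[OF _ hoch_b_faces[OF D _ n]])
  have J: "jetop (n + 1) n (ins D i)" if "i < n" for i using jetop_ins[OF D that] by simp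
  show "jetop (n + 1) n (\<lambda>c. (\<Sum>i<n. (-1) ^ i \<bullet>\<^sub>C ins D i c) + (-1) ^ n \<bullet>\<^sub>C ins D 0 (rot (n + 1) c))"
    by (intro jetop_add jetop_sum jetop_scale J jetop_compose[OF jetop_rot J] n) simp
qed

text \<open>
  \<open>a\<^sub>0 \<otimes> \<dots> \<otimes> a\<^sub>n \<mapsto> 1 \<otimes> a\<^sub>i \<otimes> \<dots> \<otimes> a\<^sub>n \<otimes> a\<^sub>0 \<otimes> \<dots> \<otimes> a\<^sub>i\<^sub>-\<^sub>1\<close>: as a function it ignores its first
  point.
\<close>

definition cyc :: "nat \<Rightarrow> nat \<Rightarrow> ('p list \<Rightarrow> complex) \<Rightarrow> 'p list \<Rightarrow> complex" where
  "cyc N i = reindex N (N + 1) (\<lambda>k. Suc ((k + (N - i)) mod N))"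

lemma connes_B_cyc:
  assumes c: "c \<in> Cinf M (n + 1)"
  shows "connes_B M c = (\<Sum>i\<le>n. (-1) ^ (n * i) \<bullet>\<^sub>C cyc (n + 1) i c)"
proof
  fix ps
  show "connes_B M c ps = (\<Sum>i\<le>n. (-1) ^ (n * i) \<bullet>\<^sub>C cyc (n + 1) i c) ps"
  proof (cases "ps \<in> tuples (n + 2)")
    case False
    then have "connes_B M c ps = 0"
    proof (cases "length ps < 2 \<or> \<not> set ps \<subseteq> pts M")
      case ok: False
      have "c (drop (k + 1 - i) (tl ps) @ take (k + 1 - i) (tl ps)) = 0" for i k
        by (rule CinfD[OF c]) (use ok False in \<open>auto simp: tuples_def\<close>)
      then show ?thesis by (simp add: connes_B_def)
    qed (simp add: connes_B_def)
    then show ?thesis using False by (simp add: sum_fun_apply cyc_def reindex_def numeral_2_eq_2)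
  next
    case True
    then obtain p qs where ps: "ps = p # qs" "length qs = n + 1" by (cases ps) (auto simp: tuples_def)
    have "map (\<lambda>k. ps ! Suc ((k + (n + 1 - i)) mod (n + 1))) [0..<n + 1] = drop (n + 1 - i) qs @ take (n + 1 - i) qs"
      if "i \<le> n" for i
    proof -
      have "map (\<lambda>k. ps ! Suc ((k + (n + 1 - i)) mod (n + 1))) [0..<n + 1] = rotate (n + 1 - i) qs"
        by (rule nth_equalityI) (use ps in \<open>auto simp: nth_rotate add.commute simp del: upt_Suc\<close>)
      also have "\<dots> = drop (n + 1 - i) qs @ take (n + 1 - i) qs"
      proof (cases "i = 0")
        case True then show ?thesis using ps rotate_length01[of qs] rotate_conv_mod[of "n + 1" qs] by simp
      next
        case False then show ?thesis using ps that by (simp add: rotate_drop_take)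
      qed
      finally show ?thesis .
    qed
    then show ?thesis using True ps
      by (auto simp: connes_B_def Let_def sum_fun_apply cyc_def reindex_def tuples_def simp del: upt_Suc intro!: sum.cong)
  qed
qed

lemma jetop_cyc: "0 < N \<Longrightarrow> jetop N (N + 1) (cyc N i)"
  unfolding cyc_def by (rule jetop_reindex) simp

lemma jetop_connes_B: "jetop (n + 1) (n + 2) (connes_B M)"
proof (rule jetop_cong[OF _ connes_B_cyc])
  have "jetop (n + 1) (n + 2) (cyc (n + 1) i)" for i using jetop_cyc[of "n + 1" i] by simp
  then show "jetop (n + 1) (n + 2) (\<lambda>c. \<Sum>i\<le>n. (-1) ^ (n * i) \<bullet>\<^sub>C cyc (n + 1) i c)"
    by (intro jetop_sum jetop_scale)
qed

end

section \<open>Tensor powers of an isomorphism of star products\<close>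

lemma sum_triangle_mult:
  "(\<Sum>i\<le>n. \<Sum>j\<le>n - i. h i j (n - i - j)) = (\<Sum>q\<le>n. \<Sum>j\<le>n - q. h j (n - q - j) (q::nat))"
  for h :: "nat \<Rightarrow> nat \<Rightarrow> nat \<Rightarrow> 'a::comm_monoid_add"
  by (simp add: sum.Sigma,
      rule sum.reindex_bij_witness[of _ "\<lambda>(q, j). (j, n - q - j)" "\<lambda>(i, j). (n - i - j, i)"]) auto

lemma sum_triangle_diag:
  "(\<Sum>i\<le>n. \<Sum>r\<le>i. h r (i - r) (n - i)) = (\<Sum>r\<le>n. \<Sum>s\<le>n - r. h r s (n - r - s))"
  for h :: "nat \<Rightarrow> nat \<Rightarrow> nat \<Rightarrow> 'a::comm_monoid_add"
  by (simp add: sum.Sigma,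
      rule sum.reindex_bij_witness[of _ "\<lambda>(r, s). (r + s, r)" "\<lambda>(i, r). (r, i - r)"]) auto

lemma sum_triangle_swap:
  "(\<Sum>i\<le>n. \<Sum>r\<le>n - i. h i r (n - i - r)) = (\<Sum>r\<le>n. \<Sum>i\<le>n - r. h i r (n - r - i))"
  for h :: "nat \<Rightarrow> nat \<Rightarrow> nat \<Rightarrow> 'a::comm_monoid_add"
  by (simp add: sum.Sigma,
      rule sum.reindex_bij_witness[of _ "\<lambda>(r, i). (i, r)" "\<lambda>(i, r). (r, i)"]) (auto simp: add.commute)

abbreviation fps_coeff :: "'a::zero fps \<Rightarrow> nat \<Rightarrow> 'a" (infixl "$$" 75) where "f $$ n \<equiv> fps_nth f n"

lemma fps_mult_nth_atMost: "(f * g) $$ n = (\<Sum>i\<le>n. f $$ i * g $$ (n - i))" for f :: "'a::comm_ring_1 fps"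
  by (simp add: fps_mult_nth atLeast0AtMost)

lemma inj_on_add_mod: "inj_on (\<lambda>k. (k + a) mod N) {..<N::nat}"
proof -
  have "k = l" if "k < N" "l < N" "(k + a) mod N = (l + a) mod N" "k \<le> l" for k l
  proof -
    have "N dvd (l + a) - (k + a)" using that mod_eq_dvd_iff_nat[of "k + a" "l + a" N] by simp
    then show ?thesis using that by (cases "l = k") (auto dest: dvd_imp_le)
  qed
  then show ?thesis unfolding inj_on_def by (metis lessThan_iff nat_le_linear)
qed

text \<open>
  Two deformations \<open>P\<close> and \<open>Q\<close> of the product of \<open>C\<^sup>\<infinity>(M)\<close>, with \<open>T\<close> multiplicative from \<open>P\<close> to \<open>Q\<close>.
\<close>

locale star_iso = smooth_mfd M for M :: "'p mfd" +
  fixes P Q T :: "nat \<Rightarrow> 'p cochain"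
  assumes P2: "multidiff M 2 (P m)" and P0: "P 0 = mult_cochain M"
    and P_unit: "1 \<le> m \<Longrightarrow> P m (tensor [unit_fun M, unit_fun M]) = 0"
    and Q2: "multidiff M 2 (Q m)" and Q0: "Q 0 = mult_cochain M"
    and Q_unit: "1 \<le> m \<Longrightarrow> Q m (tensor [unit_fun M, unit_fun M]) = 0"
    and T1: "multidiff M 1 (T m)" and T0: "a \<in> smooth_funs M \<Longrightarrow> T 0 (tensor [a]) = a"
    and intertwine: "a \<in> smooth_funs M \<Longrightarrow> b \<in> smooth_funs M \<Longrightarrow>
      (\<Sum>i\<le>m. T i (tensor [P (m - i) (tensor [a, b])])) =
      (\<Sum>i\<le>m. \<Sum>j\<le>m - i. Q (m - i - j) (tensor [T i (tensor [a]), T j (tensor [b])]))"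
begin

lemma T_smooth: "a \<in> smooth_funs M \<Longrightarrow> T m (tensor [a]) \<in> smooth_funs M"
  by (rule cochain_smooth[OF T1]) (auto intro: tensor_Cinf simp del: One_nat_def)

lemma P_smooth: "a \<in> smooth_funs M \<Longrightarrow> b \<in> smooth_funs M \<Longrightarrow> P m (tensor [a, b]) \<in> smooth_funs M"
  by (rule cochain_smooth[OF P2]) (auto intro: tensor_Cinf)

lemma mult_tensor:
  assumes "a \<in> smooth_funs M" "b \<in> smooth_funs M"
  shows "mult_cochain M (tensor [a, b]) = a * b"
proof -
  have "tensor [a, b] \<in> Cinf M 2" by (rule tensor_Cinf) (use assms in auto)
  then show ?thesis by (auto simp: mult_cochain_def tensor_map2 fun_eq_iff)
qed

lemma unit_mult: "a \<in> smooth_funs M \<Longrightarrow> unit_fun M * a = a" "a \<in> smooth_funs M \<Longrightarrow> a * unit_fun M = a"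
  using smooth_funs_zero by (auto simp: fun_eq_iff unit_fun_def)

lemma tensor_pair: "tensor [a, b] [y, z] = a y * b z"
  by (simp add: tensor_map2)

text \<open>
  Put \<open>a = b = 1\<close> in the intertwining identity. At order \<open>t\<^sup>m\<close>, by induction, all that remains is
  \<open>T\<^sub>m 1 = 2 T\<^sub>m 1\<close>.
\<close>

lemma T_unit: "1 \<le> m \<Longrightarrow> T m (tensor [unit_fun M]) = 0"
proof (induction m rule: less_induct)
  case (less m)
  let ?e = "unit_fun M" and ?s = "T m (tensor [unit_fun M])"
  note e = unit_smooth
  have p0: "P 0 (tensor [?e, ?e]) = ?e" by (simp add: P0 mult_tensor[OF e e] unit_mult[OF e])
  have "(\<Sum>i\<le>m. T i (tensor [P (m - i) (tensor [?e, ?e])])) = (\<Sum>i\<in>{m}. T i (tensor [P (m - i) (tensor [?e, ?e])]))"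
  proof (rule sum.mono_neutral_right)
    show "\<forall>i\<in>{..m} - {m}. T i (tensor [P (m - i) (tensor [?e, ?e])]) = 0"
    proof
      fix i assume "i \<in> {..m} - {m}"
      then have "P (m - i) (tensor [?e, ?e]) = 0" by (intro P_unit) auto
      then show "T i (tensor [P (m - i) (tensor [?e, ?e])]) = 0"
        by (simp add: tensor_zero cochain_null[OF T1])
    qed
  qed auto
  (* 1 * 1 = 1 for the first product *)
  then have L: "(\<Sum>i\<le>m. T i (tensor [P (m - i) (tensor [?e, ?e])])) = ?s" by (simp add: p0)
  have t0: "T i (tensor [?e]) = 0" if "i < m" "i \<noteq> 0" for i by (rule less.IH[OF that(1)]) (use that in simp)
  define G where "G = (\<lambda>i j. Q (m - i - j) (tensor [T i (tensor [?e]), T j (tensor [?e])]))"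
  have G0: "G i j = 0" if "(0 < i \<and> i < m) \<or> (0 < j \<and> j < m)" for i j
    using that t0 by (auto simp: G_def tensor_zero cochain_null[OF Q2])
  have "(\<Sum>j\<le>m - i. G i j) = (if i = 0 then ?s else if i = m then ?s else 0)" if "i \<le> m" for i
  proof -
    consider "i = 0" | "0 < i" "i < m" | "i = m" "i \<noteq> 0" using \<open>i \<le> m\<close> by linarith
    then show ?thesis
    proof cases
      case 1
      have "(\<Sum>j\<le>m. G 0 j) = (\<Sum>j\<in>{0, m}. G 0 j)"
        by (rule sum.mono_neutral_right) (auto intro!: G0)
      also have "\<dots> = ?s"
        using less.prems Q_unit[of m] by (simp add: G_def T0[OF e] Q0 mult_tensor e T_smooth unit_mult)
      finally show ?thesis using 1 by simp
    next
      case 2 then show ?thesis by (simp add: G0)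
    next
      case 3
      then show ?thesis by (simp add: G_def T0[OF e] Q0 mult_tensor e T_smooth unit_mult)
    qed
  qed
  then have "(\<Sum>i\<le>m. \<Sum>j\<le>m - i. G i j) = (\<Sum>i\<le>m. if i = 0 then ?s else if i = m then ?s else 0)"
    by (intro sum.cong) auto
  also have "\<dots> = (\<Sum>i\<in>{0, m}. ?s)"
    by (rule sum.mono_neutral_cong_right) auto
  also have "\<dots> = ?s + ?s" using less.prems by simp
  finally have "?s = ?s + ?s" using intertwine[OF e e, of m] L unfolding G_def by simp
  then show ?case by simp
qed

text \<open>
  Coefficient at \<open>t\<^sup>m\<close> of \<open>T\<close> acting on the first \<open>k\<close> tensor factors.
\<close>

primrec legs :: "nat \<Rightarrow> nat \<Rightarrow> ('p list \<Rightarrow> complex) \<Rightarrow> 'p list \<Rightarrow> complex" where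
  "legs 0 m c = (if m = 0 then c else 0)"
| "legs (Suc k) m c = (\<Sum>j\<le>m. ins (T j) k (legs k (m - j) c))"

text \<open>
  On products all identities become identities between products of power series in \<open>t\<close> with complex
  coefficients, at fixed points.
\<close>

definition tser :: "('p \<Rightarrow> complex) \<Rightarrow> 'p \<Rightarrow> complex fps" where
  "tser a p = Abs_fps (\<lambda>m. T m (tensor [a]) p)"

definition tsers :: "('p \<Rightarrow> complex) list \<Rightarrow> 'p list \<Rightarrow> complex fps" where
  "tsers as ps = prod_list (map2 tser as ps)"

lemma tsers_append: "length ps = length us \<Longrightarrow> tsers (us @ ws) (ps @ qs) = tsers us ps * tsers ws qs"
  by (simp add: tsers_def)

lemma jetop_insT: "k < N \<Longrightarrow> jetop N N (ins (T j) k)"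
  using jetop_ins[OF T1, of k N] by simp

lemma jetop_legs: "k \<le> N \<Longrightarrow> jetop N N (legs k m)"
proof (induction k arbitrary: m)
  case 0
  show ?case by (cases "m = 0") (auto intro: jetop_id jetop_const_zero simp del: zero_fun_apply)
next
  case (Suc k)
  have "jetop N N (\<lambda>c. \<Sum>j\<le>m. ins (T j) k (legs k (m - j) c))"
    by (rule jetop_sum, rule jetop_compose[OF Suc.IH jetop_insT]) (use Suc.prems in auto)
  then show ?case by (rule jetop_cong) simp
qed

text \<open>
  One leg at a time: the slice of the partially transformed tensor in the next argument is a
  multiple of a single function, to which \<open>T\<close> is applied.
\<close>

lemma legs_tensor_aux:
  "set (us @ ws) \<subseteq> smooth_funs M \<Longrightarrow> length ps = length us \<Longrightarrow> length qs = length ws \<Longrightarrow>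
   set (ps @ qs) \<subseteq> pts M \<Longrightarrow>
   legs (length us) m (tensor (us @ ws)) (ps @ qs) = tsers us ps $$ m * tensor ws qs"
proof (induction us arbitrary: ws ps qs m rule: rev_induct)
  case Nil
  then show ?case by (simp add: tsers_def)
next
  case (snoc a us)
  let ?N = "length us + 1 + length ws"
  obtain rs p where ps: "ps = rs @ [p]" "length rs = length us"
    using snoc.prems(2) by (cases ps rule: rev_cases) auto
  have c: "tensor (us @ a # ws) \<in> Cinf M ?N" by (rule tensor_Cinf) (use snoc.prems in auto)
  have ta: "tensor [a] \<in> Cinf M 1" by (rule tensor_Cinf) (use snoc.prems in auto)
  have inner: "(\<lambda>ys. legs (length us) i (tensor (us @ a # ws)) (rs @ ys @ qs))
      = (tsers us rs $$ i * tensor ws qs) \<bullet>\<^sub>C tensor [a]" for i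
  proof (rule slice_eq[OF jetopD(1)[OF jetop_legs c] Cinf_closed(4)[OF ta]])
    show "length rs + 1 + length qs = ?N" using ps snoc.prems by simp
    fix ys assume "ys \<in> tuples 1"
    then obtain y where y: "ys = [y]" "y \<in> pts M" by (cases ys) (auto simp: tuples_def)
    have "legs (length us) i (tensor (us @ a # ws)) (rs @ y # qs) = tsers us rs $$ i * tensor (a # ws) (y # qs)"
      by (rule snoc.IH) (use snoc.prems ps y in auto)
    then show "legs (length us) i (tensor (us @ a # ws)) (rs @ ys @ qs) = ((tsers us rs $$ i * tensor ws qs) \<bullet>\<^sub>C tensor [a]) ys"
      using y tensor_append[of "[y]" "[a]" ws qs] by (simp add: tensor_single)
  qed simp
  have "legs (length (us @ [a])) m (tensor ((us @ [a]) @ ws)) (ps @ qs)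
      = (\<Sum>j\<le>m. ins (T j) (length us) (legs (length us) (m - j) (tensor (us @ a # ws))) (rs @ p # qs))"
    by (simp add: ps sum_fun_apply)
  also have "\<dots> = (\<Sum>j\<le>m. (tsers us rs $$ (m - j) * tensor ws qs) * T j (tensor [a]) p)"
    unfolding ins_append[OF ps(2)] inner multidiff_linear(2)[OF T1 ta] by simp
  also have "\<dots> = (\<Sum>j\<le>m. tser a p $$ j * tsers us rs $$ (m - j)) * tensor ws qs"
    unfolding sum_distrib_right by (rule sum.cong) (simp_all add: tser_def mult_ac)
  also have "\<dots> = (tser a p * tsers us rs) $$ m * tensor ws qs"
    by (simp only: fps_mult_nth_atMost)
  also have "tser a p * tsers us rs = tsers (us @ [a]) ps"
    using ps by (simp add: tsers_append mult.commute) (simp add: tsers_def)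
  finally show ?case .
qed

lemma legs_tensor:
  "set as \<subseteq> smooth_funs M \<Longrightarrow> length as = N \<Longrightarrow> ps \<in> tuples N \<Longrightarrow> legs N m (tensor as) ps = tsers as ps $$ m"
  using legs_tensor_aux[of as "[]" ps "[]" m] by (simp add: tuples_def tensor_map2)

lemma tser_unit: "p \<in> pts M \<Longrightarrow> tser (unit_fun M) p = 1"
proof (rule fps_ext)
  fix n assume p: "p \<in> pts M"
  show "fps_nth (tser (unit_fun M) p) n = fps_nth 1 n"
  proof (cases "n = 0")
    case True
    have "unit_fun M p = 1" using p by (simp add: unit_fun_def)
    then show ?thesis using True T0[OF unit_smooth] by (simp add: tser_def)
  next
    case False
    then show ?thesis using T_unit[of n] by (simp add: tser_def)
  qed
qed

text \<open>
  The positions that are not hit carry \<open>u\<close>, which contributes the factor \<open>1\<close>. It is used for complex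
  values and for power series.
\<close>

lemma prod_list_reindex:
  fixes f :: "'a \<Rightarrow> 'p \<Rightarrow> 'b::comm_monoid_mult"
  assumes inj: "inj_on \<sigma> {..<N}" and sub: "\<sigma> ` {..<N} \<subseteq> {..<K}" and as: "length as = N" and ps: "ps \<in> tuples K"
    and u: "\<And>p. p \<in> pts M \<Longrightarrow> f u p = 1"
  defines "bs \<equiv> map (\<lambda>l. if l \<in> \<sigma> ` {..<N} then as ! inv_into {..<N} \<sigma> l else u) [0..<K]"
  shows "prod_list (map2 f bs ps) = prod_list (map2 f as (map (\<lambda>k. ps ! \<sigma> k) [0..<N]))"
proof -
  have len: "length bs = K" "length ps = K" using ps by (auto simp: bs_def tuples_def)
  have "prod_list (map2 f bs ps) = (\<Prod>l<K. f (bs ! l) (ps ! l))"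
    using len by (simp add: prod.list_conv_set_nth atLeast0LessThan)
  also have "\<dots> = (\<Prod>l\<in>\<sigma> ` {..<N}. f (bs ! l) (ps ! l))"
    by (rule prod.mono_neutral_right) (use sub u tuples_nth[OF ps] in \<open>auto simp: bs_def\<close>)
  also have "\<dots> = (\<Prod>k<N. f (bs ! \<sigma> k) (ps ! \<sigma> k))"
    by (simp add: prod.reindex[OF inj])
  also have "\<dots> = (\<Prod>k<N. f (as ! k) (ps ! \<sigma> k))"
    using sub inj by (intro prod.cong) (auto simp: bs_def image_subset_iff)
  also have "\<dots> = prod_list (map2 f as (map (\<lambda>k. ps ! \<sigma> k) [0..<N]))"
    using as by (simp add: prod.list_conv_set_nth atLeast0LessThan)
  finally show ?thesis .
qed

text \<open>
  Permuting factors and inserting units commutes with a tensor power, since \<open>T\<close> preserves the unit;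
  checked on tensors.
\<close>

lemma legs_reindex:
  assumes inj: "inj_on \<sigma> {..<N}" and sub: "\<sigma> ` {..<N} \<subseteq> {..<K}" and N: "0 < N" and c: "c \<in> Cinf M N"
  shows "legs K m (reindex N K \<sigma> c) = reindex N K \<sigma> (legs N m c)"
proof (rule jetop_eq_tensors[OF N _ _ _ c])
  have J: "jetop N K (reindex N K \<sigma>)" by (rule jetop_reindex) (use sub in auto)
  show JA: "jetop N K (\<lambda>c. legs K m (reindex N K \<sigma> c))" by (rule jetop_compose[OF J jetop_legs]) simp
  show JB: "jetop N K (\<lambda>c. reindex N K \<sigma> (legs N m c))" by (rule jetop_compose[OF jetop_legs J]) simp
  fix as assume as: "length as = N" "set as \<subseteq> smooth_funs M"
  have ca: "tensor as \<in> Cinf M N" by (rule tensor_Cinf[OF as])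
  define bs where "bs = map (\<lambda>l. if l \<in> \<sigma> ` {..<N} then as ! inv_into {..<N} \<sigma> l else unit_fun M) [0..<K]"
  have bs: "length bs = K" "set bs \<subseteq> smooth_funs M"
  proof -
    have "as ! inv_into {..<N} \<sigma> l \<in> smooth_funs M" if "l \<in> \<sigma> ` {..<N}" for l
      using inv_into_into[OF that] as nth_mem[of "inv_into {..<N} \<sigma> l" as] by auto
    then show "length bs = K" "set bs \<subseteq> smooth_funs M" using unit_smooth by (auto simp: bs_def)
  qed
  have sel: "map (\<lambda>k. ps ! \<sigma> k) [0..<N] \<in> tuples N" if "ps \<in> tuples K" for ps
    using tuples_nth[OF that] sub by (auto simp: tuples_def image_subset_iff)
  have t: "reindex N K \<sigma> (tensor as) = tensor bs"
  proof
    fix ps show "reindex N K \<sigma> (tensor as) ps = tensor bs ps"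
    proof (cases "ps \<in> tuples K")
      case True
      have "prod_list (map2 (\<lambda>a p. a p) bs ps) = prod_list (map2 (\<lambda>a p. a p) as (map (\<lambda>k. ps ! \<sigma> k) [0..<N]))"
        unfolding bs_def by (rule prod_list_reindex[OF inj sub as(1) True]) (simp add: unit_fun_def)
      then show ?thesis using True as bs by (simp add: reindex_def tensor_map2 tuples_length[OF True])
    next
      case False
      then show ?thesis using CinfD[OF tensor_Cinf[OF bs]] by (simp add: reindex_def)
    qed
  qed
  show "legs K m (reindex N K \<sigma> (tensor as)) = reindex N K \<sigma> (legs N m (tensor as))"
  proof
    fix ps show "legs K m (reindex N K \<sigma> (tensor as)) ps = reindex N K \<sigma> (legs N m (tensor as)) ps"
    proof (cases "ps \<in> tuples K")
      case True
      have "prod_list (map2 tser bs ps) = prod_list (map2 tser as (map (\<lambda>k. ps ! \<sigma> k) [0..<N]))"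
        unfolding bs_def by (rule prod_list_reindex[OF inj sub as(1) True]) (rule tser_unit)
      then show ?thesis unfolding t legs_tensor[OF bs(2,1) True]
        by (simp add: reindex_def True legs_tensor[OF as(2,1) sel[OF True]] tsers_def)
    next
      case False
      then show ?thesis using CinfD[OF jetopD(1)[OF JA ca] False] by (simp add: reindex_def)
    qed
  qed
qed

lemma legs_rot: "0 < N \<Longrightarrow> c \<in> Cinf M N \<Longrightarrow> legs N m (rot N c) = rot N (legs N m c)"
  unfolding rot_def by (rule legs_reindex[OF inj_on_add_mod]) auto

lemma legs_cyc: "0 < N \<Longrightarrow> c \<in> Cinf M N \<Longrightarrow> legs (N + 1) m (cyc N i c) = cyc N i (legs N m c)"
  unfolding cyc_def
  by (rule legs_reindex[OF comp_inj_on[OF inj_on_add_mod inj_Suc, unfolded comp_def]]) auto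

lemma legs_connes_B:
  assumes c: "c \<in> Cinf M (n + 1)"
  shows "legs (n + 2) m (connes_B M c) = connes_B M (legs (n + 1) m c)"
proof -
  have J: "jetop (n + 2) (n + 2) (legs (n + 2) m)" by (rule jetop_legs) simp
  have cc: "cyc (n + 1) i c \<in> Cinf M (n + 2)" for i using jetopD(1)[OF jetop_cyc c, of i] by simp
  have "legs (n + 2) m (connes_B M c) = (\<Sum>i\<le>n. (-1) ^ (n * i) \<bullet>\<^sub>C legs (n + 2) m (cyc (n + 1) i c))"
    unfolding connes_B_cyc[OF c] jetop_sum_value[OF J Cinf_closed(4)[OF cc]] jetopD(3)[OF J cc] ..
  also have "\<dots> = connes_B M (legs (n + 1) m c)"
    using legs_cyc[OF _ c, of m] connes_B_cyc[OF jetopD(1)[OF jetop_legs c], of "n + 1" m] by simp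
  finally show ?thesis .
qed

text \<open>
  On a tensor, all factors except \<open>a\<close> and \<open>b\<close> in positions \<open>l\<close> and \<open>l + 1\<close> contribute the same
  power series \<open>R\<close> to both sides, and what is left is the intertwining identity for \<open>a\<close> and \<open>b\<close>.
\<close>

lemma legs_face:
  assumes l: "l < n" and c: "c \<in> Cinf M (n + 1)"
  shows "(\<Sum>i\<le>m. legs n i (ins (P (m - i)) l c)) = (\<Sum>i\<le>m. ins (Q i) l (legs (n + 1) (m - i) c))"
proof (rule jetop_eq_tensors[OF _ _ _ _ c])
  have JP: "jetop (n + 1) n (ins (P i) l)" for i using jetop_ins[OF P2 l] by simp
  have JQ: "jetop (n + 1) n (ins (Q i) l)" for i using jetop_ins[OF Q2 l] by simp
  show JA: "jetop (n + 1) n (\<lambda>c. \<Sum>i\<le>m. legs n i (ins (P (m - i)) l c))"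
    by (rule jetop_sum, rule jetop_compose[OF JP jetop_legs]) simp
  show JB: "jetop (n + 1) n (\<lambda>c. \<Sum>i\<le>m. ins (Q i) l (legs (n + 1) (m - i) c))"
    by (rule jetop_sum, rule jetop_compose[OF jetop_legs JQ]) simp
  show "0 < n + 1" by simp
  fix as assume as: "length as = n + 1" "set as \<subseteq> smooth_funs M"
  have "length (take l as) = l" using as l by simp
  moreover have "as = take l as @ as ! l # as ! Suc l # drop (l + 2) as"
    using as l by (metis Cons_nth_drop_Suc Suc_eq_plus1 Suc_lessI Suc_less_eq add_2_eq_Suc' append_take_drop_id less_SucI)
  ultimately obtain us a b ws where sp: "as = us @ [a, b] @ ws" "length us = l" by force
  have S: "a \<in> smooth_funs M" "b \<in> smooth_funs M" "set (us @ ws) \<subseteq> smooth_funs M" using sp as by auto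
  have lw: "n = l + 1 + length ws" using sp as by simp
  have ta: "tensor as \<in> Cinf M (n + 1)" by (rule tensor_Cinf[OF as])
  show "(\<Sum>i\<le>m. legs n i (ins (P (m - i)) l (tensor as))) = (\<Sum>i\<le>m. ins (Q i) l (legs (n + 1) (m - i) (tensor as)))"
  proof
    fix rs
    show "(\<Sum>i\<le>m. legs n i (ins (P (m - i)) l (tensor as))) rs
        = (\<Sum>i\<le>m. ins (Q i) l (legs (n + 1) (m - i) (tensor as))) rs"
    proof (cases "rs \<in> tuples n")
      case False
      show ?thesis using CinfD[OF jetopD(1)[OF JA ta] False] CinfD[OF jetopD(1)[OF JB ta] False] by simp
    next
      case True
      then obtain ps p qs where rs: "rs = ps @ p # qs" "length ps = l" "length qs = length ws"
        using id_take_nth_drop[of l rs] l lw by (auto simp: tuples_def intro!: that[of "take l rs"])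
      have pq: "set (ps @ p # qs) \<subseteq> pts M" using True rs by (auto simp: tuples_def)
      define R where "R = tsers us ps * tsers ws qs"
      define G where "G = (\<lambda>q x. \<Sum>j\<le>x. Q q (tensor [T j (tensor [a]), T (x - j) (tensor [b])]) p)"
      have F: "legs n i (ins (P j) l (tensor as)) rs = (\<Sum>r\<le>i. R $$ r * T (i - r) (tensor [P j (tensor [a, b])]) p)" for i j
      proof -
        have "ins (P j) l (tensor as) = tensor (us @ P j (tensor [a, b]) # ws)"
          unfolding sp(1) sp(2)[symmetric] by (rule ins_tensor) (use P2 as sp in \<open>auto simp: numeral_2_eq_2\<close>)
        then have "legs n i (ins (P j) l (tensor as)) rs = legs n i (tensor (us @ P j (tensor [a, b]) # ws)) rs"
          by simp
        also have "\<dots> = tsers (us @ P j (tensor [a, b]) # ws) rs $$ i"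
          by (rule legs_tensor[OF _ _ True]) (use S P_smooth lw sp in auto)
        also have "tsers (us @ P j (tensor [a, b]) # ws) rs = R * tser (P j (tensor [a, b])) p"
          unfolding rs(1) using rs sp tsers_append[of "[p]" "[P j (tensor [a, b])]" ws qs]
          by (simp add: tsers_append R_def mult_ac) (simp add: tsers_def mult_ac)
        finally show ?thesis by (simp add: fps_mult_nth_atMost tser_def)
      qed
      have tt: "tensor [T i (tensor [a]), T j (tensor [b])] \<in> Cinf M 2" for i j
        by (rule tensor_Cinf) (use S T_smooth in auto)
      have inner: "(\<lambda>ys. legs (n + 1) x (tensor as) (ps @ ys @ qs))
        = (\<Sum>r\<le>x. (R $$ r) \<bullet>\<^sub>C (\<Sum>j\<le>x - r. tensor [T j (tensor [a]), T (x - r - j) (tensor [b])]))" for x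
      proof (rule slice_eq[OF jetopD(1)[OF jetop_legs ta]])
        show "(\<Sum>r\<le>x. (R $$ r) \<bullet>\<^sub>C (\<Sum>j\<le>x - r. tensor [T j (tensor [a]), T (x - r - j) (tensor [b])])) \<in> Cinf M 2"
          by (intro Cinf_closed(6) Cinf_closed(4) tt)
        show "length ps + 2 + length qs = n + 1" using rs lw by simp
        fix ys assume "ys \<in> tuples 2"
        then obtain y z where y: "ys = [y, z]" "y \<in> pts M" "z \<in> pts M"
          by (auto simp: tuples_def length_Suc_conv numeral_2_eq_2)
        have "legs (n + 1) x (tensor as) (ps @ ys @ qs) = tsers as (ps @ ys @ qs) $$ x"
          by (rule legs_tensor[OF as(2,1)]) (use y pq rs lw in \<open>auto simp: tuples_def\<close>)
        also have "tsers as (ps @ ys @ qs) = R * (tser a y * tser b z)"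
          unfolding sp(1) y(1) using rs sp tsers_append[of "[y, z]" "[a, b]" ws qs]
          by (simp add: tsers_append R_def mult_ac) (simp add: tsers_def mult_ac)
        finally show "legs (n + 1) x (tensor as) (ps @ ys @ qs) =
          (\<Sum>r\<le>x. (R $$ r) \<bullet>\<^sub>C (\<Sum>j\<le>x - r. tensor [T j (tensor [a]), T (x - r - j) (tensor [b])])) ys"
          by (simp add: fps_mult_nth_atMost tser_def sum_fun_apply y tensor_pair del: legs.simps)
      qed simp
      have "ins (Q i) l (legs (n + 1) x (tensor as)) rs = (\<Sum>r\<le>x. R $$ r * G i (x - r))" for i x
      proof -
        have "ins (Q i) l (legs (n + 1) x (tensor as)) rs =
          Q i (\<Sum>r\<le>x. (R $$ r) \<bullet>\<^sub>C (\<Sum>j\<le>x - r. tensor [T j (tensor [a]), T (x - r - j) (tensor [b])])) p"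
          unfolding rs(1) ins_append[OF rs(2)] inner ..
        also have "\<dots> = (\<Sum>r\<le>x. R $$ r * (\<Sum>j\<le>x - r. Q i (tensor [T j (tensor [a]), T (x - r - j) (tensor [b])]) p))"
          by (simp add: multidiff_linear(2,3)[OF Q2] Cinf_closed(4,6) tt sum_fun_apply)
        finally show ?thesis by (simp add: G_def)
      qed
      then have "(\<Sum>i\<le>m. ins (Q i) l (legs (n + 1) (m - i) (tensor as))) rs = (\<Sum>i\<le>m. \<Sum>r\<le>m - i. R $$ r * G i (m - i - r))"
        by (simp add: sum_fun_apply del: legs.simps)
      also have "\<dots> = (\<Sum>r\<le>m. \<Sum>i\<le>m - r. R $$ r * G i (m - r - i))"
        by (rule sum_triangle_swap[of "\<lambda>i r x. R $$ r * G i x"])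
      also have "\<dots> = (\<Sum>r\<le>m. R $$ r * (\<Sum>s\<le>m - r. T s (tensor [P (m - r - s) (tensor [a, b])]) p))"
      proof (rule sum.cong[OF refl])
        fix r
        let ?x = "m - r"
        have "(\<Sum>s\<le>?x. T s (tensor [P (?x - s) (tensor [a, b])]) p)
          = (\<Sum>i\<le>?x. \<Sum>j\<le>?x - i. Q (?x - i - j) (tensor [T i (tensor [a]), T j (tensor [b])]) p)"
          using fun_cong[OF intertwine[OF S(1,2), of ?x], of p] by (simp only: sum_fun_apply)
        also have "\<dots> = (\<Sum>q\<le>?x. G q (?x - q))"
          unfolding G_def by (rule sum_triangle_mult[of "\<lambda>i j q. Q q (tensor [T i (tensor [a]), T j (tensor [b])]) p"])
        finally show "(\<Sum>i\<le>?x. R $$ r * G i (?x - i)) = R $$ r * (\<Sum>s\<le>?x. T s (tensor [P (?x - s) (tensor [a, b])]) p)"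
          by (simp add: sum_distrib_left)
      qed
      also have "\<dots> = (\<Sum>i\<le>m. \<Sum>r\<le>i. R $$ r * T (i - r) (tensor [P (m - i) (tensor [a, b])]) p)"
        unfolding sum_distrib_left
        by (rule sum_triangle_diag[of "\<lambda>r s x. R $$ r * T s (tensor [P x (tensor [a, b])]) p", symmetric])
      finally show ?thesis by (simp add: F sum_fun_apply)
    qed
  qed
qed

lemma legs_hoch_b:
  assumes n: "0 < n" and c: "c \<in> Cinf M (n + 1)"
  shows "(\<Sum>i\<le>m. legs n i (hoch_b M (P (m - i)) c)) = (\<Sum>i\<le>m. hoch_b M (Q i) (legs (n + 1) (m - i) c))"
proof -
  have J: "jetop n n (legs n i)" for i by (rule jetop_legs) simp
  have J1: "jetop (n + 1) (n + 1) (legs (n + 1) i)" for i by (rule jetop_legs) simp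
  have rc: "rot (n + 1) c \<in> Cinf M (n + 1)" by (rule jetopD(1)[OF jetop_rot c])
  have e: "ins (P j) l x \<in> Cinf M n" if "l < n" "x \<in> Cinf M (n + 1)" for j l x
    using jetopD(1)[OF jetop_ins[OF P2 that(1)]] that(2) by simp
  have L: "legs n i (hoch_b M (P j) c) = (\<Sum>l<n. (-1) ^ l \<bullet>\<^sub>C legs n i (ins (P j) l c))
      + (-1) ^ n \<bullet>\<^sub>C legs n i (ins (P j) 0 (rot (n + 1) c))" for i j
  proof -
    have m1: "(\<Sum>l<n. (-1) ^ l \<bullet>\<^sub>C ins (P j) l c) \<in> Cinf M n"
      by (rule Cinf_closed(6), rule Cinf_closed(4)[OF e[OF _ c]]) simp
    have m2: "(-1) ^ n \<bullet>\<^sub>C ins (P j) 0 (rot (n + 1) c) \<in> Cinf M n" by (rule Cinf_closed(4)[OF e[OF n rc]])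
    have "legs n i (\<Sum>l<n. (-1) ^ l \<bullet>\<^sub>C ins (P j) l c) = (\<Sum>l<n. legs n i ((-1) ^ l \<bullet>\<^sub>C ins (P j) l c))"
      by (rule jetop_sum_value[OF J], rule Cinf_closed(4)[OF e[OF _ c]]) simp
    also have "\<dots> = (\<Sum>l<n. (-1) ^ l \<bullet>\<^sub>C legs n i (ins (P j) l c))"
      by (rule sum.cong[OF refl], rule jetopD(3)[OF J e[OF _ c]]) simp
    finally show ?thesis
      unfolding hoch_b_faces[OF P2 c n] jetopD(2)[OF J m1 m2] jetopD(3)[OF J e[OF n rc]] by simp
  qed
  have R: "hoch_b M (Q i) (legs (n + 1) j c) = (\<Sum>l<n. (-1) ^ l \<bullet>\<^sub>C ins (Q i) l (legs (n + 1) j c))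
      + (-1) ^ n \<bullet>\<^sub>C ins (Q i) 0 (legs (n + 1) j (rot (n + 1) c))" for i j
    unfolding hoch_b_faces[OF Q2 jetopD(1)[OF J1 c] n] using legs_rot[OF _ c, of j] by simp
  have "(\<Sum>i\<le>m. legs n i (hoch_b M (P (m - i)) c))
    = (\<Sum>l<n. (-1) ^ l \<bullet>\<^sub>C (\<Sum>i\<le>m. legs n i (ins (P (m - i)) l c)))
      + (-1) ^ n \<bullet>\<^sub>C (\<Sum>i\<le>m. legs n i (ins (P (m - i)) 0 (rot (n + 1) c)))"
    unfolding L sum.distrib cscale_sum_right by (subst sum.swap) simp
  also have "\<dots> = (\<Sum>l<n. (-1) ^ l \<bullet>\<^sub>C (\<Sum>i\<le>m. ins (Q i) l (legs (n + 1) (m - i) c)))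
      + (-1) ^ n \<bullet>\<^sub>C (\<Sum>i\<le>m. ins (Q i) 0 (legs (n + 1) (m - i) (rot (n + 1) c)))"
    by (intro arg_cong2[of _ _ _ _ plus] sum.cong arg_cong[of _ _ "cscale _"] legs_face[OF n rc] legs_face[OF _ c]) auto
  also have "\<dots> = (\<Sum>i\<le>m. hoch_b M (Q i) (legs (n + 1) (m - i) c))"
    unfolding R sum.distrib cscale_sum_right by (subst sum.swap) simp
  finally show ?thesis .
qed

end

section \<open>Conjugating a differential by a unipotent power series\<close>

text \<open>
  The operators to be transported are not known to respect null elements in advance.
\<close>

definition lin_upto :: "'v::cspace gspace \<Rightarrow> 'w::cspace gspace \<Rightarrow> int \<Rightarrow> ('v \<Rightarrow> 'w) \<Rightarrow> bool" where
  "lin_upto X Y k f \<longleftrightarrow> (\<forall>i. (\<forall>x\<in>elems X i. f x \<in> elems Y (i + k)) \<and>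
     (\<forall>x\<in>elems X i. \<forall>y\<in>elems X i. eqm Y (i + k) (f (x + y)) (f x + f y)) \<and>
     (\<forall>a. \<forall>x\<in>elems X i. eqm Y (i + k) (f (a \<bullet>\<^sub>C x)) (a \<bullet>\<^sub>C f x)))"

lemma gmap_lin_upto:
  "gmap X Y k f \<longleftrightarrow> lin_upto X Y k f \<and> (\<forall>i. \<forall>x\<in>nulls X i. f x \<in> nulls Y (i + k))"
  unfolding graded_map_def lin_upto_def eqm_def by (rule iffI; (intro conjI allI ballI)?; simp)

lemma sum_atMost_split: "(\<Sum>j\<le>m. f j) = f 0 + (\<Sum>j\<in>{1..m}. f j)" for f :: "nat \<Rightarrow> 'a::comm_monoid_add"
proof -
  have "{..m} = insert 0 {1..m}" by auto
  then show ?thesis by simp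
qed

context
  fixes N :: "'v::cspace gspace" and S \<theta> \<rho> :: "nat \<Rightarrow> 'v \<Rightarrow> 'v"
  assumes cS: "is_complex (tseries N) (\<lambda>_. tconv S)" and N: "is_gspace N"
    and S: "\<And>m. gmap N N 1 (S m)" and \<theta>: "\<And>m. gmap N N 0 (\<theta> m)"
    and \<theta>0: "\<And>i x. x \<in> elems N i \<Longrightarrow> \<theta> 0 x = x"
    and \<rho>: "\<And>m. lin_upto N N 1 (\<rho> m)"
    and comm: "\<And>m i x. x \<in> elems N i \<Longrightarrow>
      eqm N (i + 1) (\<Sum>j\<le>m. \<theta> j (\<rho> (m - j) x)) (\<Sum>j\<le>m. S j (\<theta> (m - j) x))"
begin

lemma conjugate_elem: "x \<in> elems N i \<Longrightarrow> \<rho> m x \<in> elems N (i + 1)"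
  using \<rho>[of m] by (simp add: lin_upto_def)

text \<open>
  Induction on \<open>m\<close>: in the intertwining identity at order \<open>m\<close>, the operator \<open>\<rho> m\<close> itself occurs
  only in the term with \<open>\<theta> 0 = id\<close>.
\<close>

lemma conjugate_null: "x \<in> nulls N i \<Longrightarrow> \<rho> m x \<in> nulls N (i + 1)"
proof (induction m rule: less_induct)
  case (less m)
  have x: "x \<in> elems N i" by (rule gspace_le[OF N less.prems])
  have "\<theta> (m - j) x \<in> nulls N i" for j using gm_null[OF \<theta> N N less.prems] by simp
  then have "(\<Sum>j\<le>m. S j (\<theta> (m - j) x)) \<in> nulls N (i + 1)"
    by (intro gsub_n(6)[OF N] gm_null[OF S N N])
  then have "(\<Sum>j\<le>m. \<theta> j (\<rho> (m - j) x)) \<in> nulls N (i + 1)" by (rule eqm_null[OF N comm[OF x]])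
  moreover have "(\<Sum>j\<in>{1..m}. \<theta> j (\<rho> (m - j) x)) \<in> nulls N (i + 1)"
  proof (rule gsub_n(6)[OF N])
    fix j assume "j \<in> {1..m}"
    then have "\<rho> (m - j) x \<in> nulls N (i + 1)" by (intro less.IH less.prems) auto
    then show "\<theta> j (\<rho> (m - j) x) \<in> nulls N (i + 1)" using gm_null[OF \<theta> N N] by fastforce
  qed
  ultimately have "(\<Sum>j\<le>m. \<theta> j (\<rho> (m - j) x)) - (\<Sum>j\<in>{1..m}. \<theta> j (\<rho> (m - j) x)) \<in> nulls N (i + 1)"
    by (rule gsub_n(3)[OF N])
  then show ?case unfolding sum_atMost_split using \<theta>0[OF conjugate_elem[OF x]] by simp
qed

lemma conjugate_gmap: "gmap N N 1 (\<rho> m)"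
  unfolding gmap_lin_upto using \<rho> conjugate_null by blast

lemma conjugate_commute:
  assumes x: "x \<in> elems (tseries N) i"
  shows "eqm (tseries N) (i + 1) (tconv \<theta> (tconv \<rho> x)) (tconv S (tconv \<theta> x))"
  unfolding eqm_tseries
proof
  fix m
  have a: "eqm N (i + 1) (tconv \<theta> (tconv \<rho> x) m) (\<Sum>n\<le>m. \<Sum>j\<le>n. \<theta> j (\<rho> (n - j) (x (m - n))))"
    using tconv_tconv[where m=m, OF N N N conjugate_gmap \<theta> x] by (simp only: add_0_right)
  have b: "eqm N (i + 1) (tconv S (tconv \<theta> x) m) (\<Sum>n\<le>m. \<Sum>j\<le>n. S j (\<theta> (n - j) (x (m - n))))"
    using tconv_tconv[where m=m, OF N N N \<theta> S x] by (simp only: add_0_right)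
  have "eqm N (i + 1) (\<Sum>n\<le>m. \<Sum>j\<le>n. \<theta> j (\<rho> (n - j) (x (m - n)))) (\<Sum>n\<le>m. \<Sum>j\<le>n. S j (\<theta> (n - j) (x (m - n))))"
    by (rule eqm_sum[OF N], rule comm) (use x in simp)
  then show "eqm N (i + 1) (tconv \<theta> (tconv \<rho> x) m) (tconv S (tconv \<theta> x) m)"
    by (rule eqm_trans[OF N a eqm_trans[OF N _ eqm_sym[OF N b]]])
qed

text \<open>
  The leading null-coefficient argument: \<open>\<Sum>\<^sub>m t\<^sup>m \<theta> m\<close> is the identity modulo \<open>t\<close>.
\<close>

lemma unipotent_injective:
  assumes z: "z \<in> elems (tseries N) i" and n: "tconv \<theta> z \<in> nulls (tseries N) i"
  shows "z \<in> nulls (tseries N) i"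
proof -
  have "z m \<in> nulls N i" for m
  proof (induction m rule: less_induct)
    case (less m)
    have "tconv \<theta> z m \<in> nulls N i" using n by simp
    moreover have "(\<Sum>j\<in>{1..m}. \<theta> j (z (m - j))) \<in> nulls N i"
      by (rule gsub_n(6)[OF N]) (use gm_null[OF \<theta> N N less.IH] in fastforce)
    ultimately have "tconv \<theta> z m - (\<Sum>j\<in>{1..m}. \<theta> j (z (m - j))) \<in> nulls N i" by (rule gsub_n(3)[OF N])
    moreover have "\<theta> 0 (z m) = z m" by (rule \<theta>0[of _ i]) (use z in simp)
    ultimately show ?case unfolding tconv_def sum_atMost_split by simp
  qed
  then show ?thesis by simp
qed

text \<open>
  The square of the transported differential is annihilated by the injective map \<open>\<theta>\<close>.
\<close>

lemma conjugate_chain_map: "chain_map (tseries N) (tconv \<rho>) (tseries N) (tconv S) (tconv \<theta>)"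
proof -
  note TN = gspace_tseries[OF N]
  have G\<rho>: "gmap (tseries N) (tseries N) 1 (tconv \<rho>)" by (rule gmap_tconv[OF N N conjugate_gmap])
  have G\<theta>: "gmap (tseries N) (tseries N) 0 (tconv \<theta>)" by (rule gmap_tconv[OF N N \<theta>])
  have GS: "gmap (tseries N) (tseries N) 1 (tconv S)" by (rule gmap_tconv[OF N N S])
  have "tconv \<rho> (tconv \<rho> x) \<in> nulls (tseries N) (i + 2)" if x: "x \<in> elems (tseries N) i" for i x
  proof (rule unipotent_injective)
    have r: "tconv \<rho> x \<in> elems (tseries N) (i + 1)" by (rule gm_elem[OF G\<rho> TN TN x])
    show "tconv \<rho> (tconv \<rho> x) \<in> elems (tseries N) (i + 2)" using gm_elem[OF G\<rho> TN TN r] by (simp add: add.assoc)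
    have t: "tconv \<theta> x \<in> elems (tseries N) i" using gm_elem[OF G\<theta> TN TN x] by simp
    have t1: "tconv \<theta> (tconv \<rho> x) \<in> elems (tseries N) (i + 1)" using gm_elem[OF G\<theta> TN TN r] by simp
    have s: "tconv S (tconv \<theta> x) \<in> elems (tseries N) (i + 1)" by (rule gm_elem[OF GS TN TN t])
    have "eqm (tseries N) (i + 1 + 1) (tconv \<theta> (tconv \<rho> (tconv \<rho> x))) (tconv S (tconv \<theta> (tconv \<rho> x)))"
      by (rule conjugate_commute[OF r])
    moreover have "eqm (tseries N) (i + 1 + 1) (tconv S (tconv \<theta> (tconv \<rho> x))) (tconv S (tconv S (tconv \<theta> x)))"
      by (rule gm_cong[OF GS TN TN t1 s conjugate_commute[OF x]])
    ultimately have "eqm (tseries N) (i + 2) (tconv \<theta> (tconv \<rho> (tconv \<rho> x))) (tconv S (tconv S (tconv \<theta> x)))"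
      using eqm_trans[OF TN] by (simp only: add.assoc one_add_one)
    moreover have "tconv S (tconv S (tconv \<theta> x)) \<in> nulls (tseries N) (i + 2)"
      using complexD(3)[OF cS t] by (simp add: eqm_def del: nulls_tseries)
    ultimately show "tconv \<theta> (tconv \<rho> (tconv \<rho> x)) \<in> nulls (tseries N) (i + 2)" by (rule eqm_null[OF TN])
  qed
  then have "is_complex (tseries N) (\<lambda>_. tconv \<rho>)" unfolding is_complex_def using TN G\<rho> by blast
  then show ?thesis unfolding chain_map_def using cS G\<theta> conjugate_commute by blast
qed

lemma conjugate_quasi_iso:
  assumes "\<And>i x. x \<in> elems N i \<Longrightarrow> \<rho> 0 x = S 0 x" and c0: "is_complex N (\<lambda>_. S 0)"
  shows "quasi_iso (tseries N) (\<lambda>_. tconv \<rho>) (tseries N) (\<lambda>_. tconv S) (\<lambda>_. tconv \<theta>)"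
proof (rule quasi_iso_tseries[OF N N conjugate_gmap S \<theta> conjugate_chain_map])
  have id: "gmap N N 0 (\<lambda>x. x)" using gsub_n(1)[OF N] by (simp add: graded_map_def)
  have "quasi_iso N (\<lambda>_. S 0) N (\<lambda>_. S 0) (\<lambda>_ x. x)"
    unfolding quasi_iso_def
  proof (intro conjI allI ballI impI c0 id)
    show "S 0 x - S 0 x \<in> nulls N (i + 1)" for x i using gsub_n(1)[OF N] by simp
    show "\<exists>x\<in>cocycles N (\<lambda>_. S 0) i. x - y \<in> coboundaries N (\<lambda>_. S 0) i" if y: "y \<in> cocycles N (\<lambda>_. S 0) i" for y i
    proof (rule bexI[OF _ y])
      have "S 0 0 \<in> nulls N i" using gm_null[OF S[of 0] N N gsub_n(1)[OF N], of "i - 1"] by simp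
      then have "0 - S 0 0 \<in> nulls N i" by (rule gsub_n(3)[OF N gsub_n(1)[OF N]])
      then show "y - y \<in> coboundaries N (\<lambda>_. S 0) i"
        using gsub_e(1)[OF N] by (auto simp: coboundaries_def)
    qed
  qed
  then show "quasi_iso N (\<lambda>_. \<rho> 0) N (\<lambda>_. S 0) (\<lambda>_. \<theta> 0)"
    by (rule quasi_iso_cong) (use assms(1) \<theta>0 in auto)
qed

end

lemma quasi_iso_compose:
  assumes f: "quasi_iso X (\<lambda>_. D) Y (\<lambda>_. E) (\<lambda>_. f)" and g: "quasi_iso Y (\<lambda>_. E) Z (\<lambda>_. H) (\<lambda>_. g)"
  shows "quasi_iso X (\<lambda>_. D) Z (\<lambda>_. H) (\<lambda>_ x. g (f x))"
proof -
  have cf: "chain_map X D Y E f" and cg: "chain_map Y E Z H g"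
    using quasi_iso_chain_map f g by blast+
  have cX: "is_complex X (\<lambda>_. D)" and cY: "is_complex Y (\<lambda>_. E)" and cZ: "is_complex Z (\<lambda>_. H)"
    and F: "gmap X Y 0 f" and G: "gmap Y Z 0 g" using cf cg by (auto simp: chain_map_def)
  note X = complexD(1)[OF cX] and Y = complexD(1)[OF cY] and Z = complexD(1)[OF cZ]
  have fe: "f x \<in> elems Y i" if "x \<in> elems X i" for x i using gm_elem[OF F X Y that] by simp
  have ge: "g y \<in> elems Z i" if "y \<in> elems Y i" for y i using gm_elem[OF G Y Z that] by simp
  have gc: "eqm Z i (g x) (g y)" if "x \<in> elems Y i" "y \<in> elems Y i" "eqm Y i x y" for x y i
    using gm_cong[OF G Y Z that] by simp
  have De: "D x \<in> elems X (i + 1)" if "x \<in> elems X i" for x i by (rule gm_elem[OF complexD(2)[OF cX] X X that])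
  have Ee: "E x \<in> elems Y (i + 1)" if "x \<in> elems Y i" for x i by (rule gm_elem[OF complexD(2)[OF cY] Y Y that])
  have comm: "eqm Z (i + 1) (g (f (D x))) (H (g (f x)))" if x: "x \<in> elems X i" for x i
  proof (rule eqm_trans[OF Z])
    show "eqm Z (i + 1) (g (f (D x))) (g (E (f x)))"
      by (rule gc[OF fe[OF De[OF x]] Ee[OF fe[OF x]]]) (use cf x in \<open>simp add: chain_map_def\<close>)
    show "eqm Z (i + 1) (g (E (f x))) (H (g (f x)))" using cg fe[OF x] by (simp add: chain_map_def)
  qed
  have fcoc: "f x \<in> cocycles Y (\<lambda>_. E) i" if x: "x \<in> cocycles X (\<lambda>_. D) i" for x i
  proof -
    have xe: "x \<in> elems X i" and dx: "D x \<in> nulls X (i + 1)" using x by (auto simp: cocycles_def)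
    have "eqm Y (i + 1) (E (f x)) (f (D x))" using cf xe eqm_sym[OF Y] by (simp add: chain_map_def)
    moreover have "f (D x) \<in> nulls Y (i + 1)" using gm_null[OF F X Y dx] by simp
    ultimately have "E (f x) \<in> nulls Y (i + 1)" by (rule eqm_null[OF Y])
    then show ?thesis using fe[OF xe] by (simp add: cocycles_def)
  qed
  have GF: "gmap X Z 0 (\<lambda>x. g (f x))"
    unfolding graded_map_def
  proof (intro allI conjI ballI)
    fix i x assume x: "x \<in> elems X i"
    show "g (f x) \<in> elems Z (i + 0)" using ge[OF fe[OF x]] by simp
    have "eqm Z i (g (f (x + y))) (g (f x) + g (f y))" if y: "y \<in> elems X i" for y
    proof (rule eqm_trans[OF Z])
      show "eqm Z i (g (f (x + y))) (g (f x + f y))"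
        using gm_add[OF F X Y x y] by (intro gc fe gsub_e(2)[OF X] gsub_e(2)[OF Y] x y) simp
      show "eqm Z i (g (f x + f y)) (g (f x) + g (f y))" using gm_add[OF G Y Z fe[OF x] fe[OF y]] by simp
    qed
    then show "y \<in> elems X i \<Longrightarrow> g (f (x + y)) - (g (f x) + g (f y)) \<in> nulls Z (i + 0)" for y
      by (simp add: eqm_def)
    have "eqm Z i (g (f (a \<bullet>\<^sub>C x))) (a \<bullet>\<^sub>C g (f x))" for a
    proof (rule eqm_trans[OF Z])
      show "eqm Z i (g (f (a \<bullet>\<^sub>C x))) (g (a \<bullet>\<^sub>C f x))"
        using gm_scale[OF F X Y x] by (intro gc fe gsub_e(4)[OF X] gsub_e(4)[OF Y] x) simp
      show "eqm Z i (g (a \<bullet>\<^sub>C f x)) (a \<bullet>\<^sub>C g (f x))" using gm_scale[OF G Y Z fe[OF x]] by simp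
    qed
    then show "g (f (a \<bullet>\<^sub>C x)) - a \<bullet>\<^sub>C g (f x) \<in> nulls Z (i + 0)" for a by (simp add: eqm_def)
  next
    fix i x assume "x \<in> nulls X i"
    then show "g (f x) \<in> nulls Z (i + 0)" using gm_null[OF F X Y, of x i] gm_null[OF G Y Z, of "f x" i] by simp
  qed
  show ?thesis
    unfolding quasi_iso_def
  proof (intro conjI allI ballI impI cX cZ GF)
    show "g (f (D x)) - H (g (f x)) \<in> nulls Z (i + 1)" if "x \<in> elems X i" for x i
      using comm[OF that] by (simp add: eqm_def)
    show "x \<in> coboundaries X (\<lambda>_. D) i" if "x \<in> cocycles X (\<lambda>_. D) i" "g (f x) \<in> coboundaries Z (\<lambda>_. H) i" for x i
      using fcoc[OF that(1)] that f g by (simp add: quasi_iso_def)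
    fix i z assume "z \<in> cocycles Z (\<lambda>_. H) i"
    then obtain y where y: "y \<in> cocycles Y (\<lambda>_. E) i" "g y - z \<in> coboundaries Z (\<lambda>_. H) i"
      using g unfolding quasi_iso_def by blast
    obtain x where x: "x \<in> cocycles X (\<lambda>_. D) i" "f x - y \<in> coboundaries Y (\<lambda>_. E) i"
      using f y(1) unfolding quasi_iso_def by blast
    have ye: "y \<in> elems Y i" and xe: "x \<in> elems X i" using x y by (auto simp: cocycles_def)
    obtain v where v: "v \<in> elems Z (i - 1)" "eqm Z i (g y - z) (H v)" and gz: "g y - z \<in> elems Z i"
      using y(2) by (auto simp: coboundaries_def eqm_def)
    obtain w where w: "w \<in> elems Y (i - 1)" "eqm Y i (f x - y) (E w)"
      using x(2) by (auto simp: coboundaries_def eqm_def)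
    have Ew: "E w \<in> elems Y i" using Ee[OF w(1)] by simp
    have fy: "f x - y \<in> elems Y i" by (rule gsub_e(3)[OF Y fe[OF xe] ye])
    have 1: "eqm Z i (g (f x - y)) (g (f x) - g y)" using gm_diff[OF G Y Z fe[OF xe] ye] by simp
    have 2: "eqm Z i (g (f x - y)) (g (E w))" by (rule gc[OF fy Ew w(2)])
    have 3: "eqm Z i (g (E w)) (H (g w))" using cg w(1) by (auto simp: chain_map_def dest!: spec[of _ "i - 1"])
    have a: "eqm Z i (g (f x) - g y) (H (g w))"
      by (rule eqm_trans[OF Z eqm_sym[OF Z 1] eqm_trans[OF Z 2 3]])
    have "eqm Z (i - 1 + 1) (H (g w + v)) (H (g w) + H v)"
      by (rule gm_add[OF complexD(2)[OF cZ] Z Z ge[OF w(1)] v(1)])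
    then have b: "eqm Z i (H (g w) + H v) (H (g w + v))" using eqm_sym[OF Z] by simp
    have "eqm Z i ((g (f x) - g y) + (g y - z)) (H (g w) + H v)" by (rule eqm_add[OF Z a v(2)])
    then have "eqm Z i (g (f x) - z) (H (g w + v))" using eqm_trans[OF Z _ b] by simp
    moreover have "g (f x) - z \<in> elems Z i"
      using gsub_e(2)[OF Z gsub_e(3)[OF Z ge[OF fe[OF xe]] ge[OF ye]] gz] by simp
    moreover have "g w + v \<in> elems Z (i - 1)" by (rule gsub_e(2)[OF Z ge[OF w(1)] v(1)])
    ultimately have "g (f x) - z \<in> coboundaries Z (\<lambda>_. H) i" by (auto simp: coboundaries_def eqm_def)
    then show "\<exists>x\<in>cocycles X (\<lambda>_. D) i. g (f x) - z \<in> coboundaries Z (\<lambda>_. H) i" using x(1) by blast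
  qed
qed

section \<open>Comparing the mixed complexes of isomorphic star products\<close>

lemma sum_if_last: "(\<Sum>j\<le>m. if m - j = 0 then f j else 0) = f (m::nat)" for f :: "nat \<Rightarrow> 'a::comm_monoid_add"
proof -
  have "(\<Sum>j\<le>m. if m - j = 0 then f j else 0) = (\<Sum>j\<in>{m}. f j)" by (rule sum.mono_neutral_cong_right) auto
  then show ?thesis by simp
qed

lemma sum_if_first: "(\<Sum>j\<le>m. if j = 0 then f j else 0) = f (0::nat)" for f :: "nat \<Rightarrow> 'a::comm_monoid_add"
  by (simp add: sum.delta')

context smooth_mfd
begin

lemma Cinf_unique: "c \<in> Cinf M N \<Longrightarrow> c \<in> Cinf M N' \<Longrightarrow> c \<noteq> 0 \<Longrightarrow> N = N'"
proof -
  assume c: "c \<in> Cinf M N" "c \<in> Cinf M N'" and "c \<noteq> 0"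
  then obtain ps where "c ps \<noteq> 0" by (auto simp: fun_eq_iff)
  then have "ps \<in> tuples N" "ps \<in> tuples N'" using CinfD c by blast+
  then show ?thesis by (simp add: tuples_def)
qed

lemma unit_at_sum: "(\<And>s. s \<in> S \<Longrightarrow> unit_at M i (h s)) \<Longrightarrow> unit_at M i (\<Sum>s\<in>S. h s)"
  unfolding unit_at_def sum_fun_apply by (auto intro!: sum.cong)

lemma elems_chains: "elems (chains M) i = (if i \<le> 0 then Cinf M (nat (- i) + 1) else {0})"
  and nulls_chains: "nulls (chains M) i = (if i \<le> 0 then degenerate M (nat (- i)) else {0})"
  by (auto simp: chains_def)

text \<open>
  Exact linearity on representatives. This is stronger than linearity modulo null elements and is
  what operators on smooth functions satisfy.
\<close>

definition chain_linear :: "int \<Rightarrow> (('p list \<Rightarrow> complex) \<Rightarrow> 'p list \<Rightarrow> complex) \<Rightarrow> bool" where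
  "chain_linear k A \<longleftrightarrow> A 0 = 0 \<and> (\<forall>i. \<forall>x\<in>elems (chains M) i. A x \<in> elems (chains M) (i + k) \<and>
     (\<forall>y\<in>elems (chains M) i. A (x + y) = A x + A y) \<and> (\<forall>a. A (a \<bullet>\<^sub>C x) = a \<bullet>\<^sub>C A x))"

lemma chain_linearI:
  assumes e: "\<And>n c. c \<in> Cinf M (n + 1) \<Longrightarrow> A c \<in> elems (chains M) (- int n + k)"
    and J: "\<And>n. \<exists>L. jetop (n + 1) L A"
  shows "chain_linear k A"
proof -
  have z: "A 0 = 0" using J[of 0] jetop_zero_value by blast
  have z': "0 \<in> elems (chains M) j" for j by (simp add: elems_chains Cinf_closed(1))
  show ?thesis
    unfolding chain_linear_def
  proof (intro conjI allI ballI z)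
    fix i x assume x: "x \<in> elems (chains M) i"
    show "A x \<in> elems (chains M) (i + k)"
      using x e[of x "nat (- i)"] z z' by (cases "i \<le> 0") (auto simp: elems_chains[of i])
    obtain L where L: "jetop (nat (- i) + 1) L A" using J by blast
    show "A (x + y) = A x + A y" if "y \<in> elems (chains M) i" for y
      using x that jetopD(2)[OF L, of x y] z by (cases "i \<le> 0") (auto simp: elems_chains[of i])
    show "A (a \<bullet>\<^sub>C x) = a \<bullet>\<^sub>C A x" for a
      using x jetopD(3)[OF L, of x a] z by (cases "i \<le> 0") (auto simp: elems_chains[of i])
  qed
qed

lemma chain_linearD:
  assumes "chain_linear k A"
  shows "A 0 = 0" "x \<in> elems (chains M) i \<Longrightarrow> A x \<in> elems (chains M) (i + k)"
    "x \<in> elems (chains M) i \<Longrightarrow> y \<in> elems (chains M) i \<Longrightarrow> A (x + y) = A x + A y"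
    "x \<in> elems (chains M) i \<Longrightarrow> A (a \<bullet>\<^sub>C x) = a \<bullet>\<^sub>C A x"
  using assms by (auto simp: chain_linear_def)

lemma chain_linear_hoch_b:
  assumes D: "multidiff M 2 D"
  shows "chain_linear 1 (hoch_b M D)"
proof (rule chain_linearI)
  fix n c assume c: "c \<in> Cinf M (n + 1)"
  show "hoch_b M D c \<in> elems (chains M) (- int n + 1)"
  proof (cases "n = 0")
    case True
    then show ?thesis using hoch_b_zero[OF D] c by (simp add: elems_chains)
  next
    case False
    then have "hoch_b M D c \<in> Cinf M n" by (intro jetopD(1)[OF jetop_hoch_b[OF D] c]) simp
    then show ?thesis using False by (auto simp: elems_chains nat_diff_distrib)
  qed
next
  fix n
  show "\<exists>L. jetop (n + 1) L (hoch_b M D)"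
  proof (cases "n = 0")
    case True
    have "jetop 1 0 (hoch_b M D)" by (rule jetop_cong[OF jetop_const_zero hoch_b_zero[OF D]])
    then show ?thesis using True by auto
  next
    case False then show ?thesis using jetop_hoch_b[OF D] by blast
  qed
qed

lemma chain_linear_connes_B: "chain_linear (-1) (connes_B M)"
proof (rule chain_linearI)
  fix n c assume "c \<in> Cinf M (n + 1)"
  then have "connes_B M c \<in> Cinf M (n + 2)" by (rule jetopD(1)[OF jetop_connes_B])
  moreover have "nat (- (- int n + - 1)) + 1 = n + 2" by simp
  ultimately show "connes_B M c \<in> elems (chains M) (- int n + - 1)" by (simp add: elems_chains)
qed (use jetop_connes_B in blast)

text \<open>
  Coefficient at \<open>t\<^sup>m\<close> of \<open>b + uB\<close> for a product \<open>\<Sum>\<^sub>m t\<^sup>m D m\<close>; the operator \<open>B\<close> does not involve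
  the product and is of order \<open>t\<^sup>0\<close>.
\<close>

definition mixed_op :: "(nat \<Rightarrow> 'p cochain) \<Rightarrow> nat \<Rightarrow> (nat \<Rightarrow> 'p list \<Rightarrow> complex) \<Rightarrow> nat \<Rightarrow> 'p list \<Rightarrow> complex" where
  "mixed_op D m = plus_u (hoch_b M (D m)) (if m = 0 then connes_B M else (\<lambda>_. 0))"

lemma mixed_op_apply:
  "mixed_op D m x k = hoch_b M (D m) (x k) + (if k = 0 then 0 else if m = 0 then connes_B M (x (k - 1)) else 0)"
  by (simp add: mixed_op_def plus_u_def)

lemma lin_upto_mixed_op:
  assumes D: "multidiff M 2 (D m)" and X: "is_gspace (chains M)"
  shows "lin_upto (useries (chains M)) (useries (chains M)) 1 (mixed_op D m)"
proof -
  let ?E = "(if m = 0 then connes_B M else (\<lambda>_. 0)) :: ('p list \<Rightarrow> complex) \<Rightarrow> _"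
  have b: "chain_linear 1 (hoch_b M (D m))" by (rule chain_linear_hoch_b[OF D])
  have e: "chain_linear (-1) ?E"
    using chain_linear_connes_B gsub_e(1)[OF X] by (auto simp: chain_linear_def)
  have sh: "x k \<in> elems (chains M) (i - 2 * int k)"
      "k \<noteq> 0 \<Longrightarrow> x (k - 1) \<in> elems (chains M) (i - 2 * int k + 2)"
    if "x \<in> elems (useries (chains M)) i" for x :: "nat \<Rightarrow> 'p list \<Rightarrow> complex" and i k
  proof -
    show "x k \<in> elems (chains M) (i - 2 * int k)" using that by simp
    assume "k \<noteq> 0"
    then have "i - 2 * int (k - 1) = i - 2 * int k + 2" by (simp add: of_nat_diff)
    then show "x (k - 1) \<in> elems (chains M) (i - 2 * int k + 2)" using that by (metis elems_useries)
  qed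
  have app: "mixed_op D m x k = hoch_b M (D m) (x k) + (if k = 0 then 0 else ?E (x (k - 1)))" for x k
    by (simp add: mixed_op_def plus_u_def)
  show ?thesis
    unfolding lin_upto_def
  proof (intro allI conjI ballI)
    fix i x assume x: "x \<in> elems (useries (chains M)) i"
    have "mixed_op D m x k \<in> elems (chains M) (i + 1 - 2 * int k)" for k
    proof -
      have deg: "i - 2 * int k + 1 = i + 1 - 2 * int k" "i - 2 * int k + 2 + - 1 = i + 1 - 2 * int k" by simp_all
      have 1: "hoch_b M (D m) (x k) \<in> elems (chains M) (i + 1 - 2 * int k)"
        using chain_linearD(2)[OF b sh(1)[OF x, of k]] unfolding deg .
      have 2: "k \<noteq> 0 \<Longrightarrow> ?E (x (k - 1)) \<in> elems (chains M) (i + 1 - 2 * int k)"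
        using chain_linearD(2)[OF e sh(2)[OF x, of k]] unfolding deg .
      show ?thesis unfolding app
        by (cases "k = 0") (use 1 gsub_e(2)[OF X 1 2] in simp_all)
    qed
    then show "mixed_op D m x \<in> elems (useries (chains M)) (i + 1)" by simp
    have r: "eqm (useries (chains M)) j w w" for j w using gsub_n(1)[OF X] by (simp add: eqm_def)
    show "eqm (useries (chains M)) (i + 1) (mixed_op D m (x + y)) (mixed_op D m x + mixed_op D m y)"
      if y: "y \<in> elems (useries (chains M)) i" for y
    proof -
      have pk: "(x + y) l = x l + y l" "(mixed_op D m x + mixed_op D m y) l = mixed_op D m x l + mixed_op D m y l" for l
        by (rule plus_fun_apply)+
      have "mixed_op D m (x + y) k = (mixed_op D m x + mixed_op D m y) k" for k
      proof (cases "k = 0")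
        case True
        show ?thesis by (simp only: pk app True simp_thms if_True add_0_right chain_linearD(3)[OF b sh(1)[OF x] sh(1)[OF y]])
      next
        case False
        show ?thesis by (simp only: pk app False if_False add_ac chain_linearD(3)[OF b sh(1)[OF x] sh(1)[OF y]]
            chain_linearD(3)[OF e sh(2)[OF x False] sh(2)[OF y False]])
      qed
      then have "mixed_op D m (x + y) = mixed_op D m x + mixed_op D m y" by blast
      then show ?thesis using r by simp
    qed
    show "eqm (useries (chains M)) (i + 1) (mixed_op D m (a \<bullet>\<^sub>C x)) (a \<bullet>\<^sub>C mixed_op D m x)" for a
    proof -
      have sk: "(a \<bullet>\<^sub>C x) l = a \<bullet>\<^sub>C x l" "(a \<bullet>\<^sub>C mixed_op D m x) l = a \<bullet>\<^sub>C mixed_op D m x l" for l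
        by (rule cscale_fun_apply)+
      have "mixed_op D m (a \<bullet>\<^sub>C x) k = (a \<bullet>\<^sub>C mixed_op D m x) k" for k
      proof (cases "k = 0")
        case True
        show ?thesis by (simp only: sk app True simp_thms if_True add_0_right chain_linearD(4)[OF b sh(1)[OF x]])
      next
        case False
        show ?thesis by (simp only: sk app False if_False cscale_add_right chain_linearD(4)[OF b sh(1)[OF x]]
            chain_linearD(4)[OF e sh(2)[OF x False]])
      qed
      then have "mixed_op D m (a \<bullet>\<^sub>C x) = a \<bullet>\<^sub>C mixed_op D m x" by blast
      then show ?thesis using r by simp
    qed
  qed
qed

end

context star_iso
begin

text \<open>
  For \<open>i = k\<close>, the function is constant in the argument on which \<open>T\<close> acts, and \<open>T\<close> maps constants
  to constants by \<open>T_unit\<close>.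
\<close>

lemma insT_unit:
  assumes c: "c \<in> Cinf M N" and u: "unit_at M i c" and i: "i < N" and k: "k < N"
  shows "unit_at M i (ins (T j) k c)"
  unfolding unit_at_def
proof (intro allI ballI impI)
  fix rs q assume q: "q \<in> pts M" and rs: "set rs \<subseteq> pts M"
  have Tc: "ins (T j) k c \<in> Cinf M N" by (rule jetopD(1)[OF jetop_insT[OF k] c])
  show "ins (T j) k c (rs[i := q]) = ins (T j) k c rs"
  proof (cases "length rs = N")
    case False
    then show ?thesis using CinfD[OF Tc, of rs] CinfD[OF Tc, of "rs[i := q]"] by (simp add: tuples_def)
  next
    case True
    then obtain ps p qs where sp: "rs = ps @ p # qs" "length ps = k" "length ps + 1 + length qs = N"
      using id_take_nth_drop[of k rs] k by (auto intro!: that[of "take k rs"])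
    have pq: "set ps \<subseteq> pts M" "p \<in> pts M" "set qs \<subseteq> pts M" using rs sp by auto
    have cu: "c (xs[i := q]) = c xs" if "set xs \<subseteq> pts M" for xs using u q that by (simp add: unit_at_def)
    have off: "c (xs @ ys @ zs) = 0" if "ys \<notin> tuples 1" "length xs + 1 + length zs = N" for xs ys zs
      by (rule CinfD[OF c]) (use that in \<open>auto simp: tuples_def\<close>)
    consider "i < k" | "i = k" | "k < i" by linarith
    then show ?thesis
    proof cases
      case 1
      have "c (ps[i := q] @ ys @ qs) = c (ps @ ys @ qs)" for ys
      proof (cases "ys \<in> tuples 1")
        case True
        then show ?thesis using cu[of "ps @ ys @ qs"] pq 1 sp by (simp add: list_update_append tuples_def)
      qed (use off sp in simp)
      then show ?thesis using 1 sp by (simp add: list_update_append ins_append)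
    next
      case 3
      obtain l where l: "i = k + Suc l" by (rule that[of "i - k - 1"]) (use 3 in simp)
      have "c (ps @ ys @ qs[l := q]) = c (ps @ ys @ qs)" for ys
      proof (cases "ys \<in> tuples 1")
        case True
        then show ?thesis using cu[of "ps @ ys @ qs"] pq l sp by (auto simp: list_update_append tuples_def)
      qed (use off sp in simp)
      then show ?thesis using l sp by (simp add: list_update_append ins_append)
    next
      case 2
      let ?e = "tensor [unit_fun M]" and ?v = "c (ps @ [p] @ qs)"
      have e: "?e \<in> Cinf M 1" using unit_smooth by (simp add: smooth_funs_def)
      have inner: "(\<lambda>ys. c (ps @ ys @ qs)) = ?v \<bullet>\<^sub>C ?e"
      proof (rule slice_eq[OF c Cinf_closed(4)[OF e]])
        show "length ps + 1 + length qs = N" by (rule sp(3))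
        fix ys assume "ys \<in> tuples 1"
        then obtain y where y: "ys = [y]" "y \<in> pts M" by (cases ys) (auto simp: tuples_def)
        have "set (ps @ y # qs) \<subseteq> pts M" using pq y(2) by simp
        then have "c ((ps @ y # qs)[i := p]) = c (ps @ y # qs)" using u pq(2) unfolding unit_at_def by blast
        moreover have "(ps @ y # qs)[i := p] = ps @ p # qs" using 2 sp(2) by (simp add: list_update_append)
        ultimately have "c (ps @ p # qs) = c (ps @ y # qs)"
          by simp
        then show "c (ps @ ys @ qs) = (?v \<bullet>\<^sub>C ?e) ys" using y by (simp add: tensor_single unit_fun_def)
      qed
      have v: "ins (T j) k c (ps @ y # qs) = ?v * T j ?e y" for y
        unfolding ins_append[OF sp(2)] inner multidiff_linear(2)[OF T1 e] by simp
      have "T j ?e q = T j ?e p"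
      proof (cases "j = 0")
        case True
        then show ?thesis using T0[OF unit_smooth] q pq(2) by (simp add: unit_fun_def[of M])
      next
        case False then show ?thesis using T_unit[of j] by simp
      qed
      then show ?thesis using v[of p] v[of q] 2 sp by (simp add: list_update_append)
    qed
  qed
qed

lemma legs_unit:
  "c \<in> Cinf M N \<Longrightarrow> unit_at M i c \<Longrightarrow> i < N \<Longrightarrow> k \<le> N \<Longrightarrow> unit_at M i (legs k m c)"
proof (induction k arbitrary: m)
  case 0
  have "unit_at M i 0" by (simp add: unit_at_def)
  then show ?case using 0 by simp
next
  case (Suc k)
  have "unit_at M i (\<Sum>j\<le>m. ins (T j) k (legs k (m - j) c))"
    by (rule unit_at_sum, rule insT_unit[OF jetopD(1)[OF jetop_legs Suc.prems(1)]])
      (use Suc in auto)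
  then show ?case by simp
qed

lemma legs_degenerate: "c \<in> degenerate M n \<Longrightarrow> legs (n + 1) m c \<in> degenerate M n"
proof -
  have J: "jetop (n + 1) (n + 1) (legs (n + 1) m)" by (rule jetop_legs) simp
  assume "c \<in> degenerate M n"
  then obtain d where d: "c = (\<Sum>i\<in>{1..n}. d i)" "\<And>i. i \<in> {1..n} \<Longrightarrow> d i \<in> Cinf M (n + 1) \<and> unit_at M i (d i)"
    unfolding degenerate_def by blast
  have "legs (n + 1) m c = (\<Sum>i\<in>{1..n}. legs (n + 1) m (d i))"
    unfolding d(1) by (rule jetop_sum_value[OF J]) (use d(2) in blast)
  moreover have "legs (n + 1) m (d i) \<in> Cinf M (n + 1) \<and> unit_at M i (legs (n + 1) m (d i))" if "i \<in> {1..n}" for i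
    using jetopD(1)[OF J] legs_unit[of "d i" "n + 1" i "n + 1" m] d(2)[OF that] that by simp
  ultimately show ?thesis unfolding degenerate_def
    by (intro CollectI exI[of _ "\<lambda>i. legs (n + 1) m (d i)"]) blast
qed

lemma degenerate_Cinf: "c \<in> degenerate M n \<Longrightarrow> c \<in> Cinf M (n + 1)"
  unfolding degenerate_def by (auto intro!: Cinf_closed(6))

lemma T0_id: "c \<in> Cinf M 1 \<Longrightarrow> T 0 c = (\<lambda>p. c [p])"
  using Cinf_one[of c] T0[of "\<lambda>p. c [p]"] by metis

lemma legs_zero: "c \<in> Cinf M N \<Longrightarrow> k \<le> N \<Longrightarrow> legs k 0 c = c"
proof (induction k)
  case (Suc k)
  have "ins (T 0) k c rs = c rs" for rs
  proof (cases "rs \<in> tuples N")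
    case False
    then show ?thesis using CinfD[OF jetopD(1)[OF jetop_insT Suc.prems(1)] False] CinfD[OF Suc.prems(1) False] Suc.prems by simp
  next
    case True
    then have l: "k < length rs" using Suc.prems by (simp add: tuples_def)
    have "(\<lambda>ys. c (take k rs @ ys @ drop (k + 1) rs)) \<in> Cinf M 1"
      by (rule ins_inner[of c N]) (use Suc.prems True in simp_all)
    from T0_id[OF this] show ?thesis using l by (simp add: ins_def Cons_nth_drop_Suc)
  qed
  then have eq: "ins (T 0) k c = c" by (rule ext)
  have IH: "legs k 0 c = c" by (rule Suc.IH[OF Suc.prems(1)]) (use Suc.prems in simp)
  show ?case by (simp add: IH eq)
qed simp

text \<open>
  The number of arguments of a chain is recovered from the chain itself: only the zero function
  belongs to several of the spaces \<open>Cinf M N\<close>, and on it all choices agree.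
\<close>

definition theta :: "nat \<Rightarrow> ('p list \<Rightarrow> complex) \<Rightarrow> 'p list \<Rightarrow> complex" where
  "theta m c = (if \<exists>N. c \<in> Cinf M N then legs (SOME N. c \<in> Cinf M N) m c else 0)"

lemma theta_legs: "c \<in> Cinf M N \<Longrightarrow> theta m c = legs N m c"
proof -
  assume c: "c \<in> Cinf M N"
  define L where "L = (SOME N. c \<in> Cinf M N)"
  have L: "c \<in> Cinf M L" unfolding L_def by (rule someI[of _ N], rule c)
  have "legs L m c = legs N m c"
  proof (cases "c = 0")
    case True
    then show ?thesis using jetop_zero_value[OF jetop_legs[OF le_refl]] by simp
  next
    case False
    then show ?thesis using Cinf_unique[OF L c] by simp
  qed
  then show ?thesis using c unfolding theta_def L_def by auto
qed

lemma jetop_theta: "jetop N N (theta m)"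
  by (rule jetop_cong[OF jetop_legs[OF le_refl] theta_legs])

lemma chain_linear_theta: "chain_linear 0 (theta m)"
proof (rule chain_linearI)
  show "theta m c \<in> elems (chains M) (- int n + 0)" if "c \<in> Cinf M (n + 1)" for n c
    using jetopD(1)[OF jetop_theta that] by (simp add: elems_chains)
qed (use jetop_theta in blast)

lemma theta_null: "x \<in> nulls (chains M) i \<Longrightarrow> theta m x \<in> nulls (chains M) i"
proof (cases "i \<le> 0")
  case True
  assume x: "x \<in> nulls (chains M) i"
  then have d: "x \<in> degenerate M (nat (- i))" using True by (simp add: nulls_chains)
  have "x \<in> Cinf M (nat (- i) + 1)" by (rule degenerate_Cinf[OF d])
  then show ?thesis using legs_degenerate[OF d, of m] True by (simp add: theta_legs nulls_chains)
next
  case False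
  then show "x \<in> nulls (chains M) i \<Longrightarrow> ?thesis"
    using chain_linearD(1)[OF chain_linear_theta, of m] by (simp add: nulls_chains)
qed

lemma theta_zero: "x \<in> elems (chains M) i \<Longrightarrow> theta 0 x = x"
  using chain_linearD(1)[OF chain_linear_theta, of 0] legs_zero[of x "nat (- i) + 1"] theta_legs[of x "nat (- i) + 1" 0]
  by (auto simp: elems_chains simp del: legs.simps split: if_splits)

lemma theta_connes_B: "x \<in> elems (chains M) i \<Longrightarrow> theta m (connes_B M x) = connes_B M (theta m x)"
proof (cases "i \<le> 0")
  case True
  assume "x \<in> elems (chains M) i"
  then have x: "x \<in> Cinf M (nat (- i) + 1)" using True by (simp add: elems_chains)
  show ?thesis
    unfolding theta_legs[OF x] theta_legs[OF jetopD(1)[OF jetop_connes_B x]] by (rule legs_connes_B[OF x])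
next
  case False
  then show "x \<in> elems (chains M) i \<Longrightarrow> ?thesis"
    using chain_linearD(1)[OF chain_linear_theta, of m] chain_linearD(1)[OF chain_linear_connes_B] by (simp add: elems_chains)
qed

lemma theta_hoch_b:
  assumes x: "x \<in> elems (chains M) i"
  shows "(\<Sum>j\<le>m. theta j (hoch_b M (P (m - j)) x)) = (\<Sum>j\<le>m. hoch_b M (Q j) (theta (m - j) x))"
proof -
  note z = chain_linearD(1)[OF chain_linear_theta] chain_linearD(1)[OF chain_linear_hoch_b[OF P2]]
    chain_linearD(1)[OF chain_linear_hoch_b[OF Q2]]
  consider "0 < i" | "i = 0" | "i < 0" by linarith
  then show ?thesis
  proof cases
    case 1 then show ?thesis using x z by (simp add: elems_chains)
  next
    case 2
    then have x1: "x \<in> Cinf M 1" using x by (simp add: elems_chains)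
    then show ?thesis using z hoch_b_zero[OF P2 x1] hoch_b_zero[OF Q2 jetopD(1)[OF jetop_theta x1]] by simp
  next
    case 3
    define n where "n = nat (- i)"
    have n: "0 < n" and xn: "x \<in> Cinf M (n + 1)" using 3 x by (simp_all add: elems_chains n_def)
    show ?thesis
      unfolding theta_legs[OF xn] theta_legs[OF jetopD(1)[OF jetop_hoch_b[OF P2 n] xn]]
      by (rule legs_hoch_b[OF n xn])
  qed
qed

definition Theta :: "nat \<Rightarrow> (nat \<Rightarrow> 'p list \<Rightarrow> complex) \<Rightarrow> nat \<Rightarrow> 'p list \<Rightarrow> complex" where
  "Theta m x = (\<lambda>k. theta m (x k))"

lemma gmap_Theta:
  assumes X: "is_gspace (chains M)"
  shows "gmap (useries (chains M)) (useries (chains M)) 0 (Theta m)"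
proof -
  have "Theta m (x + y) = Theta m x + Theta m y" if "x \<in> elems (useries (chains M)) i" "y \<in> elems (useries (chains M)) i" for x y i
  proof
    fix k
    have "(x + y) k = x k + y k" "(Theta m x + Theta m y) k = Theta m x k + Theta m y k" by (rule plus_fun_apply)+
    moreover have "theta m (x k + y k) = theta m (x k) + theta m (y k)"
      by (rule chain_linearD(3)[OF chain_linear_theta, of _ "i - 2 * int k"]) (use that in simp_all)
    ultimately show "Theta m (x + y) k = (Theta m x + Theta m y) k" by (simp only: Theta_def)
  qed
  moreover have "Theta m (a \<bullet>\<^sub>C x) = a \<bullet>\<^sub>C Theta m x" if "x \<in> elems (useries (chains M)) i" for a x i
  proof
    fix k
    have "(a \<bullet>\<^sub>C x) k = a \<bullet>\<^sub>C x k" "(a \<bullet>\<^sub>C Theta m x) k = a \<bullet>\<^sub>C Theta m x k" by (rule cscale_fun_apply)+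
    moreover have "theta m (a \<bullet>\<^sub>C x k) = a \<bullet>\<^sub>C theta m (x k)"
      by (rule chain_linearD(4)[OF chain_linear_theta, of _ "i - 2 * int k"]) (use that in simp)
    ultimately show "Theta m (a \<bullet>\<^sub>C x) k = (a \<bullet>\<^sub>C Theta m x) k" by (simp only: Theta_def)
  qed
  moreover have "Theta m x \<in> elems (useries (chains M)) (i + 0)" if "x \<in> elems (useries (chains M)) i" for x i
    using that chain_linearD(2)[OF chain_linear_theta] by (auto simp: Theta_def)
  moreover have "Theta m x \<in> nulls (useries (chains M)) (i + 0)" if "x \<in> nulls (useries (chains M)) i" for x i
    using that theta_null by (auto simp: Theta_def)
  moreover have "0 \<in> nulls (useries (chains M)) i" for i by (rule gsub_n(1)[OF gspace_useries[OF X]])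
  ultimately show ?thesis unfolding graded_map_def by (simp del: elems_useries nulls_useries)
qed

lemma Theta_commute:
  assumes x: "x \<in> elems (useries (chains M)) i"
  shows "(\<Sum>j\<le>m. Theta j (mixed_op P (m - j) x)) = (\<Sum>j\<le>m. mixed_op Q j (Theta (m - j) x))"
proof
  fix k
  have xk: "x k \<in> elems (chains M) (i - 2 * int k)" for k using x by simp
  note tl = chain_linear_theta
  show "(\<Sum>j\<le>m. Theta j (mixed_op P (m - j) x)) k = (\<Sum>j\<le>m. mixed_op Q j (Theta (m - j) x)) k"
  proof (cases k)
    case 0
    show ?thesis unfolding Theta_def sum_fun_apply[of _ _ k] mixed_op_apply
      by (simp only: 0 simp_thms if_True add_0_right theta_hoch_b[OF xk])
  next
    case (Suc l)
    then have k: "k \<noteq> 0" "k - 1 = l" by simp_all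
    have b: "hoch_b M (P j) (x k) \<in> elems (chains M) (i - 2 * int k + 1)" for j
      by (rule chain_linearD(2)[OF chain_linear_hoch_b[OF P2] xk])
    have B: "connes_B M (x l) \<in> elems (chains M) (i - 2 * int k + 1)"
      using chain_linearD(2)[OF chain_linear_connes_B xk, of l] Suc by (simp add: algebra_simps)
    have e: "theta j (hoch_b M (P (m - j)) (x k) + (if k = 0 then 0 else if m - j = 0 then connes_B M (x (k - 1)) else 0))
      = theta j (hoch_b M (P (m - j)) (x k)) + (if m - j = 0 then theta j (connes_B M (x l)) else 0)" for j
    proof (cases "m - j = 0")
      case True
      show ?thesis by (simp only: k if_False if_True True simp_thms chain_linearD(3)[OF tl b B])
    next
      case False
      show ?thesis by (simp only: k False if_False simp_thms add_0_right)
    qed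
    have "(\<Sum>j\<le>m. Theta j (mixed_op P (m - j) x)) k
      = (\<Sum>j\<le>m. theta j (hoch_b M (P (m - j)) (x k)) + (if m - j = 0 then theta j (connes_B M (x l)) else 0))"
      unfolding Theta_def sum_fun_apply[of _ _ k] mixed_op_apply e ..
    also have "\<dots> = (\<Sum>j\<le>m. hoch_b M (Q j) (theta (m - j) (x k))) + connes_B M (theta (m - 0) (x l))"
      unfolding sum.distrib theta_hoch_b[OF xk] sum_if_last theta_connes_B[OF xk] by (simp only: minus_nat.diff_0)
    also have "\<dots> = (\<Sum>j\<le>m. hoch_b M (Q j) (theta (m - j) (x k)) + (if j = 0 then connes_B M (theta (m - j) (x l)) else 0))"
      unfolding sum.distrib sum_if_first ..
    also have "\<dots> = (\<Sum>j\<le>m. mixed_op Q j (Theta (m - j) x)) k"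
      unfolding Theta_def sum_fun_apply[of _ _ k] mixed_op_apply by (simp only: k if_False simp_thms)
    finally show ?thesis .
  qed
qed

theorem quasi_iso_Theta:
  assumes X: "is_gspace (chains M)" and S: "\<And>m. gmap (useries (chains M)) (useries (chains M)) 1 (S m)"
    and cS: "is_complex (tseries (useries (chains M))) (\<lambda>_. tconv S)" and c0: "is_complex (useries (chains M)) (\<lambda>_. S 0)"
    and SQ: "\<And>m x i. x \<in> elems (useries (chains M)) i \<Longrightarrow> S m x = mixed_op Q m x"
  shows "quasi_iso (tseries (useries (chains M))) (\<lambda>_. tconv (mixed_op P)) (tseries (useries (chains M))) (\<lambda>_. tconv S) (\<lambda>_. tconv Theta)"
proof (rule conjugate_quasi_iso[OF cS gspace_useries[OF X] S gmap_Theta[OF X] _ lin_upto_mixed_op[OF P2 X] _ _ c0])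
  note N = gspace_useries[OF X]
  fix x i assume x: "x \<in> elems (useries (chains M)) i"
  show "Theta 0 x = x"
  proof
    fix k show "Theta 0 x k = x k" using x theta_zero[of "x k" "i - 2 * int k"] by (simp add: Theta_def)
  qed
  show "mixed_op P 0 x = S 0 x" unfolding SQ[OF x] mixed_op_def P0 Q0 ..
  fix m
  have "Theta j x \<in> elems (useries (chains M)) i" for j using gm_elem[OF gmap_Theta[OF X] N N x] by simp
  then have "(\<Sum>j\<le>m. S j (Theta (m - j) x)) = (\<Sum>j\<le>m. mixed_op Q j (Theta (m - j) x))"
    by (intro sum.cong SQ) auto
  then show "eqm (useries (chains M)) (i + 1) (\<Sum>j\<le>m. Theta j (mixed_op P (m - j) x)) (\<Sum>j\<le>m. S j (Theta (m - j) x))"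
    unfolding Theta_commute[OF x] by (simp only: eqm_refl[OF N])
qed

end

section \<open>The twisted formality morphism\<close>

text \<open>
  The coefficients at \<open>u\<^sup>0\<close> exhaust the original space.
\<close>

lemma gspace_of_useries:
  assumes U: "is_gspace (useries X)"
  shows "is_gspace X"
proof -
  have uc: "uconst x \<in> elems (useries X) i" if "x \<in> elems X i" "\<And>j. 0 \<in> elems X j" for x i
    using that by (auto simp: uconst_def)
  have un: "uconst x \<in> nulls (useries X) i" if "x \<in> nulls X i" "\<And>j. 0 \<in> nulls X j" for x i
    using that by (auto simp: uconst_def)
  have ze: "0 \<in> elems X i" and zn: "0 \<in> nulls X i" for i
    using gsub_e(1)[OF U, of i] gsub_n(1)[OF U, of i] by (auto dest!: spec[of _ "0::nat"])
  have "x + y \<in> elems X i" if "x \<in> elems X i" "y \<in> elems X i" for x y i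
    using gsub_e(2)[OF U uc uc, of x i y] that ze by (auto dest!: spec[of _ "0::nat"])
  moreover have "x + y \<in> nulls X i" if "x \<in> nulls X i" "y \<in> nulls X i" for x y i
    using gsub_n(2)[OF U un un, of x i y] that zn by (auto dest!: spec[of _ "0::nat"])
  moreover have "a \<bullet>\<^sub>C x \<in> elems X i" if "x \<in> elems X i" for a x i
    using gsub_e(4)[OF U uc, of x i a] that ze by (auto dest!: spec[of _ "0::nat"])
  moreover have "a \<bullet>\<^sub>C x \<in> nulls X i" if "x \<in> nulls X i" for a x i
    using gsub_n(4)[OF U un, of x i a] that zn by (auto dest!: spec[of _ "0::nat"])
  moreover have "x \<in> elems X i" if "x \<in> nulls X i" for x i
    using gspace_le[OF U un, of x i] that zn by (auto dest!: spec[of _ "0::nat"])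
  ultimately show ?thesis using ze zn by (auto simp: is_gspace_def csubspace_def)
qed

lemma mult_tser_elem: "is_gspace X \<Longrightarrow> x \<in> elems (tseries X) i \<Longrightarrow> mult_tser s x \<in> elems (tseries X) i"
  by (auto simp: mult_tser_def intro!: gsub_e(6) gsub_e(4))

lemma t_linear_tconv:
  assumes X: "is_gspace X" and Y: "is_gspace Y" and f: "\<And>m. gmap X Y 0 (f m)"
    and x: "x \<in> elems (tseries X) i"
  shows "eqm (tseries Y) i (tconv f (mult_tser s x)) (mult_tser s (tconv f x))"
  unfolding eqm_tseries
proof
  fix m
  have xe: "x n \<in> elems X i" for n using x by simp
  have "eqm Y (i + 0) (f j (\<Sum>l\<le>n. s l \<bullet>\<^sub>C x (n - l))) (\<Sum>l\<le>n. s l \<bullet>\<^sub>C f j (x (n - l)))" for j n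
    by (rule eqm_trans[OF Y gm_sum[OF f X Y gsub_e(4)[OF X xe]] eqm_sum[OF Y gm_scale[OF f X Y xe]]])
  then have "eqm Y i (\<Sum>j\<le>m. f j (\<Sum>l\<le>m - j. s l \<bullet>\<^sub>C x (m - j - l))) (\<Sum>j\<le>m. \<Sum>l\<le>m - j. s l \<bullet>\<^sub>C f j (x (m - j - l)))"
    by (intro eqm_sum[OF Y]) (simp only: add_0_right)
  also have "(\<Sum>j\<le>m. \<Sum>l\<le>m - j. s l \<bullet>\<^sub>C f j (x (m - j - l))) = (\<Sum>l\<le>m. \<Sum>j\<le>m - l. s l \<bullet>\<^sub>C f j (x (m - l - j)))"
    by (rule sum_triangle_swap[of "\<lambda>j l k. s l \<bullet>\<^sub>C f j (x k)"])
  finally show "eqm Y i (tconv f (mult_tser s x) m) (mult_tser s (tconv f x) m)"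
    by (simp only: tconv_def mult_tser_def cscale_sum_right)
qed

lemma mult_u_sum: "mult_u (\<Sum>j\<in>A. h j) = (\<Sum>j\<in>A. mult_u (h j))" for h :: "'a \<Rightarrow> nat \<Rightarrow> 'v::ab_group_add"
  by (rule ext) (simp add: mult_u_def sum_fun_apply)

lemma tconv_mult_u:
  assumes "\<And>j n. f j (mult_u (z n)) = mult_u (f j (z n))"
  shows "tconv f (\<lambda>m. mult_u (z m)) = (\<lambda>m. mult_u (tconv f z m))"
  by (rule ext) (simp only: tconv_def assms mult_u_sum)

lemma swap_mult_u: "swap (mult_u x) = (\<lambda>m. mult_u (swap x m))" "swap (\<lambda>m. mult_u (z m)) = mult_u (swap z)"
  by (auto simp: swap_def mult_u_def fun_eq_iff)

lemma swap_mult_tser: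
  "swap (\<lambda>k. mult_tser s (x k)) = mult_tser s (swap x)" "swap (mult_tser s z) = (\<lambda>k. mult_tser s (swap z k))"
  by (rule ext, rule ext, simp add: swap_def mult_tser_def sum_fun_apply)+

lemma swap_tconv_plus_u:
  "swap (tconv (\<lambda>i. plus_u (D i) (if i = 0 then E else (\<lambda>_. 0))) (swap x)) = plus_u (tconv D) (\<lambda>x m. E (x m)) x"
proof (rule ext, rule ext)
  fix k m
  have "(\<Sum>i\<le>m. (if i = 0 then E else (\<lambda>_. 0)) (x (k - 1) (m - i))) = (\<Sum>i\<le>m. if i = 0 then E (x (k - 1) (m - i)) else 0)"
    by (rule sum.cong) auto
  also have "\<dots> = E (x (k - 1) (m - 0))" by (rule sum_if_first)
  finally have e: "(\<Sum>i\<le>m. (if i = 0 then E else (\<lambda>_. 0)) (x (k - 1) (m - i))) = E (x (k - 1) m)" by simp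
  show "swap (tconv (\<lambda>i. plus_u (D i) (if i = 0 then E else (\<lambda>_. 0))) (swap x)) k m = plus_u (tconv D) (\<lambda>x m. E (x m)) x k m"
  proof (cases "k = 0")
    case True
    show ?thesis
      by (simp only: True swap_def tconv_def plus_u_def sum_fun_apply[of _ _ k, unfolded True] simp_thms if_True add_0_right)
  next
    case False
    show ?thesis
      by (simp only: swap_def tconv_def plus_u_def sum_fun_apply[of _ _ k] False if_False sum.distrib e plus_fun_apply[of _ _ m])
  qed
qed

text \<open>
  Forms have no null elements, so identities in the target are equalities.
\<close>

lemma eqm_forms: "eqm (useries (forms M)) i x y \<Longrightarrow> x = y" "eqm (tseries (forms M)) i x' y' \<Longrightarrow> x' = y'"
    "eqm (tseries (useries (forms M))) i z w \<Longrightarrow> z = w"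
proof -
  have n: "nulls (forms M) j = {0}" for j by (simp add: forms_def plain_def)
  show u: "x = y" if "eqm (useries (forms M)) i x y" for x y
  proof
    fix k have "x k - y k = 0" using that by (simp add: eqm_useries eqm_def n)
    then show "x k = y k" by (simp only: right_minus_eq)
  qed
  show "x' = y'" if "eqm (tseries (forms M)) i x' y'"
  proof
    fix k have "x' k - y' k = 0" using that by (simp add: eqm_tseries eqm_def n)
    then show "x' k = y' k" by (simp only: right_minus_eq)
  qed
  show "z = w" if "eqm (tseries (useries (forms M))) i z w"
    by (rule ext, rule u) (use that in \<open>simp add: eqm_tseries del: nulls_useries\<close>)
qed

context star_iso
begin

text \<open>
  The abstract form of the corollary: a chain map from the mixed complex of \<open>Q\<close> to the twisted forms
  is composed with the comparison between \<open>P\<close> and \<open>Q\<close>, and the order of the variables \<open>t\<close> and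
  \<open>u\<close> is exchanged.
\<close>

theorem untwist:
  fixes \<pi> :: "nat \<Rightarrow> 'p mvect"
  assumes X: "is_gspace (chains M)" and Y: "is_gspace (forms M)"
    and S: "\<And>m. gmap (useries (chains M)) (useries (chains M)) 1 (S m)"
    and SQ: "\<And>m x i. x \<in> elems (useries (chains M)) i \<Longrightarrow> S m x = mixed_op Q m x"
    and E: "\<And>m. gmap (useries (forms M)) (useries (forms M)) 1 (E m)"
    and EL: "\<And>m x i. x \<in> elems (useries (forms M)) i \<Longrightarrow>
      E m x = plus_u (lie_form M 2 (\<pi> m)) (if m = 0 then ext_d M else (\<lambda>_. 0)) x"
    and \<Phi>: "\<And>m. gmap (useries (chains M)) (useries (forms M)) 0 (\<Phi> m)"
    and u: "\<And>m. u_linear (useries (chains M)) (useries (forms M)) (\<Phi> m) 0"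
    and ch: "chain_map (tseries (useries (chains M))) (tconv S) (tseries (useries (forms M))) (tconv E) (tconv \<Phi>)"
    and q0: "quasi_iso (useries (chains M)) (\<lambda>_. S 0) (useries (forms M)) (\<lambda>_. E 0) (\<lambda>_. \<Phi> 0)"
  shows "\<exists>f F. quasi_iso (star_chains M) (\<lambda>_. star_b M P) (tseries (forms M)) (\<lambda>_. poisson_L M \<pi>) (\<lambda>_. f) \<and>
     t_linear (star_chains M) (tseries (forms M)) f \<and>
     quasi_iso (star_CC M) (\<lambda>_. star_bB M P) (useries (tseries (forms M))) (\<lambda>_. poisson_Lud M \<pi>) (\<lambda>_. F) \<and>
     u_linear (star_CC M) (useries (tseries (forms M))) F 0 \<and>
     ut_linear (star_CC M) (useries (tseries (forms M))) F \<and>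
     (\<forall>i. \<forall>x\<in>elems (star_CC M) i. F x 0 = f (x 0))"
proof -
  define N where "N = useries (chains M)"
  define W where "W = useries (forms M)"
  have gN: "is_gspace N" and gW: "is_gspace W" unfolding N_def W_def by (rule gspace_useries[OF X] gspace_useries[OF Y])+
  note TN = gspace_tseries[OF gN] and TW = gspace_tseries[OF gW]
  note T\<Theta> = gmap_Theta[OF X, folded N_def] and S' = S[folded N_def] and E' = E[folded W_def] and \<Phi>' = \<Phi>[folded N_def W_def]
  have cS: "is_complex (tseries N) (\<lambda>_. tconv S)" using ch by (simp add: chain_map_def N_def)
  have c0: "is_complex N (\<lambda>_. S 0)" using q0 by (simp add: quasi_iso_def N_def)
  define G where "G = (\<lambda>x. tconv \<Phi> (tconv Theta x))"
  define F where "F = (\<lambda>x. swap (G (swap x)))"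
  have "quasi_iso (tseries N) (\<lambda>_. tconv (mixed_op P)) (tseries W) (\<lambda>_. tconv E) (\<lambda>_. G)"
    unfolding G_def
    by (rule quasi_iso_compose[OF quasi_iso_Theta[OF X S cS[unfolded N_def] c0[unfolded N_def] SQ, folded N_def]
        quasi_iso_tseries[OF gN gW S' E' \<Phi>' ch[folded N_def W_def] q0[folded N_def W_def]]])
  then have q2: "quasi_iso (useries (tseries (chains M))) (\<lambda>_ x. swap (tconv (mixed_op P) (swap x)))
    (useries (tseries (forms M))) (\<lambda>_ x. swap (tconv E (swap x))) (\<lambda>_. F)"
    unfolding F_def N_def W_def by (rule quasi_iso_swap[OF _ X Y])
  have D: "star_bB M P x = swap (tconv (mixed_op P) (swap x))" for x
    unfolding star_bB_def star_b_def mixed_op_def[abs_def] by (rule swap_tconv_plus_u[symmetric])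
  have PE: "poisson_Lud M \<pi> x = swap (tconv E (swap x))" if x: "x \<in> elems (useries (tseries (forms M))) i" for x i
  proof -
    have sx: "swap x m \<in> elems (useries (forms M)) i" for m
      using elems_swap[of "swap x" "forms M" i] x by simp
    have "tconv E (swap x) = tconv (\<lambda>m. plus_u (lie_form M 2 (\<pi> m)) (if m = 0 then ext_d M else (\<lambda>_. 0))) (swap x)"
      unfolding tconv_def EL[OF sx] ..
    then show ?thesis unfolding poisson_Lud_def poisson_L_def by (simp only: swap_tconv_plus_u)
  qed
  have q3: "quasi_iso (useries (tseries (chains M))) (\<lambda>_. star_bB M P) (useries (tseries (forms M))) (\<lambda>_. poisson_Lud M \<pi>) (\<lambda>_. F)"
    by (rule quasi_iso_cong[OF q2 D PE]) simp_all
  have el: "swap x \<in> elems (tseries N) i" if "x \<in> elems (useries (tseries (chains M))) i" for x i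
    using that elems_swap[of "swap x" "chains M" i] unfolding N_def by (simp only: swap_swap)
  have \<Theta>e: "tconv Theta y \<in> elems (tseries N) i" if "y \<in> elems (tseries N) i" for y i
    using gm_elem[OF gmap_tconv[OF gN gN T\<Theta>] TN TN that] by simp
  have nF: "0 \<in> nulls (useries (tseries (forms M))) i" for i
    by (rule gsub_n(1)[OF gspace_useries[OF gspace_tseries[OF Y]]])
  have ul: "u_linear (useries (tseries (chains M))) (useries (tseries (forms M))) F 0"
    unfolding u_linear_def
  proof (intro allI ballI)
    fix i x assume x: "x \<in> elems (useries (tseries (chains M))) i"
    let ?y = "swap x"
    have th: "Theta j (mult_u z) = mult_u (Theta j z)" for j z
      using chain_linearD(1)[OF chain_linear_theta, of j] by (auto simp: Theta_def mult_u_def fun_eq_iff[where 'a=nat])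
    have ph: "\<Phi> j (mult_u (tconv Theta ?y n)) = mult_u (\<Phi> j (tconv Theta ?y n))" for j n
    proof (rule eqm_forms(1))
      have "tconv Theta ?y n \<in> elems (useries (chains M)) i" using \<Theta>e[OF el[OF x]] by (simp add: N_def)
      then show "eqm (useries (forms M)) (i + 2 + 0) (\<Phi> j (mult_u (tconv Theta ?y n))) (mult_u (\<Phi> j (tconv Theta ?y n)))"
        using u[of j] by (simp add: u_linear_def eqm_def del: elems_useries nulls_useries)
    qed
    have "F (mult_u x) = mult_u (F x)"
      unfolding F_def G_def swap_mult_u(1) tconv_mult_u[of Theta, OF th] tconv_mult_u[of \<Phi>, OF ph] swap_mult_u(2) ..
    then show "F (mult_u x) - mult_u (F x) \<in> nulls (useries (tseries (forms M))) (i + 2 + 0)" using nF by simp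
  qed
  have utl: "F (\<lambda>k. mult_tser s (x k)) = (\<lambda>k. mult_tser s (F x k))" if x: "x \<in> elems (useries (tseries (chains M))) i" for x i s
  proof -
    let ?y = "swap x"
    have y: "?y \<in> elems (tseries N) i" by (rule el[OF x])
    have 1: "eqm (tseries N) i (tconv Theta (mult_tser s ?y)) (mult_tser s (tconv Theta ?y))"
      by (rule t_linear_tconv[OF gN gN T\<Theta> y])
    have "eqm (tseries W) (i + 0) (tconv \<Phi> (tconv Theta (mult_tser s ?y))) (tconv \<Phi> (mult_tser s (tconv Theta ?y)))"
      by (rule gm_cong[OF gmap_tconv[OF gN gW \<Phi>'] TN TW \<Theta>e[OF mult_tser_elem[OF gN y]] mult_tser_elem[OF gN \<Theta>e[OF y]] 1])
    moreover have "eqm (tseries W) i (tconv \<Phi> (mult_tser s (tconv Theta ?y))) (mult_tser s (G ?y))"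
      unfolding G_def by (rule t_linear_tconv[OF gN gW \<Phi>' \<Theta>e[OF y]])
    ultimately have "G (mult_tser s ?y) = mult_tser s (G ?y)"
      unfolding G_def W_def using eqm_forms(3) by metis
    then show ?thesis unfolding F_def swap_mult_tser(1) by (simp only: swap_mult_tser(2))
  qed
  define f where "f = (\<lambda>x. F (uconst x) 0)"
  note mu = quasi_iso_mod_u[OF gspace_tseries[OF X] gspace_tseries[OF Y] q3[unfolded star_bB_def poisson_Lud_def] ul, folded f_def]
  have tl: "t_linear (tseries (chains M)) (tseries (forms M)) f"
    unfolding t_linear_def
  proof (intro allI ballI)
    fix i s x assume x: "x \<in> elems (tseries (chains M)) i"
    have ux: "uconst x \<in> elems (useries (tseries (chains M))) i" using elems_uconst[OF gspace_tseries[OF X]] x by blast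
    have z: "mult_tser s 0 = (0 :: nat \<Rightarrow> 'p list \<Rightarrow> complex)" by (rule ext) (simp add: mult_tser_def)
    have "uconst (mult_tser s x) = (\<lambda>k. mult_tser s (uconst x k))"
      by (rule ext) (simp add: uconst_def z)
    then have "f (mult_tser s x) = mult_tser s (f x)" unfolding f_def using utl[OF ux, of s] by metis
    then show "f (mult_tser s x) - mult_tser s (f x) \<in> nulls (tseries (forms M)) i"
      using gsub_n(1)[OF gspace_tseries[OF Y]] by simp
  qed
  have "F x 0 = f (x 0)" if "x \<in> elems (useries (tseries (chains M))) i" for x i
    using eqm_forms(2)[OF mu(2)[OF that]] by (simp add: f_def)
  moreover have "ut_linear (useries (tseries (chains M))) (useries (tseries (forms M))) F"
    unfolding ut_linear_def using utl nF by simp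
  ultimately show ?thesis
    unfolding star_CC_def star_chains_def using mu(1) tl q3 ul f_def
    by (intro exI[of _ f] exI[of _ F]) blast
qed

end

lemma hoch_b_cochain_sum:
  "hoch_b M (\<Sum>s\<in>S. a s \<bullet>\<^sub>C D s) c = (\<Sum>s\<in>S. a s \<bullet>\<^sub>C hoch_b M (D s) c)"
proof -
  have z: "hoch_b M 0 c = 0" by (rule ext) (simp add: hoch_b_def Let_def)
  have p: "hoch_b M (b \<bullet>\<^sub>C D1 + D2) c = b \<bullet>\<^sub>C hoch_b M D1 c + hoch_b M D2 c" for b D1 D2
    by (rule ext) (simp add: hoch_b_def Let_def algebra_simps sum.distrib sum_distrib_left)
  show ?thesis by (induction S rule: infinite_finite_induct) (simp_all only: sum.infinite sum.empty sum.insert z p if_True simp_thms)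
qed

text \<open>
  The first of the two wrap-around terms of \<open>L\<^sub>D\<close> is the last face of the Hochschild differential, the
  second one is the face that multiplies \<open>a\<^sub>0\<close> and \<open>a\<^sub>1\<close>.
\<close>

lemma hoch_L_2: "hoch_L M 2 D = hoch_b M D"
proof (rule ext, rule ext)
  fix c ps
  show "hoch_L M 2 D c ps = hoch_b M D c ps"
  proof (cases "ps = [] \<or> \<not> set ps \<subseteq> pts M")
    case True then show ?thesis by (auto simp: hoch_L_def hoch_b_def)
  next
    case False
    then obtain n where n: "length ps = Suc n" by (cases ps) auto
    have s1: "msign (int (Suc n) * (int n + 1)) = (-1) ^ Suc n"
    proof -
      have "int (Suc n) * (int n + 1) = int (Suc n * Suc n)" by (simp add: algebra_simps)
      then have "msign (int (Suc n) * (int n + 1)) = (-1) ^ (Suc n * Suc n)" by (simp only: power_int_of_nat)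
      also have "\<dots> = (-1) ^ Suc n" by (cases "even n") auto
      finally show ?thesis .
    qed
    have s2: "msign (int (Suc n) * (int (Suc n) + 1)) = 1"
    proof -
      have "int (Suc n) * (int (Suc n) + 1) = int (Suc n * Suc (Suc n))" by (simp add: algebra_simps)
      then have "msign (int (Suc n) * (int (Suc n) + 1)) = (-1) ^ (Suc n * Suc (Suc n))" by (simp only: power_int_of_nat)
      also have "\<dots> = 1" by (cases "even n") auto
      finally show ?thesis .
    qed
    have s3: "msign ((int 2 - 1) * (int i + 1)) = (-1) ^ Suc i" for i
    proof -
      have "(int 2 - 1) * (int i + 1) = int (Suc i)" by simp
      then show ?thesis by (simp only: power_int_of_nat)
    qed
    have i2: "{n..<n + 2} = {n, Suc n}" by auto
    have "hoch_L M 2 D c ps = (\<Sum>i<n. (-1) ^ Suc i * D (\<lambda>ys. c (take (Suc i) ps @ ys @ drop (Suc i + 1) ps)) (ps ! Suc i))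
      + ((-1) ^ Suc n * D (\<lambda>ys. c (drop 1 ys @ tl ps @ take 1 ys)) (ps ! 0) + D (\<lambda>ys. c (ys @ tl ps)) (ps ! 0))"
    proof -
      have m: "n + 2 - 1 = Suc n" "Suc n - 1 = n" "Suc n - n = 1" "Suc n - Suc n = 0" "i + 1 = Suc i" "i + 2 = Suc i + 1" for i :: nat by simp_all
      have ne: "n \<noteq> Suc n" by simp
      show ?thesis
        unfolding hoch_L_def Let_def n m(2) m(1) i2 s3 using False ne
        by (simp add: s1 s2 del: power_Suc of_nat_Suc)
    qed
    also have "\<dots> = hoch_b M D c ps"
      unfolding hoch_b_def Let_def n sum.lessThan_Suc_shift using False by (simp add: drop_Suc)
    finally show ?thesis .
  qed
qed

context formal_mc
begin

text \<open>
  Terms with an argument \<open>\<pi> 0 = 0\<close> vanish by multilinearity, which leaves compositions with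
  positive parts, grouped by length.
\<close>

lemma kontsevich_star_comps:
  assumes K: "sym_multilinear g (plain (grd h)) 1 K" and h: "is_gspace (plain (grd h))" and m: "1 \<le> m"
  shows "(\<Sum>n\<in>{1..m}. (1 / fact n) \<bullet>\<^sub>C (\<Sum>ms\<in>{ms. length ms = n \<and> sum_list ms = m}. K (map (\<lambda>k. (1, \<pi> k)) ms)))
    = (\<Sum>ms\<in>comps m. (1 / fact (length ms)) \<bullet>\<^sub>C K (mc_args \<pi> ms))"
proof -
  have fin: "finite {ms :: nat list. length ms = n \<and> sum_list ms = m}" for n
  proof (rule finite_subset)
    show "{ms. length ms = n \<and> sum_list ms = m} \<subseteq> {ms. set ms \<subseteq> {..m} \<and> length ms = n}"
      using member_le_sum_list by auto
  qed (simp add: finite_lists_length_eq)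
  have z: "K (mc_args \<pi> ms) = 0" if "0 \<in> set ms" for ms
  proof -
    obtain as bs where "ms = as @ 0 # bs" using split_list[OF \<open>0 \<in> set ms\<close>] by blast
    then have "mc_args \<pi> ms = mc_args \<pi> as @ (1, 0) # mc_args \<pi> bs" by (simp add: mc_args_def zero)
    then show ?thesis using multilinear_zero[OF h K homog_args homog_args, of as 1 bs] by (simp add: plain_def)
  qed
  have "(\<Sum>n\<in>{1..m}. (1 / fact n) \<bullet>\<^sub>C (\<Sum>ms\<in>{ms. length ms = n \<and> sum_list ms = m}. K (map (\<lambda>k. (1, \<pi> k)) ms)))
    = (\<Sum>n\<in>{1..m}. \<Sum>ms\<in>{ms \<in> comps m. length ms = n}. (1 / fact (length ms)) \<bullet>\<^sub>C K (mc_args \<pi> ms))"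
  proof (rule sum.cong[OF refl])
    fix n
    have "(\<Sum>ms\<in>{ms. length ms = n \<and> sum_list ms = m}. K (mc_args \<pi> ms)) = (\<Sum>ms\<in>{ms \<in> comps m. length ms = n}. K (mc_args \<pi> ms))"
    proof (rule sum.mono_neutral_right[OF fin])
      show "\<forall>ms\<in>{ms. length ms = n \<and> sum_list ms = m} - {ms \<in> comps m. length ms = n}. K (mc_args \<pi> ms) = 0"
      proof
        fix ms assume "ms \<in> {ms. length ms = n \<and> sum_list ms = m} - {ms \<in> comps m. length ms = n}"
        then obtain k where "k \<in> set ms" "\<not> 1 \<le> k" by (auto simp: comps_def)
        then show "K (mc_args \<pi> ms) = 0" by (intro z) (simp add: not_le)
      qed
    qed (auto simp: comps_def)
    then show "(1 / fact n) \<bullet>\<^sub>C (\<Sum>ms\<in>{ms. length ms = n \<and> sum_list ms = m}. K (map (\<lambda>k. (1, \<pi> k)) ms))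
      = (\<Sum>ms\<in>{ms \<in> comps m. length ms = n}. (1 / fact (length ms)) \<bullet>\<^sub>C K (mc_args \<pi> ms))"
      by (simp add: mc_args_def cscale_sum_right)
  qed
  also have "\<dots> = (\<Sum>ms\<in>comps m. (1 / fact (length ms)) \<bullet>\<^sub>C K (mc_args \<pi> ms))"
  proof (rule sum.group)
    show "length ` comps m \<subseteq> {1..m}"
    proof
      fix n assume "n \<in> length ` comps m"
      then obtain ms where ms: "ms \<in> comps m" "n = length ms" by blast
      then have "ms \<noteq> []" "length ms \<le> m" using m length_le_sum_list[of ms] by (auto simp: comps_def)
      then show "n \<in> {1..m}" using ms by (cases ms) auto
    qed
  qed simp_all
  finally show ?thesis .
qed

end
theorem corollary4p0p1:
  fixes M :: "'p mfd"
    and K :: "'p mfd \<Rightarrow> (int \<times> 'p mvect) list \<Rightarrow> 'p cochain"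
    and \<kappa> :: "nat \<Rightarrow> complex"
    and E :: "'p emb set"
    and \<pi> :: "nat \<Rightarrow> 'p mvect"
    and P :: "nat \<Rightarrow> 'p cochain"
  assumes "\<forall>(N, N', f)\<in>E. open_embedding N N' f"
    and "kontsevich_formality \<kappa> E K"
    and CF: "cyclic_formality E K"
    and "smooth_manifold M"
    and "formal_poisson M \<pi>"
    and "star_product M P"
    and "star_isomorphic M P (kontsevich_star M (K M) \<pi>)"
  shows "\<exists>(f :: (nat \<Rightarrow> 'p list \<Rightarrow> complex) \<Rightarrow> nat \<Rightarrow> 'p dform)
          (F :: (nat \<Rightarrow> nat \<Rightarrow> 'p list \<Rightarrow> complex) \<Rightarrow> nat \<Rightarrow> nat \<Rightarrow> 'p dform).
     quasi_iso (star_chains M) (\<lambda>_. star_b M P)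
       (tseries (forms M)) (\<lambda>_. poisson_L M \<pi>) (\<lambda>_. f) \<and>
     t_linear (star_chains M) (tseries (forms M)) f \<and>
     quasi_iso (star_CC M) (\<lambda>_. star_bB M P)
       (useries (tseries (forms M))) (\<lambda>_. poisson_Lud M \<pi>) (\<lambda>_. F) \<and>
     u_linear (star_CC M) (useries (tseries (forms M))) F 0 \<and>
     ut_linear (star_CC M) (useries (tseries (forms M))) F \<and>
     (\<forall>i. \<forall>x\<in>elems (star_CC M) i. F x 0 = f (x 0))"
proof -
  note mfd = assms(4)
  let ?N = "useries (chains M)" and ?W = "useries (forms M)"
  let ?r = "CC_action M (K M)" and ?q = "forms_action M"
  obtain \<phi> where qi: "Linf_module_quasi_iso (g_S M) ?N ?r ?W ?q (\<phi> M)"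
    and \<phi>u: "\<forall>xs. homog (g_S M) xs \<longrightarrow> u_linear ?N ?W (\<phi> M xs) (sdeg xs)"
    using CF mfd unfolding cyclic_formality_def by blast
  have mor: "Linf_module_morphism (g_S M) ?N ?r ?W ?q (\<phi> M)"
    and q0: "quasi_iso ?N (\<lambda>_. ?r []) ?W (\<lambda>_. ?q []) (\<lambda>_. \<phi> M [])"
    using qi by (simp_all add: Linf_module_quasi_iso_def)
  have modN: "Linf_module (g_S M) ?N ?r" and modW: "Linf_module (g_S M) ?W ?q"
    using mor by (simp_all add: Linf_module_morphism_def)
  have dg: "is_dgla (g_S M)" and gN: "is_gspace ?N" and gW: "is_gspace ?W"
    using modN modW by (simp_all add: Linf_module_def)
  note X = gspace_of_useries[OF gN] and Y = gspace_of_useries[OF gW]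
  interpret mc: formal_mc "g_S M" \<pi>
  proof
    show "is_dgla (g_S M)" by (rule dg)
    show "dif (g_S M) 1 x = 0" for x by (simp add: g_S_def)
    show "\<pi> k \<in> grd (g_S M) 1" for k
      using assms(5) by (simp add: formal_poisson_def g_S_def mvect_deg_def)
    show "\<pi> 0 = 0" "(\<Sum>i\<le>m. brk (g_S M) 1 1 (\<pi> i) (\<pi> (m - i))) = 0" for m
      using assms(5) by (simp_all add: formal_poisson_def g_S_def)
  qed
  have KL: "Linf_morphism (g_S M) (g_G M) (K M)"
    using assms(2) mfd by (simp add: kontsevich_formality_def Linf_quasi_iso_def)
  have hG: "is_gspace (plain (grd (g_G M)))"
    using KL by (simp add: Linf_morphism_def is_dgla_def is_complex_def)
  have Kml: "sym_multilinear (g_S M) (plain (grd (g_G M))) 1 (K M)"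
    and Kg: "\<And>xs. homog (g_S M) xs \<Longrightarrow> xs \<noteq> [] \<Longrightarrow> K M xs \<in> grd (g_G M) (1 + sdeg xs)"
    using KL by (simp_all add: Linf_morphism_def)
  have ne: "mc_args \<pi> ms \<noteq> []" if "ms \<in> comps m" "1 \<le> m" for ms m
    using that by (auto simp: mc_args_def comps_def)
  define Q where "Q = kontsevich_star M (K M) \<pi>"
  (* the coefficients of the Kontsevich product in the form in which the twist produces them *)
  have Qm: "Q m = (\<Sum>ms\<in>comps m. (1 / fact (length ms)) \<bullet>\<^sub>C K M (mc_args \<pi> ms))" if "1 \<le> m" for m
    unfolding Q_def kontsevich_star_def using that mc.kontsevich_star_comps[OF Kml hG that] by simp
  have Qc: "Q m \<in> cochains M 2" if "1 \<le> m" for m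
  proof -
    have "Q m \<in> elems (plain (grd (g_G M))) 1"
      unfolding Qm[OF that]
      by (intro gsub_e(6)[OF hG] gsub_e(4)[OF hG]) (use Kg[OF mc.homog_args ne[OF _ that]] in \<open>simp add: plain_def\<close>)
    then show ?thesis by (simp add: plain_def g_G_def)
  qed
  interpret smooth_mfd M by unfold_locales (rule mfd)
  have ee: "tensor [unit_fun M, unit_fun M] \<in> Cinf M 2" by (rule tensor_Cinf) (auto simp: unit_smooth)
  (* normalized cochains vanish on (1, 1), so the Kontsevich product has the unit 1 *)
  have ue: "unit_at M 0 (tensor [unit_fun M, unit_fun M])"
    unfolding unit_at_def
  proof (intro allI ballI impI)
    fix ps q assume q: "q \<in> pts M" and ps: "set ps \<subseteq> pts M"
    have v: "tensor [unit_fun M, unit_fun M] rs = (if length rs = 2 then 1 else 0)" if "set rs \<subseteq> pts M" for rs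
    proof (cases "length rs = 2")
      case True
      then obtain y z where "rs = [y, z]" by (auto simp: length_Suc_conv numeral_2_eq_2)
      then show ?thesis using that by (simp add: tensor_map2 unit_fun_def)
    qed (simp add: tensor_map2)
    have "set (ps[0 := q]) \<subseteq> pts M" using set_update_subset_insert[of ps 0 q] q ps by blast
    then show "tensor [unit_fun M, unit_fun M] (ps[0 := q]) = tensor [unit_fun M, unit_fun M] ps"
      using v[OF ps] v[of "ps[0 := q]"] by simp
  qed
  obtain T where T: "\<forall>a\<in>smooth_funs M. T 0 (tensor [a]) = a" "\<forall>m. multidiff M 1 (T m)"
    "\<forall>m. \<forall>a\<in>smooth_funs M. \<forall>b\<in>smooth_funs M.
        (\<Sum>i\<le>m. T i (tensor [P (m - i) (tensor [a, b])])) =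
        (\<Sum>i\<le>m. \<Sum>j\<le>m - i. Q (m - i - j) (tensor [T i (tensor [a]), T j (tensor [b])]))"
    using assms(7) unfolding star_isomorphic_def Q_def by blast
  have Q0: "Q 0 = mult_cochain M" by (simp add: Q_def kontsevich_star_def)
  interpret star_iso M P Q T
  proof unfold_locales
    show P2: "multidiff M 2 (P m)" for m using assms(6) by (simp add: star_product_def)
    show P0: "P 0 = mult_cochain M" using assms(6) by (simp add: star_product_def)
    show "P m (tensor [unit_fun M, unit_fun M]) = 0" if "1 \<le> m" for m
      using assms(6) that unit_smooth unfolding star_product_def by blast
    show "multidiff M 2 (Q m)" for m
    proof (cases "m = 0")
      case True
      then show ?thesis using P2[of 0] by (simp add: P0 Q0)
    next
      case False
      then show ?thesis using Qc[of m] by (simp add: cochains_def)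
    qed
    show "Q 0 = mult_cochain M" by (rule Q0)
    show "Q m (tensor [unit_fun M, unit_fun M]) = 0" if "1 \<le> m" for m
      using Qc[OF that] ee ue unfolding cochains_def by (auto dest!: spec[of _ "0::nat"])
  qed (use T in blast)+
  (* contract is a definite description, so its linearity comes from the module structure on forms *)
  have lie0: "lie_form M 2 0 \<omega> = 0" if \<omega>: "\<omega> \<in> elems (forms M) j" for \<omega> j
  proof -
    have "uconst \<omega> \<in> elems ?W j" using elems_uconst[OF Y] \<omega> by blast
    then have "sym_multilinear (g_S M) ?W (j + 1) (\<lambda>xs. ?q xs (uconst \<omega>))"
      using modW unfolding Linf_module_def by blast
    from mc.multilinear_zero[OF gW this, of "[]" "[]" 1]
    have "?q [(1, 0)] (uconst \<omega>) \<in> nulls ?W (j + 1 + sdeg [(1, 0 :: 'p mvect)])"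
      by (simp add: homog_def)
    then have "?q [(1, 0)] (uconst \<omega>) 0 \<in> nulls (forms M) (j + 1 + sdeg [(1, 0 :: 'p mvect)] - 2 * int 0)"
      unfolding nulls_useries by blast
    then show ?thesis by (simp add: forms_def plain_def cscale_one)
  qed
  show ?thesis
  proof (rule untwist[OF X Y mc.complex_twist(2)[OF modN] _ mc.complex_twist(2)[OF modW] _ mc.chain_map_twist(2)[OF mor]
        _ mc.chain_map_twist(1)[OF mor]])
    show "twist \<pi> ?r m x = mixed_op Q m x" for m x
    proof (cases "m = 0")
      case True
      then show ?thesis by (simp add: twist_0 CC_action_def mixed_op_def Q0)
    next
      case False
      then have m: "1 \<le> m" by simp
      show ?thesis
      proof
        fix k
        have "((1 / fact (length ms)) \<bullet>\<^sub>C ?r (mc_args \<pi> ms) x) k = (1 / fact (length ms)) \<bullet>\<^sub>C hoch_b M (K M (mc_args \<pi> ms)) (x k)"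
          if "ms \<in> comps m" for ms
          by (rule trans[OF cscale_fun_apply]) (use ne[OF that m] in \<open>simp add: CC_action_def hoch_L_2 cscale_one\<close>)
        then have "twist \<pi> ?r m x k = (\<Sum>ms\<in>comps m. (1 / fact (length ms)) \<bullet>\<^sub>C hoch_b M (K M (mc_args \<pi> ms)) (x k))"
          unfolding twist_def sum_fun_apply[of _ _ k] by (intro sum.cong) auto
        also have "\<dots> = hoch_b M (Q m) (x k)" unfolding Qm[OF m] by (rule hoch_b_cochain_sum[symmetric])
        also have "\<dots> = mixed_op Q m x k" using False unfolding mixed_op_apply by (simp only: if_False if_cancel add_0_right)
        finally show "twist \<pi> ?r m x k = mixed_op Q m x k" .
      qed
    qed
    show "twist \<pi> ?q m x = plus_u (lie_form M 2 (\<pi> m)) (if m = 0 then ext_d M else (\<lambda>_. 0)) x"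
      if x: "x \<in> elems ?W i" for m x i
    proof (cases "m = 0")
      case True
      have "lie_form M 2 (\<pi> 0) (x k) = 0" for k
        unfolding mc.zero by (rule lie0[of _ "i - 2 * int k"]) (use x in simp)
      then show ?thesis using True by (simp add: twist_0 plus_u_def)
    next
      case False
      have z: "?q (mc_args \<pi> ms) x = 0" if "ms \<in> comps m - {[m]}" for ms
        using that False by (cases ms; cases "tl ms") (auto simp: comps_def mc_args_def)
      have "twist \<pi> ?q m x = (\<Sum>ms\<in>{[m]}. (1 / fact (length ms)) \<bullet>\<^sub>C ?q (mc_args \<pi> ms) x)"
        unfolding twist_def
      proof (rule sum.mono_neutral_right)
        show "{[m]} \<subseteq> comps m" using False by (simp add: comps_def)
        show "\<forall>ms\<in>comps m - {[m]}. (1 / fact (length ms)) \<bullet>\<^sub>C ?q (mc_args \<pi> ms) x = 0"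
        proof
          fix ms assume "ms \<in> comps m - {[m]}"
          then show "(1 / fact (length ms)) \<bullet>\<^sub>C ?q (mc_args \<pi> ms) x = 0" by (simp only: z cscale_zero_right)
        qed
      qed simp
      also have "\<dots> = ?q [(1, \<pi> m)] x" by (simp add: mc_args_def cscale_one)
      also have "\<dots> = plus_u (lie_form M 2 (\<pi> m)) (\<lambda>_. 0) x" by (simp add: plus_u_def cscale_one)
      finally show ?thesis using False by simp
    qed
    show "u_linear ?N ?W (twist \<pi> (\<phi> M) m) 0" for m
      unfolding u_linear_def
    proof (intro allI ballI)
      fix i x assume x: "x \<in> elems ?N i"
      have e: "\<phi> M (mc_args \<pi> ms) (mult_u x) = mult_u (\<phi> M (mc_args \<pi> ms) x)" for ms
      proof (rule eqm_forms(1))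
        have "u_linear ?N ?W (\<phi> M (mc_args \<pi> ms)) (sdeg (mc_args \<pi> ms))" using \<phi>u mc.homog_args by blast
        then show "eqm ?W (i + 2 + 0) (\<phi> M (mc_args \<pi> ms) (mult_u x)) (mult_u (\<phi> M (mc_args \<pi> ms) x))"
          using x unfolding u_linear_def eqm_def sdeg_mc_args by blast
      qed
      have s: "mult_u (a \<bullet>\<^sub>C y) = a \<bullet>\<^sub>C mult_u y" for a and y :: "nat \<Rightarrow> 'p dform"
        by (rule ext) (simp add: mult_u_def)
      have "twist \<pi> (\<phi> M) m (mult_u x) = mult_u (twist \<pi> (\<phi> M) m x)"
        unfolding twist_def mult_u_sum e s ..
      then show "twist \<pi> (\<phi> M) m (mult_u x) - mult_u (twist \<pi> (\<phi> M) m x) \<in> nulls ?W (i + 2 + 0)"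
        using gsub_n(1)[OF gW] by simp
    qed
    show "quasi_iso ?N (\<lambda>_. twist \<pi> ?r 0) ?W (\<lambda>_. twist \<pi> ?q 0) (\<lambda>_. twist \<pi> (\<phi> M) 0)"
      by (rule quasi_iso_cong[OF q0]) (rule twist_0)+
  qed
qed

end
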